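(* Let $\Omega$ be a bounded $H^1$-extension domain of $\mathbb R^3$. The operator $\boldsymbol\pi_T:\boldsymbol H^1(\Omega)\to\boldsymbol B'_\perp(\partial\Omega)$ is linear and continuous, with $$\|\boldsymbol\pi_T\boldsymbol u\|_{\boldsymbol B'_\perp(\partial\Omega)}\le\sqrt2\,\|\boldsymbol u\|_{\boldsymbol H^1(\Omega)}\qquad\text{for all }\boldsymbol u\in\boldsymbol H^1(\Omega).$$ For all $\boldsymbol u,\boldsymbol v\in\boldsymbol H^1(\Omega)$, $$b(\boldsymbol u,\boldsymbol v)=-\langle\boldsymbol\pi_T\boldsymbol u,\boldsymbol{\mathrm{Tr}}_T\boldsymbol v\rangle_{\boldsymbol B'_\perp(\partial\Omega),\boldsymbol B_\perp(\partial\Omega)}=\langle\boldsymbol\pi_T\boldsymbol v,\boldsymbol{\mathrm{Tr}}_T\boldsymbol u\rangle_{\boldsymbol B'_\perp(\partial\Omega),\boldsymbol B_\perp(\partial\Omega)} .$$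
   Context: All functions are real-valued. A bounded domain (bounded open connected set) $\Omega\subset\mathbb R^3$ is an $H^1$-extension domain if there is a bounded linear operator $E:H^1(\Omega)\to H^1(\mathbb R^3)$ with $(Eu)|_\Omega=u$ for all $u\in H^1(\Omega)$. For such $\Omega$, the trace of $u\in H^1(\Omega)$ is defined for quasi-every $x\in\partial\Omega$ (with respect to the capacity associated with $H^1(\mathbb R^3)$) by $\mathrm{Tr}\,u(x)=\lim_{r\to0^+}\frac{1}{\lambda(\Omega\cap B_r(x))}\int_{\Omega\cap B_r(x)}u(y)\,dy$, where $\lambda$ is Lebesgue measure; functions on $\partial\Omega$ are identified when they agree quasi-everywhere. The trace space is $\mathcal B(\partial\Omega):=\mathrm{Tr}(H^1(\Omega))$ with norm $\|f\|_{\mathcal B(\partial\Omega)}=\min\{\|v\|_{H^1(\Omega)} : \mathrm{Tr}\,v=f\}$. It is known that $\mathcal B(\partial\Omega)$ is a Hilbert space and that $\mathrm{Ker}\,\mathrm{Tr}=H^1_0(\Omega)$. Vector-valued versions: $\boldsymbol H^1(\Omega)=H^1(\Omega)^3$, $\boldsymbol B(\partial\Omega)=\mathcal B(\partial\Omega)^3$, $\boldsymbol{\mathrm{Tr}}$ is the componentwise trace, $\boldsymbol B'(\partial\Omega)$ the dual of $\boldsymbol B(\partial\Omega)$. Primes denote dual spaces. Stokes form: $b(\boldsymbol u,\boldsymbol v)=\int_\Omega(\boldsymbol u\cdot\mathbf{curl}\,\boldsymbol v-\boldsymbol v\cdot\mathbf{curl}\,\boldsymbol u)\,dx$. Tangential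 trace: for $\boldsymbol u\in\boldsymbol H^1(\Omega)$, $\boldsymbol{\mathrm{Tr}}_T\boldsymbol u\in\boldsymbol B'(\partial\Omega)$ is the (well-defined) continuous functional with $\langle\boldsymbol{\mathrm{Tr}}_T\boldsymbol u,\boldsymbol{\mathrm{Tr}}\,\boldsymbol v\rangle=b(\boldsymbol u,\boldsymbol v)$ for all $\boldsymbol v\in\boldsymbol H^1(\Omega)$. $\boldsymbol K:=\mathrm{Ker}(\boldsymbol{\mathrm{Tr}}_T)\subset\boldsymbol H^1(\Omega)$ and $\boldsymbol K^\perp$ is its orthogonal complement in $\boldsymbol H^1(\Omega)$. $\boldsymbol B_\perp(\partial\Omega):=\boldsymbol{\mathrm{Tr}}_T(\boldsymbol H^1(\Omega))$ has the quotient norm $\|\boldsymbol f\|_{\boldsymbol B_\perp}=\inf\{\|\boldsymbol v\|_{\boldsymbol H^1(\Omega)}:\boldsymbol{\mathrm{Tr}}_T\boldsymbol v=\boldsymbol f\}$; each $\boldsymbol f\in\boldsymbol B_\perp(\partial\Omega)$ has a unique optimal lift $\boldsymbol w_f\in\boldsymbol K^\perp$ with $\boldsymbol{\mathrm{Tr}}_T\boldsymbol w_f=\boldsymbol f$, and $\|\boldsymbol f\|_{\boldsymbol B_\perp}=\|\boldsymbol w_f\|_{\boldsymbol H^1(\Omega)}$. Tangential component trace: for $\boldsymbol u\in\boldsymbol H^1(\Omega)$, $\boldsymbol\pi_T\boldsymbol u$ is the linear functional on $\boldsymbol B_\perp(\partial\Omega)$ defined by $\langle\boldsymbol\pi_T\boldsymbol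 u,\boldsymbol f\rangle_{\boldsymbol B'_\perp,\boldsymbol B_\perp}:=-b(\boldsymbol u,\boldsymbol w_f)$ for all $\boldsymbol f\in\boldsymbol B_\perp(\partial\Omega)$. *)

theory Defs
  imports "HOL-Analysis.Analysis"
begin

text \<open>
  Elements of Lebesgue and Sobolev spaces over \<open>\<Omega>\<close> are given by representatives, i.e. functions
  on the whole space of which only the values almost everywhere on \<open>\<Omega>\<close> matter; elements of trace
  spaces are given by functions of which only the values quasi-everywhere on \<open>frontier \<Omega>\<close> matter.
  All norms and forms below are invariant under a change of representative.
  Elements of dual spaces are functionals extended by \<open>0\<close> outside the space on which they act, so
  that equality of functionals is equality of functions.
\<close>

type_synonym R3 = "real ^ 3"
type_synonym scalar_field = "R3 \<Rightarrow> real"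
type_synonym vector_field = "R3 \<Rightarrow> R3"

abbreviation component :: "vector_field \<Rightarrow> 3 \<Rightarrow> scalar_field"
  where "component u i \<equiv> (\<lambda>x. u x $ i)"


section \<open>Sobolev spaces of first order\<close>

definition partial :: "3 \<Rightarrow> scalar_field \<Rightarrow> scalar_field"
  where "partial i \<phi> x = frechet_derivative \<phi> (at x) (axis i 1)"

primrec C_k :: "nat \<Rightarrow> scalar_field \<Rightarrow> bool" where
  "C_k 0 \<phi> \<longleftrightarrow> continuous_on UNIV \<phi>"
| "C_k (Suc k) \<phi> \<longleftrightarrow> (\<forall>x. \<phi> differentiable (at x)) \<and> (\<forall>i. C_k k (partial i \<phi>))"

definition test_fun :: "R3 set \<Rightarrow> scalar_field set"
  where "test_fun \<Omega> = {\<phi>. (\<forall>k. C_k k \<phi>) \<and> compact (closure {x. \<phi> x \<noteq> 0}) \<and> closure {x. \<phi> x \<noteq> 0} \<subseteq> \<Omega>}"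

definition L2 :: "R3 set \<Rightarrow> scalar_field set"
  where "L2 \<Omega> = {u. u \<in> borel_measurable (lebesgue_on \<Omega>) \<and> integrable (lebesgue_on \<Omega>) (\<lambda>x. (u x)\<^sup>2)}"

definition is_weak_deriv :: "R3 set \<Rightarrow> 3 \<Rightarrow> scalar_field \<Rightarrow> scalar_field \<Rightarrow> bool"
  where "is_weak_deriv \<Omega> i u g \<longleftrightarrow>
    (\<forall>\<phi>\<in>test_fun \<Omega>. (LINT x|lebesgue_on \<Omega>. u x * partial i \<phi> x) = - (LINT x|lebesgue_on \<Omega>. g x * \<phi> x))"

definition H1 :: "R3 set \<Rightarrow> scalar_field set"
  where "H1 \<Omega> = {u \<in> L2 \<Omega>. \<forall>i. \<exists>g\<in>L2 \<Omega>. is_weak_deriv \<Omega> i u g}"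

text \<open>The weak derivative is unique only almost everywhere; some representative is chosen.\<close>

definition wderiv :: "R3 set \<Rightarrow> 3 \<Rightarrow> scalar_field \<Rightarrow> scalar_field"
  where "wderiv \<Omega> i u = (SOME g. g \<in> L2 \<Omega> \<and> is_weak_deriv \<Omega> i u g)"

definition inner_H1 :: "R3 set \<Rightarrow> scalar_field \<Rightarrow> scalar_field \<Rightarrow> real"
  where "inner_H1 \<Omega> u v =
    (LINT x|lebesgue_on \<Omega>. u x * v x) + (\<Sum>i\<in>UNIV. LINT x|lebesgue_on \<Omega>. wderiv \<Omega> i u x * wderiv \<Omega> i v x)"

definition norm_H1 :: "R3 set \<Rightarrow> scalar_field \<Rightarrow> real"
  where "norm_H1 \<Omega> u = sqrt (inner_H1 \<Omega> u u)"

definition H1_extension_domain :: "R3 set \<Rightarrow> bool"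
  where "H1_extension_domain \<Omega> \<longleftrightarrow>
    (\<exists>E. (\<forall>u\<in>H1 \<Omega>. E u \<in> H1 UNIV \<and> (AE x in lebesgue_on \<Omega>. E u x = u x)) \<and>
         (\<forall>u\<in>H1 \<Omega>. \<forall>v\<in>H1 \<Omega>. \<forall>a c. AE x in lebesgue. E (\<lambda>y. a * u y + c * v y) x = a * E u x + c * E v x) \<and>
         (\<exists>C. \<forall>u\<in>H1 \<Omega>. norm_H1 UNIV (E u) \<le> C * norm_H1 \<Omega> u))"

definition H1v :: "R3 set \<Rightarrow> vector_field set"
  where "H1v \<Omega> = {u. \<forall>i. component u i \<in> H1 \<Omega>}"

definition inner_H1v :: "R3 set \<Rightarrow> vector_field \<Rightarrow> vector_field \<Rightarrow> real"
  where "inner_H1v \<Omega> u v = (\<Sum>i\<in>UNIV. inner_H1 \<Omega> (component u i) (component v i))"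

definition norm_H1v :: "R3 set \<Rightarrow> vector_field \<Rightarrow> real"
  where "norm_H1v \<Omega> u = sqrt (inner_H1v \<Omega> u u)"


section \<open>Capacity and traces\<close>

text \<open>The infimum over the empty set is \<open>\<infinity>\<close> in \<^typ>\<open>ennreal\<close>.\<close>

definition capacity :: "R3 set \<Rightarrow> ennreal"
  where "capacity A =
    (INF u\<in>{u \<in> H1 UNIV. \<exists>U. open U \<and> A \<subseteq> U \<and> (AE x in lebesgue_on U. u x \<ge> 1)}. ennreal ((norm_H1 UNIV u)\<^sup>2))"

definition qe_eq :: "R3 set \<Rightarrow> scalar_field \<Rightarrow> scalar_field \<Rightarrow> bool"
  where "qe_eq \<Omega> f g \<longleftrightarrow> capacity {x \<in> frontier \<Omega>. f x \<noteq> g x} = 0"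

text \<open>Where the limit does not exist the value below is arbitrary.\<close>

definition Tr :: "R3 set \<Rightarrow> scalar_field \<Rightarrow> scalar_field"
  where "Tr \<Omega> u x = Lim (at_right 0)
    (\<lambda>r. (1 / measure lebesgue (\<Omega> \<inter> ball x r)) * (LINT y|lebesgue_on (\<Omega> \<inter> ball x r). u y))"

definition tr_space :: "R3 set \<Rightarrow> scalar_field set"
  where "tr_space \<Omega> = {f. \<exists>v\<in>H1 \<Omega>. qe_eq \<Omega> (Tr \<Omega> v) f}"

definition norm_B :: "R3 set \<Rightarrow> scalar_field \<Rightarrow> real"
  where "norm_B \<Omega> f = Inf {norm_H1 \<Omega> v | v. v \<in> H1 \<Omega> \<and> qe_eq \<Omega> (Tr \<Omega> v) f}"

definition qe_eqv :: "R3 set \<Rightarrow> vector_field \<Rightarrow> vector_field \<Rightarrow> bool"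
  where "qe_eqv \<Omega> f g \<longleftrightarrow> (\<forall>i. qe_eq \<Omega> (component f i) (component g i))"

definition Trv :: "R3 set \<Rightarrow> vector_field \<Rightarrow> vector_field"
  where "Trv \<Omega> u x = (\<chi> i. Tr \<Omega> (component u i) x)"

definition Bv :: "R3 set \<Rightarrow> vector_field set"
  where "Bv \<Omega> = {f. \<forall>i. component f i \<in> tr_space \<Omega>}"

definition norm_Bv :: "R3 set \<Rightarrow> vector_field \<Rightarrow> real"
  where "norm_Bv \<Omega> f = sqrt (\<Sum>i\<in>UNIV. (norm_B \<Omega> (component f i))\<^sup>2)"

text \<open>Linearity is stated modulo equality quasi-everywhere; the case \<open>a = 1\<close>, \<open>c = 0\<close> says that
  the functional does not depend on the representative.\<close>

definition Bv_dual :: "R3 set \<Rightarrow> (vector_field \<Rightarrow> real) set"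
  where "Bv_dual \<Omega> = {F.
    (\<forall>f\<in>Bv \<Omega>. \<forall>g\<in>Bv \<Omega>. \<forall>h\<in>Bv \<Omega>. \<forall>a c.
       qe_eqv \<Omega> h (\<lambda>x. a *\<^sub>R f x + c *\<^sub>R g x) \<longrightarrow> F h = a * F f + c * F g) \<and>
    (\<exists>C. \<forall>f\<in>Bv \<Omega>. \<bar>F f\<bar> \<le> C * norm_Bv \<Omega> f) \<and>
    (\<forall>f. f \<notin> Bv \<Omega> \<longrightarrow> F f = 0)}"


section \<open>Stokes form and tangential traces\<close>

definition curl :: "R3 set \<Rightarrow> vector_field \<Rightarrow> vector_field"
  where "curl \<Omega> u x = vector
    [wderiv \<Omega> 2 (component u 3) x - wderiv \<Omega> 3 (component u 2) x,
     wderiv \<Omega> 3 (component u 1) x - wderiv \<Omega> 1 (component u 3) x,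
     wderiv \<Omega> 1 (component u 2) x - wderiv \<Omega> 2 (component u 1) x]"

definition stokes_form :: "R3 set \<Rightarrow> vector_field \<Rightarrow> vector_field \<Rightarrow> real"
  where "stokes_form \<Omega> u v = (LINT x|lebesgue_on \<Omega>. u x \<bullet> curl \<Omega> v x - v x \<bullet> curl \<Omega> u x)"

definition TrT :: "R3 set \<Rightarrow> vector_field \<Rightarrow> (vector_field \<Rightarrow> real)"
  where "TrT \<Omega> u = (THE F. F \<in> Bv_dual \<Omega> \<and> (\<forall>v\<in>H1v \<Omega>. F (Trv \<Omega> v) = stokes_form \<Omega> u v))"

definition ker_TrT :: "R3 set \<Rightarrow> vector_field set"
  where "ker_TrT \<Omega> = {u \<in> H1v \<Omega>. TrT \<Omega> u = (\<lambda>f. 0)}"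

definition K_perp :: "R3 set \<Rightarrow> vector_field set"
  where "K_perp \<Omega> = {w \<in> H1v \<Omega>. \<forall>u\<in>ker_TrT \<Omega>. inner_H1v \<Omega> w u = 0}"

definition B_perp :: "R3 set \<Rightarrow> (vector_field \<Rightarrow> real) set"
  where "B_perp \<Omega> = TrT \<Omega> ` H1v \<Omega>"

definition norm_B_perp :: "R3 set \<Rightarrow> (vector_field \<Rightarrow> real) \<Rightarrow> real"
  where "norm_B_perp \<Omega> f = Inf {norm_H1v \<Omega> v | v. v \<in> H1v \<Omega> \<and> TrT \<Omega> v = f}"

text \<open>The optimal lift is unique as an element of the Sobolev space, i.e. almost everywhere on
  \<open>\<Omega>\<close>; some representative is chosen.\<close>

definition optimal_lift :: "R3 set \<Rightarrow> (vector_field \<Rightarrow> real) \<Rightarrow> vector_field"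
  where "optimal_lift \<Omega> f = (SOME w. w \<in> K_perp \<Omega> \<and> TrT \<Omega> w = f)"

definition B_perp_dual :: "R3 set \<Rightarrow> ((vector_field \<Rightarrow> real) \<Rightarrow> real) set"
  where "B_perp_dual \<Omega> = {F.
    (\<forall>f\<in>B_perp \<Omega>. \<forall>g\<in>B_perp \<Omega>. \<forall>a c. F (\<lambda>h. a * f h + c * g h) = a * F f + c * F g) \<and>
    (\<exists>C. \<forall>f\<in>B_perp \<Omega>. \<bar>F f\<bar> \<le> C * norm_B_perp \<Omega> f) \<and>
    (\<forall>f. f \<notin> B_perp \<Omega> \<longrightarrow> F f = 0)}"

definition norm_B_perp_dual :: "R3 set \<Rightarrow> ((vector_field \<Rightarrow> real) \<Rightarrow> real) \<Rightarrow> real"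
  where "norm_B_perp_dual \<Omega> F = Sup {\<bar>F f\<bar> | f. f \<in> B_perp \<Omega> \<and> norm_B_perp \<Omega> f \<le> 1}"

definition piT :: "R3 set \<Rightarrow> vector_field \<Rightarrow> ((vector_field \<Rightarrow> real) \<Rightarrow> real)"
  where "piT \<Omega> u = (\<lambda>f. if f \<in> B_perp \<Omega> then - stokes_form \<Omega> u (optimal_lift \<Omega> f) else 0)"

end

theory Submission
  imports Defs
begin

text \<open>
  The point is that \<^const>\<open>TrT\<close> is well defined and that optimal lifts exist; then
  \<open>\<langle>\<pi>\<^sub>T u, Tr\<^sub>T v\<rangle> = - b(u, w) = b(w, u) = \<langle>Tr\<^sub>T w, Tr u\<rangle> = \<langle>Tr\<^sub>T v, Tr u\<rangle> = b(v, u)\<close> for the optimal lift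
  \<open>w\<close> of \<open>Tr\<^sub>T v\<close>, and everything follows from the antisymmetry of \<open>b\<close> and from \<open>\<bar>b(u, v)\<bar> \<le> \<surd>2 \<parallel>u\<parallel> \<parallel>v\<parallel>\<close>,
  a consequence of \<open>\<bar>curl u\<bar>\<^sup>2 \<le> 2 \<bar>\<nabla>u\<bar>\<^sup>2\<close>. Optimal lifts are orthogonal projections in the complete
  space \<open>H\<^sup>1(\<Omega>)\<^sup>3\<close>.

  That \<open>b(u, v)\<close> depends only on the trace of \<open>v\<close> is seen on lines parallel to the coordinate axes.
  On almost every such line the extension of \<open>v\<close> to the whole space is absolutely continuous, every
  point of the line is a Lebesgue point, and the line misses any given set of capacity zero. Since an
  extension domain occupies a fixed fraction of every small ball centred at its boundary, the trace
  agrees on the line with the absolutely continuous version. If the trace vanishes quasi-everywhere,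
  then this version vanishes at the end points of every component of the section of \<open>\<Omega>\<close> by the line;
  integrating the derivative of a product over the components and then over all lines gives
  \<open>\<integral>\<^sub>\<Omega> (u \<partial>\<^sub>i v + v \<partial>\<^sub>i u) = 0\<close>, and \<open>b\<close> is a sum of such terms.
\<close>

section \<open>Square integrable functions\<close>

text \<open>The obstacle is a mismatch of exceptional sets: \<open>stokes_form\<close> sees
  functions up to null sets, while the trace is a pointwise limit known up to sets of capacity zero
  on a frontier that may itself be a null set. Lines reconcile the two: a set of capacity zero
  misses almost every line entirely, so there the boundary values are known at every frontier point.
  Hence Lebesgue points are needed at all points of almost every line; one derivative in L2 along
  the line supplies this through Hoelder continuity of exponent 1/2. The averages defining the trace
  run over \<Omega> intersected with balls, whereas Lebesgue points of the extension control
  averages over full cubes. The comparison costs the quotient of the volumes, hence the density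
  bound. It comes from the extension operator itself: a cutoff has small norm where \<Omega> is
  thin, and a Sobolev type inequality, built from one-dimensional bounds on the three lines through
  a point and the Loomis-Whitney inequality, turns this into a still smaller share of volume at the
  next scale.\<close>

definition sqint :: "'a measure \<Rightarrow> ('a \<Rightarrow> real) \<Rightarrow> bool"
  where "sqint M u \<longleftrightarrow> u \<in> borel_measurable M \<and> integrable M (\<lambda>x. (u x)\<^sup>2)"

lemma L2_iff_sqint: "u \<in> L2 \<Omega> \<longleftrightarrow> sqint (lebesgue_on \<Omega>) u"
  by (simp add: L2_def sqint_def)

lemma sqint_measurable: "sqint M u \<Longrightarrow> u \<in> borel_measurable M"
  and sqint_integrable: "sqint M u \<Longrightarrow> integrable M (\<lambda>x. (u x)\<^sup>2)"
  by (simp_all add: sqint_def)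

lemma sqint_mult:
  assumes "sqint M u" "sqint M v"
  shows "integrable M (\<lambda>x. u x * v x)"
proof (rule Bochner_Integration.integrable_bound[of M "\<lambda>x. (u x)\<^sup>2 + (v x)\<^sup>2"])
  show "integrable M (\<lambda>x. (u x)\<^sup>2 + (v x)\<^sup>2)" using assms by (simp add: sqint_def)
  show "(\<lambda>x. u x * v x) \<in> borel_measurable M" using assms by (auto simp: sqint_def intro!: borel_measurable_times)
  have "\<bar>a * b\<bar> \<le> a\<^sup>2 + b\<^sup>2" for a b :: real
  proof -
    have "0 \<le> (\<bar>a\<bar> - \<bar>b\<bar>)\<^sup>2" by simp
    then have "2 * (\<bar>a\<bar> * \<bar>b\<bar>) \<le> a\<^sup>2 + b\<^sup>2" by (simp only: power2_diff) simp
    moreover have "0 \<le> \<bar>a\<bar> * \<bar>b\<bar>" by simp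
    ultimately show ?thesis unfolding abs_mult by linarith
  qed
  then show "AE x in M. norm (u x * v x) \<le> norm ((u x)\<^sup>2 + (v x)\<^sup>2)"
    by (auto intro!: AE_I2 order_trans[OF _ abs_ge_self])
qed

lemma sqint_lincomb:
  assumes "sqint M u" "sqint M v"
  shows "sqint M (\<lambda>x. a * u x + c * v x)"
proof -
  have "integrable M (\<lambda>x. a\<^sup>2 * (u x)\<^sup>2 + 2 * a * c * (u x * v x) + c\<^sup>2 * (v x)\<^sup>2)"
    using assms sqint_mult[OF assms] by (auto simp: sqint_def)
  moreover have "(\<lambda>x. a\<^sup>2 * (u x)\<^sup>2 + 2 * a * c * (u x * v x) + c\<^sup>2 * (v x)\<^sup>2) = (\<lambda>x. (a * u x + c * v x)\<^sup>2)"
    by (auto simp: power2_eq_square algebra_simps)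
  ultimately show ?thesis using assms by (auto simp: sqint_def)
qed

lemma sqint_diff: "sqint M u \<Longrightarrow> sqint M v \<Longrightarrow> sqint M (\<lambda>x. u x - v x)"
  using sqint_lincomb[of M u v 1 "-1"] by simp

lemma integral_Cauchy_Schwarz:
  assumes "sqint M u" "sqint M v"
  shows "\<bar>LINT x|M. u x * v x\<bar> \<le> sqrt (LINT x|M. (u x)\<^sup>2) * sqrt (LINT x|M. (v x)\<^sup>2)"
proof -
  define A B C where "A = (LINT x|M. (u x)\<^sup>2)" and "B = (LINT x|M. u x * v x)" and "C = (LINT x|M. (v x)\<^sup>2)"
  have q: "A * s\<^sup>2 + 2 * B * s * t + C * t\<^sup>2 \<ge> 0" for s t
  proof -
    have "0 \<le> (LINT x|M. (s * u x + t * v x)\<^sup>2)" by simp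
    also have "(\<lambda>x. (s * u x + t * v x)\<^sup>2) = (\<lambda>x. s\<^sup>2 * (u x)\<^sup>2 + 2 * s * t * (u x * v x) + t\<^sup>2 * (v x)\<^sup>2)"
      by (auto simp: power2_eq_square algebra_simps)
    also have "(LINT x|M. s\<^sup>2 * (u x)\<^sup>2 + 2 * s * t * (u x * v x) + t\<^sup>2 * (v x)\<^sup>2) = s\<^sup>2 * A + 2 * s * t * B + t\<^sup>2 * C"
      unfolding A_def B_def C_def using assms sqint_mult[OF assms]
      by (simp add: sqint_def)
    finally show ?thesis by (simp add: algebra_simps)
  qed
  have AC: "A \<ge> 0" "C \<ge> 0" by (auto simp: A_def C_def)
  have "B\<^sup>2 \<le> A * C"
  proof (cases "A = 0")
    case True
    have "B = 0"
    proof (rule ccontr)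
      assume "B \<noteq> 0"
      \<comment> \<open>With \<open>A = 0\<close> the quadratic form is linear in \<open>s\<close>;
        at this point it takes the value -1.\<close>
      have "2 * B * (- (C + 1) / (2*B)) * 1 + C * 1 \<ge> 0"
        using q[of "- (C + 1) / (2*B)" 1] True by simp
      then show False using \<open>B \<noteq> 0\<close> by (simp add: field_simps)
    qed
    then show ?thesis using True by simp
  next
    case False
    then have "A > 0" using AC by simp
    have "A * (A * C - B\<^sup>2) \<ge> 0"
      using q[of "-B" A] by (simp add: power2_eq_square algebra_simps)
    then show ?thesis using \<open>A > 0\<close> by (simp add: zero_le_mult_iff)
  qed
  then have "sqrt (B\<^sup>2) \<le> sqrt (A * C)" by (rule real_sqrt_le_mono)
  then show ?thesis by (simp add: A_def B_def C_def real_sqrt_mult)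
qed

lemma (in finite_measure) sqint_const: "sqint M (\<lambda>x. c)"
  by (simp add: sqint_def)

lemma (in finite_measure) sqint_imp_integrable: "sqint M u \<Longrightarrow> integrable M u"
  using sqint_mult[OF _ sqint_const[of 1], of u] by simp

lemma integrable_indicator_abs_diff:
  fixes f :: "'a \<Rightarrow> real"
  assumes "integrable M (\<lambda>x. indicator A x * f x)" "A \<in> sets M" "emeasure M A < \<infinity>"
  shows "integrable M (\<lambda>x. indicator A x * \<bar>f x - c\<bar>)"
proof -
  have "integrable M (\<lambda>x. \<bar>indicator A x * f x - indicator A x * c\<bar>)"
    using assms by (intro integrable_abs Bochner_Integration.integrable_diff integrable_mult_left integrable_real_indicator) auto
  moreover have "\<bar>indicator A x * f x - indicator A x * c\<bar> = indicator A x * \<bar>f x - c\<bar>" for x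
    by (auto simp: indicator_def)
  ultimately show ?thesis by simp
qed

section \<open>Smooth bump functions\<close>

text \<open>\<open>hexp 1\<close> is the classical flat function exp(-1/t). The polynomial in 1/t
  makes the family closed under differentiation, so that one derivative formula serves all
  orders.\<close>

definition hexp :: "real poly \<Rightarrow> real \<Rightarrow> real"
  where "hexp p t = (if t > 0 then poly p (1/t) * exp (- (1/t)) else 0)"

lemma poly_exp_tendsto_0: "((\<lambda>s::real. poly p s * exp (- s)) \<longlongrightarrow> 0) at_top"
proof -
  have "((\<lambda>s::real. \<Sum>i\<le>degree p. coeff p i * (s ^ i / exp s)) \<longlongrightarrow> (\<Sum>i\<le>degree p. coeff p i * 0)) at_top"
    by (intro tendsto_sum tendsto_mult tendsto_const tendsto_power_div_exp_0)
  moreover have "(\<Sum>i\<le>degree p. coeff p i * (s ^ i / exp s)) = poly p s * exp (- s)" for s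
    unfolding poly_altdef sum_distrib_right by (rule sum.cong) (auto simp: exp_minus field_simps)
  ultimately show ?thesis by simp
qed

text \<open>The polynomial \<open>[:0,0,1:]\<close> is the square of the variable: both the
  exponential and p(1/t) contribute a factor 1/t^2 when differentiated, the first with p, the second
  with -p'.\<close>

lemma hexp_has_derivative:
  "(hexp p has_real_derivative hexp ([:0,0,1:] * (p - pderiv p)) t) (at t)"
proof -
  let ?q = "[:0,0,1:] * (p - pderiv p)"
  consider "t > 0" | "t < 0" | "t = 0" by linarith
  then show ?thesis
  proof cases
    case 1
    have "((\<lambda>t. poly p (1/t) * exp (- (1/t))) has_real_derivative
        poly ?q (1/t) * exp (- (1/t))) (at t)"
    proof -
      have "((\<lambda>t. - (1/t)) has_real_derivative (1/t)\<^sup>2) (at t)"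
        by (rule derivative_eq_intros refl | use 1 in \<open>simp add: power2_eq_square\<close>)+
      then have e: "((\<lambda>t. exp (- (1/t))) has_real_derivative exp (- (1/t)) * (1/t)\<^sup>2) (at t)"
        by (rule DERIV_chain2[OF DERIV_exp])
      have "((\<lambda>t. 1/t) has_real_derivative - ((1/t)\<^sup>2)) (at t)"
        by (rule derivative_eq_intros refl | use 1 in \<open>simp add: power2_eq_square\<close>)+
      then have "((\<lambda>t. poly p (1/t)) has_real_derivative poly (pderiv p) (1/t) * (- ((1/t)\<^sup>2))) (at t)"
        by (rule DERIV_chain2[OF poly_DERIV])
      from DERIV_mult[OF this e] show ?thesis
        by (rule DERIV_cong) (simp add: algebra_simps power2_eq_square)
    qed
    moreover have "\<forall>\<^sub>F x in nhds t. hexp p x = poly p (1/x) * exp (- (1/x))"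
      by (rule eventually_mono[OF eventually_nhds_in_open[of "{0<..}" t]]) (use 1 in \<open>auto simp: hexp_def\<close>)
    moreover have "hexp ?q t = poly ?q (1/t) * exp (- (1/t))" using 1 by (simp add: hexp_def)
    ultimately show ?thesis
      by (intro iffD2[OF DERIV_cong_ev[of t t "hexp p" "\<lambda>t. poly p (1/t) * exp (- (1/t))" "hexp ?q t" "hexp ?q t"]])
         (simp_all only: refl)
  next
    case 2
    moreover have "\<forall>\<^sub>F x in nhds t. hexp p x = 0"
      by (rule eventually_mono[OF eventually_nhds_in_open[of "{..<0}" t]]) (use 2 in \<open>auto simp: hexp_def\<close>)
    moreover have "hexp ?q t = 0" using 2 by (simp add: hexp_def)
    ultimately show ?thesis
      by (intro iffD2[OF DERIV_cong_ev[of t t "hexp p" "\<lambda>t. 0" "hexp ?q t" 0]]) (simp_all only: refl DERIV_const)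
  next
    case 3
    have "((\<lambda>h. hexp p h / h) \<longlongrightarrow> 0) (at 0)"
    proof (rule filterlim_split_at)
      show "((\<lambda>h. hexp p h / h) \<longlongrightarrow> 0) (at_left 0)"
        by (rule tendsto_eventually, rule eventually_mono[OF eventually_at_left_real[of "-1" 0]])
           (auto simp: hexp_def)
      \<comment> \<open>With s = 1/h the difference quotient at 0 becomes s p(s) exp(-s);
        \<open>pCons 0 p\<close> is p times the variable.\<close>
      have "((\<lambda>h. poly (pCons 0 p) (inverse h) * exp (- inverse h)) \<longlongrightarrow> 0) (at_right (0::real))"
        by (rule filterlim_compose[OF poly_exp_tendsto_0 filterlim_inverse_at_top_right])
      moreover have "\<forall>\<^sub>F h in at_right 0. poly (pCons 0 p) (inverse h) * exp (- inverse h) = hexp p h / h"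
        by (rule eventually_mono[OF eventually_at_right_real[of 0 1]]) (auto simp: hexp_def inverse_eq_divide)
      ultimately show "((\<lambda>h. hexp p h / h) \<longlongrightarrow> 0) (at_right 0)"
        by (rule Lim_transform_eventually)
    qed
    moreover have "hexp r 0 = 0" for r by (simp add: hexp_def)
    ultimately show ?thesis using 3 by (simp add: DERIV_def)
  qed
qed

text \<open>\<open>C_k\<close> asks for all iterated partial derivatives. An algebra that contains
  the flat functions of single coordinates and is closed under partial derivatives yields them by
  one induction on the order.\<close>

inductive_set bump_alg :: "scalar_field set" where
  gen: "(\<lambda>x. hexp p (c * x $ i + d)) \<in> bump_alg"
| const: "(\<lambda>x. c) \<in> bump_alg"
| add: "f \<in> bump_alg \<Longrightarrow> g \<in> bump_alg \<Longrightarrow> (\<lambda>x. f x + g x) \<in> bump_alg"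
| mult: "f \<in> bump_alg \<Longrightarrow> g \<in> bump_alg \<Longrightarrow> (\<lambda>x. f x * g x) \<in> bump_alg"

lemma bump_alg_derivative:
  assumes "f \<in> bump_alg"
  shows "\<exists>D. (\<forall>x. (f has_derivative D x) (at x)) \<and> (\<forall>i. (\<lambda>x. D x (axis i 1)) \<in> bump_alg)"
  using assms
proof induction
  case (gen p c i d)
  let ?q = "[:0,0,1:] * (p - pderiv p)"
  have "((\<lambda>x::R3. hexp p (c * x $ i + d)) has_derivative (\<lambda>h. (c * h $ i) * hexp ?q (c * x $ i + d))) (at x)" for x
    by (rule has_derivative_eq_rhs, rule DERIV_compose_FDERIV[OF hexp_has_derivative])
       (auto intro!: derivative_eq_intros bounded_linear.has_derivative[OF bounded_linear_vec_nth])
  moreover have "(\<lambda>x. (c * (axis j 1 :: R3) $ i) * hexp ?q (c * x $ i + d)) \<in> bump_alg" for j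
    by (intro bump_alg.mult bump_alg.const bump_alg.gen)
  ultimately show ?case by (intro exI[of _ "\<lambda>x h. (c * h $ i) * hexp ?q (c * x $ i + d)"]) auto
next
  case (const c)
  show ?case by (intro exI[of _ "\<lambda>x h. 0"]) (auto intro: bump_alg.const)
next
  case (add f g)
  then obtain D E where
    "\<forall>x. (f has_derivative D x) (at x)" "\<forall>i. (\<lambda>x. D x (axis i 1)) \<in> bump_alg"
    "\<forall>x. (g has_derivative E x) (at x)" "\<forall>i. (\<lambda>x. E x (axis i 1)) \<in> bump_alg" by blast
  then show ?case
    by (intro exI[of _ "\<lambda>x h. D x h + E x h"]) (auto intro: bump_alg.add has_derivative_add)
next
  case (mult f g)
  then obtain D E where
    D: "\<forall>x. (f has_derivative D x) (at x)" "\<forall>i. (\<lambda>x. D x (axis i 1)) \<in> bump_alg"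
    "\<forall>x. (g has_derivative E x) (at x)" "\<forall>i. (\<lambda>x. E x (axis i 1)) \<in> bump_alg" by blast
  show ?case
    by (intro exI[of _ "\<lambda>x h. f x * E x h + D x h * g x"] conjI allI has_derivative_mult
        bump_alg.add bump_alg.mult mult.hyps) (use D in auto)
qed

lemma bump_alg_C_k: "f \<in> bump_alg \<Longrightarrow> C_k k f"
proof (induction k arbitrary: f)
  case 0
  obtain D where "\<forall>x. (f has_derivative D x) (at x)" using bump_alg_derivative[OF 0] by blast
  then show ?case
    by (auto intro!: continuous_at_imp_continuous_on has_derivative_continuous)
next
  case (Suc k)
  obtain D where D: "\<forall>x. (f has_derivative D x) (at x)" "\<forall>i. (\<lambda>x. D x (axis i 1)) \<in> bump_alg"
    using bump_alg_derivative[OF Suc.prems] by blast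
  then have "partial i f = (\<lambda>x. D x (axis i 1))" for i
    using frechet_derivative_at[of f "D x" x for x] by (fastforce simp: partial_def fun_eq_iff)
  then show ?case using D Suc.IH by (auto simp: differentiable_def)
qed

lemma hexp_nonneg: "0 \<le> hexp 1 t" and hexp_le_1: "hexp 1 t \<le> 1" and hexp_eq_0: "hexp 1 t = 0 \<longleftrightarrow> t \<le> 0"
  by (auto simp: hexp_def)

lemma hexp_mono: "s \<le> t \<Longrightarrow> hexp 1 s \<le> hexp 1 t"
  by (auto simp: hexp_def field_simps)

text \<open>The parameter \<open>n\<close> is the steepness: for every positive \<open>n\<close> the
  function is nonzero exactly on the open box, and as \<open>n\<close> grows it tends to the
  indicator of the box while staying below 1. Indicators of boxes thus become bounded limits of test
  functions.\<close>

definition bump :: "real \<Rightarrow> R3 \<Rightarrow> R3 \<Rightarrow> scalar_field"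
  where "bump n a b x = (\<Prod>i\<in>UNIV. hexp 1 (n * (x $ i - a $ i)) * hexp 1 (n * (b $ i - x $ i)))"

lemma bump_alg_prod: "(\<And>i. i \<in> I \<Longrightarrow> f i \<in> bump_alg) \<Longrightarrow> (\<lambda>x. \<Prod>i\<in>I. f i x) \<in> bump_alg"
  by (induction I rule: infinite_finite_induct) (auto intro: bump_alg.intros)

lemma bump_in_alg: "bump n a b \<in> bump_alg"
proof -
  have "(\<lambda>x. \<Prod>i\<in>UNIV. hexp 1 (n * x $ i + (- n * a $ i)) * hexp 1 ((-n) * x $ i + n * b $ i)) \<in> bump_alg"
    by (intro bump_alg_prod bump_alg.mult bump_alg.gen)
  then show ?thesis by (simp add: bump_def[abs_def] algebra_simps)
qed

lemma bump_nonneg: "0 \<le> bump n a b x" and bump_le_1: "bump n a b x \<le> 1"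
  unfolding bump_def by (auto intro!: prod_nonneg prod_le_1 mult_le_one simp: hexp_nonneg hexp_le_1)

lemma bump_nz: "n > 0 \<Longrightarrow> bump n a b x \<noteq> 0 \<longleftrightarrow> x \<in> box a b"
  by (auto simp: bump_def hexp_eq_0 mem_box_cart zero_less_mult_iff not_le mult_le_0_iff)

lemma bump_test_fun:
  assumes "n > 0" "cbox a b \<subseteq> \<Omega>"
  shows "bump n a b \<in> test_fun \<Omega>"
proof -
  have "{x. bump n a b x \<noteq> 0} = box a b" using assms bump_nz by auto
  moreover have "closure (box a b) \<subseteq> cbox a b" by (intro closure_minimal box_subset_cbox closed_cbox)
  moreover have "compact (closure (box a b))" by simp
  ultimately show ?thesis using assms bump_alg_C_k[OF bump_in_alg] by (auto simp: test_fun_def)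
qed

lemma hexp_tendsto_1:
  assumes t: "t > 0"
  shows "(\<lambda>n. hexp 1 (real (Suc n) * t)) \<longlonglongrightarrow> 1"
proof -
  have "(\<lambda>n. exp (- (inverse (real (Suc n)) * (1 / t)))) \<longlonglongrightarrow> exp (- (0 * (1 / t)))"
    by (intro tendsto_exp tendsto_minus tendsto_mult tendsto_const LIMSEQ_inverse_real_of_nat)
  moreover have "hexp 1 (real (Suc n) * t) = exp (- (inverse (real (Suc n)) * (1 / t)))" for n
  proof -
    have "real (Suc n) * t > 0" using t by (intro mult_pos_pos) auto
    moreover have "1 / (real (Suc n) * t) = inverse (real (Suc n)) * (1 / t)"
      by (simp add: inverse_eq_divide)
    ultimately show ?thesis by (simp add: hexp_def del: of_nat_Suc)
  qed
  ultimately show ?thesis by simp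
qed

lemma bump_tendsto: "(\<lambda>n. bump (real (Suc n)) a b x) \<longlonglongrightarrow> indicator (box a b) x"
proof (cases "x \<in> box a b")
  case True
  have "(\<lambda>n. bump (real (Suc n)) a b x) \<longlonglongrightarrow> (\<Prod>i\<in>(UNIV::3 set). 1 * 1)"
    unfolding bump_def using True
    by (intro tendsto_prod tendsto_mult hexp_tendsto_1) (auto simp: mem_box_cart)
  then show ?thesis using True by simp
next
  case False
  then show ?thesis using bump_nz[of "real (Suc _)" a b x] by auto
qed

section \<open>Weak derivatives\<close>

lemma test_fun_mono: "\<Omega> \<subseteq> \<Omega>' \<Longrightarrow> test_fun \<Omega> \<subseteq> test_fun \<Omega>'"
  by (auto simp: test_fun_def)

lemma test_funD:
  assumes "\<phi> \<in> test_fun \<Omega>"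
  shows "\<phi> differentiable (at x)" "continuous_on UNIV \<phi>" "continuous_on UNIV (partial i \<phi>)"
    "compact (closure {x. \<phi> x \<noteq> 0})" "closure {x. \<phi> x \<noteq> 0} \<subseteq> \<Omega>"
proof -
  have "C_k (Suc 0) \<phi>" "C_k 0 \<phi>" using assms unfolding test_fun_def by blast+
  then show "\<phi> differentiable (at x)" "continuous_on UNIV \<phi>" "continuous_on UNIV (partial i \<phi>)" by auto
qed (use assms in \<open>auto simp: test_fun_def\<close>)

lemma fun_eq_0_outside_support: "x \<notin> closure {x. \<phi> x \<noteq> 0} \<Longrightarrow> \<phi> x = 0"
  using closure_subset[of "{x. \<phi> x \<noteq> 0}"] by blast

lemma partial_eq_0_outside_support:
  assumes "x \<notin> closure {x. \<phi> x \<noteq> 0}"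
  shows "partial i \<phi> x = 0"
proof -
  let ?S = "- closure {x. \<phi> x \<noteq> 0}"
  have "(\<phi> has_derivative (\<lambda>h. 0)) (at x)"
  proof (rule has_derivative_transform_within_open[of "\<lambda>x. 0"])
    show "open ?S" "x \<in> ?S" using assms by auto
    show "0 = \<phi> y" if "y \<in> ?S" for y using fun_eq_0_outside_support[of y \<phi>] that by auto
  qed (rule has_derivative_const)
  then show ?thesis using frechet_derivative_at[of \<phi> "\<lambda>h. 0" x] by (auto simp: partial_def fun_eq_iff)
qed

lemma integrable_compact_support:
  fixes f :: "'a::euclidean_space \<Rightarrow> real"
  assumes "continuous_on UNIV f" "compact K" "\<And>x. x \<notin> K \<Longrightarrow> f x = 0"
  shows "integrable lborel f"
proof -
  have "integrable lborel (\<lambda>x. indicator K x *\<^sub>R f x)"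
    using assms by (intro borel_integrable_compact) (auto intro: continuous_on_subset)
  moreover have "(\<lambda>x. indicator K x *\<^sub>R f x) = f" using assms(3) by (force simp: indicator_def)
  ultimately show ?thesis by metis
qed

lemma sqint_compact_support:
  fixes f :: "'a::euclidean_space \<Rightarrow> real"
  assumes "continuous_on UNIV f" "compact K" "\<And>x. x \<notin> K \<Longrightarrow> f x = 0"
  shows "sqint lborel f"
  unfolding sqint_def
  using assms by (auto intro!: integrable_compact_support[of _ K] continuous_intros borel_measurable_continuous_onI)

lemma sqint_lebesgue: "sqint lborel f \<Longrightarrow> sqint lebesgue f"
  by (auto simp: sqint_def integrable_completion intro: measurable_completion)

lemma sqint_lebesgue_on:
  assumes "sqint lebesgue f" "\<Omega> \<in> sets lebesgue"
  shows "sqint (lebesgue_on \<Omega>) f"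
  using assms integrable_mult_indicator[of \<Omega> lebesgue "\<lambda>x. (f x)\<^sup>2"]
  by (auto simp: sqint_def integrable_restrict_space intro: measurable_restrict_space1)

lemma sqint_lebesgue_on_iff:
  assumes "\<Omega> \<in> sets lebesgue"
  shows "sqint (lebesgue_on \<Omega>) f \<longleftrightarrow> sqint lebesgue (\<lambda>x. if x \<in> \<Omega> then f x else 0)"
proof -
  have "(\<lambda>x. indicator \<Omega> x *\<^sub>R (f x)\<^sup>2) = (\<lambda>x. (if x \<in> \<Omega> then f x else 0)\<^sup>2)"
    by (auto simp: indicator_def)
  then show ?thesis using assms
    by (simp add: sqint_def integrable_restrict_space borel_measurable_if)
qed

lemma sqint_test_fun:
  assumes "\<phi> \<in> test_fun \<Omega>"
  shows "sqint lborel \<phi>" "sqint lborel (partial i \<phi>)"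
  by (rule sqint_compact_support[of _ "closure {x. \<phi> x \<noteq> 0}", OF test_funD(2)[OF assms] test_funD(4)[OF assms]],
      erule fun_eq_0_outside_support)
     (rule sqint_compact_support[of _ "closure {x. \<phi> x \<noteq> 0}", OF test_funD(3)[OF assms] test_funD(4)[OF assms]],
      erule partial_eq_0_outside_support)

lemma sqint_test_fun_on:
  assumes "\<phi> \<in> test_fun \<Omega>'" "\<Omega> \<in> sets lebesgue"
  shows "sqint (lebesgue_on \<Omega>) \<phi>" "sqint (lebesgue_on \<Omega>) (partial i \<phi>)"
  using sqint_test_fun[OF assms(1)] assms(2) by (auto intro: sqint_lebesgue_on sqint_lebesgue)

lemma partial_line_derivative:
  assumes "\<And>x. \<phi> differentiable (at x)"
  shows "((\<lambda>s. \<phi> (x + s *\<^sub>R axis i 1)) has_real_derivative partial i \<phi> (x + s *\<^sub>R axis i 1)) (at s)"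
proof -
  have 1: "(\<phi> has_derivative frechet_derivative \<phi> (at y)) (at y)" for y
    using assms frechet_derivative_works by blast
  have lin: "linear (frechet_derivative \<phi> (at y))" for y
    using 1 has_derivative_linear by blast
  have "((\<lambda>s. \<phi> (x + s *\<^sub>R axis i 1)) has_derivative
      (\<lambda>h. frechet_derivative \<phi> (at (x + s *\<^sub>R axis i 1)) (h *\<^sub>R axis i 1))) (at s)"
    by (rule has_derivative_compose[OF _ 1]) (auto intro!: derivative_eq_intros)
  moreover have "(\<lambda>h. frechet_derivative \<phi> (at (x + s *\<^sub>R axis i 1)) (h *\<^sub>R axis i 1)) =
     (*) (partial i \<phi> (x + s *\<^sub>R axis i 1))"
    by (auto simp: partial_def linear_cmul[OF lin])
  ultimately show ?thesis by (simp add: has_field_derivative_def)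
qed

lemma partial_FTC:
  assumes "\<And>x. \<phi> differentiable (at x)" "continuous_on UNIV (partial i \<phi>)" "0 \<le> t"
  shows "(LINT s|lborel. partial i \<phi> (x + s *\<^sub>R axis i 1) * indicator {0..t} s) = \<phi> (x + t *\<^sub>R axis i 1) - \<phi> x"
proof -
  have "isCont (\<lambda>s. partial i \<phi> (x + s *\<^sub>R axis i 1)) s" for s
    by (rule continuous_on_interior[of UNIV])
       (auto intro!: continuous_on_compose2[OF assms(2)] continuous_intros)
  then show ?thesis
    using integral_FTC_Icc_real[of 0 t "\<lambda>s. \<phi> (x + s *\<^sub>R axis i 1)" "\<lambda>s. partial i \<phi> (x + s *\<^sub>R axis i 1)"]
      partial_line_derivative[OF assms(1)] assms(3) by auto
qed

text \<open>At almost every point G is the limit of its averages over cubes with lower corner at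
  that point, and inside the box all these averages vanish. The boundary of the box is
  negligible.\<close>

lemma box_integral_0_imp_AE_0:
  fixes G :: "'a::euclidean_space \<Rightarrow> real"
  assumes int: "set_integrable lebesgue (cbox a b) G"
    and zero: "\<And>c d. cbox c d \<subseteq> cbox a b \<Longrightarrow> (LINT x:cbox c d|lebesgue. G x) = 0"
  shows "AE x in lebesgue. x \<in> cbox a b \<longrightarrow> G x = 0"
proof -
  define f where "f = (\<lambda>x. indicator (cbox a b) x *\<^sub>R G x)"
  have f: "integrable lebesgue f" using int by (simp add: set_integrable_def f_def)
  have "set_integrable lebesgue (cbox c d) f" for c d
    unfolding set_integrable_def by (rule integrable_mult_indicator[OF _ f]) simp
  then have fi: "f integrable_on cbox c d" for c d
    by (simp add: set_borel_integral_eq_integral(1) set_lebesgue_integral_eq_integral(1))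
  obtain N where N: "negligible N" "\<And>x e. \<lbrakk>x \<notin> N; 0 < e\<rbrakk> \<Longrightarrow>
      \<exists>d>0. \<forall>h. 0 < h \<and> h < d \<longrightarrow> norm(integral (cbox x (x + h *\<^sub>R One)) f /\<^sub>R h ^ DIM('a) - f x) < e"
    using integrable_ccontinuous_explicit[of f] fi by blast
  have z: "G x = 0" if x: "x \<in> box a b" "x \<notin> N" for x
  proof (rule ccontr)
    assume nz: "G x \<noteq> 0"
    have fx: "f x = G x" using x box_subset_cbox by (force simp: f_def)
    obtain d where d: "d > 0" "\<And>h. 0 < h \<Longrightarrow> h < d \<Longrightarrow> norm(integral (cbox x (x + h *\<^sub>R One)) f /\<^sub>R h ^ DIM('a) - f x) < \<bar>G x\<bar>"
      using N(2)[of x "\<bar>G x\<bar>"] x nz by auto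
    obtain r where r: "r > 0" "\<And>y. dist x y < r \<Longrightarrow> y \<in> box a b"
      using open_box[of a b] x unfolding open_dist by (metis dist_commute)
    \<comment> \<open>The first bound keeps \<open>h\<close> in the range of the differentiation
      theorem, the second keeps the opposite corner of the cube inside the open box.\<close>
    define h where "h = min d (r / (norm (One::'a) + 1)) / 2"
    have np: "norm (One::'a) + 1 > 0" by (smt (verit) norm_ge_zero)
    have h: "0 < h" "h < d" "h * (norm (One::'a) + 1) < r"
    proof -
      show "0 < h" "h < d" using d(1) r(1) np by (auto simp: h_def)
      have "h \<le> (r / (norm (One::'a) + 1)) / 2" unfolding h_def by (intro divide_right_mono) auto
      then have "h * (norm (One::'a) + 1) \<le> (r / (norm (One::'a) + 1)) / 2 * (norm (One::'a) + 1)"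
        using np by (intro mult_right_mono) auto
      also have "\<dots> = r / 2" using np by (simp add: divide_simps)
      finally show "h * (norm (One::'a) + 1) < r" using r(1) by simp
    qed
    have sub: "cbox x (x + h *\<^sub>R One) \<subseteq> cbox a b"
    proof -
      have "dist x (x + h *\<^sub>R One) < r" using h by (simp add: dist_norm algebra_simps)
      then have "x + h *\<^sub>R One \<in> box a b" using r by blast
      then show ?thesis using x by (auto simp: subset_box mem_box)
    qed
    then have "integral (cbox x (x + h *\<^sub>R One)) f = integral (cbox x (x + h *\<^sub>R One)) G"
      by (intro integral_cong) (auto simp: f_def)
    also have "\<dots> = (LINT x:cbox x (x + h *\<^sub>R One)|lebesgue. G x)"
      by (rule set_lebesgue_integral_eq_integral(2)[symmetric], rule set_integrable_subset[OF int])
         (use sub in auto)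
    also have "\<dots> = 0" using zero[OF sub] .
    finally show False using d(2)[OF h(1,2)] fx by simp
  qed
  have "negligible (N \<union> (cbox a b - box a b))"
    using N(1) negligible_frontier_interval[of a b] by simp
  then have "N \<union> (cbox a b - box a b) \<in> null_sets lebesgue" by (simp add: negligible_iff_null_sets)
  then show ?thesis by (rule AE_I') (use z in auto)
qed

text \<open>The fundamental lemma of the calculus of variations with bumps as the only test
  functions: they tend boundedly to the indicator of a box, so the integrals of G over boxes vanish,
  and countably many boxes cover \<Omega>.\<close>

lemma bump_integral_0_imp_AE_0:
  assumes "open \<Omega>"
    and int: "\<And>a b. cbox a b \<subseteq> \<Omega> \<Longrightarrow> set_integrable lebesgue (cbox a b) G"
    and zero: "\<And>a b n. n > 0 \<Longrightarrow> cbox a b \<subseteq> \<Omega> \<Longrightarrow> (LINT x:\<Omega>|lebesgue. G x * bump n a b x) = 0"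
  shows "AE x in lebesgue. x \<in> \<Omega> \<longrightarrow> G x = 0"
proof -
  have box0: "(LINT x:cbox a b|lebesgue. G x) = 0" if sub: "cbox a b \<subseteq> \<Omega>" for a b
  proof -
    have eq: "(LINT x:\<Omega>|lebesgue. G x * bump n a b x) = (LINT x|lebesgue. indicator (cbox a b) x *\<^sub>R G x * bump n a b x)"
      if "n > 0" for n
      unfolding set_lebesgue_integral_def
    proof (rule Bochner_Integration.integral_cong[OF refl])
      show "indicator \<Omega> x *\<^sub>R (G x * bump n a b x) = indicator (cbox a b) x *\<^sub>R G x * bump n a b x" for x
        using bump_nz[OF \<open>n > 0\<close>, of a b x] box_subset_cbox[of a b] sub by (auto simp: indicator_def)
    qed
    have meas: "(\<lambda>x. indicator (cbox a b) x *\<^sub>R G x) \<in> borel_measurable lebesgue"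
      using int[OF sub] by (auto simp: set_integrable_def)
    have bm: "bump n a b \<in> borel_measurable lebesgue" if "n > 0" for n
      using sqint_test_fun(1)[OF bump_test_fun[OF that subset_UNIV], of a b]
      by (auto simp: sqint_def intro: measurable_completion)
    have "(\<lambda>n. LINT x|lebesgue. indicator (cbox a b) x *\<^sub>R G x * bump (real (Suc n)) a b x) \<longlonglongrightarrow>
       (LINT x|lebesgue. indicator (cbox a b) x *\<^sub>R G x * indicator (box a b) x)"
    proof (rule integral_dominated_convergence[where w = "\<lambda>x. \<bar>indicator (cbox a b) x *\<^sub>R G x\<bar>"])
      show "integrable lebesgue (\<lambda>x. \<bar>indicator (cbox a b) x *\<^sub>R G x\<bar>)"
        using int[OF sub] unfolding set_integrable_def by (rule integrable_abs)
      show "(\<lambda>x. indicator (cbox a b) x *\<^sub>R G x * indicator (box a b) x) \<in> borel_measurable lebesgue"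
        by (intro borel_measurable_times meas borel_measurable_indicator) simp
      show "(\<lambda>x. indicator (cbox a b) x *\<^sub>R G x * bump (real (Suc n)) a b x) \<in> borel_measurable lebesgue" for n
        by (intro borel_measurable_times meas bm) simp
      show "AE x in lebesgue. (\<lambda>n. indicator (cbox a b) x *\<^sub>R G x * bump (real (Suc n)) a b x) \<longlonglongrightarrow>
         indicator (cbox a b) x *\<^sub>R G x * indicator (box a b) x"
        by (intro AE_I2 tendsto_mult tendsto_const bump_tendsto)
      show "AE x in lebesgue. norm (indicator (cbox a b) x *\<^sub>R G x * bump (real (Suc n)) a b x)
         \<le> \<bar>indicator (cbox a b) x *\<^sub>R G x\<bar>" for n
        by (intro AE_I2) (auto simp: abs_mult bump_nonneg bump_le_1 intro!: mult_left_le)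
    qed
    moreover have "(LINT x|lebesgue. indicator (cbox a b) x *\<^sub>R G x * bump (real (Suc n)) a b x) = 0" for n
      using eq[of "real (Suc n)"] zero[OF _ sub, of "real (Suc n)"] by simp
    ultimately have "(LINT x|lebesgue. indicator (cbox a b) x *\<^sub>R G x * indicator (box a b) x) = 0"
      using LIMSEQ_unique[OF _ tendsto_const] by (metis (no_types, lifting) LIMSEQ_const_iff ext)
    moreover have "(LINT x|lebesgue. indicator (cbox a b) x *\<^sub>R G x * indicator (box a b) x) = (LINT x|lebesgue. indicator (cbox a b) x *\<^sub>R G x)"
    proof (rule integral_cong_AE)
      have "cbox a b - box a b \<in> null_sets lebesgue"
        using negligible_frontier_interval negligible_iff_null_sets by blast
      then show "AE x in lebesgue. indicator (cbox a b) x *\<^sub>R G x * indicator (box a b) x = indicator (cbox a b) x *\<^sub>R G x"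
        by (rule AE_I') (auto simp: indicator_def)
      show "(\<lambda>x. indicator (cbox a b) x *\<^sub>R G x * indicator (box a b) x) \<in> borel_measurable lebesgue"
        by (intro borel_measurable_times meas borel_measurable_indicator) simp
    qed (rule meas)
    ultimately show ?thesis by (simp add: set_lebesgue_integral_def)
  qed
  obtain \<D> where D: "countable \<D>" "\<D> \<subseteq> Pow \<Omega>" "\<And>X. X \<in> \<D> \<Longrightarrow> \<exists>a b. X = cbox a b" "\<Union>\<D> = \<Omega>"
    using open_countable_Union_open_cbox[OF assms(1)] by metis
  have "AE x in lebesgue. \<forall>X\<in>\<D>. x \<in> X \<longrightarrow> G x = 0"
  proof (subst AE_ball_countable[OF D(1)], intro ballI)
    fix X assume X: "X \<in> \<D>"
    then obtain a b where ab: "X = cbox a b" using D by blast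
    then have sub: "cbox a b \<subseteq> \<Omega>" using D X by auto
    show "AE x in lebesgue. x \<in> X \<longrightarrow> G x = 0"
      unfolding ab using int[OF sub] box0 sub by (intro box_integral_0_imp_AE_0) auto
  qed
  then show ?thesis by eventually_elim (use D(4) in blast)
qed

lemma set_integrable_cbox_L2:
  assumes "sqint (lebesgue_on \<Omega>) g" "\<Omega> \<in> sets lebesgue" "cbox a b \<subseteq> \<Omega>"
  shows "set_integrable lebesgue (cbox a b) (\<lambda>x::'a::euclidean_space. g x)"
proof -
  interpret finite_measure "lebesgue_on (cbox a b)"
    by (rule finite_measure_lebesgue_on) simp
  have "sqint lebesgue (\<lambda>x. if x \<in> \<Omega> then g x else 0)" using assms sqint_lebesgue_on_iff by blast
  then have "sqint (lebesgue_on (cbox a b)) (\<lambda>x. if x \<in> \<Omega> then g x else 0)"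
    by (rule sqint_lebesgue_on) simp
  then have "integrable (lebesgue_on (cbox a b)) (\<lambda>x. if x \<in> \<Omega> then g x else 0)"
    by (rule sqint_imp_integrable)
  then have "set_integrable lebesgue (cbox a b) (\<lambda>x. if x \<in> \<Omega> then g x else 0)"
    by (simp add: integrable_restrict_space set_integrable_def)
  moreover have "set_integrable lebesgue (cbox a b) (\<lambda>x. if x \<in> \<Omega> then g x else 0) \<longleftrightarrow> set_integrable lebesgue (cbox a b) g"
    by (rule set_integrable_cong) (use assms in auto)
  ultimately show ?thesis by simp
qed

lemma AE_lebesgue_on_iff:
  "\<Omega> \<in> sets lebesgue \<Longrightarrow> (AE x in lebesgue_on \<Omega>. P x) \<longleftrightarrow> (AE x in lebesgue. x \<in> \<Omega> \<longrightarrow> P x)"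
  by (simp add: AE_restrict_space_iff)

lemma integral_lebesgue_on_eq:
  fixes f :: "'a::euclidean_space \<Rightarrow> real"
  shows "\<Omega> \<in> sets lebesgue \<Longrightarrow> (LINT x|lebesgue_on \<Omega>. f x) = (LINT x:\<Omega>|lebesgue. f x)"
  by (simp add: integral_restrict_space set_lebesgue_integral_def)

text \<open>This makes the choice in \<open>wderiv\<close> harmless: an identity proved for some
  weak derivative transfers almost everywhere to the chosen representative.\<close>

lemma weak_deriv_unique:
  assumes "open \<Omega>" "g \<in> L2 \<Omega>" "h \<in> L2 \<Omega>" "is_weak_deriv \<Omega> i u g" "is_weak_deriv \<Omega> i u h"
  shows "AE x in lebesgue_on \<Omega>. g x = h x"
proof -
  have meas: "\<Omega> \<in> sets lebesgue" using assms(1) by auto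
  have L: "sqint (lebesgue_on \<Omega>) g" "sqint (lebesgue_on \<Omega>) h" using assms by (auto simp: L2_iff_sqint)
  have "AE x in lebesgue. x \<in> \<Omega> \<longrightarrow> g x - h x = 0"
  proof (rule bump_integral_0_imp_AE_0[OF assms(1)])
    show "set_integrable lebesgue (cbox a b) (\<lambda>x. g x - h x)" if "cbox a b \<subseteq> \<Omega>" for a b
      using set_integrable_cbox_L2[OF sqint_diff[OF L] meas that] .
    fix a b and n :: real assume *: "n > 0" "cbox a b \<subseteq> \<Omega>"
    have t: "bump n a b \<in> test_fun \<Omega>" using bump_test_fun * by blast
    have "(LINT x|lebesgue_on \<Omega>. (g x - h x) * bump n a b x) = (LINT x|lebesgue_on \<Omega>. g x * bump n a b x) - (LINT x|lebesgue_on \<Omega>. h x * bump n a b x)"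
      using sqint_mult[OF L(1) sqint_test_fun_on(1)[OF t meas]] sqint_mult[OF L(2) sqint_test_fun_on(1)[OF t meas]]
      by (simp add: left_diff_distrib)
    also have "\<dots> = 0" using bspec[OF assms(4)[unfolded is_weak_deriv_def] t] bspec[OF assms(5)[unfolded is_weak_deriv_def] t] by simp
    finally show "(LINT x:\<Omega>|lebesgue. (g x - h x) * bump n a b x) = 0"
      using integral_lebesgue_on_eq[OF meas] by simp
  qed
  then show ?thesis by (simp add: AE_lebesgue_on_iff[OF meas])
qed

lemma weak_deriv_lincomb:
  assumes "\<Omega> \<in> sets lebesgue" "u \<in> L2 \<Omega>" "v \<in> L2 \<Omega>" "g \<in> L2 \<Omega>" "h \<in> L2 \<Omega>"
    "is_weak_deriv \<Omega> i u g" "is_weak_deriv \<Omega> i v h"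
  shows "is_weak_deriv \<Omega> i (\<lambda>x. a * u x + c * v x) (\<lambda>x. a * g x + c * h x)"
  unfolding is_weak_deriv_def
proof
  fix \<phi> assume t: "\<phi> \<in> test_fun \<Omega>"
  note [simp] = sqint_mult[OF _ sqint_test_fun_on(1)[OF t assms(1)]] sqint_mult[OF _ sqint_test_fun_on(2)[OF t assms(1)]]
  have L: "sqint (lebesgue_on \<Omega>) u" "sqint (lebesgue_on \<Omega>) v" "sqint (lebesgue_on \<Omega>) g" "sqint (lebesgue_on \<Omega>) h"
    using assms by (auto simp: L2_iff_sqint)
  have "(LINT x|lebesgue_on \<Omega>. (a * u x + c * v x) * partial i \<phi> x) =
     a * (LINT x|lebesgue_on \<Omega>. u x * partial i \<phi> x) + c * (LINT x|lebesgue_on \<Omega>. v x * partial i \<phi> x)"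
    using L by (simp add: distrib_right mult.assoc)
  also have "\<dots> = - (a * (LINT x|lebesgue_on \<Omega>. g x * \<phi> x) + c * (LINT x|lebesgue_on \<Omega>. h x * \<phi> x))"
    using assms(6,7) t unfolding is_weak_deriv_def by (simp add: algebra_simps)
  also have "a * (LINT x|lebesgue_on \<Omega>. g x * \<phi> x) + c * (LINT x|lebesgue_on \<Omega>. h x * \<phi> x) =
     (LINT x|lebesgue_on \<Omega>. (a * g x + c * h x) * \<phi> x)"
    using L by (simp add: distrib_right mult.assoc)
  finally show "(LINT x|lebesgue_on \<Omega>. (a * u x + c * v x) * partial i \<phi> x) = - (LINT x|lebesgue_on \<Omega>. (a * g x + c * h x) * \<phi> x)" .
qed

lemma weak_deriv_cong_AE:
  assumes "is_weak_deriv \<Omega> i u g" "AE x in lebesgue_on \<Omega>. u x = v x" "AE x in lebesgue_on \<Omega>. g x = h x"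
    "u \<in> borel_measurable (lebesgue_on \<Omega>)" "v \<in> borel_measurable (lebesgue_on \<Omega>)"
    "g \<in> borel_measurable (lebesgue_on \<Omega>)" "h \<in> borel_measurable (lebesgue_on \<Omega>)" "\<Omega> \<in> sets lebesgue"
  shows "is_weak_deriv \<Omega> i v h"
  unfolding is_weak_deriv_def
proof
  fix \<phi> assume t: "\<phi> \<in> test_fun \<Omega>"
  have m: "\<phi> \<in> borel_measurable (lebesgue_on \<Omega>)" "partial i \<phi> \<in> borel_measurable (lebesgue_on \<Omega>)"
    using sqint_test_fun_on[OF t assms(8)] by (auto simp: sqint_def)
  have "(LINT x|lebesgue_on \<Omega>. v x * partial i \<phi> x) = (LINT x|lebesgue_on \<Omega>. u x * partial i \<phi> x)"
    using assms m by (intro integral_cong_AE borel_measurable_times) auto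
  also have "\<dots> = - (LINT x|lebesgue_on \<Omega>. g x * \<phi> x)" using assms(1) t by (auto simp: is_weak_deriv_def)
  also have "(LINT x|lebesgue_on \<Omega>. g x * \<phi> x) = (LINT x|lebesgue_on \<Omega>. h x * \<phi> x)"
    using assms m by (intro integral_cong_AE borel_measurable_times) auto
  finally show "(LINT x|lebesgue_on \<Omega>. v x * partial i \<phi> x) = - (LINT x|lebesgue_on \<Omega>. h x * \<phi> x)" .
qed

lemma weak_deriv_restrict:
  assumes "is_weak_deriv UNIV i u g" "\<Omega> \<in> sets lebesgue"
  shows "is_weak_deriv \<Omega> i u g"
  unfolding is_weak_deriv_def
proof
  fix \<phi> assume t: "\<phi> \<in> test_fun \<Omega>"
  have z: "\<phi> x = 0" "partial i \<phi> x = 0" if "x \<notin> \<Omega>" for x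
    using that test_funD(5)[OF t] fun_eq_0_outside_support[of x \<phi>] partial_eq_0_outside_support[of x \<phi>] by auto
  have e: "(LINT x|lebesgue_on \<Omega>. f x * \<psi> x) = (LINT x|lebesgue_on UNIV. f x * \<psi> x)"
    if "\<And>x. x \<notin> \<Omega> \<Longrightarrow> \<psi> x = 0" for f \<psi> :: scalar_field
    using that unfolding integral_lebesgue_on_eq[OF assms(2)] set_lebesgue_integral_def lebesgue_on_UNIV_eq
    by (intro Bochner_Integration.integral_cong) (auto simp: indicator_def)
  show "(LINT x|lebesgue_on \<Omega>. u x * partial i \<phi> x) = - (LINT x|lebesgue_on \<Omega>. g x * \<phi> x)"
    using assms(1) t test_fun_mono[of \<Omega> UNIV] z e[of "partial i \<phi>" u] e[of \<phi> g]
    by (auto simp: is_weak_deriv_def)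
qed

lemma H1_L2: "u \<in> H1 \<Omega> \<Longrightarrow> u \<in> L2 \<Omega>" by (simp add: H1_def)

lemma wderiv:
  assumes "u \<in> H1 \<Omega>"
  shows "wderiv \<Omega> i u \<in> L2 \<Omega>" "is_weak_deriv \<Omega> i u (wderiv \<Omega> i u)"
proof -
  have "\<exists>g. g \<in> L2 \<Omega> \<and> is_weak_deriv \<Omega> i u g" using assms by (auto simp: H1_def)
  from someI_ex[OF this] show "wderiv \<Omega> i u \<in> L2 \<Omega>" "is_weak_deriv \<Omega> i u (wderiv \<Omega> i u)"
    by (simp_all add: wderiv_def)
qed

lemma wderiv_unique:
  assumes "open \<Omega>" "u \<in> H1 \<Omega>" "g \<in> L2 \<Omega>" "is_weak_deriv \<Omega> i u g"
  shows "AE x in lebesgue_on \<Omega>. wderiv \<Omega> i u x = g x"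
  using weak_deriv_unique[OF assms(1) wderiv(1) assms(3) wderiv(2) assms(4)] assms(2) by blast

lemma H1_lincomb:
  assumes "open \<Omega>" "u \<in> H1 \<Omega>" "v \<in> H1 \<Omega>"
  shows "(\<lambda>x. a * u x + c * v x) \<in> H1 \<Omega>"
    and "AE x in lebesgue_on \<Omega>. wderiv \<Omega> i (\<lambda>x. a * u x + c * v x) x = a * wderiv \<Omega> i u x + c * wderiv \<Omega> i v x"
proof -
  have m: "\<Omega> \<in> sets lebesgue" using assms by auto
  have L: "(\<lambda>x. a * wderiv \<Omega> i u x + c * wderiv \<Omega> i v x) \<in> L2 \<Omega>" for i
    using assms wderiv(1) by (auto simp: L2_iff_sqint intro: sqint_lincomb)
  have w: "is_weak_deriv \<Omega> i (\<lambda>x. a * u x + c * v x) (\<lambda>x. a * wderiv \<Omega> i u x + c * wderiv \<Omega> i v x)" for i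
    using assms m wderiv by (intro weak_deriv_lincomb) (auto simp: H1_L2)
  show H: "(\<lambda>x. a * u x + c * v x) \<in> H1 \<Omega>"
  proof -
    have "(\<lambda>x. a * u x + c * v x) \<in> L2 \<Omega>"
      using H1_L2[OF assms(2)] H1_L2[OF assms(3)] by (simp add: L2_iff_sqint sqint_lincomb)
    then show ?thesis unfolding H1_def using L w by blast
  qed
  show "AE x in lebesgue_on \<Omega>. wderiv \<Omega> i (\<lambda>x. a * u x + c * v x) x = a * wderiv \<Omega> i u x + c * wderiv \<Omega> i v x"
    by (rule wderiv_unique[OF assms(1) H L w])
qed

lemma H1_sqint:
  assumes "u \<in> H1 \<Omega>"
  shows "sqint (lebesgue_on \<Omega>) u" "sqint (lebesgue_on \<Omega>) (wderiv \<Omega> i u)"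
  using assms wderiv H1_L2 by (auto simp: L2_iff_sqint[symmetric])

lemma inner_H1_lincomb_left:
  assumes "open \<Omega>" "u \<in> H1 \<Omega>" "v \<in> H1 \<Omega>" "w \<in> H1 \<Omega>"
  shows "inner_H1 \<Omega> (\<lambda>x. a * u x + c * v x) w = a * inner_H1 \<Omega> u w + c * inner_H1 \<Omega> v w"
proof -
  note s = H1_sqint[OF assms(2)] H1_sqint[OF assms(3)] H1_sqint[OF assms(4)] H1_sqint[OF H1_lincomb(1)[OF assms(1-3)]]
  have m: "sqint (lebesgue_on \<Omega>) f \<Longrightarrow> f \<in> borel_measurable (lebesgue_on \<Omega>)" for f by (simp add: sqint_def)
  have "(LINT x|lebesgue_on \<Omega>. wderiv \<Omega> i (\<lambda>x. a * u x + c * v x) x * wderiv \<Omega> i w x) =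
    (LINT x|lebesgue_on \<Omega>. (a * wderiv \<Omega> i u x + c * wderiv \<Omega> i v x) * wderiv \<Omega> i w x)" for i
  proof (rule integral_cong_AE)
    show "AE x in lebesgue_on \<Omega>. wderiv \<Omega> i (\<lambda>x. a * u x + c * v x) x * wderiv \<Omega> i w x =
      (a * wderiv \<Omega> i u x + c * wderiv \<Omega> i v x) * wderiv \<Omega> i w x"
      using H1_lincomb(2)[OF assms(1-3), of i a c] by eventually_elim simp
  qed (intro borel_measurable_times borel_measurable_add borel_measurable_const m s)+
  moreover have "(LINT x|lebesgue_on \<Omega>. (a * f x + c * g x) * h x) = a * (LINT x|lebesgue_on \<Omega>. f x * h x) + c * (LINT x|lebesgue_on \<Omega>. g x * h x)"
    if "sqint (lebesgue_on \<Omega>) f" "sqint (lebesgue_on \<Omega>) g" "sqint (lebesgue_on \<Omega>) h" for f g h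
    using that by (simp add: distrib_right mult.assoc sqint_mult)
  ultimately show ?thesis using s
    by (simp add: inner_H1_def sum.distrib sum_distrib_left algebra_simps)
qed

lemma inner_H1_commute: "inner_H1 \<Omega> u v = inner_H1 \<Omega> v u"
  by (simp add: inner_H1_def mult.commute)

lemma inner_H1_nonneg: "0 \<le> inner_H1 \<Omega> u u"
  by (auto simp: inner_H1_def intro!: add_nonneg_nonneg sum_nonneg)

lemma norm_H1_sq: "(norm_H1 \<Omega> u)\<^sup>2 = (LINT x|lebesgue_on \<Omega>. (u x)\<^sup>2) + (\<Sum>i\<in>UNIV. LINT x|lebesgue_on \<Omega>. (wderiv \<Omega> i u x)\<^sup>2)"
  using inner_H1_nonneg[of \<Omega> u] by (simp add: norm_H1_def inner_H1_def power2_eq_square)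

lemma norm_H1_nonneg: "0 \<le> norm_H1 \<Omega> u"
  using inner_H1_nonneg[of \<Omega> u] by (simp add: norm_H1_def)

lemma norm_H1_ge:
  shows "(LINT x|lebesgue_on \<Omega>. (u x)\<^sup>2) \<le> (norm_H1 \<Omega> u)\<^sup>2" "(LINT x|lebesgue_on \<Omega>. (wderiv \<Omega> i u x)\<^sup>2) \<le> (norm_H1 \<Omega> u)\<^sup>2"
proof -
  have "(LINT x|lebesgue_on \<Omega>. (wderiv \<Omega> i u x)\<^sup>2) \<le> (\<Sum>i\<in>UNIV. LINT x|lebesgue_on \<Omega>. (wderiv \<Omega> i u x)\<^sup>2)"
    by (rule member_le_sum) auto
  then show "(LINT x|lebesgue_on \<Omega>. (u x)\<^sup>2) \<le> (norm_H1 \<Omega> u)\<^sup>2" "(LINT x|lebesgue_on \<Omega>. (wderiv \<Omega> i u x)\<^sup>2) \<le> (norm_H1 \<Omega> u)\<^sup>2"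
    unfolding norm_H1_sq by (auto intro!: sum_nonneg add_increasing)
qed

section \<open>Coordinate lines\<close>

text \<open>Addition on the index type \<^typ>\<open>3\<close> is modulo \<open>3\<close>, so \<open>i\<close>, \<open>i + 1\<close>, \<open>i + 2\<close> are the three indices.\<close>

definition slot :: "3 \<Rightarrow> real \<Rightarrow> real \<times> real \<Rightarrow> R3"
  where "slot i t y = (\<chi> j. if j = i then t else if j = i + 1 then fst y else snd y)"

lemma three_neq: "i + 1 \<noteq> (i::3)" "i + 2 \<noteq> (i::3)" "i + 2 \<noteq> i + 1"
  using exhaust_3[of i] by auto

lemma three_cases: "j = i \<or> j = i + 1 \<or> j = i + (2::3)"
  using exhaust_3[of i] exhaust_3[of j] by auto

lemma slot_nth: "slot i t y $ i = t" "slot i t y $ (i + 1) = fst y" "slot i t y $ (i + 2) = snd y"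
  using three_neq[of i] by (auto simp: slot_def)

lemma three_all: "(\<forall>j. P j) \<longleftrightarrow> P i \<and> P (i + 1) \<and> P (i + (2::3))"
  using three_cases[of _ i] by metis

lemma slot_eqI: "x $ i = t \<Longrightarrow> x $ (i + 1) = fst y \<Longrightarrow> x $ (i + 2) = snd y \<Longrightarrow> slot i t y = x"
  unfolding vec_eq_iff three_all[of _ i] by (simp add: slot_nth)

lemma axis_nth_3:
  fixes i :: 3
  shows "axis i (1::real) $ i = 1" "axis i (1::real) $ (i + 1) = 0" "axis i (1::real) $ (i + 2) = 0"
  using three_neq[of i] by (auto simp: axis_def)

lemma slot_add_axis: "slot i t y + s *\<^sub>R axis i 1 = slot i (t + s) y"
  by (rule slot_eqI[symmetric]) (auto simp: slot_nth axis_nth_3)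

lemma prod_3_shift: "(\<Prod>j\<in>UNIV. f j) = f i * f (i + 1) * (f (i + (2::3)) :: 'a::comm_monoid_mult)"
proof -
  have "UNIV = {i, i + 1, i + 2}" using three_cases[of _ i] by auto
  then have "prod f UNIV = prod f {i, i + 1, i + 2}" by simp
  also have "\<dots> = f i * (f (i + 1) * f (i + 2))"
    using three_neq[of i] three_neq[of i, symmetric] by simp
  finally show ?thesis by (simp add: mult.assoc)
qed

lemma continuous_slot: "continuous_on UNIV (\<lambda>p. slot i (fst p) (snd p))"
proof -
  have "continuous_on UNIV (\<lambda>p::real \<times> real \<times> real. if j = i then fst p else if j = i + 1 then fst (snd p) else snd (snd p))" for j
    by (cases "j = i"; cases "j = i + 1") (auto intro!: continuous_intros)
  then show ?thesis unfolding slot_def by (intro continuous_on_vec_lambda)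
qed

lemma slot_measurable_pair [measurable]: "(\<lambda>p. slot i (fst p) (snd p)) \<in> borel_measurable borel"
  by (rule borel_measurable_continuous_onI[OF continuous_slot])

lemma slot_measurable [measurable (raw)]:
  assumes "f \<in> borel_measurable M" "g \<in> borel_measurable M"
  shows "(\<lambda>x. slot i (f x) (g x)) \<in> borel_measurable M"
proof -
  have "(\<lambda>x. (f x, g x)) \<in> borel_measurable M" using assms by (rule borel_measurable_Pair)
  from measurable_compose[OF this slot_measurable_pair[of i]] show ?thesis by simp
qed

text \<open>Lebesgue measure is characterised by its values on boxes, and \<open>slot\<close> turns
  products of intervals into boxes. Fubini along the lines of any of the three directions is thereby
  the Fubini theorem of one product space.\<close>

lemma distr_slot: "distr (lborel \<Otimes>\<^sub>M lborel) borel (\<lambda>(t, y). slot i t y) = lborel"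
proof (rule lborel_eqI[symmetric])
  have m: "(\<lambda>(t, y). slot i t y) \<in> borel_measurable (lborel \<Otimes>\<^sub>M (lborel :: (real \<times> real) measure))"
    by (simp add: lborel_prod split_beta')
  fix l u :: R3 assume le: "\<And>b. b \<in> Basis \<Longrightarrow> l \<bullet> b \<le> u \<bullet> b"
  then have le': "l $ j \<le> u $ j" for j using le[of "axis j 1"] by (simp add: axis_in_Basis_iff inner_axis)
  have "emeasure (distr (lborel \<Otimes>\<^sub>M lborel) borel (\<lambda>(t, y). slot i t y)) (box l u) =
     emeasure (lborel \<Otimes>\<^sub>M lborel) ({l $ i <..< u $ i} \<times> ({l $ (i + 1) <..< u $ (i + 1)} \<times> {l $ (i + 2) <..< u $ (i + 2)}))"
    by (subst emeasure_distr[OF m]) (auto simp: mem_box_cart three_all[of _ i] slot_nth space_pair_measure intro!: arg_cong[of _ _ "emeasure _"])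
  also have "\<dots> = emeasure lborel {l $ i <..< u $ i} * emeasure (lborel \<Otimes>\<^sub>M lborel) ({l $ (i + 1) <..< u $ (i + 1)} \<times> {l $ (i + 2) <..< u $ (i + 2)})"
    by (subst lborel.emeasure_pair_measure_Times) (auto simp: lborel_prod intro!: borel_open open_Times)
  also have "\<dots> = ennreal (u $ i - l $ i) * (ennreal (u $ (i + 1) - l $ (i + 1)) * ennreal (u $ (i + 2) - l $ (i + 2)))"
    using le' by (subst lborel.emeasure_pair_measure_Times) auto
  also have "\<dots> = ennreal ((u $ i - l $ i) * (u $ (i + 1) - l $ (i + 1)) * (u $ (i + 2) - l $ (i + 2)))"
    using le' by (simp add: ennreal_mult mult.assoc)
  also have "(u $ i - l $ i) * (u $ (i + 1) - l $ (i + 1)) * (u $ (i + 2) - l $ (i + 2)) = (\<Prod>j\<in>UNIV. (u - l) $ j)"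
    by (simp add: prod_3_shift[of _ i])
  also have "\<dots> = (\<Prod>b\<in>Basis. (u - l) \<bullet> b)"
    by (simp add: Basis_vec_def Basis_real_def cart_eq_inner_axis UNION_singleton_eq_range prod.reindex axis_eq_axis inj_on_def)
  finally show "emeasure (distr (lborel \<Otimes>\<^sub>M lborel) borel (\<lambda>(t, y). slot i t y)) (box l u) = (\<Prod>b\<in>Basis. (u - l) \<bullet> b)" .
qed simp

lemma nn_integral_slot:
  assumes [measurable]: "f \<in> borel_measurable borel"
  shows "(\<integral>\<^sup>+x. f x \<partial>lborel) = (\<integral>\<^sup>+y. \<integral>\<^sup>+t. f (slot i t y) \<partial>lborel \<partial>lborel)"
proof -
  have "(\<integral>\<^sup>+x. f x \<partial>lborel) = (\<integral>\<^sup>+p. f (case p of (t, y) \<Rightarrow> slot i t y) \<partial>(lborel \<Otimes>\<^sub>M lborel))"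
    by (subst distr_slot[of i, symmetric], subst nn_integral_distr) (simp_all add: split_beta' lborel_prod)
  also have "\<dots> = (\<integral>\<^sup>+y. \<integral>\<^sup>+t. f (slot i t y) \<partial>lborel \<partial>lborel)"
    by (subst lborel_pair.nn_integral_snd[symmetric]) (simp_all add: split_beta' lborel_prod)
  finally show ?thesis .
qed

lemma AE_slot:
  assumes "AE x in lborel. P x"
  shows "AE y in lborel. AE t in lborel. P (slot i t y)"
proof -
  obtain N where N: "{x. \<not> P x} \<subseteq> N" "N \<in> null_sets lborel"
    using assms by (auto elim!: AE_E simp: null_sets_def)
  then have [measurable]: "N \<in> sets borel" by auto
  have "(\<integral>\<^sup>+x. indicator N x \<partial>lborel) = 0" using N(2) by auto
  then have "(\<integral>\<^sup>+y. \<integral>\<^sup>+t. indicator N (slot i t y) \<partial>lborel \<partial>lborel) = 0"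
    by (subst (asm) nn_integral_slot[of _ i]) auto
  then have "AE y in lborel. (\<integral>\<^sup>+t. indicator N (slot i t y) \<partial>lborel) = 0"
    by (subst (asm) nn_integral_0_iff_AE) auto
  then show ?thesis
  proof eventually_elim
    case (elim y)
    then have "AE t in lborel. indicator N (slot i t y) = (0::ennreal)"
      by (subst (asm) nn_integral_0_iff_AE) auto
    then show ?case by eventually_elim (use N(1) in \<open>auto simp: indicator_def split: if_splits\<close>)
  qed
qed

lemma integral_slot:
  fixes f :: "R3 \<Rightarrow> real"
  assumes "integrable lborel f"
  shows "AE y in lborel. integrable lborel (\<lambda>t. f (slot i t y))"
    and "integrable lborel (\<lambda>y. LINT t|lborel. f (slot i t y))"
    and "(LINT x|lborel. f x) = (LINT y|lborel. LINT t|lborel. f (slot i t y))"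
proof -
  have m: "(\<lambda>(t, y). slot i t y) \<in> borel_measurable (lborel \<Otimes>\<^sub>M (lborel :: (real \<times> real) measure))"
    by (simp add: lborel_prod split_beta')
  have i: "integrable (lborel \<Otimes>\<^sub>M lborel) (\<lambda>(t, y). f (slot i t y))"
    using assms integrable_distr[OF m, of f] distr_slot[of i] by (simp add: split_beta')
  show "AE y in lborel. integrable lborel (\<lambda>t. f (slot i t y))"
    using lborel_pair.AE_integrable_snd[OF i] by simp
  show "integrable lborel (\<lambda>y. LINT t|lborel. f (slot i t y))"
    using lborel_pair.integrable_snd[OF i] by simp
  have "(LINT x|lborel. f x) = (LINT p|(lborel \<Otimes>\<^sub>M lborel). f (case p of (t, y) \<Rightarrow> slot i t y))"
    using assms by (subst distr_slot[of i, symmetric], subst integral_distr[OF m]) auto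
  also have "\<dots> = (LINT y|lborel. LINT t|lborel. f (slot i t y))"
    using lborel_pair.integral_snd[OF i] by (simp add: split_beta')
  finally show "(LINT x|lborel. f x) = (LINT y|lborel. LINT t|lborel. f (slot i t y))" .
qed

lemma sqint_slot:
  assumes "sqint lborel f"
  shows "AE y in lborel. sqint lborel (\<lambda>t. f (slot i t y))"
    and "integrable lborel (\<lambda>y. LINT t|lborel. (f (slot i t y))\<^sup>2)"
    and "(LINT x|lborel. (f x)\<^sup>2) = (LINT y|lborel. LINT t|lborel. (f (slot i t y))\<^sup>2)"
proof -
  have [measurable]: "f \<in> borel_measurable borel" using assms by (simp add: sqint_def)
  note I = integral_slot[OF sqint_integrable[OF assms], of i]
  show "AE y in lborel. sqint lborel (\<lambda>t. f (slot i t y))"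
    using I(1) by eventually_elim (simp add: sqint_def)
  show "integrable lborel (\<lambda>y. LINT t|lborel. (f (slot i t y))\<^sup>2)" by (rule I(2))
  show "(LINT x|lborel. (f x)\<^sup>2) = (LINT y|lborel. LINT t|lborel. (f (slot i t y))\<^sup>2)" by (rule I(3))
qed

lemma AE_lebesgue_iff: "(AE x in lebesgue. P x) \<longleftrightarrow> (AE x in lborel. P x)"
  by (rule AE_completion_iff)

section \<open>Absolute continuity on lines\<close>

lemma integrable_translate:
  fixes f :: "'a::euclidean_space \<Rightarrow> real"
  assumes "integrable lborel f"
  shows "integrable lborel (\<lambda>x. f (x + c))" "(LINT x|lborel. f (x + c)) = (LINT x|lborel. f x)"
proof -
  have m: "f \<in> borel_measurable borel" using assms by auto
  have "integrable (distr lborel borel ((+) c)) f" using assms lborel_distr_plus[of c] by simp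
  then show "integrable lborel (\<lambda>x. f (x + c))"
    by (subst (asm) integrable_distr_eq) (use m in \<open>auto simp: add.commute\<close>)
  have "(LINT x|distr lborel borel ((+) c). f x) = (LINT x|lborel. f (c + x))"
    by (rule integral_distr) (use m in auto)
  then show "(LINT x|lborel. f (x + c)) = (LINT x|lborel. f x)"
    by (simp add: lborel_distr_plus add.commute)
qed

lemma sqint_translate:
  fixes f :: "'a::euclidean_space \<Rightarrow> real"
  assumes "sqint lborel f"
  shows "sqint lborel (\<lambda>x. f (x + c))" "(LINT x|lborel. (f (x + c))\<^sup>2) = (LINT x|lborel. (f x)\<^sup>2)"
proof -
  have [measurable]: "f \<in> borel_measurable borel" using assms by (simp add: sqint_def)
  show "sqint lborel (\<lambda>x. f (x + c))" "(LINT x|lborel. (f (x + c))\<^sup>2) = (LINT x|lborel. (f x)\<^sup>2)"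
    using integrable_translate[OF sqint_integrable[OF assms], of c] by (auto simp: sqint_def)
qed

lemma sqint_abs: "sqint M f \<Longrightarrow> sqint M (\<lambda>x. \<bar>f x\<bar>)"
  by (auto simp: sqint_def intro!: borel_measurable_abs)

text \<open>For each s, Cauchy-Schwarz and translation invariance bound the inner integral by one
  constant B, and s runs through a bounded interval; this is the integrability that Fubini asks
  for.\<close>

lemma translate_product_integrable:
  fixes g \<psi> :: scalar_field
  assumes g: "sqint lborel g" and \<psi>: "sqint lborel \<psi>"
  shows "integrable (lborel \<Otimes>\<^sub>M lborel) (\<lambda>(s::real, x). indicator {0..t} s * (g (x + s *\<^sub>R c) * \<psi> x))"
proof (rule lborel_pair.Fubini_integrable)
  have [measurable]: "g \<in> borel_measurable borel" "\<psi> \<in> borel_measurable borel"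
    using assms by (auto simp: sqint_def)
  have i: "integrable lborel (\<lambda>x. g (x + s *\<^sub>R c) * \<psi> x)" for s
    by (intro sqint_mult sqint_translate g \<psi>)
  define B where "B = sqrt (LINT x|lborel. (g x)\<^sup>2) * sqrt (LINT x|lborel. (\<psi> x)\<^sup>2)"
  have b: "\<bar>LINT x|lborel. \<bar>g (x + s *\<^sub>R c) * \<psi> x\<bar>\<bar> \<le> B" for s
    using integral_Cauchy_Schwarz[OF sqint_abs[OF sqint_translate(1)[OF g]] sqint_abs[OF \<psi>], of "s *\<^sub>R c"]
    by (simp add: B_def abs_mult sqint_translate(2)[OF g])
  have [measurable]: "(\<lambda>(s, x). indicator {0..t} s * (g (x + s *\<^sub>R c) * \<psi> x)) \<in> borel_measurable (lborel \<Otimes>\<^sub>M lborel)"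
  proof -
    have "fst \<in> borel_measurable (borel :: (real \<times> R3) measure)"
      by (intro borel_measurable_continuous_onI continuous_intros)
    then have 1: "(\<lambda>p :: real \<times> R3. indicator {0..t} (fst p) :: real) \<in> borel_measurable borel"
      by (rule measurable_compose) simp
    have "(\<lambda>p :: real \<times> R3. snd p + fst p *\<^sub>R c) \<in> borel_measurable borel"
      by (intro borel_measurable_continuous_onI continuous_intros)
    then have 2: "(\<lambda>p. g (snd p + fst p *\<^sub>R c)) \<in> borel_measurable borel"
      by (rule measurable_compose) fact
    have "snd \<in> borel_measurable (borel :: (real \<times> R3) measure)"
      by (intro borel_measurable_continuous_onI continuous_intros)
    then have 3: "(\<lambda>p :: real \<times> R3. \<psi> (snd p)) \<in> borel_measurable borel"
      by (rule measurable_compose) fact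
    from borel_measurable_times[OF 1 borel_measurable_times[OF 2 3]] show ?thesis
      by (simp add: lborel_prod split_beta')
  qed
  show "(\<lambda>(s, x). indicator {0..t} s * (g (x + s *\<^sub>R c) * \<psi> x)) \<in> borel_measurable (lborel \<Otimes>\<^sub>M lborel)" by fact
  show "AE s in lborel. integrable lborel (\<lambda>x. case (s, x) of (s, x) \<Rightarrow> indicator {0..t} s * (g (x + s *\<^sub>R c) * \<psi> x))"
    using i by auto
  show "integrable lborel (\<lambda>s. LINT x|lborel. norm (case (s, x) of (s, x) \<Rightarrow> indicator {0..t} s * (g (x + s *\<^sub>R c) * \<psi> x)))"
  proof (rule Bochner_Integration.integrable_bound)
    show "integrable lborel (\<lambda>s. B * indicator {0..t} s)" by (intro integrable_mult_right integrable_real_indicator) (auto simp: emeasure_lborel_Icc_eq)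
    show "(\<lambda>s. LINT x|lborel. norm (case (s, x) of (s, x) \<Rightarrow> indicator {0..t} s * (g (x + s *\<^sub>R c) * \<psi> x))) \<in> borel_measurable lborel"
      using measurable_compose[OF \<open>_ \<in> borel_measurable (lborel \<Otimes>\<^sub>M lborel)\<close> borel_measurable_norm]
      by (intro lborel.borel_measurable_lebesgue_integral) (simp add: split_beta')
    show "AE s in lborel. norm (LINT x|lborel. norm (case (s, x) of (s, x) \<Rightarrow> indicator {0..t} s * (g (x + s *\<^sub>R c) * \<psi> x)))
      \<le> norm (B * indicator {0..t} s)"
      using b by (auto simp: abs_mult indicator_def intro!: AE_I2 order_trans[OF _ abs_ge_self])
  qed
qed

text \<open>The counterpart of \<open>is_weak_deriv\<close> on the whole space for Borel
  representatives. Sections of a Borel function are measurable on every line, those of a Lebesgue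
  measurable one need not be.\<close>

definition weak_partial :: "3 \<Rightarrow> scalar_field \<Rightarrow> scalar_field \<Rightarrow> bool"
  where "weak_partial i u g \<longleftrightarrow> sqint lborel u \<and> sqint lborel g \<and>
    (\<forall>\<phi>\<in>test_fun UNIV. (LINT x|lborel. u x * partial i \<phi> x) = - (LINT x|lborel. g x * \<phi> x))"

lemma partial_translate:
  assumes "\<And>x. \<phi> differentiable (at x)"
  shows "partial i (\<lambda>x. \<phi> (x - c)) x = partial i \<phi> (x - c)"
proof -
  have 1: "(\<phi> has_derivative frechet_derivative \<phi> (at y)) (at y)" for y
    using assms frechet_derivative_works by blast
  have "((\<lambda>x. \<phi> (x - c)) has_derivative frechet_derivative \<phi> (at (x - c))) (at x)"
    by (rule has_derivative_compose[OF _ 1, of "\<lambda>x. x - c" "\<lambda>h. h", simplified]) (auto intro!: derivative_eq_intros)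
  from frechet_derivative_at[OF this] show ?thesis by (simp add: partial_def)
qed

lemma bump_translate: "bump n a b (x - c) = bump n (a + c) (b + c) x"
  by (simp add: bump_def algebra_simps)

text \<open>Translating the test function moves the difference quotient onto \<open>u\<close>, without mollification.\<close>

lemma weak_partial_difference:
  assumes w: "weak_partial i u g" and "0 \<le> t"
  shows "AE x in lborel. u (x + t *\<^sub>R axis i 1) - u x = (LINT s|lborel. indicator {0..t} s * g (x + s *\<^sub>R axis i 1))"
proof -
  define e where "e = (axis i 1 :: R3)"
  have u: "sqint lborel u" and g: "sqint lborel g" using w by (auto simp: weak_partial_def)
  define J where "J x = (LINT s|lborel. indicator {0..t} s * g (x + s *\<^sub>R e))" for x
  define F where "F x = u (x + t *\<^sub>R e) - u x - J x" for x
  have J: "integrable lborel (\<lambda>x. J x * \<psi> x)"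
    "(LINT x|lborel. J x * \<psi> x) = (LINT s|lborel. indicator {0..t} s * (LINT x|lborel. g (x + s *\<^sub>R e) * \<psi> x))"
    if "sqint lborel \<psi>" for \<psi>
  proof -
    have i: "integrable (lborel \<Otimes>\<^sub>M lborel) (case_prod (\<lambda>s x. indicator {0..t} s * (g (x + s *\<^sub>R e) * \<psi> x)))"
      using translate_product_integrable[OF g that] by simp
    have eq: "(LINT s|lborel. indicator {0..t} s * (g (x + s *\<^sub>R e) * \<psi> x)) = J x * \<psi> x" for x
    proof -
      have "(LINT s|lborel. indicator {0..t} s * (g (x + s *\<^sub>R e) * \<psi> x)) = (LINT s|lborel. (indicator {0..t} s * g (x + s *\<^sub>R e)) * \<psi> x)"
        by (simp add: mult.assoc)
      then show ?thesis unfolding J_def by (simp only: integral_mult_left_zero)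
    qed
    show "integrable lborel (\<lambda>x. J x * \<psi> x)"
      using lborel_pair.integrable_snd[OF i] by (simp add: eq)
    show "(LINT x|lborel. J x * \<psi> x) = (LINT s|lborel. indicator {0..t} s * (LINT x|lborel. g (x + s *\<^sub>R e) * \<psi> x))"
      using lborel_pair.Fubini_integral[OF i] by (simp add: eq)
  qed
  have "AE x in lebesgue. x \<in> UNIV \<longrightarrow> F x = 0"
  proof (rule bump_integral_0_imp_AE_0)
    fix a b :: R3
    have ind: "sqint lborel (indicator (cbox a b) :: scalar_field)"
    proof -
      have "integrable lborel (indicator (cbox a b) :: scalar_field)"
        by (intro integrable_real_indicator emeasure_lborel_cbox_finite) auto
      moreover have "(\<lambda>x. (indicator (cbox a b) x)\<^sup>2) = (indicator (cbox a b) :: scalar_field)"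
        by (auto simp: indicator_def)
      ultimately show ?thesis by (simp add: sqint_def)
    qed
    have "integrable lborel (\<lambda>x. (u (x + t *\<^sub>R e) - u x) * indicator (cbox a b) x - J x * indicator (cbox a b) x)"
      by (intro Bochner_Integration.integrable_diff J(1) ind sqint_mult sqint_diff sqint_translate u)
    then have "integrable lebesgue (\<lambda>x. indicator (cbox a b) x *\<^sub>R F x)"
      by (intro integrable_completion[THEN iffD2]) (auto simp: F_def algebra_simps)
    then show "set_integrable lebesgue (cbox a b) F" by (simp add: set_integrable_def)
    fix n :: real assume n: "n > 0"
    define \<phi> where "\<phi> = bump n a b"
    have \<phi>: "\<phi> \<in> test_fun UNIV" using bump_test_fun[OF n] by (simp add: \<phi>_def)
    have \<phi>s: "(\<lambda>x. \<phi> (x - c)) \<in> test_fun UNIV" for c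
      unfolding \<phi>_def bump_translate using bump_test_fun[OF n] by simp
    have p\<phi>: "partial i (\<lambda>x. \<phi> (x - c)) x = partial i \<phi> (x - c)" for c x
      using test_funD(1)[OF \<phi>] by (rule partial_translate)
    note sq = sqint_test_fun[OF \<phi>]
    \<comment> \<open>The derivative is integrated backwards along the line, because translating u
      forwards amounts to translating \<phi> backwards.\<close>
    have ftc: "(LINT s|lborel. indicator {0..t} s * partial i \<phi> (x + s *\<^sub>R (- e))) = \<phi> x - \<phi> (x - t *\<^sub>R e)" for x
    proof -
      have "((\<lambda>s. - \<phi> (x + (- s) *\<^sub>R e)) has_real_derivative partial i \<phi> (x + (- s) *\<^sub>R e)) (at s)" for s
        using DERIV_minus[OF DERIV_mirror[THEN iffD1, OF partial_line_derivative[OF test_funD(1)[OF \<phi>], where s = "-s"]]]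
        by (simp add: e_def)
      moreover have "isCont (\<lambda>s. partial i \<phi> (x + (- s) *\<^sub>R e)) s" for s
        by (rule continuous_on_interior[of UNIV])
          (auto intro!: continuous_on_compose2[OF test_funD(3)[OF \<phi>]] continuous_intros)
      ultimately show ?thesis
        using integral_FTC_Icc_real[of 0 t "\<lambda>s. - \<phi> (x + (- s) *\<^sub>R e)" "\<lambda>s. partial i \<phi> (x + (- s) *\<^sub>R e)"] assms(2)
        by (simp add: mult.commute)
    qed
    have tr: "(LINT x|lborel. u (x + t *\<^sub>R e) * \<phi> x) = (LINT x|lborel. u x * \<phi> (x - t *\<^sub>R e))"
      using integrable_translate(2)[OF sqint_mult[OF u sqint_test_fun(1)[OF \<phi>s]], of "t *\<^sub>R e" "t *\<^sub>R e"] by simp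
    have i\<phi>: "integrable (lborel \<Otimes>\<^sub>M lborel) (case_prod (\<lambda>s x. indicator {0..t} s * (partial i \<phi> (x + s *\<^sub>R (- e)) * u x)))"
      by (rule translate_product_integrable[OF sq(2) u])
    have eq: "(LINT s|lborel. indicator {0..t} s * (partial i \<phi> (x + s *\<^sub>R (- e)) * u x)) = u x * \<phi> x - u x * \<phi> (x - t *\<^sub>R e)" for x
    proof -
      have "(LINT s|lborel. indicator {0..t} s * (partial i \<phi> (x + s *\<^sub>R (- e)) * u x)) =
        (LINT s|lborel. (indicator {0..t} s * partial i \<phi> (x + s *\<^sub>R (- e))) * u x)"
        by (simp add: mult.assoc)
      also have "\<dots> = (\<phi> x - \<phi> (x - t *\<^sub>R e)) * u x" by (simp only: integral_mult_left_zero ftc)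
      finally show ?thesis by (simp add: algebra_simps)
    qed
    have "(LINT x|lborel. u x * \<phi> x - u x * \<phi> (x - t *\<^sub>R e)) =
      (LINT s|lborel. indicator {0..t} s * (LINT x|lborel. partial i \<phi> (x + s *\<^sub>R (- e)) * u x))"
      using lborel_pair.Fubini_integral[OF i\<phi>] by (simp add: eq[simplified])
    also have "\<dots> = (LINT s|lborel. indicator {0..t} s * (- (LINT x|lborel. g (x + s *\<^sub>R e) * \<phi> x)))"
    proof (rule Bochner_Integration.integral_cong[OF refl])
      fix s
      have "(LINT x|lborel. u x * partial i (\<lambda>x. \<phi> (x - s *\<^sub>R e)) x) = - (LINT x|lborel. g x * \<phi> (x - s *\<^sub>R e))"
        using w \<phi>s by (simp add: weak_partial_def)
      moreover have "(LINT x|lborel. g (x + s *\<^sub>R e) * \<phi> x) = (LINT x|lborel. g x * \<phi> (x - s *\<^sub>R e))"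
        using integrable_translate(2)[OF sqint_mult[OF g sqint_test_fun(1)[OF \<phi>s]], of "s *\<^sub>R e" "s *\<^sub>R e"] by simp
      ultimately show "indicator {0..t} s * (LINT x|lborel. partial i \<phi> (x + s *\<^sub>R (- e)) * u x) =
        indicator {0..t} s * (- (LINT x|lborel. g (x + s *\<^sub>R e) * \<phi> x))"
        by (simp add: p\<phi> mult.commute)
    qed
    also have "\<dots> = - (LINT x|lborel. J x * \<phi> x)"
      unfolding J(2)[OF sq(1)] by simp
    finally have main: "(LINT x|lborel. u x * \<phi> x - u x * \<phi> (x - t *\<^sub>R e)) = - (LINT x|lborel. J x * \<phi> x)" .
    have ii: "integrable lborel (\<lambda>x. u (x + t *\<^sub>R e) * \<phi> x)" "integrable lborel (\<lambda>x. u x * \<phi> x)"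
      "integrable lborel (\<lambda>x. J x * \<phi> x)" "integrable lborel (\<lambda>x. u x * \<phi> (x - t *\<^sub>R e))"
      by (intro sqint_mult sqint_translate u sq J(1) sqint_test_fun(1)[OF \<phi>s])+
    have "(LINT x|lborel. u (x + t *\<^sub>R e) * \<phi> x - u x * \<phi> x - J x * \<phi> x) = 0"
      using main tr ii by simp
    then have "(LINT x|lborel. F x * bump n a b x) = 0"
      by (simp add: F_def \<phi>_def algebra_simps)
    moreover have "(\<lambda>x. F x * bump n a b x) \<in> borel_measurable lborel"
    proof -
      have "(\<lambda>x. u (x + t *\<^sub>R e) * \<phi> x - u x * \<phi> x - J x * \<phi> x) \<in> borel_measurable lborel"
        using ii by (intro borel_measurable_diff) auto
      then show ?thesis by (simp add: F_def \<phi>_def algebra_simps)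
    qed
    ultimately show "(LINT x:UNIV|lebesgue. F x * bump n a b x) = 0"
      by (simp add: set_lebesgue_integral_def integral_completion)
  qed simp
  then have "AE x in lborel. F x = 0" by (simp add: AE_lebesgue_iff)
  then show ?thesis by eventually_elim (simp add: F_def J_def e_def)
qed

section \<open>Functions of one real variable: almost everywhere constancy and absolute
  continuity\<close>

lemma AE_translate:
  fixes P :: "real \<Rightarrow> bool"
  assumes "AE t in lborel. P (r + t)"
  shows "AE t in lborel. P t"
proof -
  obtain N where N: "{t. \<not> P (r + t)} \<subseteq> N" "N \<in> null_sets lborel"
    using assms by (auto elim!: AE_E simp: null_sets_def)
  then have [measurable]: "N \<in> sets borel" by auto
  have "emeasure lborel N = emeasure (distr lborel borel ((+) (- r))) N" by (simp add: lborel_distr_plus)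
  also have "\<dots> = emeasure lborel ((+) (- r) -` N)" by (subst emeasure_distr) auto
  moreover have "(+) (- r) -` N \<in> sets borel" using measurable_sets[of "(+) (- r)" borel borel N] by simp
  ultimately have "(+) (- r) -` N \<in> null_sets lborel" using N(2) by (auto simp: null_sets_def)
  moreover have "{t. \<not> P t} \<subseteq> (+) (- r) -` N"
    using N(1) by (auto simp: subset_iff)
  ultimately show ?thesis by (intro AE_I') auto
qed

lemma AE_ex_in_interval:
  assumes "AE t in lborel. P t" "a < (b::real)"
  obtains t where "a < t" "t < b" "P t"
proof -
  have "\<exists>t. a < t \<and> t < b \<and> P t"
  proof (rule ccontr)
    assume "\<nexists>t. a < t \<and> t < b \<and> P t"
    then have "AE t in lborel. t \<notin> {a<..<b}" using assms(1) by (auto elim!: eventually_mono)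
    then have "emeasure lborel {a<..<b} = 0" by (subst (asm) AE_iff_measurable[of "{a<..<b}"]) auto
    then show False using assms(2) by simp
  qed
  then show ?thesis using that by blast
qed

text \<open>The exceptional t depend on r, so H is compared only with good base points. These are
  taken to minus infinity: from each of them H is almost everywhere constant to the right, and
  overlapping half lines force the same constant.\<close>

lemma AE_const_if_AE_shift_eq:
  fixes H :: "real \<Rightarrow> real"
  assumes "AE r in lborel. AE t in lborel. 0 \<le> t \<longrightarrow> H (r + t) = H r"
  obtains c where "AE r in lborel. H r = c"
proof -
  have "\<exists>r. r < - real n \<and> (AE \<tau> in lborel. r \<le> \<tau> \<longrightarrow> H \<tau> = H r)" for n
  proof -
    obtain r where r: "r < - real n" "AE t in lborel. 0 \<le> t \<longrightarrow> H (r + t) = H r"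
      using AE_ex_in_interval[OF assms, of "- real n - 1" "- real n"] by auto
    then have "AE t in lborel. r \<le> r + t \<longrightarrow> H (r + t) = H r" by simp
    from AE_translate[OF this] show ?thesis using r by blast
  qed
  then obtain r where r: "\<And>n. r n < - real n" "\<And>n. AE \<tau> in lborel. r n \<le> \<tau> \<longrightarrow> H \<tau> = H (r n)" by metis
  have same: "H (r n) = H (r 0)" for n
  proof -
    have "AE \<tau> in lborel. (r n \<le> \<tau> \<longrightarrow> H \<tau> = H (r n)) \<and> (r 0 \<le> \<tau> \<longrightarrow> H \<tau> = H (r 0))"
      using r(2)[of n] r(2)[of 0] by auto
    \<comment> \<open>Both base points are negative, so their half lines overlap in (0, 1), where a
      point good for both exists.\<close>
    then obtain \<tau> where "0 < \<tau>" "(r n \<le> \<tau> \<longrightarrow> H \<tau> = H (r n)) \<and> (r 0 \<le> \<tau> \<longrightarrow> H \<tau> = H (r 0))"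
      by (rule AE_ex_in_interval[of _ 0 1]) auto
    moreover have "r n < 0" "r 0 < 0" using r(1)[of n] r(1)[of 0] by auto
    ultimately show ?thesis by auto
  qed
  have "AE \<tau> in lborel. \<forall>n. r n \<le> \<tau> \<longrightarrow> H \<tau> = H (r n)" using r(2) by (simp add: AE_all_countable)
  then have "AE \<tau> in lborel. H \<tau> = H (r 0)"
  proof eventually_elim
    case (elim \<tau>)
    obtain n where "- real n \<le> \<tau>" using real_arch_simple[of "-\<tau>"] by (auto simp: minus_le_iff)
    then have "r n \<le> \<tau>" using r(1)[of n] by linarith
    then show ?case using elim same[of n] by simp
  qed
  then show ?thesis using that by blast
qed

text \<open>Absolute continuity in the form of the fundamental theorem, with a derivative that is
  square integrable over the whole line. The later estimates are this identity combined with
  Cauchy-Schwarz.\<close>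

definition ac_line :: "(real \<Rightarrow> real) \<Rightarrow> (real \<Rightarrow> real) \<Rightarrow> bool"
  where "ac_line w f \<longleftrightarrow> sqint lborel f \<and>
    (\<forall>a b. a \<le> b \<longrightarrow> w b - w a = (LINT s|lborel. indicator {a..b} s * f s))"

lemma sqint_indicator: "emeasure M A < \<infinity> \<Longrightarrow> A \<in> sets M \<Longrightarrow> sqint M (indicator A)"
proof -
  assume "emeasure M A < \<infinity>" "A \<in> sets M"
  moreover have "(\<lambda>x. (indicator A x)\<^sup>2) = (indicator A :: _ \<Rightarrow> real)"
    by (auto simp: indicator_def)
  ultimately show ?thesis by (auto simp: sqint_def intro!: integrable_real_indicator)
qed

lemma sqint_mult_indicator:
  assumes "sqint M f" "A \<in> sets M"
  shows "sqint M (\<lambda>x. indicator A x * f x)"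
proof -
  have "(\<lambda>x. (indicator A x * f x)\<^sup>2) = (\<lambda>x. indicator A x *\<^sub>R (f x)\<^sup>2)"
    by (auto simp: indicator_def)
  then show ?thesis
    using assms integrable_mult_indicator[OF assms(2) sqint_integrable[OF assms(1)]]
    by (auto simp: sqint_def intro!: borel_measurable_times borel_measurable_indicator)
qed

lemma sqint_integrable_Icc:
  fixes f :: "real \<Rightarrow> real"
  assumes "sqint lborel f"
  shows "integrable lborel (\<lambda>s. indicator {a..b} s * f s)"
  by (intro sqint_mult assms sqint_indicator) (auto simp: emeasure_lborel_Icc_eq)

text \<open>The integral of f from 0 to t, with the sign reversed for negative t; at t = 0 the two
  indicators coincide and cancel.\<close>

definition primitive :: "(real \<Rightarrow> real) \<Rightarrow> real \<Rightarrow> real"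
  where "primitive f t = (LINT s|lborel. (indicator {0..t} s - indicator {t..0} s) * f s)"

lemma primitive_diff:
  assumes f: "sqint lborel f" and "a \<le> b"
  shows "primitive f b - primitive f a = (LINT s|lborel. indicator {a..b} s * f s)"
proof -
  have [measurable]: "f \<in> borel_measurable borel" using f by (simp add: sqint_def)
  note i = sqint_integrable_Icc[OF f]
  have "primitive f b - primitive f a = (LINT s|lborel. (indicator {0..b} s - indicator {b..0} s) * f s - (indicator {0..a} s - indicator {a..0} s) * f s)"
    unfolding primitive_def using i by (subst Bochner_Integration.integral_diff) (auto simp: left_diff_distrib)
  also have "\<dots> = (LINT s|lborel. indicator {a..b} s * f s)"
  proof (rule integral_cong_AE)
    show "AE s in lborel. (indicator {0..b} s - indicator {b..0} s) * f s - (indicator {0..a} s - indicator {a..0} s) * f s = indicator {a..b} s * f s"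
      using AE_lborel_singleton[of 0] AE_lborel_singleton[of a] AE_lborel_singleton[of b]
      by eventually_elim (use assms(2) in \<open>auto simp: indicator_def\<close>)
  qed measurable
  finally show ?thesis .
qed

lemma ac_line_primitive: "sqint lborel f \<Longrightarrow> ac_line (\<lambda>t. c + primitive f t) f"
  by (simp add: ac_line_def primitive_diff)

lemma ac_lineD: "ac_line w f \<Longrightarrow> a \<le> b \<Longrightarrow> w b - w a = (LINT s|lborel. indicator {a..b} s * f s)"
  by (simp add: ac_line_def)

text \<open>Cauchy-Schwarz against the indicator of the interval; this is Hoelder continuity of
  exponent 1/2, with the energy on the interval as constant.\<close>

lemma ac_line_increment_sq:
  assumes ac: "ac_line w f" and "a \<le> b"
  shows "(w b - w a)\<^sup>2 \<le> (b - a) * (LINT s|lborel. indicator {a..b} s * (f s)\<^sup>2)"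
proof -
  have f: "sqint lborel f" using ac by (simp add: ac_line_def)
  have 1: "sqint lborel (\<lambda>s. indicator {a..b} s :: real)" by (rule sqint_indicator) (auto simp: emeasure_lborel_Icc_eq)
  have 2: "sqint lborel (\<lambda>s. indicator {a..b} s * f s)" by (rule sqint_mult_indicator[OF f]) simp
  have "\<bar>w b - w a\<bar> = \<bar>LINT s|lborel. indicator {a..b} s * (indicator {a..b} s * f s)\<bar>"
    unfolding ac_lineD[OF assms] by (intro arg_cong[of _ _ abs] Bochner_Integration.integral_cong) (auto simp: indicator_def)
  also have "\<dots> \<le> sqrt (LINT s|lborel. (indicator {a..b} s)\<^sup>2) * sqrt (LINT s|lborel. (indicator {a..b} s * f s)\<^sup>2)"
    by (rule integral_Cauchy_Schwarz[OF 1 2])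
  also have "(LINT s|lborel. (indicator {a..b} s)\<^sup>2) = (LINT s|lborel. indicator {a..b} s :: real)"
    by (intro Bochner_Integration.integral_cong) (auto simp: indicator_def)
  also have "\<dots> = b - a" using assms(2) by simp
  also have "(LINT s|lborel. (indicator {a..b} s * f s)\<^sup>2) = (LINT s|lborel. indicator {a..b} s * (f s)\<^sup>2)"
    by (intro Bochner_Integration.integral_cong) (auto simp: indicator_def)
  finally have "\<bar>w b - w a\<bar>\<^sup>2 \<le> (sqrt (b - a) * sqrt (LINT s|lborel. indicator {a..b} s * (f s)\<^sup>2))\<^sup>2"
    by (rule power_mono) simp
  moreover have "0 \<le> (LINT s|lborel. indicator {a..b} s * (f s)\<^sup>2)" by simp
  ultimately show ?thesis using assms(2) by (simp add: power_mult_distrib)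
qed

lemma integrable_Icc_sq:
  assumes "sqint lborel f"
  shows "integrable lborel (\<lambda>s::real. indicator {a..b} s * (f s)\<^sup>2)"
  using integrable_mult_indicator[OF _ sqint_integrable[OF assms], of "{a..b}"] by simp

lemma integral_Icc_sq_mono:
  assumes "sqint lborel f" "{a..b} \<subseteq> {c..d}"
  shows "(LINT s|lborel. indicator {a..b} s * (f s)\<^sup>2) \<le> (LINT s|lborel. indicator {c..d::real} s * (f s)\<^sup>2)"
  using assms(2) by (intro integral_mono integrable_Icc_sq assms(1)) (auto simp: indicator_def)

lemma integral_Icc_sq_le:
  assumes "sqint lborel f"
  shows "(LINT s|lborel. indicator {a..b::real} s * (f s)\<^sup>2) \<le> (LINT s|lborel. (f s)\<^sup>2)"
  by (intro integral_mono integrable_Icc_sq sqint_integrable assms) (auto simp: indicator_def)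

lemma ac_line_continuous:
  assumes ac: "ac_line w f"
  shows "continuous_on S w"
proof -
  have f: "sqint lborel f" using ac by (simp add: ac_line_def)
  define D where "D = (LINT s|lborel. (f s)\<^sup>2)"
  have D: "D \<ge> 0" by (simp add: D_def)
  have b: "(w t - w s)\<^sup>2 \<le> \<bar>t - s\<bar> * D" for s t
  proof -
    have *: "(w t - w s)\<^sup>2 \<le> (t - s) * D" if "s \<le> t" for s t
      using ac_line_increment_sq[OF ac that] mult_left_mono[OF integral_Icc_sq_le[OF f, of s t], of "t - s"] that
      by (simp add: D_def)
    show ?thesis using *[of s t] *[of t s] by (cases "s \<le> t") (auto simp: power2_commute)
  qed
  have "(w \<longlongrightarrow> w s) (at s)" for s
  proof -
    have "((\<lambda>t. sqrt (\<bar>t - s\<bar> * D)) \<longlongrightarrow> sqrt (\<bar>s - s\<bar> * D)) (at s)"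
      by (intro tendsto_intros)
    then have 0: "((\<lambda>t. sqrt (\<bar>t - s\<bar> * D)) \<longlongrightarrow> 0) (at s)" by simp
    have "norm (w t - w s) \<le> sqrt (\<bar>t - s\<bar> * D)" for t
      using real_sqrt_le_mono[OF b[of t s]] by (simp only: real_sqrt_abs real_norm_def)
    then have "((\<lambda>t. w t - w s) \<longlongrightarrow> 0) (at s)"
      by (intro Lim_null_comparison[OF _ 0] always_eventually allI)
    then show ?thesis by (rule LIM_zero_cancel)
  qed
  then show ?thesis by (intro continuous_at_imp_continuous_on) (auto simp: isCont_def)
qed

lemma ac_line_measurable: "ac_line w f \<Longrightarrow> w \<in> borel_measurable borel"
  by (rule borel_measurable_continuous_onI[OF ac_line_continuous])

text \<open>Average (w t)^2 \<le> 2 (w s)^2 + 2 (w t - w s)^2 over s in the interval. It is the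
  one-dimensional embedding of H1 into bounded functions, with the dependence on the length kept
  because the estimates on small cubes rest on this scaling. Only the integral of U appears, w and U
  being equal almost everywhere.\<close>

lemma ac_line_sup_sq:
  assumes ac: "ac_line w f" and U: "sqint lborel U" "AE t in lborel. w t = U t"
    and "a < b" "t \<in> {a..b}"
  shows "(w t)\<^sup>2 \<le> 2 / (b - a) * (LINT s|lborel. indicator {a..b} s * (U s)\<^sup>2) + 2 * (b - a) * (LINT s|lborel. indicator {a..b} s * (f s)\<^sup>2)"
proof -
  have f: "sqint lborel f" using ac by (simp add: ac_line_def)
  have m [measurable]: "U \<in> borel_measurable borel" using U by (simp add: sqint_def)
  define D where "D = (LINT s|lborel. indicator {a..b} s * (f s)\<^sup>2)"
  have pt: "(w t)\<^sup>2 \<le> 2 * (w s)\<^sup>2 + 2 * ((b - a) * D)" if s: "s \<in> {a..b}" for s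
  proof -
    have D0: "0 \<le> D" by (simp add: D_def)
    have *: "(w y - w x)\<^sup>2 \<le> (b - a) * D" if "x \<le> y" "x \<in> {a..b}" "y \<in> {a..b}" for x y
    proof -
      have "(w y - w x)\<^sup>2 \<le> (y - x) * (LINT s|lborel. indicator {x..y} s * (f s)\<^sup>2)"
        by (rule ac_line_increment_sq[OF ac that(1)])
      also have "\<dots> \<le> (b - a) * D"
        unfolding D_def using that by (intro mult_mono integral_Icc_sq_mono f) auto
      finally show ?thesis .
    qed
    have "(w t - w s)\<^sup>2 \<le> (b - a) * D"
      using *[of s t] *[of t s] s assms(5) by (cases "s \<le> t") (auto simp: power2_commute)
    moreover have "(w t)\<^sup>2 \<le> 2 * (w s)\<^sup>2 + 2 * (w t - w s)\<^sup>2"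
      using zero_le_power2[of "w t - 2 * w s"] by (simp add: power2_eq_square algebra_simps)
    ultimately show ?thesis by linarith
  qed
  have i: "integrable lborel (\<lambda>s. indicator {a..b} s * (U s)\<^sup>2)" by (rule integrable_Icc_sq[OF U(1)])
  have ind: "integrable lborel (indicator {a..b} :: real \<Rightarrow> real)"
    by (intro integrable_real_indicator) (auto simp: emeasure_lborel_Icc_eq)
  have "(b - a) * (w t)\<^sup>2 = (LINT s|lborel. indicator {a..b} s * (w t)\<^sup>2)" using \<open>a < b\<close> by simp
  also have "\<dots> \<le> (LINT s|lborel. 2 * (indicator {a..b} s * (U s)\<^sup>2) + indicator {a..b} s * (2 * ((b - a) * D)))"
  proof (rule integral_mono_AE)
    show "AE s in lborel. indicator {a..b} s * (w t)\<^sup>2 \<le> 2 * (indicator {a..b} s * (U s)\<^sup>2) + indicator {a..b} s * (2 * ((b - a) * D))"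
      using U(2)
    proof eventually_elim
      case (elim s)
      show ?case using pt[of s] by (cases "s \<in> {a..b}") (auto simp: elim)
    qed
  qed (intro Bochner_Integration.integrable_add integrable_mult_right integrable_mult_left i ind)+
  also have "\<dots> = 2 * (LINT s|lborel. indicator {a..b} s * (U s)\<^sup>2) + (b - a) * (2 * ((b - a) * D))"
    using i ind \<open>a < b\<close> by simp
  finally show ?thesis using \<open>a < b\<close> unfolding D_def[symmetric] by (simp add: field_simps)
qed

lemma ac_line_lincomb:
  assumes "ac_line w f" "ac_line v h"
  shows "ac_line (\<lambda>t. a * w t + c * v t) (\<lambda>t. a * f t + c * h t)"
proof -
  have s: "sqint lborel f" "sqint lborel h" using assms by (auto simp: ac_line_def)
  have "(a * w y + c * v y) - (a * w x + c * v x) = (LINT s|lborel. indicator {x..y} s * (a * f s + c * h s))" if "x \<le> y" for x y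
  proof -
    have "(LINT s|lborel. indicator {x..y} s * (a * f s + c * h s)) =
      (LINT s|lborel. a * (indicator {x..y} s * f s) + c * (indicator {x..y} s * h s))"
      by (simp add: algebra_simps)
    also have "\<dots> = a * (w y - w x) + c * (v y - v x)"
      using sqint_integrable_Icc[OF s(1)] sqint_integrable_Icc[OF s(2)]
      by (simp add: ac_lineD[OF assms(1) that] ac_lineD[OF assms(2) that])
    finally show ?thesis by (simp add: algebra_simps)
  qed
  then show ?thesis using s by (auto simp: ac_line_def intro: sqint_lincomb)
qed

text \<open>The product of the increments of w and v is the integral of f(s) h(t) over a square. The
  triangle s \<le> t contributes the integral of h (w - w a), the other one the integral of f (v - v
  a), the diagonal being negligible; Fubini thus gives the product rule directly in integrated
  form.\<close>

lemma ac_line_product: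
  assumes w: "ac_line w f" and v: "ac_line v h" and ab: "a \<le> b"
  shows "integrable lborel (\<lambda>s. indicator {a..b} s * (w s * h s + f s * v s))"
    and "w b * v b - w a * v a = (LINT s|lborel. indicator {a..b} s * (w s * h s + f s * v s))"
proof -
  have s: "sqint lborel f" "sqint lborel h" using assms by (auto simp: ac_line_def)
  have [measurable]: "f \<in> borel_measurable borel" "h \<in> borel_measurable borel" using s by (auto simp: sqint_def)
  define I where "I = (indicator {a..b} :: real \<Rightarrow> real)"
  have [measurable]: "I \<in> borel_measurable borel" by (simp add: I_def)
  have If: "integrable lborel (\<lambda>s. I s * f s)" and Ih: "integrable lborel (\<lambda>s. I s * h s)"
    unfolding I_def by (intro sqint_integrable_Icc s)+
  have bd: "integrable lborel (\<lambda>s. I s * h s * p s)" if c: "continuous_on UNIV p" and h: "sqint lborel h" for p h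
  proof -
    have "compact (p ` {a..b})" by (intro compact_continuous_image continuous_on_subset[OF c]) auto
    then obtain B where B: "\<And>x. x \<in> {a..b} \<Longrightarrow> \<bar>p x\<bar> \<le> B" using compact_imp_bounded bounded_real by (metis imageI)
    show ?thesis
    proof (rule Bochner_Integration.integrable_bound[of _ "\<lambda>s. B * (I s * h s)"])
      show "integrable lborel (\<lambda>s. B * (I s * h s))" unfolding I_def by (intro integrable_mult_right sqint_integrable_Icc h)
      have [measurable]: "h \<in> borel_measurable borel" "p \<in> borel_measurable borel"
        using h borel_measurable_continuous_onI[OF c] by (auto simp: sqint_def)
      show "(\<lambda>s. I s * h s * p s) \<in> borel_measurable lborel" by measurable
      show "AE s in lborel. norm (I s * h s * p s) \<le> norm (B * (I s * h s))"
      proof (rule AE_I2)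
        fix s show "norm (I s * h s * p s) \<le> norm (B * (I s * h s))"
          using mult_mono[OF B[of s, THEN order_trans[OF _ abs_ge_self]] order_refl, of "\<bar>h s\<bar>"] 
          by (auto simp: I_def indicator_def abs_mult mult.commute)
      qed
    qed
  qed
  have c: "continuous_on UNIV w" "continuous_on UNIV v" using w v ac_line_continuous by auto
  note i1 = bd[OF c(1) s(2)] and i2 = bd[OF c(2) s(1)]
  have "integrable lborel (\<lambda>s. I s * h s * w s + I s * f s * v s)" using i1 i2 by simp
  then show "integrable lborel (\<lambda>s. indicator {a..b} s * (w s * h s + f s * v s))"
    by (simp add: I_def algebra_simps)
  define K where "K = (\<lambda>(s, t). (I s * f s) * (I t * h t))"
  have K: "integrable (lborel \<Otimes>\<^sub>M lborel) K"
  proof (rule lborel_pair.Fubini_integrable)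
    show "K \<in> borel_measurable (lborel \<Otimes>\<^sub>M lborel)" unfolding K_def by measurable
    have "(\<lambda>s. LINT t|lborel. norm (K (s, t))) = (\<lambda>s. \<bar>I s * f s\<bar> * (LINT t|lborel. \<bar>I t * h t\<bar>))"
      by (auto simp: K_def abs_mult[of "I _ * f _"])
    then show "integrable lborel (\<lambda>s. LINT t|lborel. norm (K (s, t)))"
      using If by (auto intro!: integrable_mult_left)
    show "AE s in lborel. integrable lborel (\<lambda>t. K (s, t))"
      unfolding K_def using Ih by (auto intro!: AE_I2 integrable_mult_right)
  qed
  define A where "A = {p :: real \<times> real. fst p \<le> snd p}"
  have A: "A \<in> sets (lborel \<Otimes>\<^sub>M lborel)"
    unfolding lborel_prod A_def by (auto intro!: borel_closed closed_Collect_le continuous_intros)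
  have KA: "integrable (lborel \<Otimes>\<^sub>M lborel) (\<lambda>p. indicator A p * K p)" "integrable (lborel \<Otimes>\<^sub>M lborel) (\<lambda>p. (1 - indicator A p) * K p)"
  proof -
    show *: "integrable (lborel \<Otimes>\<^sub>M lborel) (\<lambda>p. indicator A p * K p)"
      using integrable_mult_indicator[OF A K] by simp
    have "integrable (lborel \<Otimes>\<^sub>M lborel) (\<lambda>p. K p - indicator A p * K p)"
      using K * by (rule Bochner_Integration.integrable_diff)
    then show "integrable (lborel \<Otimes>\<^sub>M lborel) (\<lambda>p. (1 - indicator A p) * K p)" by (simp add: algebra_simps)
  qed
  have e1: "(LINT s|lborel. indicator A (s, t) * K (s, t)) = I t * h t * w t - w a * (I t * h t)" for t
  proof (cases "t \<in> {a..b}")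
    case True
    have "(LINT s|lborel. indicator A (s, t) * K (s, t)) = (LINT s|lborel. (indicator {a..t} s * f s) * (I t * h t))"
      using True by (intro Bochner_Integration.integral_cong) (auto simp: A_def K_def I_def indicator_def)
    also have "\<dots> = (w t - w a) * (I t * h t)" using True by (simp add: ac_lineD[OF w])
    finally show ?thesis by (simp add: algebra_simps)
  next
    case False then show ?thesis by (simp add: K_def I_def)
  qed
  have e2: "(LINT t|lborel. (1 - indicator A (s, t)) * K (s, t)) = I s * f s * v s - v a * (I s * f s)" for s
  proof (cases "s \<in> {a..b}")
    case True
    have "(LINT t|lborel. (1 - indicator A (s, t)) * K (s, t)) = (LINT t|lborel. (indicator {a..s} t * h t) * (I s * f s))"
    proof (rule integral_cong_AE)
      show "AE t in lborel. (1 - indicator A (s, t)) * K (s, t) = (indicator {a..s} t * h t) * (I s * f s)"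
        using AE_lborel_singleton[of s]
        by eventually_elim (use True in \<open>auto simp: A_def K_def I_def indicator_def\<close>)
      have "(\<lambda>t. (1 - indicator A (s, t)) * K (s, t)) = (\<lambda>t. (1 - indicator {s..} t) * ((I s * f s) * (I t * h t)))"
        by (auto simp: A_def K_def indicator_def)
      then show "(\<lambda>t. (1 - indicator A (s, t)) * K (s, t)) \<in> borel_measurable lborel" by simp
    qed simp
    also have "\<dots> = (v s - v a) * (I s * f s)" using True by (simp add: ac_lineD[OF v])
    finally show ?thesis by (simp add: algebra_simps)
  next
    case False then show ?thesis by (simp add: K_def I_def)
  qed
  have "(w b - w a) * (v b - v a) = (LINT t|lborel. LINT s|lborel. K (s, t))"
    by (simp add: K_def ac_lineD[OF w ab] ac_lineD[OF v ab] I_def)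
  also have "\<dots> = (LINT p|(lborel \<Otimes>\<^sub>M lborel). K p)"
    using lborel_pair.integral_snd[of "\<lambda>s t. K (s, t)"] K by simp
  also have "\<dots> = (LINT p|(lborel \<Otimes>\<^sub>M lborel). indicator A p * K p + (1 - indicator A p) * K p)"
    by (intro Bochner_Integration.integral_cong) (auto simp: algebra_simps)
  also have "\<dots> = (LINT p|(lborel \<Otimes>\<^sub>M lborel). indicator A p * K p) + (LINT p|(lborel \<Otimes>\<^sub>M lborel). (1 - indicator A p) * K p)"
    using KA by (rule Bochner_Integration.integral_add)
  also have "(LINT p|(lborel \<Otimes>\<^sub>M lborel). indicator A p * K p) = (LINT t|lborel. I t * h t * w t - w a * (I t * h t))"
    using lborel_pair.integral_snd[of "\<lambda>s t. indicator A (s, t) * K (s, t)"] KA(1) by (simp add: e1 split_beta')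
  also have "\<dots> = (LINT t|lborel. I t * h t * w t) - w a * (v b - v a)"
    using i1 Ih ac_lineD[OF v ab] by (simp add: I_def)
  also have "(LINT p|(lborel \<Otimes>\<^sub>M lborel). (1 - indicator A p) * K p) = (LINT s|lborel. I s * f s * v s - v a * (I s * f s))"
    using lborel_pair.integral_fst[of "\<lambda>s t. (1 - indicator A (s, t)) * K (s, t)"] KA(2) by (simp add: e2 split_beta')
  also have "\<dots> = (LINT s|lborel. I s * f s * v s) - v a * (w b - w a)"
    using i2 If ac_lineD[OF w ab] by (simp add: I_def)
  finally have "w b * v b - w a * v a = (LINT t|lborel. I t * h t * w t) + (LINT s|lborel. I s * f s * v s)"
    by (simp add: algebra_simps)
  also have "\<dots> = (LINT s|lborel. I s * h s * w s + I s * f s * v s)" using i1 i2 by simp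
  finally show "w b * v b - w a * v a = (LINT s|lborel. indicator {a..b} s * (w s * h s + f s * v s))"
    by (simp add: I_def algebra_simps)
qed

text \<open>On a good line u minus the primitive of g is almost everywhere a constant, which is
  recovered here as its mean over \<open>{0..1}\<close>. A formula, in place of a choice made on
  each line, keeps the representative Borel measurable in the transversal variable
  \<open>y\<close>.\<close>

definition line_rep :: "3 \<Rightarrow> scalar_field \<Rightarrow> scalar_field \<Rightarrow> real \<Rightarrow> real \<times> real \<Rightarrow> real"
  where "line_rep i u g t y =
    (LINT r|lborel. indicator {0..1} r * (u (slot i r y) - primitive (\<lambda>s. g (slot i s y)) r)) + primitive (\<lambda>s. g (slot i s y)) t"

text \<open>An identity for each t and almost every x becomes one for almost every x and almost
  every t. The exceptional sets of uncountably many t cannot be collected, so Fubini for null sets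
  is used; most of the work is the joint measurability it requires.\<close>

lemma weak_partial_difference_AE:
  assumes w: "weak_partial i u g"
  shows "AE x in lborel. AE t in lborel. 0 \<le> t \<longrightarrow>
    u (x + t *\<^sub>R axis i 1) - u x = (LINT s|lborel. indicator {0..t} s * g (x + s *\<^sub>R axis i 1))"
proof -
  have [measurable]: "u \<in> borel_measurable borel" "g \<in> borel_measurable borel"
    using w by (auto simp: weak_partial_def sqint_def)
  define P where "P = (\<lambda>(t::real) x. 0 \<le> t \<longrightarrow>
    u (x + t *\<^sub>R axis i 1) - u x = (LINT s|lborel. indicator {0..t} s * g (x + s *\<^sub>R axis i 1)))"
  have "(\<lambda>q :: (real \<times> R3) \<times> real. snd (fst q) + snd q *\<^sub>R axis i 1) \<in> borel_measurable borel"
    by (intro borel_measurable_continuous_onI continuous_intros)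
  then have m1: "(\<lambda>q :: (real \<times> R3) \<times> real. g (snd (fst q) + snd q *\<^sub>R axis i 1)) \<in> borel_measurable borel"
    by (rule measurable_compose) fact
  have "closed {q :: (real \<times> R3) \<times> real. 0 \<le> snd q}" "closed {q :: (real \<times> R3) \<times> real. snd q \<le> fst (fst q)}"
    by (auto intro!: closed_Collect_le continuous_intros)
  then have "closed ({q :: (real \<times> R3) \<times> real. 0 \<le> snd q} \<inter> {q. snd q \<le> fst (fst q)})" by (rule closed_Int)
  then have "(\<lambda>q :: (real \<times> R3) \<times> real. indicator ({q. 0 \<le> snd q} \<inter> {q. snd q \<le> fst (fst q)}) q :: real) \<in> borel_measurable borel"
    by (intro borel_measurable_indicator borel_closed)
  also have "(\<lambda>q :: (real \<times> R3) \<times> real. indicator ({q. 0 \<le> snd q} \<inter> {q. snd q \<le> fst (fst q)}) q :: real) =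
    (\<lambda>q. indicator {0..fst (fst q)} (snd q))"
    by (auto simp: indicator_def)
  finally have "(\<lambda>q :: (real \<times> R3) \<times> real. indicator {0..fst (fst q)} (snd q) * g (snd (fst q) + snd q *\<^sub>R axis i 1)) \<in> borel_measurable borel"
    using m1 by (intro borel_measurable_times)
  then have "(\<lambda>(p, s). indicator {0..fst p} s * g (snd p + s *\<^sub>R axis i 1)) \<in> borel_measurable ((borel :: (real \<times> R3) measure) \<Otimes>\<^sub>M lborel)"
    by (subst measurable_cong_sets[of _ borel _ borel]) (auto simp: split_beta' borel_prod[symmetric] intro!: sets_pair_measure_cong)
  then have [measurable]: "(\<lambda>p. LINT s|lborel. indicator {0..fst p} s * g (snd p + s *\<^sub>R axis i 1)) \<in> borel_measurable (borel :: (real \<times> R3) measure)"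
    by (rule lborel.borel_measurable_lebesgue_integral)
  have "(\<lambda>p :: real \<times> R3. snd p + fst p *\<^sub>R axis i 1) \<in> borel_measurable borel" "(\<lambda>p :: real \<times> R3. snd p) \<in> borel_measurable borel"
    "(\<lambda>p :: real \<times> R3. fst p) \<in> borel_measurable borel"
    by (intro borel_measurable_continuous_onI continuous_intros)+
  then have [measurable]: "(\<lambda>p :: real \<times> R3. u (snd p + fst p *\<^sub>R axis i 1)) \<in> borel_measurable borel"
    "(\<lambda>p :: real \<times> R3. u (snd p)) \<in> borel_measurable borel" "(\<lambda>p :: real \<times> R3. fst p) \<in> borel_measurable borel"
    using measurable_compose[OF _ \<open>u \<in> borel_measurable borel\<close>] by auto
  have "{p \<in> space (borel :: (real \<times> R3) measure). P (fst p) (snd p)} \<in> sets borel"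
    unfolding P_def by measurable
  then have m: "{p \<in> space (lborel \<Otimes>\<^sub>M lborel). P (fst p) (snd p)} \<in> sets (lborel \<Otimes>\<^sub>M lborel)"
    unfolding lborel_prod sets_lborel space_lborel .
  have "AE t in lborel. AE x in lborel. P t x"
    using weak_partial_difference[OF w] by (auto simp: P_def intro!: AE_I2)
  then have "AE x in lborel. AE t in lborel. P t x"
    using lborel_pair.AE_commute[OF m] by simp
  then show ?thesis by (simp add: P_def)
qed

text \<open>Read along a line, the difference identity says that u minus the primitive of g takes
  the same value at r and at r + t for almost all r and almost all t \<ge> 0, so it is almost
  everywhere constant.\<close>

lemma line_rep:
  assumes w: "weak_partial i u g"
  shows "AE y in lborel. sqint lborel (\<lambda>t. u (slot i t y)) \<and>
    ac_line (\<lambda>t. line_rep i u g t y) (\<lambda>t. g (slot i t y)) \<and>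
    (AE t in lborel. line_rep i u g t y = u (slot i t y))"
proof -
  have s: "sqint lborel u" "sqint lborel g" using w by (auto simp: weak_partial_def)
  show ?thesis
    using sqint_slot(1)[OF s(1), of i] sqint_slot(1)[OF s(2), of i] AE_slot[OF weak_partial_difference_AE[OF w], of i]
  proof eventually_elim
    case (elim y)
    define G where "G = (\<lambda>t. g (slot i t y))"
    define U where "U = (\<lambda>t. u (slot i t y))"
    have G: "sqint lborel G" and U: "sqint lborel U" using elim by (auto simp: G_def U_def)
    have "AE r in lborel. AE t in lborel. 0 \<le> t \<longrightarrow> U (r + t) - primitive G (r + t) = U r - primitive G r"
      using elim(3)
    proof eventually_elim
      case (elim r)
      then show ?case
      proof eventually_elim
        case (elim t)
        have "U (r + t) - U r = primitive G (r + t) - primitive G r" if "0 \<le> t"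
        proof -
          have "U (r + t) - U r = (LINT s|lborel. indicator {0..t} s * G (r + s))"
            using elim that by (simp add: U_def G_def slot_add_axis)
          also have "\<dots> = (LINT s|lborel. indicator {r..r + t} (s + r) * G (s + r))"
            by (intro Bochner_Integration.integral_cong) (auto simp: indicator_def add.commute)
          also have "\<dots> = (LINT s|lborel. indicator {r..r + t} s * G s)"
            by (rule integrable_translate(2)[OF sqint_integrable_Icc[OF G]])
          also have "\<dots> = primitive G (r + t) - primitive G r"
            using primitive_diff[OF G, of r "r + t"] that by simp
          finally show ?thesis .
        qed
        then show ?case by (auto simp: algebra_simps)
      qed
    qed
    then obtain c where c: "AE r in lborel. U r - primitive G r = c"
      using AE_const_if_AE_shift_eq[of "\<lambda>r. U r - primitive G r"] by auto
    have acp: "ac_line (\<lambda>t. 0 + primitive G t) G" by (rule ac_line_primitive[OF G])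
    have [measurable]: "primitive G \<in> borel_measurable borel" using ac_line_measurable[OF acp] by simp
    have [measurable]: "U \<in> borel_measurable borel" using U by (simp add: sqint_def)
    have "(LINT r|lborel. indicator {0..1} r * (U r - primitive G r)) = (LINT r|lborel. indicator {0..1::real} r * c)"
      by (rule integral_cong_AE) (use c in \<open>auto elim!: eventually_mono\<close>)
    also have "\<dots> = c" by simp
    finally have lr: "line_rep i u g t y = c + primitive G t" for t
      by (simp add: line_rep_def G_def U_def)
    have "AE t in lborel. c + primitive G t = U t" using c by eventually_elim simp
    then show ?case
      using U ac_line_primitive[OF G, of c] by (simp add: lr U_def G_def)
  qed
qed

section \<open>Borel representatives and sets of capacity zero\<close>

lemma borel_representative:
  fixes f :: "'a::euclidean_space \<Rightarrow> real"
  assumes "sqint lebesgue f"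
  obtains f' where "sqint lborel f'" "AE x in lborel. f x = f' x"
    "(LINT x|lborel. (f' x)\<^sup>2) = (LINT x|lebesgue. (f x)\<^sup>2)"
proof -
  have f: "f \<in> borel_measurable (completion lborel)" using assms by (simp add: sqint_def)
  obtain f' where f': "f' \<in> borel_measurable lborel" "AE x in lborel. f x = f' x"
    using completion_ex_borel_measurable_real[OF f] by blast
  have ae: "AE x in lebesgue. (f x)\<^sup>2 = (f' x)\<^sup>2"
    unfolding AE_lebesgue_iff using f'(2) by eventually_elim simp
  have m: "(\<lambda>x. (f' x)\<^sup>2) \<in> borel_measurable lborel" "(\<lambda>x. (f' x)\<^sup>2) \<in> borel_measurable lebesgue"
    "(\<lambda>x. (f x)\<^sup>2) \<in> borel_measurable lebesgue"
    using f f'(1) by (auto intro!: borel_measurable_power measurable_completion)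
  have "integrable lebesgue (\<lambda>x. (f' x)\<^sup>2)"
    using integrable_cong_AE[OF m(3,2) ae] assms by (simp add: sqint_def)
  then have s: "sqint lborel f'" using f'(1) m integrable_completion[OF m(1)] by (simp add: sqint_def)
  have "(LINT x|lborel. (f' x)\<^sup>2) = (LINT x|lebesgue. (f' x)\<^sup>2)"
    by (rule integral_completion[OF m(1), symmetric])
  also have "\<dots> = (LINT x|lebesgue. (f x)\<^sup>2)"
    by (rule integral_cong_AE[OF m(2,3)]) (use ae in \<open>auto elim: eventually_mono\<close>)
  finally show ?thesis using that s f'(2) by blast
qed

text \<open>The passage from elements of H1 to \<open>weak_partial\<close>, for all three directions
  with one common representative of the function. The two norm bounds are what the capacity and
  density estimates draw on.\<close>

lemma H1_UNIV_weak_partial: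
  assumes "u \<in> H1 UNIV"
  obtains u' g where "AE x in lborel. u x = u' x" "\<forall>i. AE x in lborel. wderiv UNIV i u x = g i x"
    "\<forall>i. weak_partial i u' (g i)" "(LINT x|lborel. (u' x)\<^sup>2) \<le> (norm_H1 UNIV u)\<^sup>2"
    "\<forall>i. (LINT x|lborel. (g i x)\<^sup>2) \<le> (norm_H1 UNIV u)\<^sup>2"
proof -
  note s = H1_sqint[OF assms, unfolded lebesgue_on_UNIV_eq]
  obtain u' where u': "sqint lborel u'" "AE x in lborel. u x = u' x" "(LINT x|lborel. (u' x)\<^sup>2) = (LINT x|lebesgue. (u x)\<^sup>2)"
    using borel_representative[OF s(1)] .
  have "\<exists>g. sqint lborel g \<and> (AE x in lborel. wderiv UNIV i u x = g x) \<and>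
    (LINT x|lborel. (g x)\<^sup>2) = (LINT x|lebesgue. (wderiv UNIV i u x)\<^sup>2)" for i
    by (rule borel_representative[OF s(2)[of i]]) blast
  then have "\<forall>i. \<exists>g. sqint lborel g \<and> (AE x in lborel. wderiv UNIV i u x = g x) \<and>
    (LINT x|lborel. (g x)\<^sup>2) = (LINT x|lebesgue. (wderiv UNIV i u x)\<^sup>2)" ..
  from choice[OF this] obtain g where g: "\<And>i. sqint lborel (g i)" "\<And>i. AE x in lborel. wderiv UNIV i u x = g i x"
    "\<And>i. (LINT x|lborel. (g i x)\<^sup>2) = (LINT x|lebesgue. (wderiv UNIV i u x)\<^sup>2)" by blast
  have "weak_partial i u' (g i)" for i
    unfolding weak_partial_def
  proof (intro conjI ballI)
    fix \<phi> assume t: "\<phi> \<in> test_fun UNIV"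
    have m: "sqint lborel f \<Longrightarrow> f \<in> borel_measurable lborel" "sqint lborel f \<Longrightarrow> f \<in> borel_measurable lebesgue" for f :: scalar_field
      by (auto simp: sqint_def intro: measurable_completion)
    note st = sqint_test_fun[OF t]
    have w: "is_weak_deriv UNIV i u' (g i)"
      by (rule weak_deriv_cong_AE[OF wderiv(2)[OF assms, of i]], unfold lebesgue_on_UNIV_eq)
         (use s u' g in \<open>auto simp: AE_lebesgue_iff intro!: m sqint_measurable[OF s(1)] sqint_measurable[OF s(2)]\<close>)
    have "(LINT x|lborel. u' x * partial i \<phi> x) = (LINT x|lebesgue. u' x * partial i \<phi> x)"
      "(LINT x|lborel. g i x * \<phi> x) = (LINT x|lebesgue. g i x * \<phi> x)"
      by (intro integral_completion[symmetric] borel_measurable_times m u' g st)+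
    then show "(LINT x|lborel. u' x * partial i \<phi> x) = - (LINT x|lborel. g i x * \<phi> x)"
      using w t by (simp add: is_weak_deriv_def lebesgue_on_UNIV_eq)
  qed (use u' g in auto)
  moreover have "(LINT x|lborel. (u' x)\<^sup>2) \<le> (norm_H1 UNIV u)\<^sup>2" "(LINT x|lborel. (g i x)\<^sup>2) \<le> (norm_H1 UNIV u)\<^sup>2" for i
    using norm_H1_ge(1)[where \<Omega> = UNIV and u = u] norm_H1_ge(2)[where \<Omega> = UNIV and u = u]
    by (simp_all add: u' g lebesgue_on_UNIV_eq)
  ultimately show ?thesis by (intro that[of u' g]) (use u' g in auto)
qed

lemma line_sup_sq:
  assumes "ac_line w f" "sqint lborel U" "AE t in lborel. w t = U t"
  shows "(w t)\<^sup>2 \<le> 2 * ((LINT s|lborel. (U s)\<^sup>2) + (LINT s|lborel. (f s)\<^sup>2))"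
proof -
  have "sqint lborel f" using assms by (simp add: ac_line_def)
  then show ?thesis
    using ac_line_sup_sq[OF assms, of t "t + 1" t] integral_Icc_sq_le[OF assms(2), of t "t + 1"]
      integral_Icc_sq_le[of f t "t + 1"] by simp
qed

lemma continuous_slot_line: "continuous_on S (\<lambda>t. slot i t y)"
proof -
  have c: "continuous_on S (\<lambda>t. (t, y))" by (intro continuous_intros)
  from continuous_on_compose2[OF continuous_slot[of i] c] show ?thesis by simp
qed

lemma continuous_AE_ge_on_open:
  fixes w :: "real \<Rightarrow> real"
  assumes "continuous_on UNIV w" "open S" "AE t in lborel. t \<in> S \<longrightarrow> c \<le> w t" "t \<in> S"
  shows "c \<le> w t"
proof (rule ccontr)
  assume "\<not> c \<le> w t"
  define T where "T = S \<inter> w -` {..<c}"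
  have "open T" unfolding T_def using assms(1,2) by (intro open_Int open_vimage) auto
  moreover have "t \<in> T" using \<open>\<not> c \<le> w t\<close> assms by (auto simp: T_def)
  ultimately obtain e where e: "e > 0" "\<And>x. dist x t < e \<Longrightarrow> x \<in> T" by (metis open_dist)
  obtain s where "t < s" "s < t + e" "s \<in> S \<longrightarrow> c \<le> w s"
    using AE_ex_in_interval[OF assms(3), of t "t + e"] e(1) by auto
  moreover have "s \<in> T" using e(2)[of s] calculation by (auto simp: dist_real_def)
  ultimately show False by (auto simp: T_def)
qed

text \<open>An \<open>H\<^sup>1\<close> function is bounded on almost every coordinate line by its energy on that line, and
  these energies have a small integral over all parallel lines.\<close>

lemma capacity_0_AE_line:
  assumes "capacity A = 0"
  shows "AE y in lborel. \<forall>t. slot i t y \<notin> A"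
proof -
  \<comment> \<open>The numerator 4 is the factor 2 of \<open>line_sup_sq\<close> times the two
    integrals, of the function and of one derivative, each at most the squared norm of a competitor
    in the infimum defining the capacity.\<close>
  have "\<exists>E :: real \<times> real \<Rightarrow> real. integrable lborel E \<and> (\<forall>y. 0 \<le> E y) \<and> (LINT y|lborel. E y) \<le> 4 / real (Suc n) \<and>
    (AE y in lborel. \<forall>t. slot i t y \<in> A \<longrightarrow> 1 \<le> E y)" for n
  proof -
    have "capacity A < ennreal (1 / real (Suc n))" using assms by simp
    then obtain u O' where u: "u \<in> H1 UNIV" "open O'" "A \<subseteq> O'" "AE x in lebesgue_on O'. 1 \<le> u x"
      "ennreal ((norm_H1 UNIV u)\<^sup>2) < ennreal (1 / real (Suc n))"
      unfolding capacity_def INF_less_iff by auto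
    have nu: "(norm_H1 UNIV u)\<^sup>2 \<le> 1 / real (Suc n)" using u(5) by (subst (asm) ennreal_less_iff) auto
    obtain v g where vg: "AE x in lborel. u x = v x" "\<forall>i. AE x in lborel. wderiv UNIV i u x = g i x"
      "\<forall>i. weak_partial i v (g i)" "(LINT x|lborel. (v x)\<^sup>2) \<le> (norm_H1 UNIV u)\<^sup>2"
      "\<forall>i. (LINT x|lborel. (g i x)\<^sup>2) \<le> (norm_H1 UNIV u)\<^sup>2"
      using H1_UNIV_weak_partial[OF u(1)] .
    note v = vg(1) vg(3)[rule_format, of i] vg(4) vg(5)[rule_format, of i]
    have s: "sqint lborel v" "sqint lborel (g i)" using v(2) by (auto simp: weak_partial_def)
    define E where "E y = 2 * ((LINT t|lborel. (v (slot i t y))\<^sup>2) + (LINT t|lborel. (g i (slot i t y))\<^sup>2))" for y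
    have "integrable lborel E" unfolding E_def
      by (intro integrable_mult_right Bochner_Integration.integrable_add sqint_slot s)
    moreover have "(LINT y|lborel. E y) = 2 * ((LINT x|lborel. (v x)\<^sup>2) + (LINT x|lborel. (g i x)\<^sup>2))"
      unfolding E_def sqint_slot(3)[OF s(1), of i] sqint_slot(3)[OF s(2), of i]
      using sqint_slot(2)[OF s(1), of i] sqint_slot(2)[OF s(2), of i] by simp
    moreover have "AE y in lborel. \<forall>t. slot i t y \<in> A \<longrightarrow> 1 \<le> E y"
    proof -
      have "AE x in lborel. x \<in> O' \<longrightarrow> 1 \<le> v x"
      proof -
        have "AE x in lborel. x \<in> O' \<longrightarrow> 1 \<le> u x"
          using u(2,4) by (simp add: AE_lebesgue_on_iff AE_lebesgue_iff)
        then show ?thesis using v(1) by eventually_elim simp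
      qed
      from AE_slot[OF this, of i] line_rep[OF v(2)]
      show ?thesis
      proof eventually_elim
        case (elim y)
        define w where "w t = line_rep i v (g i) t y" for t
        have w: "ac_line w (\<lambda>t. g i (slot i t y))" "sqint lborel (\<lambda>t. v (slot i t y))" "AE t in lborel. w t = v (slot i t y)"
          using elim(2) by (auto simp: w_def[abs_def])
        have op: "open {t. slot i t y \<in> O'}"
        proof -
          have "open ((\<lambda>t. slot i t y) -` O')" by (rule open_vimage[OF u(2) continuous_slot_line])
          then show ?thesis by (simp add: vimage_def)
        qed
        have ae: "AE t in lborel. t \<in> {t. slot i t y \<in> O'} \<longrightarrow> 1 \<le> w t"
          using elim(1) w(3) by eventually_elim auto
        have "1 \<le> E y" if "slot i t y \<in> A" for t
        proof -
          \<comment> \<open>The competitor is at least 1 only almost everywhere near A. As A lies in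
            the open set \<open>O'\<close>, continuity on the line extends the inequality to every
            point of the line in A.\<close>
          have "1 \<le> w t"
            by (rule continuous_AE_ge_on_open[OF ac_line_continuous[OF w(1)] op ae]) (use that u(3) in auto)
          then have "1 \<le> (w t)\<^sup>2" by (simp add: power2_eq_square mult_ge1_I)
          also have "\<dots> \<le> E y" unfolding E_def by (rule line_sup_sq[OF w])
          finally show ?thesis .
        qed
        then show ?case by blast
      qed
    qed
    moreover have "2 * ((LINT x|lborel. (v x)\<^sup>2) + (LINT x|lborel. (g i x)\<^sup>2)) \<le> 4 / real (Suc n)"
      using v(3,4) nu by simp
    moreover have "0 \<le> E y" for y by (simp add: E_def)
    ultimately show ?thesis by (intro exI[of _ E]) auto
  qed
  then have "\<forall>n. \<exists>E :: real \<times> real \<Rightarrow> real. integrable lborel E \<and> (\<forall>y. 0 \<le> E y) \<and> (LINT y|lborel. E y) \<le> 4 / real (Suc n) \<and>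
    (AE y in lborel. \<forall>t. slot i t y \<in> A \<longrightarrow> 1 \<le> E y)" ..
  from choice[OF this] obtain E :: "nat \<Rightarrow> real \<times> real \<Rightarrow> real" where E: "\<And>n. integrable lborel (E n)" "\<And>n y. 0 \<le> E n y"
    "\<And>n. (LINT y|lborel. E n y) \<le> 4 / real (Suc n)"
    "\<And>n. AE y in lborel. \<forall>t. slot i t y \<in> A \<longrightarrow> 1 \<le> E n y" by blast
  have [measurable]: "E n \<in> borel_measurable borel" for n using E(1)[of n] by auto
  define S where "S = {y. \<forall>n. 1 \<le> E n y}"
  have [measurable]: "S \<in> sets borel" unfolding S_def by simp
  \<comment> \<open>Markov's inequality for every n; a line meeting A lies in S unless it belongs to
    one of countably many null families.\<close>
  have "emeasure lborel S \<le> ennreal (4 / real (Suc n))" for n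
  proof -
    have "emeasure lborel S = (\<integral>\<^sup>+y. indicator S y \<partial>lborel)" by simp
    also have "\<dots> \<le> (\<integral>\<^sup>+y. ennreal (E n y) \<partial>lborel)"
      by (intro nn_integral_mono) (auto simp: S_def indicator_def one_ennreal_def[symmetric] ennreal_1[symmetric] simp del: ennreal_1 intro!: ennreal_leI)
    also have "\<dots> = ennreal (LINT y|lborel. E n y)" using E by (intro nn_integral_eq_integral) auto
    also have "\<dots> \<le> ennreal (4 / real (Suc n))" by (intro ennreal_leI E)
    finally show ?thesis .
  qed
  moreover have "(\<lambda>n. ennreal (4 / real (Suc n))) \<longlonglongrightarrow> ennreal 0"
  proof (rule tendsto_ennrealI)
    have "(\<lambda>n. 4 * inverse (real (Suc n))) \<longlonglongrightarrow> 4 * 0"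
      by (intro tendsto_mult tendsto_const LIMSEQ_inverse_real_of_nat)
    then show "(\<lambda>n. 4 / real (Suc n)) \<longlonglongrightarrow> 0" by (simp add: divide_inverse)
  qed
  ultimately have "emeasure lborel S \<le> 0"
    by (intro LIMSEQ_le_const[of _ _ "emeasure lborel S"]) (auto simp del: of_nat_Suc)
  then have "S \<in> null_sets lborel" by (auto simp: null_sets_def)
  then have "AE y in lborel. y \<notin> S" by (rule AE_not_in)
  moreover have "AE y in lborel. \<forall>n. \<forall>t. slot i t y \<in> A \<longrightarrow> 1 \<le> E n y"
    unfolding AE_all_countable using E(4) by (rule allI)
  ultimately show ?thesis by eventually_elim (auto simp: S_def)
qed

section \<open>Lebesgue points on lines\<close>

text \<open>The differentiation theorem controls averages of a fixed function, not of the deviation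
  from its own value at y. It is therefore applied to |f - q| for the countably many rational q, and
  f y is approximated by one of them.\<close>

lemma lebesgue_point_one_sided:
  fixes f :: "'a::euclidean_space \<Rightarrow> real"
  assumes f: "\<And>a b. integrable lborel (\<lambda>x. indicator (cbox a b) x * f x)"
  shows "AE y in lborel. \<forall>e>0. \<exists>d>0. \<forall>h. 0 < h \<and> h < d \<longrightarrow>
    (LINT z|lborel. indicator (cbox y (y + h *\<^sub>R One)) z * \<bar>f z - f y\<bar>) \<le> e * h ^ DIM('a)"
proof -
  have fq: "integrable lborel (\<lambda>x. indicator (cbox a b) x * \<bar>f x - q\<bar>)" for a b and q :: real
    by (intro integrable_indicator_abs_diff f emeasure_lborel_cbox_finite) simp
  have eqI: "(\<lambda>x. \<bar>f x - q\<bar>) integrable_on cbox a b"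
    "integral (cbox a b) (\<lambda>x. \<bar>f x - q\<bar>) = (LINT z|lborel. indicator (cbox a b) z * \<bar>f z - q\<bar>)" for a b and q :: real
    using set_borel_integral_eq_integral[of "cbox a b" "\<lambda>x. \<bar>f x - q\<bar>"] fq[of a b q]
    by (auto simp: set_integrable_def set_lebesgue_integral_def)
  have "AE y in lborel. \<forall>e>0. \<exists>d>0. \<forall>h. 0 < h \<and> h < d \<longrightarrow>
    (LINT z|lborel. indicator (cbox y (y + h *\<^sub>R One)) z * \<bar>f z - q\<bar>) \<le> (\<bar>f y - q\<bar> + e) * h ^ DIM('a)" for q :: real
  proof -
    obtain N where N: "negligible N" "\<And>x e. \<lbrakk>x \<notin> N; 0 < e\<rbrakk> \<Longrightarrow>
        \<exists>d>0. \<forall>h. 0 < h \<and> h < d \<longrightarrow>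
          norm(integral (cbox x (x + h *\<^sub>R One)) (\<lambda>x. \<bar>f x - q\<bar>) /\<^sub>R h ^ DIM('a) - \<bar>f x - q\<bar>) < e"
      using integrable_ccontinuous_explicit[of "\<lambda>x. \<bar>f x - q\<bar>"] eqI(1) by blast
    have "AE x in lebesgue. x \<notin> N" using N(1) by (intro AE_not_in) (simp add: negligible_iff_null_sets)
    then have "AE x in lborel. x \<notin> N" by (simp add: AE_lebesgue_iff)
    then show ?thesis
    proof eventually_elim
      case (elim y)
      show ?case
      proof (intro allI impI)
        fix e :: real assume "e > 0"
        obtain d where d: "d > 0" "\<And>h. 0 < h \<and> h < d \<Longrightarrow>
          norm(integral (cbox y (y + h *\<^sub>R One)) (\<lambda>x. \<bar>f x - q\<bar>) /\<^sub>R h ^ DIM('a) - \<bar>f y - q\<bar>) < e"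
          using N(2)[OF elim \<open>e > 0\<close>] by blast
        show "\<exists>d>0. \<forall>h. 0 < h \<and> h < d \<longrightarrow>
          (LINT z|lborel. indicator (cbox y (y + h *\<^sub>R One)) z * \<bar>f z - q\<bar>) \<le> (\<bar>f y - q\<bar> + e) * h ^ DIM('a)"
        proof (intro exI[of _ d] conjI allI impI)
          fix h assume h: "0 < h \<and> h < d"
          then have "integral (cbox y (y + h *\<^sub>R One)) (\<lambda>x. \<bar>f x - q\<bar>) / h ^ DIM('a) < \<bar>f y - q\<bar> + e"
            using d(2)[OF h] by (simp add: divide_inverse mult.commute abs_less_iff)
          then show "(LINT z|lborel. indicator (cbox y (y + h *\<^sub>R One)) z * \<bar>f z - q\<bar>) \<le> (\<bar>f y - q\<bar> + e) * h ^ DIM('a)"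
            using h by (simp add: eqI(2)[symmetric] pos_divide_less_eq less_imp_le)
        qed (rule d(1))
      qed
    qed
  qed
  then have "AE y in lborel. \<forall>q\<in>\<rat>. \<forall>e>0. \<exists>d>0. \<forall>h. 0 < h \<and> h < d \<longrightarrow>
    (LINT z|lborel. indicator (cbox y (y + h *\<^sub>R One)) z * \<bar>f z - q\<bar>) \<le> (\<bar>f y - q\<bar> + e) * h ^ DIM('a)"
    by (subst AE_ball_countable[OF countable_rat]) blast
  then show ?thesis
  proof eventually_elim
    case (elim y)
    show ?case
    proof (intro allI impI)
      fix e :: real assume "e > 0"
      obtain q where q: "q \<in> \<rat>" "f y < q" "q < f y + e / 3"
        using Rats_dense_in_real[of "f y" "f y + e / 3"] \<open>e > 0\<close> by auto
      obtain d where d: "d > 0" "\<And>h. 0 < h \<and> h < d \<Longrightarrow>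
        (LINT z|lborel. indicator (cbox y (y + h *\<^sub>R One)) z * \<bar>f z - q\<bar>) \<le> (\<bar>f y - q\<bar> + e / 3) * h ^ DIM('a)"
        using elim[rule_format, OF q(1), of "e / 3"] \<open>e > 0\<close> by auto
      show "\<exists>d>0. \<forall>h. 0 < h \<and> h < d \<longrightarrow>
        (LINT z|lborel. indicator (cbox y (y + h *\<^sub>R One)) z * \<bar>f z - f y\<bar>) \<le> e * h ^ DIM('a)"
      proof (intro exI[of _ d] conjI allI impI)
        fix h assume h: "0 < h \<and> h < d"
        let ?B = "cbox y (y + h *\<^sub>R One)"
        have m: "measure lborel ?B = h ^ DIM('a)" using h
          by (subst measure_lborel_cbox_eq) (auto simp: inner_add_left)
        have i: "integrable lborel (indicator ?B :: 'a \<Rightarrow> real)"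
          by (intro integrable_real_indicator emeasure_lborel_cbox_finite) auto
        have "(LINT z|lborel. indicator ?B z * \<bar>f z - f y\<bar>) \<le> (LINT z|lborel. indicator ?B z * \<bar>f z - q\<bar> + indicator ?B z * (e / 3))"
          by (intro integral_mono fq Bochner_Integration.integrable_add integrable_mult_left i)
             (use q in \<open>auto simp: indicator_def\<close>)
        also have "\<dots> = (LINT z|lborel. indicator ?B z * \<bar>f z - q\<bar>) + h ^ DIM('a) * (e / 3)"
          using fq i m by simp
        also have "\<dots> \<le> (\<bar>f y - q\<bar> + e / 3) * h ^ DIM('a) + h ^ DIM('a) * (e / 3)" using d(2)[OF h] by simp
        also have "\<dots> = (\<bar>f y - q\<bar> + e / 3 + e / 3) * h ^ DIM('a)" by (simp add: algebra_simps)
        also have "\<dots> \<le> e * h ^ DIM('a)" using q h by (intro mult_right_mono) auto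
        finally show "(LINT z|lborel. indicator ?B z * \<bar>f z - f y\<bar>) \<le> e * h ^ DIM('a)" .
      qed (rule d(1))
    qed
  qed
qed

section \<open>Lebesgue points with respect to centred squares\<close>

definition reflect :: "real \<times> real \<Rightarrow> real \<times> real \<Rightarrow> real \<times> real"
  where "reflect \<sigma> z = (fst \<sigma> * fst z, snd \<sigma> * snd z)"

abbreviation signs :: "(real \<times> real) set"
  where "signs \<equiv> {- 1, 1} \<times> {- 1, 1}"

lemma reflect_measurable: "reflect \<sigma> \<in> borel_measurable borel"
  unfolding reflect_def by (intro borel_measurable_continuous_onI continuous_intros)

lemma reflect_reflect: "\<sigma> \<in> signs \<Longrightarrow> reflect \<sigma> (reflect \<sigma> z) = z"
  by (auto simp: reflect_def)

lemma distr_reflect: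
  assumes "\<sigma> \<in> signs"
  shows "distr lborel borel (reflect \<sigma>) = lborel"
proof -
  have B: "Basis = {(1 :: real, 0 :: real), (0, 1)}" "(1::real, 0::real) \<noteq> (0, 1)" by (auto simp: Basis_prod_def Basis_real_def)
  have c: "\<sigma> \<bullet> j \<noteq> 0" "\<bar>\<sigma> \<bullet> j\<bar> = 1" if "j \<in> Basis" for j
    using that assms unfolding B by auto
  have T: "0 + (\<Sum>j\<in>Basis. ((\<sigma> \<bullet> j) * (x \<bullet> j)) *\<^sub>R j) = reflect \<sigma> x" for x
    unfolding B(1) using B(2) by (cases \<sigma>; cases x) (simp add: reflect_def)
  have "lborel = density (distr lborel borel (reflect \<sigma>)) (\<lambda>_. (\<Prod>j\<in>Basis. \<bar>\<sigma> \<bullet> j\<bar>))"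
    using lborel_affine_euclidean[of "\<lambda>j. \<sigma> \<bullet> j" 0] c(1) unfolding T by simp
  then show ?thesis using c(2) by (simp add: density_1)
qed

lemma integral_reflect:
  fixes f :: "real \<times> real \<Rightarrow> real"
  assumes "\<sigma> \<in> signs" "f \<in> borel_measurable borel"
  shows "(LINT z|lborel. f (reflect \<sigma> z)) = (LINT z|lborel. f z)"
    and "integrable lborel (\<lambda>z. f (reflect \<sigma> z)) \<longleftrightarrow> integrable lborel f"
proof -
  have "(LINT z|distr lborel borel (reflect \<sigma>). f z) = (LINT z|lborel. f (reflect \<sigma> z))"
    by (rule integral_distr) (use assms reflect_measurable in auto)
  then show "(LINT z|lborel. f (reflect \<sigma> z)) = (LINT z|lborel. f z)" by (simp add: distr_reflect[OF assms(1)])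
  have "integrable (distr lborel borel (reflect \<sigma>)) f \<longleftrightarrow> integrable lborel (\<lambda>z. f (reflect \<sigma> z))"
    by (rule integrable_distr_eq) (use assms reflect_measurable in auto)
  then show "integrable lborel (\<lambda>z. f (reflect \<sigma> z)) \<longleftrightarrow> integrable lborel f" by (simp add: distr_reflect[OF assms(1)])
qed

lemma AE_reflect:
  assumes "\<sigma> \<in> signs" "AE z in lborel. P z"
  shows "AE z in lborel. P (reflect \<sigma> z)"
proof -
  obtain N where N: "{z. \<not> P z} \<subseteq> N" "N \<in> null_sets lborel"
    using assms(2) by (auto elim!: AE_E simp: null_sets_def)
  then have Nb: "N \<in> sets borel" by auto
  have m: "reflect \<sigma> -` N \<in> sets borel" using measurable_sets[OF reflect_measurable Nb] by simp
  have "emeasure lborel N = emeasure (distr lborel borel (reflect \<sigma>)) N" by (simp add: distr_reflect[OF assms(1)])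
  also have "\<dots> = emeasure lborel (reflect \<sigma> -` N)" by (subst emeasure_distr) (use Nb reflect_measurable in auto)
  finally have "reflect \<sigma> -` N \<in> null_sets lborel" using N(2) m by (auto simp: null_sets_def)
  then show ?thesis by (rule AE_I') (use N(1) in auto)
qed

definition square :: "real \<times> real \<Rightarrow> real \<Rightarrow> (real \<times> real) set"
  where "square y r = {z. \<bar>fst z - fst y\<bar> \<le> r \<and> \<bar>snd z - snd y\<bar> \<le> r}"

lemma square_cbox: "square y r = cbox (fst y - r, snd y - r) (fst y + r, snd y + r)"
  by (auto simp: square_def cbox_Pair_eq abs_le_iff)

text \<open>The one-sided result concerns squares with y as a corner. Composed with the four sign
  changes it covers the four quadrants around y, which together contain the centred square; each
  receives a quarter of e.\<close>

lemma lebesgue_point_square: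
  fixes f :: "real \<times> real \<Rightarrow> real"
  assumes fm: "f \<in> borel_measurable borel" and f: "\<And>a b. integrable lborel (\<lambda>x. indicator (cbox a b) x * f x)"
  shows "AE y in lborel. \<forall>e>0. \<exists>d>0. \<forall>h. 0 < h \<and> h < d \<longrightarrow>
    (LINT z|lborel. indicator (square y h) z * \<bar>f z - f y\<bar>) \<le> e * h\<^sup>2"
proof -
  have One: "(One :: real \<times> real) = (1, 1)" by (simp add: Basis_prod_def)
  have DIM: "DIM(real \<times> real) = 2" by simp
  have "AE y in lborel. \<forall>e>0. \<exists>d>0. \<forall>h. 0 < h \<and> h < d \<longrightarrow>
    (LINT z|lborel. indicator (reflect \<sigma> -` cbox (reflect \<sigma> y) (reflect \<sigma> y + h *\<^sub>R One)) z * \<bar>f z - f y\<bar>) \<le> e * h\<^sup>2"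
    if s: "\<sigma> \<in> signs" for \<sigma>
  proof -
    have m: "(\<lambda>x. f (reflect \<sigma> x)) \<in> borel_measurable borel" by (rule measurable_compose[OF reflect_measurable fm])
    have "integrable lborel (\<lambda>x. indicator (cbox a b) x * f (reflect \<sigma> x))" for a b
    proof -
      have mb: "(\<lambda>z. indicator (reflect \<sigma> -` cbox a b) z * f z) \<in> borel_measurable borel"
        using measurable_sets[OF reflect_measurable, of "cbox a b" \<sigma>] fm
        by (intro borel_measurable_times borel_measurable_indicator) auto
      have "bounded (reflect \<sigma> ` cbox a b)"
        by (intro compact_imp_bounded compact_continuous_image) (auto simp: reflect_def[abs_def] intro!: continuous_intros)
      then obtain c d where cd: "reflect \<sigma> ` cbox a b \<subseteq> cbox c d" using bounded_subset_cbox_symmetric by metis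
      have "integrable lborel (\<lambda>z. indicator (reflect \<sigma> -` cbox a b) z * f z)"
      proof (rule Bochner_Integration.integrable_bound[OF f[of c d]])
        have "z \<in> cbox c d" if "z \<in> reflect \<sigma> -` cbox a b" for z
          using that cd reflect_reflect[OF s, of z] by force
        then show "AE z in lborel. norm (indicator (reflect \<sigma> -` cbox a b) z * f z) \<le> norm (indicator (cbox c d) z * f z)"
          by (auto simp: indicator_def)
      qed (use mb in simp)
      then show ?thesis
        by (subst (asm) integral_reflect(2)[OF s mb, symmetric])
           (simp add: indicator_def reflect_reflect[OF s])
    qed
    from AE_reflect[OF s lebesgue_point_one_sided[OF this]]
    show ?thesis
    proof eventually_elim
      case (elim y)
      have "(LINT z|lborel. indicator (cbox (reflect \<sigma> y) (reflect \<sigma> y + h *\<^sub>R One)) z * \<bar>f (reflect \<sigma> z) - f (reflect \<sigma> (reflect \<sigma> y))\<bar>)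
        = (LINT z|lborel. indicator (reflect \<sigma> -` cbox (reflect \<sigma> y) (reflect \<sigma> y + h *\<^sub>R One)) z * \<bar>f z - f y\<bar>)" for h
      proof -
        have "(\<lambda>z. indicator (reflect \<sigma> -` cbox (reflect \<sigma> y) (reflect \<sigma> y + h *\<^sub>R One)) z * \<bar>f z - f y\<bar>) \<in> borel_measurable borel"
          using measurable_sets[OF reflect_measurable, of "cbox (reflect \<sigma> y) (reflect \<sigma> y + h *\<^sub>R One)" \<sigma>] fm
          by (intro borel_measurable_times borel_measurable_indicator borel_measurable_abs borel_measurable_diff) auto
        from integral_reflect(1)[OF s this] show ?thesis
          by (simp add: reflect_reflect[OF s] indicator_def)
      qed
      then show ?case using elim unfolding DIM by simp
    qed
  qed
  then have "AE y in lborel. \<forall>\<sigma>\<in>signs. \<forall>e>0. \<exists>d>0. \<forall>h. 0 < h \<and> h < d \<longrightarrow>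
    (LINT z|lborel. indicator (reflect \<sigma> -` cbox (reflect \<sigma> y) (reflect \<sigma> y + h *\<^sub>R One)) z * \<bar>f z - f y\<bar>) \<le> e * h\<^sup>2"
    by (subst AE_ball_countable) (auto intro: countable_finite)
  then show ?thesis
  proof eventually_elim
    case (elim y)
    define Q where "Q \<sigma> h = reflect \<sigma> -` cbox (reflect \<sigma> y) (reflect \<sigma> y + h *\<^sub>R One)" for \<sigma> h
    have fin: "finite signs" and card: "card signs = 4" by auto
    have Qs: "Q \<sigma> h \<subseteq> square y h" if "\<sigma> \<in> signs" for \<sigma> h
      using that by (auto simp: Q_def reflect_def square_def One cbox_Pair_eq)
    have Qm: "Q \<sigma> h \<in> sets borel" for \<sigma> h
      unfolding Q_def using measurable_sets[OF reflect_measurable, of _ \<sigma>] by auto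
    have cov: "square y h \<subseteq> (\<Union>\<sigma>\<in>signs. Q \<sigma> h)" for h
    proof
      fix z assume z: "z \<in> square y h"
      let ?\<sigma> = "(if fst y \<le> fst z then 1 else - 1, if snd y \<le> snd z then 1 else - 1)"
      have "?\<sigma> \<in> signs" by auto
      moreover have "z \<in> Q ?\<sigma> h" using z by (auto simp: Q_def reflect_def square_def One cbox_Pair_eq)
      ultimately show "z \<in> (\<Union>\<sigma>\<in>signs. Q \<sigma> h)" by blast
    qed
    have ic: "integrable lborel (\<lambda>z. indicator (square y h) z * \<bar>f z - f y\<bar>)" for h
      unfolding square_cbox by (intro integrable_indicator_abs_diff f emeasure_lborel_cbox_finite) simp
    have iQ: "integrable lborel (\<lambda>z. indicator (Q \<sigma> h) z * \<bar>f z - f y\<bar>)" if "\<sigma> \<in> signs" for \<sigma> h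
    proof (rule Bochner_Integration.integrable_bound[OF ic[of h]])
      show "(\<lambda>z. indicator (Q \<sigma> h) z * \<bar>f z - f y\<bar>) \<in> borel_measurable lborel"
        using Qm fm by (intro borel_measurable_times borel_measurable_indicator borel_measurable_abs borel_measurable_diff) auto
    qed (use Qs[OF that] in \<open>auto simp: indicator_def\<close>)
    show ?case
    proof (intro allI impI)
      fix e :: real assume "e > 0"
      then have "\<forall>\<sigma>\<in>signs. \<exists>d>0. \<forall>h. 0 < h \<and> h < d \<longrightarrow> (LINT z|lborel. indicator (Q \<sigma> h) z * \<bar>f z - f y\<bar>) \<le> (e / 4) * h\<^sup>2"
      proof (intro ballI)
        fix \<sigma> :: "real \<times> real" assume "\<sigma> \<in> signs"
        have e4: "e / 4 > 0" using \<open>e > 0\<close> by simp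
        from mp[OF spec[OF bspec[OF elim \<open>\<sigma> \<in> signs\<close>], of "e / 4"] e4]
        show "\<exists>d>0. \<forall>h. 0 < h \<and> h < d \<longrightarrow> (LINT z|lborel. indicator (Q \<sigma> h) z * \<bar>f z - f y\<bar>) \<le> (e / 4) * h\<^sup>2"
          unfolding Q_def .
      qed
      from bchoice[OF this] obtain d where d0: "\<forall>\<sigma>\<in>signs. d \<sigma> > 0 \<and>
        (\<forall>h. 0 < h \<and> h < d \<sigma> \<longrightarrow> (LINT z|lborel. indicator (Q \<sigma> h) z * \<bar>f z - f y\<bar>) \<le> (e / 4) * h\<^sup>2)" ..
      have d: "d \<sigma> > 0"
        "0 < h \<and> h < d \<sigma> \<Longrightarrow> (LINT z|lborel. indicator (Q \<sigma> h) z * \<bar>f z - f y\<bar>) \<le> (e / 4) * h\<^sup>2"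
        if "\<sigma> \<in> signs" for \<sigma> h
        using bspec[OF d0 that] by (rule conjunct1) (rule mp[OF spec[OF conjunct2[OF bspec[OF d0 that]]]])
      show "\<exists>d>0. \<forall>h. 0 < h \<and> h < d \<longrightarrow> (LINT z|lborel. indicator (square y h) z * \<bar>f z - f y\<bar>) \<le> e * h\<^sup>2"
      proof (intro exI[of _ "Min (d ` signs)"] conjI allI impI)
        show "0 < Min (d ` signs)" using d(1) by (subst Min_gr_iff) auto
        fix h assume h: "0 < h \<and> h < Min (d ` signs)"
        have hd: "0 < h \<and> h < d \<sigma>" if "\<sigma> \<in> signs" for \<sigma>
          using h Min_le[OF finite_imageI[OF fin], of "d \<sigma>" d] that by force
        have "(LINT z|lborel. indicator (square y h) z * \<bar>f z - f y\<bar>) \<le> (LINT z|lborel. (\<Sum>\<sigma>\<in>signs. indicator (Q \<sigma> h) z * \<bar>f z - f y\<bar>))"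
        proof (rule integral_mono[OF ic Bochner_Integration.integrable_sum[OF iQ]])
          fix z show "indicator (square y h) z * \<bar>f z - f y\<bar> \<le> (\<Sum>\<sigma>\<in>signs. indicator (Q \<sigma> h) z * \<bar>f z - f y\<bar>)"
          proof (cases "z \<in> square y h")
            case True
            then obtain \<sigma> where \<sigma>: "\<sigma> \<in> signs" "z \<in> Q \<sigma> h" using cov by blast
            have "indicator (Q \<sigma> h) z * \<bar>f z - f y\<bar> \<le> (\<Sum>\<sigma>\<in>signs. indicator (Q \<sigma> h) z * \<bar>f z - f y\<bar>)"
              by (rule member_le_sum[OF \<sigma>(1) _ fin]) auto
            then show ?thesis using \<sigma>(2) True by simp
          next
            case False
            then show ?thesis by (auto intro!: sum_nonneg)
          qed
        qed
        also have "\<dots> = (\<Sum>\<sigma>\<in>signs. LINT z|lborel. indicator (Q \<sigma> h) z * \<bar>f z - f y\<bar>)"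
          by (rule Bochner_Integration.integral_sum[OF iQ])
        also have "\<dots> \<le> (\<Sum>\<sigma>\<in>signs. (e / 4) * h\<^sup>2)" by (intro sum_mono d(2) hd)
        also have "\<dots> = real (card signs) * ((e / 4) * h\<^sup>2)" by (rule sum_constant)
        also have "\<dots> = e * h\<^sup>2" unfolding card by simp
        finally show "(LINT z|lborel. indicator (square y h) z * \<bar>f z - f y\<bar>) \<le> e * h\<^sup>2" .
      qed
    qed
  qed
qed

text \<open>A ball of the maximum norm: a line parallel to an axis meets it in an interval that is
  the same for all lines meeting it, so that Fubini splits it into that interval and a
  \<open>square\<close>.\<close>

definition cube :: "R3 \<Rightarrow> real \<Rightarrow> R3 set"
  where "cube x r = {z. \<forall>j. \<bar>z $ j - x $ j\<bar> \<le> r}"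

lemma cube_cbox: "cube x r = cbox (x - (\<chi> j. r)) (x + (\<chi> j. r))"
  by (auto simp: cube_def mem_box_cart abs_le_iff algebra_simps)

lemma cube_measurable [measurable]: "cube x r \<in> sets borel"
  by (simp add: cube_cbox)

lemma slot_mem_cube: "slot i s z \<in> cube (slot i t y) r \<longleftrightarrow> \<bar>s - t\<bar> \<le> r \<and> z \<in> square y r"
  unfolding cube_def mem_Collect_eq three_all[of _ i] by (simp add: slot_nth square_def)

lemma emeasure_cube: "emeasure lborel (cube x r) < \<infinity>"
  unfolding cube_cbox by (rule emeasure_lborel_cbox_finite)

lemma measure_square: "0 \<le> r \<Longrightarrow> measure lborel (square y r) = 4 * r\<^sup>2"
  unfolding square_cbox by (subst measure_lborel_cbox_eq) (auto simp: Basis_prod_def power2_eq_square)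

lemma measure_cube: "0 \<le> r \<Longrightarrow> measure lborel (cube x r) = 8 * r ^ 3"
proof -
  assume r: "0 \<le> r"
  have "measure lborel (cube x r) = (\<Prod>b\<in>Basis. ((x + (\<chi> j. r)) - (x - (\<chi> j. r))) \<bullet> b)"
    unfolding cube_cbox using r by (subst measure_lborel_cbox_eq) (auto simp: Basis_vec_def inner_axis algebra_simps)
  also have "\<dots> = (\<Prod>j\<in>(UNIV::3 set). 2 * r)"
    by (simp add: Basis_vec_def Basis_real_def UNION_singleton_eq_range prod.reindex axis_eq_axis inj_on_def inner_axis)
  finally show ?thesis by (simp add: power_mult_distrib)
qed

section \<open>Measurability across lines, and Lebesgue points at every point of a line\<close>

lemma primitive_slot_measurable:
  assumes "g \<in> borel_measurable borel"
  shows "(\<lambda>p. primitive (\<lambda>s. g (slot i s (snd p))) (fst p)) \<in> borel_measurable (borel :: (real \<times> real \<times> real) measure)"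
proof -
  let ?M = "borel :: ((real \<times> real \<times> real) \<times> real) measure"
  have m: "(\<lambda>q. snd q) \<in> borel_measurable ?M" "(\<lambda>q. snd (fst q)) \<in> borel_measurable ?M"
    by (intro borel_measurable_continuous_onI continuous_intros)+
  have g: "(\<lambda>q. g (slot i (snd q) (snd (fst q)))) \<in> borel_measurable ?M"
    by (rule measurable_compose[OF slot_measurable[OF m] assms])
  have "closed ({q :: (real \<times> real \<times> real) \<times> real. 0 \<le> snd q} \<inter> {q. snd q \<le> fst (fst q)})"
    "closed ({q :: (real \<times> real \<times> real) \<times> real. fst (fst q) \<le> snd q} \<inter> {q. snd q \<le> 0})"
    by (intro closed_Int closed_Collect_le continuous_intros)+
  then have "(\<lambda>q. indicator ({q :: (real \<times> real \<times> real) \<times> real. 0 \<le> snd q} \<inter> {q. snd q \<le> fst (fst q)}) q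
      - indicator ({q. fst (fst q) \<le> snd q} \<inter> {q. snd q \<le> 0}) q :: real) \<in> borel_measurable ?M"
    by (intro borel_measurable_diff borel_measurable_indicator borel_closed)
  also have "(\<lambda>q. indicator ({q :: (real \<times> real \<times> real) \<times> real. 0 \<le> snd q} \<inter> {q. snd q \<le> fst (fst q)}) q
      - indicator ({q. fst (fst q) \<le> snd q} \<inter> {q. snd q \<le> 0}) q :: real) =
    (\<lambda>q. indicator {0..fst (fst q)} (snd q) - indicator {fst (fst q)..0} (snd q))"
    by (auto simp: indicator_def)
  finally have "(\<lambda>q. (indicator {0..fst (fst q)} (snd q) - indicator {fst (fst q)..0} (snd q)) * g (slot i (snd q) (snd (fst q)))) \<in> borel_measurable ?M"
    using g by (rule borel_measurable_times)
  then have "(\<lambda>(p, s). (indicator {0..fst p} s - indicator {fst p..0} s) * g (slot i s (snd p))) \<in>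
      borel_measurable ((borel :: (real \<times> real \<times> real) measure) \<Otimes>\<^sub>M lborel)"
    by (subst measurable_cong_sets[of _ borel _ borel]) (auto simp: split_beta' borel_prod[symmetric] intro!: sets_pair_measure_cong)
  then show ?thesis unfolding primitive_def by (rule lborel.borel_measurable_lebesgue_integral)
qed

lemma line_rep_measurable:
  assumes "u \<in> borel_measurable borel" "g \<in> borel_measurable borel"
  shows "line_rep i u g t \<in> borel_measurable borel"
proof -
  let ?M = "borel :: ((real \<times> real) \<times> real) measure"
  have m: "(\<lambda>q. snd q) \<in> borel_measurable ?M" "(\<lambda>q. fst q) \<in> borel_measurable ?M"
    by (intro borel_measurable_continuous_onI continuous_intros)+
  have "(\<lambda>q. (snd q, fst q)) \<in> borel_measurable ?M" by (rule borel_measurable_Pair[OF m])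
  from measurable_compose[OF this primitive_slot_measurable[OF assms(2), of i]]
  have 1: "(\<lambda>q. primitive (\<lambda>s. g (slot i s (fst q))) (snd q)) \<in> borel_measurable ?M" by simp
  have 2: "(\<lambda>q. u (slot i (snd q) (fst q))) \<in> borel_measurable ?M"
    by (rule measurable_compose[OF slot_measurable[OF m] assms(1)])
  have "(\<lambda>q. indicator {0..1} (snd q) :: real) \<in> borel_measurable ?M"
    by (rule measurable_compose[OF m(1)]) simp
  from borel_measurable_times[OF this borel_measurable_diff[OF 2 1]]
  have "(\<lambda>(y, r). indicator {0..1} r * (u (slot i r y) - primitive (\<lambda>s. g (slot i s y)) r)) \<in>
      borel_measurable ((borel :: (real \<times> real) measure) \<Otimes>\<^sub>M lborel)"
    by (subst measurable_cong_sets[of _ borel _ borel]) (auto simp: split_beta' borel_prod[symmetric] intro!: sets_pair_measure_cong)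
  then have 3: "(\<lambda>y. LINT r|lborel. indicator {0..1} r * (u (slot i r y) - primitive (\<lambda>s. g (slot i s y)) r)) \<in> borel_measurable borel"
    by (rule lborel.borel_measurable_lebesgue_integral)
  have "(\<lambda>y. (t, y)) \<in> borel_measurable (borel :: (real \<times> real) measure)"
    by (intro borel_measurable_continuous_onI continuous_intros)
  from measurable_compose[OF this primitive_slot_measurable[OF assms(2), of i]]
  have "(\<lambda>y. primitive (\<lambda>s. g (slot i s y)) t) \<in> borel_measurable borel" by simp
  from borel_measurable_add[OF 3 this] show ?thesis by (simp add: line_rep_def[abs_def])
qed

text \<open>Every point of almost every line is a Lebesgue point: the section \<open>w(q, \<cdot>)\<close> has Lebesgue points
  almost everywhere for all rational \<open>q\<close>, and the Hoelder continuity of \<open>w(\<cdot>, y)\<close> is controlled by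
  the energy \<open>D\<close> of the line, which has Lebesgue points almost everywhere as well.\<close>

lemma line_lebesgue_point:
  assumes wp: "weak_partial i u g"
  shows "AE y in lborel. \<forall>t. \<forall>e>0. \<exists>d>0. \<forall>r. 0 < r \<and> r < d \<longrightarrow>
    (LINT x|lborel. indicator (cube (slot i t y) r) x * \<bar>u x - line_rep i u g t y\<bar>) \<le> e * r ^ 3"
proof -
  have s: "sqint lborel u" "sqint lborel g" using wp by (auto simp: weak_partial_def)
  have um [measurable]: "u \<in> borel_measurable borel" and gm [measurable]: "g \<in> borel_measurable borel"
    using s by (auto simp: sqint_def)
  define w where "w = line_rep i u g"
  define A where "A y = (LINT t|lborel. (u (slot i t y))\<^sup>2)" for y
  define D where "D y = (LINT t|lborel. (g (slot i t y))\<^sup>2)" for y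
  have iA: "integrable lborel A" and iD: "integrable lborel D"
    unfolding A_def D_def by (intro sqint_slot s)+
  have D0: "0 \<le> D y" for y by (simp add: D_def)
  have good: "AE y in lborel. sqint lborel (\<lambda>t. u (slot i t y)) \<and> ac_line (\<lambda>t. w t y) (\<lambda>t. g (slot i t y)) \<and>
    (AE t in lborel. w t y = u (slot i t y))"
    unfolding w_def by (rule line_rep[OF wp])
  have wm: "w t \<in> borel_measurable borel" for t
    unfolding w_def by (rule line_rep_measurable[OF um gm])
  \<comment> \<open>A plane is a null set, so integrability of u says nothing about a single
    section. The section is bounded by 1 plus its square, and the square at each point by the energy
    of the line through it.\<close>
  have wi: "integrable lborel (\<lambda>y. indicator (cbox a b) y * w t y)" for a b t
  proof (rule Bochner_Integration.integrable_bound)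
    show "integrable lborel (\<lambda>y. indicator (cbox a b) y + (2 * A y + 2 * D y))"
      by (intro Bochner_Integration.integrable_add integrable_mult_right iA iD integrable_real_indicator emeasure_lborel_cbox_finite) auto
    show "(\<lambda>y. indicator (cbox a b) y * w t y) \<in> borel_measurable lborel" using wm by simp
    show "AE y in lborel. norm (indicator (cbox a b) y * w t y) \<le> norm (indicator (cbox a b) y + (2 * A y + 2 * D y))"
      using good
    proof eventually_elim
      case (elim y)
      have b: "(w t y)\<^sup>2 \<le> 2 * (A y + D y)"
        unfolding A_def D_def by (rule line_sup_sq) (use elim in auto)
      have "\<bar>w t y\<bar> \<le> 1 + (w t y)\<^sup>2"
      proof -
        have "0 \<le> (\<bar>w t y\<bar> - 1)\<^sup>2" by simp
        then have "2 * \<bar>w t y\<bar> \<le> 1 + (w t y)\<^sup>2" by (simp add: power2_diff)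
        then show ?thesis by (smt (verit) zero_le_power2)
      qed
      moreover have "0 \<le> A y" "0 \<le> D y" by (simp_all add: A_def D_def)
      ultimately show ?case using b by (auto simp: indicator_def)
    qed
  qed
  have Dl: "integrable lborel (\<lambda>y. indicator (cbox a b) y * D y)" for a b
    using integrable_mult_indicator[OF _ iD, of "cbox a b"] by simp
  have "AE y in lborel. \<forall>q\<in>\<rat>. \<forall>e>0. \<exists>d>0. \<forall>h. 0 < h \<and> h < d \<longrightarrow>
    (LINT z|lborel. indicator (square y h) z * \<bar>w q z - w q y\<bar>) \<le> e * h\<^sup>2"
    by (subst AE_ball_countable[OF countable_rat]) (intro ballI lebesgue_point_square wm wi)
  moreover have "AE y in lborel. \<forall>e>0. \<exists>d>0. \<forall>h. 0 < h \<and> h < d \<longrightarrow>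
    (LINT z|lborel. indicator (square y h) z * \<bar>D z - D y\<bar>) \<le> e * h\<^sup>2"
    by (intro lebesgue_point_square Dl) (use iD in auto)
  ultimately show ?thesis using good
  proof eventually_elim
    case (elim y)
    show ?case unfolding w_def[symmetric]
    proof (intro allI impI)
      fix t e :: real assume "e > 0"
      \<comment> \<open>The normalised integral will come out as at most 2 (8 K \<eta> + e/8), which
        this \<eta> makes 3 e/4. With \<delta> half the square of \<eta>, Hoelder continuity over a
        distance of 2 \<delta> gives at most \<eta> times the root of the energy, and the root is
        replaced by the integrable bound 1 + D.\<close>
      define K where "K = 2 + D y"
      have K: "K \<ge> 2" using D0 by (simp add: K_def)
      define \<eta> where "\<eta> = e / (32 * K)"
      define \<delta> where "\<delta> = \<eta>\<^sup>2 / 2"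
      have \<eta>: "\<eta> > 0" using \<open>e > 0\<close> K by (simp add: \<eta>_def)
      then have \<delta>: "\<delta> > 0" by (simp add: \<delta>_def)
      obtain q where q: "q \<in> \<rat>" "t < q" "q < t + \<delta>" using Rats_dense_in_real[of t "t + \<delta>"] \<delta> by auto
      obtain d1 where d1: "d1 > 0" "\<And>h. 0 < h \<Longrightarrow> h < d1 \<Longrightarrow> (LINT z|lborel. indicator (square y h) z * \<bar>w q z - w q y\<bar>) \<le> (e / 8) * h\<^sup>2"
        using elim(1)[rule_format, OF q(1), of "e / 8"] \<open>e > 0\<close> by auto
      obtain d2 where d2: "d2 > 0" "\<And>h. 0 < h \<Longrightarrow> h < d2 \<Longrightarrow> (LINT z|lborel. indicator (square y h) z * \<bar>D z - D y\<bar>) \<le> 1 * h\<^sup>2"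
        using elim(2)[rule_format, of 1] by auto
      have hoel: "\<bar>w b z - w a z\<bar> \<le> \<eta> * (1 + D z)"
        if ac: "ac_line (\<lambda>t. w t z) (\<lambda>t. g (slot i t z))" and ab: "\<bar>b - a\<bar> \<le> 2 * \<delta>" for a b z
      proof -
        have *: "(w b z - w a z)\<^sup>2 \<le> (2 * \<delta>) * D z" if ab: "a \<le> b" "b - a \<le> 2 * \<delta>" for a b
        proof -
          have "(w b z - w a z)\<^sup>2 \<le> (b - a) * (LINT s|lborel. indicator {a..b} s * (g (slot i s z))\<^sup>2)"
            by (rule ac_line_increment_sq[OF ac ab(1)])
          also have "\<dots> \<le> (2 * \<delta>) * D z"
            unfolding D_def using ab ac by (intro mult_mono integral_Icc_sq_le) (auto simp: ac_line_def)
          finally show ?thesis .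
        qed
        have "(w b z - w a z)\<^sup>2 \<le> (2 * \<delta>) * D z"
          using *[of a b] *[of b a] ab by (cases "a \<le> b") (auto simp: power2_commute)
        also have "\<dots> = \<eta>\<^sup>2 * D z" by (simp add: \<delta>_def)
        also have "\<dots> \<le> \<eta>\<^sup>2 * (1 + D z)\<^sup>2"
          using D0[of z] by (intro mult_left_mono) (auto simp: power2_eq_square algebra_simps)
        finally have "(w b z - w a z)\<^sup>2 \<le> (\<eta> * (1 + D z))\<^sup>2" by (simp add: power_mult_distrib)
        then show ?thesis using \<eta> D0[of z] by (simp add: abs_le_square_iff[symmetric])
      qed
      define d where "d = Min {d1, d2, \<delta>}"
      have "d > 0" using d1 d2 \<delta> by (simp add: d_def)
      show "\<exists>d>0. \<forall>r. 0 < r \<and> r < d \<longrightarrow>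
        (LINT x|lborel. indicator (cube (slot i t y) r) x * \<bar>u x - w t y\<bar>) \<le> e * r ^ 3"
      proof (intro exI[of _ d] conjI allI impI)
        fix r assume "0 < r \<and> r < d"
        then have r: "0 < r" "r < d1" "r < d2" "r < \<delta>" by (auto simp: d_def)
        define c where "c = w t y"
        define Sq where "Sq = square y r"
        have Sqm: "Sq \<in> sets borel" by (simp add: Sq_def square_cbox)
        have Sqi: "integrable lborel (indicator Sq :: real \<times> real \<Rightarrow> real)"
          unfolding Sq_def square_cbox by (intro integrable_real_indicator emeasure_lborel_cbox_finite) auto
        have Sqc: "(LINT z|lborel. indicator Sq z) = 4 * r\<^sup>2"
          using measure_square[of r y] r by (simp add: Sq_def)
        \<comment> \<open>A bound for |u(s, z) - w(t, y)| along the chain w(s, z), w(q, z), w(q, y),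
          w(t, y): Hoelder continuity on the line z, the Lebesgue point y of the section at the
          rational q, Hoelder continuity on the line y.\<close>
        define R where "R z = \<eta> * (1 + D z) + \<bar>w q z - w q y\<bar> + \<eta> * (1 + D y)" for z
        have iu: "integrable lborel (\<lambda>x. indicator (cube (slot i t y) r) x * \<bar>u x - c\<bar>)"
          by (intro integrable_indicator_abs_diff sqint_mult sqint_indicator s emeasure_cube) simp_all
        have Sqe: "emeasure lborel Sq < \<infinity>" unfolding Sq_def square_cbox by (rule emeasure_lborel_cbox_finite)
        have idw: "integrable lborel (\<lambda>z. indicator Sq z * \<bar>w q z - w q y\<bar>)"
          by (intro integrable_indicator_abs_diff Sqe) (use Sqm wi in \<open>auto simp: Sq_def square_cbox\<close>)
        have idD: "integrable lborel (\<lambda>z. indicator Sq z * D z)"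
          unfolding Sq_def square_cbox by (rule Dl)
        have idDD: "integrable lborel (\<lambda>z. indicator Sq z * \<bar>D z - D y\<bar>)"
          by (intro integrable_indicator_abs_diff Sqe idD) (use Sqm in simp)
        have inner: "AE z in lborel. (LINT s|lborel. indicator (cube (slot i t y) r) (slot i s z) * \<bar>u (slot i s z) - c\<bar>) \<le> 2 * r * (indicator Sq z * R z)"
          using good
        proof eventually_elim
          case (elim z)
          note acz = elim[THEN conjunct2, THEN conjunct1]
          show ?case
          proof (cases "z \<in> Sq")
            case False
            then show ?thesis by (simp add: slot_mem_cube Sq_def indicator_def)
          next
            case True
            have ii: "integrable lborel (indicator {t - r..t + r} :: real \<Rightarrow> real)"
              by (intro integrable_real_indicator) (auto simp: emeasure_lborel_Icc_eq)
            have "(LINT s|lborel. indicator (cube (slot i t y) r) (slot i s z) * \<bar>u (slot i s z) - c\<bar>) \<le> (LINT s|lborel. indicator {t - r..t + r} s * R z)"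
            proof (rule integral_mono_AE')
              show "integrable lborel (\<lambda>s. indicator {t - r..t + r} s * R z)" by (intro integrable_mult_left ii)
              show "AE s in lborel. indicator (cube (slot i t y) r) (slot i s z) * \<bar>u (slot i s z) - c\<bar> \<le> indicator {t - r..t + r} s * R z"
                using elim[THEN conjunct2, THEN conjunct2]
              proof eventually_elim
                case (elim s)
                show ?case
                proof (cases "\<bar>s - t\<bar> \<le> r")
                  case False then show ?thesis by (auto simp: slot_mem_cube indicator_def)
                next
                  case st: True
                  have "\<bar>s - q\<bar> \<le> 2 * \<delta>" using st q r by auto
                  then have "\<bar>w s z - w q z\<bar> \<le> \<eta> * (1 + D z)" by (intro hoel acz)
                  moreover have "\<bar>w q y - w t y\<bar> \<le> \<eta> * (1 + D y)"
                    by (intro hoel) (use \<open>_ \<and> ac_line (\<lambda>t. w t y) _ \<and> _\<close> q \<delta> in auto)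
                  ultimately have "\<bar>u (slot i s z) - c\<bar> \<le> R z" unfolding R_def c_def elim[symmetric] by linarith
                  moreover have "s \<in> {t - r..t + r}" using st by auto
                  ultimately show ?thesis by (auto simp: indicator_def)
                qed
              qed
              show "AE s in lborel. 0 \<le> indicator {t - r..t + r} s * R z"
                using \<eta> D0 by (auto simp: R_def intro!: AE_I2 mult_nonneg_nonneg add_nonneg_nonneg)
            qed
            also have "\<dots> = 2 * r * (indicator Sq z * R z)" using True r by simp
            finally show ?thesis .
          qed
        qed
        have iR: "integrable lborel (\<lambda>z. indicator Sq z * R z)"
        proof -
          have "integrable lborel (\<lambda>z. \<eta> * (indicator Sq z + indicator Sq z * D z) + indicator Sq z * \<bar>w q z - w q y\<bar> + indicator Sq z * (\<eta> * (1 + D y)))"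
            using Sqi idD idw by (intro Bochner_Integration.integrable_add integrable_mult_left integrable_mult_right)
          then show ?thesis by (simp add: R_def algebra_simps)
        qed
        have "(LINT x|lborel. indicator (cube (slot i t y) r) x * \<bar>u x - c\<bar>) =
          (LINT z|lborel. LINT s|lborel. indicator (cube (slot i t y) r) (slot i s z) * \<bar>u (slot i s z) - c\<bar>)"
          by (rule integral_slot(3)[OF iu])
        also have "\<dots> \<le> (LINT z|lborel. 2 * r * (indicator Sq z * R z))"
          by (intro integral_mono_AE integral_slot(2)[OF iu] integrable_mult_right iR inner)
        also have "\<dots> = 2 * r * (LINT z|lborel. indicator Sq z * R z)" by simp
        also have "(LINT z|lborel. indicator Sq z * R z) \<le> (LINT z|lborel. \<eta> * (2 * (indicator Sq z * (1 + D y)) + indicator Sq z * \<bar>D z - D y\<bar>) + indicator Sq z * \<bar>w q z - w q y\<bar>)"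
        proof (rule integral_mono[OF iR])
          show "integrable lborel (\<lambda>z. \<eta> * (2 * (indicator Sq z * (1 + D y)) + indicator Sq z * \<bar>D z - D y\<bar>) + indicator Sq z * \<bar>w q z - w q y\<bar>)"
            using Sqi idDD idw by (intro Bochner_Integration.integrable_add integrable_mult_left integrable_mult_right)
          fix z
          have "\<eta> * D z \<le> \<eta> * (D y + \<bar>D z - D y\<bar>)" using \<eta> by (intro mult_left_mono) auto
          then show "indicator Sq z * R z \<le> \<eta> * (2 * (indicator Sq z * (1 + D y)) + indicator Sq z * \<bar>D z - D y\<bar>) + indicator Sq z * \<bar>w q z - w q y\<bar>"
            by (auto simp: R_def indicator_def algebra_simps)
        qed
        also have "\<dots> = \<eta> * (2 * (4 * r\<^sup>2 * (1 + D y)) + (LINT z|lborel. indicator Sq z * \<bar>D z - D y\<bar>)) + (LINT z|lborel. indicator Sq z * \<bar>w q z - w q y\<bar>)"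
          using Sqi idDD idw Sqc by simp
        also have "\<dots> \<le> \<eta> * (2 * (4 * r\<^sup>2 * (1 + D y)) + 1 * r\<^sup>2) + (e / 8) * r\<^sup>2"
          using d1(2)[OF r(1,2)] d2(2)[OF r(1,3)] \<eta> unfolding Sq_def
          by (intro add_mono mult_left_mono) auto
        also have "\<dots> \<le> (8 * K * \<eta> + e / 8) * r\<^sup>2"
        proof -
          have "\<eta> * r\<^sup>2 * 0 \<le> \<eta> * r\<^sup>2 * 7" using \<eta> by (intro mult_left_mono) auto
          then show ?thesis by (simp add: K_def algebra_simps)
        qed
        also have "\<dots> = (3 * e / 8) * r\<^sup>2" using K by (simp add: \<eta>_def)
        finally have "(LINT x|lborel. indicator (cube (slot i t y) r) x * \<bar>u x - c\<bar>) \<le> 2 * r * ((3 * e / 8) * r\<^sup>2)"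
          using r by (simp add: mult_left_mono)
        also have "\<dots> \<le> e * r ^ 3" using r \<open>e > 0\<close> by (simp add: power2_eq_square power3_eq_cube algebra_simps)
        finally show "(LINT x|lborel. indicator (cube (slot i t y) r) x * \<bar>u x - w t y\<bar>) \<le> e * r ^ 3" by (simp add: c_def)
      qed (rule \<open>d > 0\<close>)
    qed
  qed
qed

section \<open>Measure density of extension domains\<close>

lemma bounded_compact_support:
  fixes f :: "R3 \<Rightarrow> real"
  assumes "continuous_on UNIV f" "compact K" "\<And>x. x \<notin> K \<Longrightarrow> f x = 0"
  obtains B where "B > 0" "\<And>x. \<bar>f x\<bar> \<le> B"
proof -
  have "compact (f ` K)" using assms by (intro compact_continuous_image) (auto intro: continuous_on_subset)
  then obtain B where B: "\<And>x. x \<in> K \<Longrightarrow> \<bar>f x\<bar> \<le> B"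
    using compact_imp_bounded[of "f ` K"] unfolding bounded_real by blast
  have "\<bar>f x\<bar> \<le> \<bar>B\<bar> + 1" for x using B[of x] assms(3)[of x] by (cases "x \<in> K") auto
  then show ?thesis using that[of "\<bar>B\<bar> + 1"] by auto
qed

lemma integral_partial_eq_0:
  assumes d: "\<And>x. f differentiable (at x)" and c: "continuous_on UNIV (partial i f)"
    and K: "compact K" "\<And>x. x \<notin> K \<Longrightarrow> f x = 0" "\<And>x. x \<notin> K \<Longrightarrow> partial i f x = 0"
  shows "(LINT x|lborel. partial i f x) = 0"
proof -
  obtain B where B: "\<And>x. x \<in> K \<Longrightarrow> norm x \<le> B"
    using compact_imp_bounded[OF K(1)] unfolding bounded_iff by blast
  define b where "b = \<bar>B\<bar> + 1"
  have b: "b > 0" by (simp add: b_def)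
  have out: "slot i t y \<notin> K" if "b \<le> \<bar>t\<bar>" for t y
  proof
    assume "slot i t y \<in> K"
    then have "\<bar>slot i t y $ i\<bar> \<le> B" using B component_le_norm_cart[of "slot i t y" i] by (meson order_trans)
    then show False using that by (simp add: slot_nth b_def)
  qed
  have z: "(LINT t|lborel. partial i f (slot i t y)) = 0" for y
  proof -
    have "integrable lborel (\<lambda>t. partial i f (slot i t y))"
    proof (rule integrable_compact_support[of _ "{-b..b}"])
      show "continuous_on UNIV (\<lambda>t. partial i f (slot i t y))"
        by (rule continuous_on_compose2[OF c continuous_slot_line]) simp
      show "partial i f (slot i t y) = 0" if "t \<notin> {- b..b}" for t
        using K(3)[OF out[of t y]] that by auto
    qed simp
    from integrable_translate(2)[OF this, of "-b"]
    have "(LINT t|lborel. partial i f (slot i t y)) = (LINT t|lborel. partial i f (slot i (t + - b) y))" by simp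
    also have "\<dots> = (LINT t|lborel. partial i f (slot i (- b) y + t *\<^sub>R axis i 1) * indicator {0..2 * b} t)"
    proof (rule Bochner_Integration.integral_cong[OF refl])
      fix t
      have "b \<le> \<bar>t - b\<bar>" if "t \<notin> {0..2 * b}" using that b by auto
      then show "partial i f (slot i (t + - b) y) = partial i f (slot i (- b) y + t *\<^sub>R axis i 1) * indicator {0..2 * b} t"
        using K(3)[OF out[of "t - b" y]] by (cases "t \<in> {0..2 * b}") (auto simp: slot_add_axis)
    qed
    also have "\<dots> = f (slot i (- b) y + (2 * b) *\<^sub>R axis i 1) - f (slot i (- b) y)"
      using b by (intro partial_FTC d c) simp
    also have "\<dots> = 0" using K(2)[OF out[of b y]] K(2)[OF out[of "-b" y]] b by (simp add: slot_add_axis)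
    finally show ?thesis .
  qed
  have "integrable lborel (partial i f)" by (rule integrable_compact_support[OF c K(1,3)])
  from integral_slot(3)[OF this, of i] show ?thesis by (simp add: z)
qed

text \<open>\<psi> need not vanish near the frontier of \<Omega>, but its product with a test
  function of \<Omega> does. The integral of the derivative of the product is therefore zero, and
  the product rule identifies the weak derivative.\<close>

lemma test_fun_restrict_H1:
  assumes \<psi>: "\<psi> \<in> test_fun UNIV" and "open \<Omega>"
  shows "\<psi> \<in> H1 \<Omega>" "AE x in lebesgue_on \<Omega>. wderiv \<Omega> i \<psi> x = partial i \<psi> x"
proof -
  have m: "\<Omega> \<in> sets lebesgue" using assms by auto
  have L: "\<psi> \<in> L2 \<Omega>" "partial i \<psi> \<in> L2 \<Omega>" for i
    using sqint_test_fun_on[OF \<psi> m] by (auto simp: L2_iff_sqint)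
  have w: "is_weak_deriv \<Omega> i \<psi> (partial i \<psi>)" for i
    unfolding is_weak_deriv_def
  proof
    fix \<phi> assume \<phi>: "\<phi> \<in> test_fun \<Omega>"
    let ?f = "\<lambda>x. \<psi> x * \<phi> x"
    note D\<psi> = test_funD[OF \<psi>] and D\<phi> = test_funD[OF \<phi>]
    have p: "partial i ?f x = \<psi> x * partial i \<phi> x + partial i \<psi> x * \<phi> x" for x
    proof -
      have "(?f has_derivative (\<lambda>h. \<psi> x * frechet_derivative \<phi> (at x) h + frechet_derivative \<psi> (at x) h * \<phi> x)) (at x)"
        using D\<psi>(1) D\<phi>(1) by (intro has_derivative_mult) (simp_all add: frechet_derivative_works[symmetric])
      from fun_cong[OF frechet_derivative_at[OF this], of "axis i 1"] show ?thesis by (simp add: partial_def)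
    qed
    let ?K = "closure {x. \<phi> x \<noteq> 0}"
    have f0: "\<phi> x = 0" "partial i \<phi> x = 0" if "x \<notin> ?K" for x
      using that fun_eq_0_outside_support[of x \<phi>] partial_eq_0_outside_support[of x \<phi>] by auto
    have I: "integrable (lebesgue_on \<Omega>) (\<lambda>x. \<psi> x * partial i \<phi> x)" "integrable (lebesgue_on \<Omega>) (\<lambda>x. partial i \<psi> x * \<phi> x)"
      by (intro sqint_mult sqint_test_fun_on[OF \<psi> m] sqint_test_fun_on[OF \<phi> m])+
    have "(LINT x|lebesgue_on \<Omega>. \<psi> x * partial i \<phi> x) + (LINT x|lebesgue_on \<Omega>. partial i \<psi> x * \<phi> x) = (LINT x|lebesgue_on \<Omega>. partial i ?f x)"
      using I by (simp add: p)
    also have "\<dots> = (LINT x|lebesgue. partial i ?f x)"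
      unfolding integral_lebesgue_on_eq[OF m] set_lebesgue_integral_def
    proof (rule Bochner_Integration.integral_cong[OF refl])
      fix x
      show "indicator \<Omega> x *\<^sub>R partial i ?f x = partial i ?f x"
      proof (cases "x \<in> \<Omega>")
        case False
        then have "x \<notin> ?K" using D\<phi>(5) by blast
        from f0[OF this] show ?thesis by (simp only: p mult_zero_right add_0_right scaleR_zero_right)
      next
        case True
        then show ?thesis by (simp only: indicator_simps scaleR_one)
      qed
    qed
    also have "\<dots> = (LINT x|lborel. partial i ?f x)"
      unfolding p using sqint_test_fun[OF \<psi>, THEN sqint_measurable] sqint_test_fun[OF \<phi>, THEN sqint_measurable]
      by (intro integral_completion borel_measurable_add borel_measurable_times)
    also have "\<dots> = 0"
    proof (rule integral_partial_eq_0)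
      show "?f differentiable at x" for x using D\<psi>(1) D\<phi>(1) by simp
      show "continuous_on UNIV (partial i ?f)" unfolding p[abs_def]
        by (intro continuous_intros D\<psi> D\<phi>)
      show "compact ?K" by (rule D\<phi>(4))
      show "?f x = 0" "partial i ?f x = 0" if "x \<notin> ?K" for x using f0[OF that] by (simp_all add: p)
    qed
    finally show "(LINT x|lebesgue_on \<Omega>. \<psi> x * partial i \<phi> x) = - (LINT x|lebesgue_on \<Omega>. partial i \<psi> x * \<phi> x)" by simp
  qed
  show H: "\<psi> \<in> H1 \<Omega>" using L w by (auto simp: H1_def)
  show "AE x in lebesgue_on \<Omega>. wderiv \<Omega> i \<psi> x = partial i \<psi> x"
    by (rule wderiv_unique[OF assms(2) H L(2) w])
qed

lemma partial_affine:
  assumes "\<And>x. \<phi> differentiable (at x)"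
  shows "partial i (\<lambda>x. k * \<phi> (s *\<^sub>R (x - c))) x = k * (s * partial i \<phi> (s *\<^sub>R (x - c)))"
proof -
  have 1: "(\<phi> has_derivative frechet_derivative \<phi> (at y)) (at y)" for y
    using assms frechet_derivative_works by blast
  have "((\<lambda>x. \<phi> (s *\<^sub>R (x - c))) has_derivative (\<lambda>h. frechet_derivative \<phi> (at (s *\<^sub>R (x - c))) (s *\<^sub>R h))) (at x)"
    by (rule has_derivative_compose[OF _ 1]) (auto intro!: derivative_eq_intros)
  then have "((\<lambda>x. k * \<phi> (s *\<^sub>R (x - c))) has_derivative (\<lambda>h. k * frechet_derivative \<phi> (at (s *\<^sub>R (x - c))) (s *\<^sub>R h))) (at x)"
    by (rule has_derivative_mult_right)
  from fun_cong[OF frechet_derivative_at[OF this], of "axis i 1"] show ?thesis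
    using linear_cmul[OF has_derivative_linear[OF 1[of "s *\<^sub>R (x - c)"]]] by (simp add: partial_def)
qed

text \<open>All cutoffs are scaled translates of a single bump, whence one constant for all centres
  and scales; the scaling costs 1/r in the derivatives. The inner cube has size r/16 to fit the
  ratio of consecutive scales in the density argument.\<close>

lemma cutoff_exists:
  obtains C where "C > 0"
    "\<forall>x0 r. 0 < r \<longrightarrow> (\<exists>\<psi>\<in>test_fun UNIV. (\<forall>x. \<bar>\<psi> x\<bar> \<le> C) \<and> (\<forall>x i. \<bar>partial i \<psi> x\<bar> \<le> C / r) \<and>
      (\<forall>x. x \<notin> cube x0 r \<longrightarrow> \<psi> x = 0 \<and> (\<forall>i. partial i \<psi> x = 0)) \<and> (\<forall>x\<in>cube x0 (r / 16). 1 \<le> \<psi> x))"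
proof -
  define a b :: R3 where "a = (\<chi> j. - 1)" and "b = (\<chi> j. 1)"
  define \<beta> where "\<beta> = bump 1 a b"
  have \<beta>: "\<beta> \<in> test_fun UNIV" unfolding \<beta>_def by (rule bump_test_fun) auto
  note D = test_funD[OF \<beta>]
  have "\<exists>B>0. \<forall>x. \<bar>partial i \<beta> x\<bar> \<le> B" for i
    by (rule bounded_compact_support[OF D(3) D(4) partial_eq_0_outside_support]) auto
  then obtain B where B: "\<And>i. B i > 0" "\<And>i x. \<bar>partial i \<beta> x\<bar> \<le> B i" by metis
  \<comment> \<open>On the cube of size 1/16 each of the six factors of \<beta> has argument at
    least 15/16, so \<open>c\<close> bounds \<beta> from below there.\<close>
  define c where "c = (hexp 1 (15 / 16)) ^ 6"
  have c: "c > 0" unfolding c_def using hexp_nonneg[of "15/16"] hexp_eq_0[of "15/16"] by (auto simp: less_le)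
  define C where "C = (1 + (\<Sum>i\<in>UNIV. B i)) / c"
  have Bs: "B i \<le> (\<Sum>i\<in>UNIV. B i)" for i by (rule member_le_sum) (use B(1) in \<open>auto intro: less_imp_le\<close>)
  have Bp: "0 \<le> (\<Sum>i\<in>UNIV. B i)" by (intro sum_nonneg) (use B(1) less_imp_le in blast)
  have "0 < 1 + (\<Sum>i\<in>UNIV. B i)" using Bp by linarith
  then have C: "C > 0" unfolding C_def using c by (rule divide_pos_pos)
  have C1: "1 / c \<le> C" and CB: "B i / c \<le> C" for i
  proof -
    show "1 / c \<le> C" unfolding C_def using c Bp by (intro divide_right_mono) linarith+
    show "B i / c \<le> C" unfolding C_def using c Bs[of i] by (intro divide_right_mono) linarith+
  qed
  show ?thesis
  proof (rule that[OF C], intro allI impI)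
    fix x0 and r :: real assume r: "0 < r"
    define \<psi> where "\<psi> x = (1 / c) * \<beta> ((1 / r) *\<^sub>R (x - x0))" for x
    have \<psi>b: "\<psi> = (\<lambda>x. (1 / c) * bump (1 / r) (x0 - (\<chi> j. r)) (x0 + (\<chi> j. r)) x)"
      using r by (auto simp: \<psi>_def \<beta>_def bump_def a_def b_def field_simps fun_eq_iff)
    have sub: "{x. \<psi> x \<noteq> 0} \<subseteq> cube x0 r"
      using bump_nz[of "1 / r" "x0 - (\<chi> j. r)" "x0 + (\<chi> j. r)"] box_subset_cbox r
      by (auto simp: \<psi>b cube_cbox)
    have cl: "closure {x. \<psi> x \<noteq> 0} \<subseteq> cube x0 r" by (rule closure_minimal[OF sub]) (simp add: cube_cbox closed_cbox)
    have alg: "\<psi> \<in> bump_alg" unfolding \<psi>b by (intro bump_alg.mult bump_alg.const bump_in_alg)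
    have "compact (closure {x. \<psi> x \<noteq> 0})"
      using bounded_subset[OF bounded_cbox cl[unfolded cube_cbox]] by (simp add: compact_eq_bounded_closed)
    then have t: "\<psi> \<in> test_fun UNIV" using bump_alg_C_k[OF alg] by (auto simp: test_fun_def)
    have p: "partial i \<psi> x = (1 / c) * ((1 / r) * partial i \<beta> ((1 / r) *\<^sub>R (x - x0)))" for i x
      unfolding \<psi>_def[abs_def] by (rule partial_affine[OF D(1)])
    show "\<exists>\<psi>\<in>test_fun UNIV. (\<forall>x. \<bar>\<psi> x\<bar> \<le> C) \<and> (\<forall>x i. \<bar>partial i \<psi> x\<bar> \<le> C / r) \<and>
      (\<forall>x. x \<notin> cube x0 r \<longrightarrow> \<psi> x = 0 \<and> (\<forall>i. partial i \<psi> x = 0)) \<and> (\<forall>x\<in>cube x0 (r / 16). 1 \<le> \<psi> x)"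
    proof (intro bexI[OF _ t] conjI allI ballI impI)
      fix x i
      have "\<bar>\<psi> x\<bar> = (1 / c) * \<bar>\<beta> ((1 / r) *\<^sub>R (x - x0))\<bar>" using c by (simp add: \<psi>_def abs_mult)
      also have "\<dots> \<le> (1 / c) * 1" using c bump_nonneg bump_le_1 by (intro mult_left_mono) (auto simp: \<beta>_def)
      finally show "\<bar>\<psi> x\<bar> \<le> C" using C1 by simp
      have "\<bar>partial i \<psi> x\<bar> = (\<bar>partial i \<beta> ((1 / r) *\<^sub>R (x - x0))\<bar> / c) / r" using c r by (simp add: p abs_mult)
      also have "\<dots> \<le> (B i / c) / r" using c r B(2) by (intro divide_right_mono) auto
      also have "\<dots> \<le> C / r" using CB r by (intro divide_right_mono) auto
      finally show "\<bar>partial i \<psi> x\<bar> \<le> C / r" .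
    next
      fix x assume "x \<notin> cube x0 r"
      then have "x \<notin> closure {x. \<psi> x \<noteq> 0}" using cl by auto
      then show "\<psi> x = 0" "partial i \<psi> x = 0" for i
        using fun_eq_0_outside_support partial_eq_0_outside_support by auto
    next
      fix x assume x: "x \<in> cube x0 (r / 16)"
      have "hexp 1 (15 / 16) * hexp 1 (15 / 16) \<le>
        hexp 1 (1 * (((1 / r) *\<^sub>R (x - x0)) $ j - a $ j)) * hexp 1 (1 * (b $ j - ((1 / r) *\<^sub>R (x - x0)) $ j))" for j
      proof -
        have "\<bar>x $ j - x0 $ j\<bar> \<le> r / 16" using x by (simp add: cube_def)
        then have q: "\<bar>(x $ j - x0 $ j) / r\<bar> \<le> 1 / 16" using r by (simp add: abs_divide divide_le_eq)
        have e: "((1 / r) *\<^sub>R (x - x0)) $ j = (x $ j - x0 $ j) / r" by simp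
        define q' where "q' = (x $ j - x0 $ j) / r"
        have "\<bar>q'\<bar> \<le> 1 / 16" using q by (simp add: q'_def)
        then have 1: "15 / 16 \<le> 1 * (q' - - 1)" "15 / 16 \<le> 1 * (1 - q')"
          by (simp_all add: abs_le_iff)
        show ?thesis unfolding e a_def b_def vec_lambda_beta q'_def[symmetric]
          by (intro mult_mono hexp_mono hexp_nonneg 1)
      qed
      then have "(\<Prod>j\<in>(UNIV::3 set). hexp 1 (15 / 16) * hexp 1 (15 / 16)) \<le> \<beta> ((1 / r) *\<^sub>R (x - x0))"
        unfolding \<beta>_def bump_def by (intro prod_mono) (auto simp: hexp_nonneg)
      moreover have "(\<Prod>j\<in>(UNIV::3 set). hexp 1 (15 / 16) * hexp 1 (15 / 16)) = c"
        by (simp add: c_def eval_nat_numeral)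
      ultimately show "1 \<le> \<psi> x" using c by (simp add: \<psi>_def field_simps)
    qed
  qed
qed

section \<open>Decay of the L2 norm on small cubes\<close>

definition brick :: "R3 \<Rightarrow> (3 \<Rightarrow> real) \<Rightarrow> R3 set"
  where "brick x \<rho> = {z. \<forall>j. \<bar>z $ j - x $ j\<bar> \<le> \<rho> j}"

lemma brick_cbox: "brick x \<rho> = cbox (x - (\<chi> j. \<rho> j)) (x + (\<chi> j. \<rho> j))"
  by (auto simp: brick_def mem_box_cart abs_le_iff algebra_simps)

lemma cube_brick: "cube x r = brick x (\<lambda>j. r)"
  by (simp add: cube_def brick_def)

lemma slot_mem_brick: "slot i t y \<in> brick x \<rho> \<longleftrightarrow> t \<in> {x $ i - \<rho> i .. x $ i + \<rho> i} \<and>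
    \<bar>fst y - x $ (i + 1)\<bar> \<le> \<rho> (i + 1) \<and> \<bar>snd y - x $ (i + 2)\<bar> \<le> \<rho> (i + 2)"
  unfolding brick_def mem_Collect_eq three_all[of _ i] by (auto simp: slot_nth abs_le_iff)

lemma sqint_indicator_sq:
  assumes "sqint M f" "A \<in> sets M"
  shows "integrable M (\<lambda>x. indicator A x * (f x)\<^sup>2)"
  using integrable_mult_indicator[OF assms(2) sqint_integrable[OF assms(1)]] by simp

text \<open>Iterated over the three coordinates, the factor \<open>1/8\<close> becomes \<open>1/512\<close>, which still beats the
  factor \<open>256\<close> lost by passing from the scale \<open>R\<^sup>2\<close> to \<open>(16 R)\<^sup>2\<close>; hence \<open>\<integral>u\<^sup>2\<close> over a cube of size \<open>R\<close>
  is of order \<open>R\<^sup>2 Q\<close>.\<close>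

lemma brick_contraction:
  assumes wp: "weak_partial i u g" and R: "R > 0" "\<rho> i = R"
  shows "(LINT x|lborel. indicator (brick x0 \<rho>) x * (u x)\<^sup>2) \<le>
    (1 / 8) * (LINT x|lborel. indicator (brick x0 (\<rho>(i := 16 * R))) x * (u x)\<^sup>2) + 128 * R\<^sup>2 * (LINT x|lborel. (g x)\<^sup>2)"
proof -
  have s: "sqint lborel u" "sqint lborel g" using wp by (auto simp: weak_partial_def)
  define Y where "Y = {y. \<bar>fst y - x0 $ (i + 1)\<bar> \<le> \<rho> (i + 1) \<and> \<bar>snd y - x0 $ (i + 2)\<bar> \<le> \<rho> (i + 2)}"
  define J where "J r = {x0 $ i - r .. x0 $ i + r}" for r
  have i1: "indicator (brick x0 \<rho>) (slot i t y) = (indicator Y y * indicator (J R) t :: real)" for t y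
    using R(2) by (auto simp: indicator_def slot_mem_brick Y_def J_def)
  have i2: "indicator (brick x0 (\<rho>(i := 16 * R))) (slot i t y) = (indicator Y y * indicator (J (16 * R)) t :: real)" for t y
    using three_neq[of i] by (auto simp: indicator_def slot_mem_brick Y_def J_def)
  have int: "integrable lborel (\<lambda>x. indicator (brick x0 \<rho>) x * (u x)\<^sup>2)" for \<rho>
    by (rule sqint_indicator_sq[OF s(1)]) (simp add: brick_cbox)
  define P where "P y = (LINT t|lborel. indicator (brick x0 (\<rho>(i := 16 * R))) (slot i t y) * (u (slot i t y))\<^sup>2)" for y
  define G where "G y = (LINT t|lborel. (g (slot i t y))\<^sup>2)" for y
  have iP: "integrable lborel P" unfolding P_def by (rule integral_slot(2)[OF int])
  have iG: "integrable lborel G" unfolding G_def by (rule sqint_slot(2)[OF s(2)])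
  have "(LINT x|lborel. indicator (brick x0 \<rho>) x * (u x)\<^sup>2) = (LINT y|lborel. LINT t|lborel. indicator (brick x0 \<rho>) (slot i t y) * (u (slot i t y))\<^sup>2)"
    by (rule integral_slot(3)[OF int])
  also have "\<dots> \<le> (LINT y|lborel. (1 / 8) * P y + 128 * R\<^sup>2 * G y)"
  proof (rule integral_mono_AE)
    show "AE y in lborel. (LINT t|lborel. indicator (brick x0 \<rho>) (slot i t y) * (u (slot i t y))\<^sup>2) \<le> (1 / 8) * P y + 128 * R\<^sup>2 * G y"
      using line_rep[OF wp]
    proof eventually_elim
      case (elim y)
      define U where "U t = u (slot i t y)" for t
      have U: "sqint lborel U" and g': "sqint lborel (\<lambda>t. g (slot i t y))"
        using elim by (auto simp: U_def[abs_def] ac_line_def)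
      have G0: "0 \<le> G y" by (simp add: G_def)
      define p where "p = (LINT t|lborel. indicator (J (16 * R)) t * (U t)\<^sup>2)"
      show ?case
      proof (cases "y \<in> Y")
        case False
        then have "(LINT t|lborel. indicator (brick x0 \<rho>) (slot i t y) * (u (slot i t y))\<^sup>2) = 0" "P y = 0"
          by (simp_all add: P_def i1 i2)
        then show ?thesis using G0 by simp
      next
        case True
        then have Py: "P y = p" by (simp add: P_def p_def i2 U_def)
        \<comment> \<open>The large interval has length 32 R, which gives the weights 1/(16 R) and
          64 R. Integrating afterwards over the small interval, of length 2 R, produces the factors
          1/8 and 128 R^2.\<close>
        have sup: "(line_rep i u g t y)\<^sup>2 \<le> p / (16 * R) + 64 * R * G y" if "t \<in> J (16 * R)" for t
        proof -
          have "(line_rep i u g t y)\<^sup>2 \<le> 2 / ((x0 $ i + 16 * R) - (x0 $ i - 16 * R)) * (LINT s|lborel. indicator {x0 $ i - 16 * R..x0 $ i + 16 * R} s * (U s)\<^sup>2) +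
            2 * ((x0 $ i + 16 * R) - (x0 $ i - 16 * R)) * (LINT s|lborel. indicator {x0 $ i - 16 * R..x0 $ i + 16 * R} s * (g (slot i s y))\<^sup>2)"
            by (rule ac_line_sup_sq) (use elim U R that in \<open>auto simp: U_def J_def\<close>)
          also have "\<dots> \<le> p / (16 * R) + 64 * R * G y"
          proof -
            have "64 * R * (LINT s|lborel. indicator {x0 $ i - 16 * R..x0 $ i + 16 * R} s * (g (slot i s y))\<^sup>2) \<le> 64 * R * G y"
              unfolding G_def using R by (intro mult_left_mono integral_Icc_sq_le g') auto
            then show ?thesis using R by (simp add: p_def J_def field_simps)
          qed
          finally show ?thesis .
        qed
        have ii: "integrable lborel (indicator (J R) :: real \<Rightarrow> real)"
          unfolding J_def by (intro integrable_real_indicator) (auto simp: emeasure_lborel_Icc_eq)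
        have "(LINT t|lborel. indicator (brick x0 \<rho>) (slot i t y) * (u (slot i t y))\<^sup>2) = (LINT t|lborel. indicator (J R) t * (U t)\<^sup>2)"
          using True by (simp add: i1 U_def)
        also have "\<dots> \<le> (LINT t|lborel. indicator (J R) t * (p / (16 * R) + 64 * R * G y))"
        proof (rule integral_mono_AE)
          show "integrable lborel (\<lambda>t. indicator (J R) t * (U t)\<^sup>2)" unfolding J_def by (rule integrable_Icc_sq[OF U])
          show "integrable lborel (\<lambda>t. indicator (J R) t * (p / (16 * R) + 64 * R * G y))" by (intro integrable_mult_left ii)
          show "AE t in lborel. indicator (J R) t * (U t)\<^sup>2 \<le> indicator (J R) t * (p / (16 * R) + 64 * R * G y)"
            using elim[THEN conjunct2, THEN conjunct2]
          proof eventually_elim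
            case (elim t)
            have "J R \<subseteq> J (16 * R)" using R by (auto simp: J_def)
            then show ?case using sup[of t] by (cases "t \<in> J R") (auto simp: elim U_def)
          qed
        qed
        also have "\<dots> = (2 * R) * (p / (16 * R) + 64 * R * G y)" using R by (simp add: J_def)
        also have "\<dots> = (1 / 8) * P y + 128 * R\<^sup>2 * G y" using R by (simp add: Py field_simps power2_eq_square)
        finally show ?thesis .
      qed
    qed
  qed (intro Bochner_Integration.integrable_add integrable_mult_right iP iG integral_slot(2)[OF int])+
  also have "\<dots> = (1 / 8) * (LINT y|lborel. P y) + 128 * R\<^sup>2 * (LINT y|lborel. G y)" using iP iG by simp
  also have "(LINT y|lborel. P y) = (LINT x|lborel. indicator (brick x0 (\<rho>(i := 16 * R))) x * (u x)\<^sup>2)"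
    unfolding P_def by (rule integral_slot(3)[OF int, symmetric])
  also have "(LINT y|lborel. G y) = (LINT x|lborel. (g x)\<^sup>2)"
    unfolding G_def by (rule sqint_slot(3)[OF s(2), symmetric])
  finally show ?thesis .
qed

lemma cube_contraction:
  assumes wp: "\<And>i. weak_partial i u (g i)" and Q: "\<And>i. (LINT x|lborel. (g i x)\<^sup>2) \<le> Q" and R: "R > 0"
  shows "(LINT x|lborel. indicator (cube x0 R) x * (u x)\<^sup>2) \<le>
    (1 / 512) * (LINT x|lborel. indicator (cube x0 (16 * R)) x * (u x)\<^sup>2) + 147 * R\<^sup>2 * Q"
proof -
  define I where "I \<rho> = (LINT x|lborel. indicator (brick x0 \<rho>) x * (u x)\<^sup>2)" for \<rho>
  have step: "I \<rho> \<le> (1 / 8) * I (\<rho>(i := 16 * R)) + 128 * R\<^sup>2 * Q" if "\<rho> i = R" for \<rho> i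
  proof -
    have "I \<rho> \<le> (1 / 8) * I (\<rho>(i := 16 * R)) + 128 * R\<^sup>2 * (LINT x|lborel. (g i x)\<^sup>2)"
      unfolding I_def by (rule brick_contraction[where i = i and \<rho> = \<rho>, OF wp R that])
    also have "\<dots> \<le> (1 / 8) * I (\<rho>(i := 16 * R)) + 128 * R\<^sup>2 * Q"
      using Q[of i] by (intro add_left_mono mult_left_mono) auto
    finally show ?thesis .
  qed
  define \<rho>0 :: "3 \<Rightarrow> real" where "\<rho>0 = (\<lambda>j. R)"
  have 1: "I \<rho>0 \<le> (1 / 8) * I (\<rho>0(1 := 16 * R)) + 128 * R\<^sup>2 * Q" by (rule step) (simp add: \<rho>0_def)
  have 2: "I (\<rho>0(1 := 16 * R)) \<le> (1 / 8) * I (\<rho>0(1 := 16 * R, 2 := 16 * R)) + 128 * R\<^sup>2 * Q" by (rule step) (simp add: \<rho>0_def)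
  have 3: "I (\<rho>0(1 := 16 * R, 2 := 16 * R)) \<le> (1 / 8) * I (\<rho>0(1 := 16 * R, 2 := 16 * R, 3 := 16 * R)) + 128 * R\<^sup>2 * Q"
    by (rule step) (simp add: \<rho>0_def)
  have 4: "\<rho>0(1 := 16 * R, 2 := 16 * R, 3 := 16 * R) = (\<lambda>j. 16 * R)"
    using exhaust_3 by (auto simp: fun_eq_iff)
  have "0 \<le> Q" using Q[of 1] by (rule order_trans[rotated]) simp
  then have "0 \<le> R\<^sup>2 * Q" by simp
  \<comment> \<open>The three error terms add up to 128 (1 + 1/8 + 1/64) = 146.\<close>
  then have "I \<rho>0 \<le> (1 / 512) * I (\<lambda>j. 16 * R) + 147 * (R\<^sup>2 * Q)" using 1 2 3 unfolding 4 by simp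
  then show ?thesis by (simp add: I_def \<rho>0_def cube_brick)
qed

text \<open>This is the decay that an embedding of H1 into L6 would give, obtained from the scaling
  alone. The induction closes because 300 * 256 / 512 + 147 = 297 is below 300, and it starts from
  the norm over the whole space.\<close>

lemma cube_integral_bound:
  assumes wp: "\<And>i. weak_partial i u (g i)" and Q: "\<And>i. (LINT x|lborel. (g i x)\<^sup>2) \<le> Q" "(LINT x|lborel. (u x)\<^sup>2) \<le> Q"
  shows "(LINT x|lborel. indicator (cube x0 (1 / 16 ^ k)) x * (u x)\<^sup>2) \<le> 300 * (1 / 16 ^ k)\<^sup>2 * Q"
proof (induction k)
  case 0
  have s: "sqint lborel u" using wp by (auto simp: weak_partial_def)
  have "0 \<le> Q" using Q(1)[of 1] by (rule order_trans[rotated]) simp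
  moreover have "(LINT x|lborel. indicator (cube x0 1) x * (u x)\<^sup>2) \<le> (LINT x|lborel. (u x)\<^sup>2)"
    by (intro integral_mono sqint_indicator_sq[OF s] sqint_integrable[OF s]) (auto simp: indicator_def)
  ultimately show ?case using Q(2) by simp
next
  case (Suc k)
  define R :: real where "R = 1 / 16 ^ Suc k"
  have R: "R > 0" "16 * R = 1 / 16 ^ k" by (auto simp: R_def)
  have "0 \<le> Q" using Q(1)[of 1] by (rule order_trans[rotated]) simp
  then have RQ: "0 \<le> R\<^sup>2 * Q" by simp
  have "(LINT x|lborel. indicator (cube x0 R) x * (u x)\<^sup>2) \<le>
    (1 / 512) * (LINT x|lborel. indicator (cube x0 (16 * R)) x * (u x)\<^sup>2) + 147 * R\<^sup>2 * Q"
    by (rule cube_contraction[OF wp Q(1) R(1)])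
  also have "\<dots> \<le> (1 / 512) * (300 * (16 * R)\<^sup>2 * Q) + 147 * R\<^sup>2 * Q"
    using Suc.IH unfolding R(2) by (simp add: mult_ac)
  also have "\<dots> \<le> 300 * R\<^sup>2 * Q" using RQ by (simp add: power_mult_distrib mult.commute[of Q])
  finally show ?case by (simp add: R_def)
qed

section \<open>A weak Sobolev inequality\<close>

lemma AE_slot_converse:
  assumes m: "{x. P x} \<in> sets borel" and ae: "AE y in lborel. AE t in lborel. P (slot i t y)"
  shows "AE x in lborel. P x"
proof -
  have N: "- {x. P x} \<in> sets borel" using m by (rule borel_comp)
  have "(\<integral>\<^sup>+x. indicator (- {x. P x}) x \<partial>lborel) = (\<integral>\<^sup>+y. \<integral>\<^sup>+t. indicator (- {x. P x}) (slot i t y) \<partial>lborel \<partial>lborel)"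
    by (rule nn_integral_slot) (use N in simp)
  also have "\<dots> = (\<integral>\<^sup>+(y :: real \<times> real). 0 \<partial>lborel)"
  proof (rule nn_integral_cong_AE)
    show "AE y in lborel. (\<integral>\<^sup>+t. indicator (- {x. P x}) (slot i t y) \<partial>lborel) = 0"
      using ae
    proof eventually_elim
      case (elim y)
      have "(\<integral>\<^sup>+t. indicator (- {x. P x}) (slot i t y) \<partial>lborel) = (\<integral>\<^sup>+(t::real). 0 \<partial>lborel)"
        by (rule nn_integral_cong_AE) (use elim in \<open>eventually_elim, simp\<close>)
      then show ?case by simp
    qed
  qed
  finally have "emeasure lborel (- {x. P x}) = 0" using N by simp
  then have "- {x. P x} \<in> null_sets lborel" using N by (auto simp: null_sets_def)
  then show ?thesis by (rule AE_I') auto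
qed

text \<open>Each factor misses one coordinate. Cauchy-Schwarz in the first coordinate separates
  \<open>F 2\<close> from \<open>F 3\<close> and leaves a function of the third coordinate times a
  function of the second; Cauchy-Schwarz in these two then separates \<open>F 1\<close>, and the
  remaining integral factorises.\<close>

lemma Loomis_Whitney:
  fixes F :: "3 \<Rightarrow> real \<times> real \<Rightarrow> ennreal"
  assumes [measurable]: "\<And>i. F i \<in> borel_measurable borel"
  shows "(\<integral>\<^sup>+(z::R3). F 1 (z $ 2, z $ 3) * F 2 (z $ 3, z $ 1) * F 3 (z $ 1, z $ 2) \<partial>lborel)\<^sup>2 \<le>
    (\<integral>\<^sup>+y. (F 1 y)\<^sup>2 \<partial>lborel) * (\<integral>\<^sup>+y. (F 2 y)\<^sup>2 \<partial>lborel) * (\<integral>\<^sup>+y. (F 3 y)\<^sup>2 \<partial>lborel)"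
proof -
  have sl: "slot 1 t y $ 1 = t" "slot 1 t y $ 2 = fst y" "slot 1 t y $ 3 = snd y" for t y
    using slot_nth[of 1 t y] by simp_all
  have mm [measurable]: "fst \<in> borel_measurable (borel :: (real \<times> real) measure)" "snd \<in> borel_measurable (borel :: (real \<times> real) measure)"
    by (intro borel_measurable_continuous_onI continuous_intros)+
  have [measurable]: "(\<lambda>x. (f x, g x)) \<in> borel_measurable M" if "f \<in> borel_measurable M" "g \<in> borel_measurable M"
    for f g :: "_ \<Rightarrow> real" and M :: "'z measure" using that by (rule borel_measurable_Pair)
  have nth: "(\<lambda>z::R3. z $ j) \<in> borel_measurable borel" for j
    by (intro borel_measurable_continuous_onI continuous_intros)
  have m0: "(\<lambda>z::R3. F i (z $ j, z $ k)) \<in> borel_measurable borel" for i j k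
    by (rule measurable_compose[OF borel_measurable_Pair[OF nth nth]]) simp
  define A2 where "A2 q = (\<integral>\<^sup>+t. (F 2 (q, t))\<^sup>2 \<partial>lborel)" for q
  define A3 where "A3 p = (\<integral>\<^sup>+t. (F 3 (t, p))\<^sup>2 \<partial>lborel)" for p
  define S where "S y = (\<integral>\<^sup>+t. F 2 (snd y, t) * F 3 (t, fst y) \<partial>lborel)" for y
  have c: "(\<lambda>t. F i (q, t)) \<in> borel_measurable lborel" "(\<lambda>t. F i (t, q)) \<in> borel_measurable lborel" for i q
    using measurable_compose[OF borel_measurable_Pair[OF borel_measurable_const measurable_ident] \<open>F i \<in> borel_measurable borel\<close>]
      measurable_compose[OF borel_measurable_Pair[OF measurable_ident borel_measurable_const] \<open>F i \<in> borel_measurable borel\<close>]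
    by (simp_all add: id_def)
  have S2: "(S y)\<^sup>2 \<le> A2 (snd y) * A3 (fst y)" for y
    unfolding S_def A2_def A3_def by (rule Cauchy_Schwarz_nn_integral[OF c])
  have pm: "F i \<in> borel_measurable (lborel \<Otimes>\<^sub>M lborel)" for i by (simp add: lborel_prod)
  have pm2: "(\<lambda>p. (F i p)\<^sup>2) \<in> borel_measurable (lborel \<Otimes>\<^sub>M lborel)" for i using pm[of i] by measurable
  have m2: "A2 \<in> borel_measurable lborel"
    unfolding A2_def by (rule lborel.borel_measurable_nn_integral) (use pm2[of 2] in \<open>simp add: split_beta'\<close>)
  have m3: "A3 \<in> borel_measurable lborel"
    unfolding A3_def
    using lborel.borel_measurable_nn_integral[of "\<lambda>p t. (F 3 (t, p))\<^sup>2" lborel] measurable_pair_swap[OF pm2[of 3]]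
    by (simp add: split_beta')
  have mS: "S \<in> borel_measurable lborel"
  proof -
    let ?M = "borel :: ((real \<times> real) \<times> real) measure"
    have m: "(\<lambda>q. snd q) \<in> borel_measurable ?M" "(\<lambda>q. snd (fst q)) \<in> borel_measurable ?M" "(\<lambda>q. fst (fst q)) \<in> borel_measurable ?M"
      by (intro borel_measurable_continuous_onI continuous_intros)+
    have "(\<lambda>q. F 2 (snd (fst q), snd q) * F 3 (snd q, fst (fst q))) \<in> borel_measurable ?M"
      by (intro borel_measurable_times_ennreal measurable_compose[OF borel_measurable_Pair[OF m(2,1)]] measurable_compose[OF borel_measurable_Pair[OF m(1,3)]]) auto
    then have "(\<lambda>(y, t). F 2 (snd y, t) * F 3 (t, fst y)) \<in> borel_measurable ((lborel :: (real \<times> real) measure) \<Otimes>\<^sub>M lborel)"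
      by (simp add: lborel_prod split_beta')
    then show ?thesis unfolding S_def by (rule lborel.borel_measurable_nn_integral)
  qed
  have "(\<integral>\<^sup>+(z::R3). F 1 (z $ 2, z $ 3) * F 2 (z $ 3, z $ 1) * F 3 (z $ 1, z $ 2) \<partial>lborel) =
    (\<integral>\<^sup>+y. \<integral>\<^sup>+t. F 1 y * (F 2 (snd y, t) * F 3 (t, fst y)) \<partial>lborel \<partial>lborel)"
    by (subst nn_integral_slot[of _ 1]) (use m0 in \<open>auto simp: sl mult.assoc intro!: borel_measurable_times_ennreal\<close>)
  also have "\<dots> = (\<integral>\<^sup>+y. F 1 y * S y \<partial>lborel)"
    unfolding S_def by (intro nn_integral_cong nn_integral_cmult borel_measurable_times_ennreal c)
  finally have "(\<integral>\<^sup>+(z::R3). F 1 (z $ 2, z $ 3) * F 2 (z $ 3, z $ 1) * F 3 (z $ 1, z $ 2) \<partial>lborel)\<^sup>2 = (\<integral>\<^sup>+y. F 1 y * S y \<partial>lborel)\<^sup>2" by simp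
  also have "\<dots> \<le> (\<integral>\<^sup>+y. (F 1 y)\<^sup>2 \<partial>lborel) * (\<integral>\<^sup>+y. (S y)\<^sup>2 \<partial>lborel)"
    by (rule Cauchy_Schwarz_nn_integral) (use mS in auto)
  also have "(\<integral>\<^sup>+y. (S y)\<^sup>2 \<partial>lborel) \<le> (\<integral>\<^sup>+y. A2 (snd y) * A3 (fst y) \<partial>lborel)"
    by (intro nn_integral_mono S2)
  also have "\<dots> = (\<integral>\<^sup>+p. \<integral>\<^sup>+q. A2 q * A3 p \<partial>lborel \<partial>lborel)"
    unfolding lborel_prod[symmetric]
    by (subst lborel.nn_integral_fst[symmetric]) (use m2 m3 in auto)
  also have "\<dots> = (\<integral>\<^sup>+q. A2 q \<partial>lborel) * (\<integral>\<^sup>+p. A3 p \<partial>lborel)"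
    using m2 m3 by (simp add: nn_integral_multc nn_integral_cmult)
  also have "(\<integral>\<^sup>+q. A2 q \<partial>lborel) = (\<integral>\<^sup>+y. (F 2 y)\<^sup>2 \<partial>lborel)"
    unfolding A2_def using lborel.nn_integral_fst[OF pm2[of 2]] by (simp add: lborel_prod)
  also have "(\<integral>\<^sup>+p. A3 p \<partial>lborel) = (\<integral>\<^sup>+y. (F 3 y)\<^sup>2 \<partial>lborel)"
    unfolding A3_def using lborel_pair.nn_integral_snd[OF pm2[of 3]] by (simp add: lborel_prod)
  finally show ?thesis by (simp add: mult.assoc mult_left_mono)
qed

text \<open>At almost every point of A the square of u is at least 1 and is bounded, for each
  direction, by a quantity \<open>H i\<close> that depends only on the line through the point. The
  three square roots of the \<open>H i\<close> are hence admissible factors for Loomis-Whitney, and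
  their product dominates the indicator of A.\<close>

lemma cube_measure_bound:
  assumes wp: "\<And>i. weak_partial i u (g i)" and Q: "\<And>i. (LINT x|lborel. (g i x)\<^sup>2) \<le> Q" "(LINT x|lborel. (u x)\<^sup>2) \<le> Q"
    and R: "R = 1 / 16 ^ k" and A: "A \<in> sets borel" "A \<subseteq> cube x0 R" and ge: "AE x in lborel. x \<in> A \<longrightarrow> 1 \<le> u x"
  shows "(measure lborel A)\<^sup>2 \<le> (304 * R * Q) ^ 3"
proof -
  have s: "sqint lborel u" "sqint lborel (g i)" for i using wp by (auto simp: weak_partial_def)
  have um [measurable]: "u \<in> borel_measurable borel" using s(1) by (simp add: sqint_def)
  have R0: "R > 0" by (simp add: R)
  have Q0: "0 \<le> Q" using Q(2) by (rule order_trans[rotated]) simp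
  define P where "P i y = (LINT t|lborel. indicator (cube x0 R) (slot i t y) * (u (slot i t y))\<^sup>2)" for i y
  define G where "G i y = (LINT t|lborel. (g i (slot i t y))\<^sup>2)" for i y
  \<comment> \<open>The weights are those of \<open>ac_line_sup_sq\<close> on an interval of length
    2 R. Integrated over all lines, the first term gives at most 300 R Q by the decay on cubes and
    the second at most 4 R Q, whence 304.\<close>
  define H where "H i y = (1 / R) * P i y + 4 * R * G i y" for i y
  have int: "integrable lborel (\<lambda>x. indicator (cube x0 R) x * (u x)\<^sup>2)"
    by (rule sqint_indicator_sq[OF s(1)]) simp
  have iP: "integrable lborel (P i)" for i unfolding P_def by (rule integral_slot(2)[OF int])
  have iG: "integrable lborel (G i)" for i unfolding G_def by (rule sqint_slot(2)[OF s(2)])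
  have iH: "integrable lborel (H i)" for i unfolding H_def using iP iG by simp
  have Hm [measurable]: "H i \<in> borel_measurable borel" for i using iH[of i] by auto
  have H0: "0 \<le> H i y" for i y using R0 by (simp add: H_def P_def G_def)
  have IH: "(LINT y|lborel. H i y) \<le> 304 * R * Q" for i
  proof -
    have "(LINT y|lborel. H i y) = (1 / R) * (LINT y|lborel. P i y) + 4 * R * (LINT y|lborel. G i y)"
      unfolding H_def using iP iG by simp
    also have "(LINT y|lborel. P i y) = (LINT x|lborel. indicator (cube x0 R) x * (u x)\<^sup>2)"
      unfolding P_def by (rule integral_slot(3)[OF int, symmetric])
    also have "(LINT y|lborel. G i y) = (LINT x|lborel. (g i x)\<^sup>2)"
      unfolding G_def by (rule sqint_slot(3)[OF s(2), symmetric])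
    also have "(1 / R) * (LINT x|lborel. indicator (cube x0 R) x * (u x)\<^sup>2) + 4 * R * (LINT x|lborel. (g i x)\<^sup>2) \<le>
      (1 / R) * (300 * R\<^sup>2 * Q) + 4 * R * Q"
      using cube_integral_bound[OF wp Q, of x0 k] Q(1)[of i] R0 unfolding R[symmetric]
      by (intro add_mono mult_left_mono) auto
    also have "\<dots> = 304 * R * Q" using R0 by (simp add: power2_eq_square)
    finally show ?thesis .
  qed
  have pt: "AE x in lborel. x \<in> cube x0 R \<longrightarrow> (u x)\<^sup>2 \<le> H i (x $ (i + 1), x $ (i + 2))" for i
  proof (rule AE_slot_converse)
    have nth: "(\<lambda>z::R3. z $ j) \<in> borel_measurable borel" for j
      by (intro borel_measurable_continuous_onI continuous_intros)
    have [measurable]: "(\<lambda>x::R3. H i (x $ (i + 1), x $ (i + 2))) \<in> borel_measurable borel"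
      by (rule measurable_compose[OF borel_measurable_Pair[OF nth nth] Hm])
    show "{x. x \<in> cube x0 R \<longrightarrow> (u x)\<^sup>2 \<le> H i (x $ (i + 1), x $ (i + 2))} \<in> sets borel"
      by measurable
    show "AE y in lborel. AE t in lborel. slot i t y \<in> cube x0 R \<longrightarrow> (u (slot i t y))\<^sup>2 \<le> H i (slot i t y $ (i + 1), slot i t y $ (i + 2))"
      using line_rep[OF wp[of i]]
    proof eventually_elim
      case (elim y)
      have sU: "sqint lborel (\<lambda>t. u (slot i t y))" and ac: "ac_line (\<lambda>t. line_rep i u (g i) t y) (\<lambda>t. g i (slot i t y))"
        and eq: "AE t in lborel. line_rep i u (g i) t y = u (slot i t y)"
        using elim by auto
      show ?case using eq
      proof eventually_elim
        case (elim t)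
        show ?case
        proof
          assume c: "slot i t y \<in> cube x0 R"
          have tt: "t \<in> {x0 $ i - R..x0 $ i + R}" and yy: "\<bar>fst y - x0 $ (i + 1)\<bar> \<le> R" "\<bar>snd y - x0 $ (i + 2)\<bar> \<le> R"
            using c unfolding cube_brick slot_mem_brick by auto
          have "(u (slot i t y))\<^sup>2 \<le> 2 / ((x0 $ i + R) - (x0 $ i - R)) * (LINT s|lborel. indicator {x0 $ i - R..x0 $ i + R} s * (u (slot i s y))\<^sup>2) +
            2 * ((x0 $ i + R) - (x0 $ i - R)) * (LINT s|lborel. indicator {x0 $ i - R..x0 $ i + R} s * (g i (slot i s y))\<^sup>2)"
            unfolding elim[symmetric] by (rule ac_line_sup_sq[OF ac sU eq]) (use tt R0 in auto)
          also have "(LINT s|lborel. indicator {x0 $ i - R..x0 $ i + R} s * (u (slot i s y))\<^sup>2) = P i y"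
            unfolding P_def using yy by (intro Bochner_Integration.integral_cong) (auto simp: cube_brick slot_mem_brick indicator_def)
          also have "2 / ((x0 $ i + R) - (x0 $ i - R)) * P i y = (1 / R) * P i y" using R0 by simp
          also have "2 * ((x0 $ i + R) - (x0 $ i - R)) * (LINT s|lborel. indicator {x0 $ i - R..x0 $ i + R} s * (g i (slot i s y))\<^sup>2) \<le> 4 * R * G i y"
          proof -
            have "(LINT s|lborel. indicator {x0 $ i - R..x0 $ i + R} s * (g i (slot i s y))\<^sup>2) \<le> G i y"
              unfolding G_def using ac by (intro integral_Icc_sq_le) (simp add: ac_line_def)
            then have "4 * R * (LINT s|lborel. indicator {x0 $ i - R..x0 $ i + R} s * (g i (slot i s y))\<^sup>2) \<le> 4 * R * G i y"
              using R0 by (intro mult_left_mono) auto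
            then show ?thesis by simp
          qed
          finally show "(u (slot i t y))\<^sup>2 \<le> H i (slot i t y $ (i + 1), slot i t y $ (i + 2))"
            by (simp add: H_def slot_nth)
        qed
      qed
    qed
  qed
  define F where "F i y = ennreal (sqrt (H i y))" for i y
  have Fm: "F i \<in> borel_measurable borel" for i unfolding F_def by measurable
  have F2: "(\<integral>\<^sup>+y. (F i y)\<^sup>2 \<partial>lborel) \<le> ennreal (304 * R * Q)" for i
  proof -
    have "(\<integral>\<^sup>+y. (F i y)\<^sup>2 \<partial>lborel) = (\<integral>\<^sup>+y. ennreal (H i y) \<partial>lborel)"
      unfolding F_def using H0 by (intro nn_integral_cong) (simp add: ennreal_power)
    also have "\<dots> = ennreal (LINT y|lborel. H i y)" using iH H0 by (intro nn_integral_eq_integral) auto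
    finally show ?thesis using IH by (simp add: ennreal_leI)
  qed
  have n3: "(2::3) + 1 = 3" "(2::3) + 2 = 1" "(3::3) + 1 = 1" "(3::3) + 2 = 2" "(1::3) + 1 = 2" "(1::3) + 2 = 3" by simp_all
  have "emeasure lborel A = (\<integral>\<^sup>+x. indicator A x \<partial>lborel)" using A by simp
  also have "\<dots> \<le> (\<integral>\<^sup>+(z::R3). F 1 (z $ 2, z $ 3) * F 2 (z $ 3, z $ 1) * F 3 (z $ 1, z $ 2) \<partial>lborel)"
  proof (rule nn_integral_mono_AE)
    show "AE z in lborel. indicator A z \<le> F 1 (z $ 2, z $ 3) * F 2 (z $ 3, z $ 1) * F 3 (z $ 1, z $ 2)"
      using pt[of 1] pt[of 2] pt[of 3] ge
    proof eventually_elim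
      case (elim z)
      show ?case
      proof (cases "z \<in> A")
        case True
        then have "z \<in> cube x0 R" "1 \<le> u z" using A elim(4) by auto
        then have "1 \<le> (u z)\<^sup>2" by (simp add: power2_eq_square mult_ge1_I)
        then have "1 \<le> H 1 (z $ 2, z $ 3)" "1 \<le> H 2 (z $ 3, z $ 1)" "1 \<le> H 3 (z $ 1, z $ 2)"
          using elim(1-3) \<open>z \<in> cube x0 R\<close> unfolding n3 by (meson order_trans)+
        then have "1 \<le> F 1 (z $ 2, z $ 3)" "1 \<le> F 2 (z $ 3, z $ 1)" "1 \<le> F 3 (z $ 1, z $ 2)"
          unfolding F_def ennreal_1[symmetric] by (intro ennreal_leI; simp)+
        then have "1 * 1 * 1 \<le> F 1 (z $ 2, z $ 3) * F 2 (z $ 3, z $ 1) * F 3 (z $ 1, z $ 2)"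
          by (intro mult_mono) auto
        then show ?thesis using True by simp
      qed simp
    qed
  qed
  finally have "(emeasure lborel A)\<^sup>2 \<le> (\<integral>\<^sup>+(z::R3). F 1 (z $ 2, z $ 3) * F 2 (z $ 3, z $ 1) * F 3 (z $ 1, z $ 2) \<partial>lborel)\<^sup>2"
    by (rule power_mono) simp
  also have "\<dots> \<le> (\<integral>\<^sup>+y. (F 1 y)\<^sup>2 \<partial>lborel) * (\<integral>\<^sup>+y. (F 2 y)\<^sup>2 \<partial>lborel) * (\<integral>\<^sup>+y. (F 3 y)\<^sup>2 \<partial>lborel)"
    by (rule Loomis_Whitney[OF Fm])
  also have "\<dots> \<le> ennreal (304 * R * Q) * ennreal (304 * R * Q) * ennreal (304 * R * Q)"
    by (intro mult_mono F2) auto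
  also have "\<dots> = ennreal ((304 * R * Q) ^ 3)"
    using R0 Q0 by (simp add: ennreal_mult[symmetric] power3_eq_cube)
  finally have "(emeasure lborel A)\<^sup>2 \<le> ennreal ((304 * R * Q) ^ 3)" .
  moreover have "emeasure lborel A = ennreal (measure lborel A)"
  proof -
    have "emeasure lborel A \<le> emeasure lborel (cube x0 R)" by (intro emeasure_mono A) simp
    then have "emeasure lborel A \<noteq> \<infinity>" using emeasure_cube[of x0 R] by (auto simp: top_unique)
    then show ?thesis by (rule emeasure_eq_ennreal_measure[unfolded infinity_ennreal_def[symmetric]])
  qed
  ultimately have "ennreal ((measure lborel A)\<^sup>2) \<le> ennreal ((304 * R * Q) ^ 3)"
    by (simp add: ennreal_power)
  then show ?thesis using R0 Q0 by (subst (asm) ennreal_le_iff) auto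
qed

section \<open>From scale to scale: the density of the domain in small cubes\<close>

definition portion :: "R3 set \<Rightarrow> R3 \<Rightarrow> real \<Rightarrow> real"
  where "portion \<Omega> x r = measure lborel (\<Omega> \<inter> cube x r)"

text \<open>A cutoff at scale \<open>r\<close> has squared norm of order \<open>portion r / r\<^sup>2\<close> on \<open>\<Omega>\<close>, and its extension is at
  least \<open>1\<close> on the part of \<open>\<Omega>\<close> in the cube of size \<open>r / 16\<close>. Relative to the volume of the cubes this
  is a superlinear estimate, so a small density at one scale stays small at all smaller scales,
  which is impossible at an interior point.\<close>

lemma portion_step:
  assumes "open \<Omega>" and ext: "H1_extension_domain \<Omega>"
  obtains C where "C > 0" "\<forall>x0 k. (portion \<Omega> x0 (1 / 16 ^ Suc k))\<^sup>2 \<le> C * (portion \<Omega> x0 (1 / 16 ^ k) * 16 ^ k) ^ 3"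
proof -
  obtain E C0 where E: "\<And>u. u \<in> H1 \<Omega> \<Longrightarrow> E u \<in> H1 UNIV" "\<And>u. u \<in> H1 \<Omega> \<Longrightarrow> AE x in lebesgue_on \<Omega>. E u x = u x"
    "\<And>u. u \<in> H1 \<Omega> \<Longrightarrow> norm_H1 UNIV (E u) \<le> C0 * norm_H1 \<Omega> u"
    using ext unfolding H1_extension_domain_def by blast
  obtain C1 where C1: "C1 > 0"
    "\<forall>x0 r. 0 < r \<longrightarrow> (\<exists>\<psi>\<in>test_fun UNIV. (\<forall>x. \<bar>\<psi> x\<bar> \<le> C1) \<and> (\<forall>x i. \<bar>partial i \<psi> x\<bar> \<le> C1 / r) \<and>
      (\<forall>x. x \<notin> cube x0 r \<longrightarrow> \<psi> x = 0 \<and> (\<forall>i. partial i \<psi> x = 0)) \<and> (\<forall>x\<in>cube x0 (r / 16). 1 \<le> \<psi> x))"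
    using cutoff_exists .
  have m: "\<Omega> \<in> sets lebesgue" using assms by auto
  have Ob: "\<Omega> \<in> sets borel" using assms by auto
  \<comment> \<open>This is 304 (r/16) Q for Q = 4 C0^2 (C1/r)^2 M with the factor M/r split off;
    the 4 counts the cutoff and its three derivatives. Adding 1 makes the constant positive also
    when C0 = 0.\<close>
  define C where "C = (304 / 16 * (4 * C0\<^sup>2 * C1\<^sup>2)) ^ 3 + 1"
  have C: "C > 0" unfolding C_def by (intro add_nonneg_pos zero_le_power mult_nonneg_nonneg zero_le_power2) auto
  show ?thesis
  proof (rule that[OF C], intro allI)
    fix x0 k
    define r :: real where "r = 1 / 16 ^ k"
    have r: "0 < r" "r \<le> 1" by (auto simp: r_def)
    define M where "M = portion \<Omega> x0 r"
    have M0: "0 \<le> M" by (simp add: M_def portion_def)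
    obtain \<psi> where \<psi>: "\<psi> \<in> test_fun UNIV" "\<And>x. \<bar>\<psi> x\<bar> \<le> C1" "\<And>x i. \<bar>partial i \<psi> x\<bar> \<le> C1 / r"
      "\<And>x. x \<notin> cube x0 r \<Longrightarrow> \<psi> x = 0" "\<And>x i. x \<notin> cube x0 r \<Longrightarrow> partial i \<psi> x = 0" "\<And>x. x \<in> cube x0 (r / 16) \<Longrightarrow> 1 \<le> \<psi> x"
      using C1(2)[rule_format, OF r(1), of x0] by blast
    have H: "\<psi> \<in> H1 \<Omega>" by (rule test_fun_restrict_H1(1)[OF \<psi>(1) assms(1)])
    have bnd: "(LINT x|lebesgue_on \<Omega>. (f x)\<^sup>2) \<le> (C1 / r)\<^sup>2 * M"
      if f: "sqint lborel f" "\<And>x. \<bar>f x\<bar> \<le> C1 / r" "\<And>x. x \<notin> cube x0 r \<Longrightarrow> f x = 0" for f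
    proof -
      have fm: "f \<in> borel_measurable lborel" using f by (simp add: sqint_def)
      have "(LINT x|lebesgue_on \<Omega>. (f x)\<^sup>2) = (LINT x|lebesgue. indicator \<Omega> x *\<^sub>R (f x)\<^sup>2)"
        by (simp add: integral_lebesgue_on_eq[OF m] set_lebesgue_integral_def)
      also have "\<dots> = (LINT x|lborel. indicator \<Omega> x *\<^sub>R (f x)\<^sup>2)"
        by (intro integral_completion) (use fm Ob in auto)
      also have "\<dots> \<le> (LINT x|lborel. (C1 / r)\<^sup>2 * indicator (\<Omega> \<inter> cube x0 r) x)"
      proof (rule integral_mono)
        show "integrable lborel (\<lambda>x. indicator \<Omega> x *\<^sub>R (f x)\<^sup>2)"
          by (rule integrable_mult_indicator) (use Ob sqint_integrable[OF f(1)] in auto)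
        have "emeasure lborel (\<Omega> \<inter> cube x0 r) < \<infinity>"
          using emeasure_cube[of x0 r] emeasure_mono[of "\<Omega> \<inter> cube x0 r" "cube x0 r" lborel] by (auto intro: le_less_trans)
        then show "integrable lborel (\<lambda>x. (C1 / r)\<^sup>2 * indicator (\<Omega> \<inter> cube x0 r) x)"
          using Ob by (intro integrable_mult_right integrable_real_indicator) auto
        fix x
        have "(f x)\<^sup>2 \<le> (C1 / r)\<^sup>2" using power_mono[OF f(2)[of x] abs_ge_zero, of 2] by simp
        then show "indicator \<Omega> x *\<^sub>R (f x)\<^sup>2 \<le> (C1 / r)\<^sup>2 * indicator (\<Omega> \<inter> cube x0 r) x"
          using f(3)[of x] by (auto simp: indicator_def)
      qed
      also have "\<dots> = (C1 / r)\<^sup>2 * M" by (simp add: M_def portion_def)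
      finally show ?thesis .
    qed
    \<comment> \<open>The scales are at most 1, so the bound for the derivatives also serves for the
      cutoff itself.\<close>
    have "C1 \<le> C1 / r" using C1(1) r by (simp add: field_simps)
    then have b0: "\<bar>\<psi> x\<bar> \<le> C1 / r" for x using \<psi>(2)[of x] by linarith
    have bi: "(LINT x|lebesgue_on \<Omega>. (wderiv \<Omega> i \<psi> x)\<^sup>2) \<le> (C1 / r)\<^sup>2 * M" for i
    proof -
      have ae: "AE x in lebesgue_on \<Omega>. (wderiv \<Omega> i \<psi> x)\<^sup>2 = (partial i \<psi> x)\<^sup>2"
        using test_fun_restrict_H1(2)[OF \<psi>(1) assms(1), of i] by eventually_elim simp
      have "(LINT x|lebesgue_on \<Omega>. (wderiv \<Omega> i \<psi> x)\<^sup>2) = (LINT x|lebesgue_on \<Omega>. (partial i \<psi> x)\<^sup>2)"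
        by (intro integral_cong_AE borel_measurable_power ae sqint_measurable[OF H1_sqint(2)[OF H]] sqint_measurable[OF sqint_test_fun_on(2)[OF \<psi>(1) m]])
      also have "\<dots> \<le> (C1 / r)\<^sup>2 * M" by (rule bnd[OF sqint_test_fun(2)[OF \<psi>(1)] \<psi>(3) \<psi>(5)])
      finally show ?thesis .
    qed
    have "(norm_H1 \<Omega> \<psi>)\<^sup>2 \<le> (C1 / r)\<^sup>2 * M + (\<Sum>i\<in>(UNIV::3 set). (C1 / r)\<^sup>2 * M)"
      unfolding norm_H1_sq by (intro add_mono sum_mono bi bnd[OF sqint_test_fun(1)[OF \<psi>(1)] b0 \<psi>(4)])
    then have n\<psi>: "(norm_H1 \<Omega> \<psi>)\<^sup>2 \<le> 4 * (C1 / r)\<^sup>2 * M" by (simp add: mult_ac)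
    define Q where "Q = C0\<^sup>2 * (4 * (C1 / r)\<^sup>2 * M)"
    have "(norm_H1 UNIV (E \<psi>))\<^sup>2 \<le> (C0 * norm_H1 \<Omega> \<psi>)\<^sup>2"
      by (rule power_mono[OF E(3)[OF H] norm_H1_nonneg])
    also have "\<dots> \<le> Q" unfolding Q_def power_mult_distrib by (intro mult_left_mono n\<psi>) simp
    finally have EQ: "(norm_H1 UNIV (E \<psi>))\<^sup>2 \<le> Q" .
    obtain v g where v: "AE x in lborel. E \<psi> x = v x" "\<forall>i. AE x in lborel. wderiv UNIV i (E \<psi>) x = g i x"
      "\<forall>i. weak_partial i v (g i)" "(LINT x|lborel. (v x)\<^sup>2) \<le> (norm_H1 UNIV (E \<psi>))\<^sup>2"
      "\<forall>i. (LINT x|lborel. (g i x)\<^sup>2) \<le> (norm_H1 UNIV (E \<psi>))\<^sup>2"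
      using H1_UNIV_weak_partial[OF E(1)[OF H]] .
    have rs: "r / 16 = 1 / 16 ^ Suc k" by (simp add: r_def)
    have "(measure lborel (\<Omega> \<inter> cube x0 (r / 16)))\<^sup>2 \<le> (304 * (r / 16) * Q) ^ 3"
    proof (rule cube_measure_bound)
      show "weak_partial i v (g i)" for i using v(3) by blast
      show "(LINT x|lborel. (g i x)\<^sup>2) \<le> Q" for i using v(5) EQ order_trans by blast
      show "(LINT x|lborel. (v x)\<^sup>2) \<le> Q" using v(4) EQ order_trans by blast
      show "r / 16 = 1 / 16 ^ Suc k" by (rule rs)
      show "\<Omega> \<inter> cube x0 (r / 16) \<in> sets borel" using Ob by auto
      have "AE x in lborel. x \<in> \<Omega> \<longrightarrow> E \<psi> x = \<psi> x"
        using E(2)[OF H] by (simp add: AE_lebesgue_on_iff[OF m] AE_lebesgue_iff)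
      with v(1) show "AE x in lborel. x \<in> \<Omega> \<inter> cube x0 (r / 16) \<longrightarrow> 1 \<le> v x"
        by eventually_elim (use \<psi>(6) in auto)
    qed auto
    also have "304 * (r / 16) * Q = (304 / 16 * (4 * C0\<^sup>2 * C1\<^sup>2)) * (M / r)"
      using r(1) by (simp add: Q_def power_divide power2_eq_square)
    also have "\<dots> ^ 3 = (304 / 16 * (4 * C0\<^sup>2 * C1\<^sup>2)) ^ 3 * (M / r) ^ 3" by (rule power_mult_distrib)
    also have "\<dots> \<le> C * (M / r) ^ 3" unfolding C_def using M0 r by (intro mult_right_mono) auto
    finally show "(portion \<Omega> x0 (1 / 16 ^ Suc k))\<^sup>2 \<le> C * (portion \<Omega> x0 (1 / 16 ^ k) * 16 ^ k) ^ 3"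
      by (simp add: portion_def[symmetric] M_def r_def rs mult.commute[of "16 ^ _" "16::real"])
  qed
qed

lemma norm_le_sup_R3: 
  fixes z :: R3
  assumes "\<And>j. \<bar>z $ j\<bar> \<le> a" "0 \<le> a"
  shows "norm z \<le> 2 * a"
proof -
  have "(norm z)\<^sup>2 = (z $ 1)\<^sup>2 + (z $ 2)\<^sup>2 + (z $ 3)\<^sup>2"
    by (simp add: norm_vec_def L2_set_def sum_3 sum_nonneg)
  also have "\<dots> \<le> a\<^sup>2 + a\<^sup>2 + a\<^sup>2"
    using assms by (intro add_mono) (auto simp: abs_le_square_iff[symmetric])
  also have "\<dots> \<le> (2 * a)\<^sup>2" by (simp add: power_mult_distrib)
  finally show ?thesis by (rule power2_le_imp_le) (use assms(2) in simp)
qed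

lemma portion_lower_bound_interior:
  assumes "open \<Omega>" and ext: "H1_extension_domain \<Omega>"
  obtains \<delta> where "\<delta> > 0" "\<forall>x\<in>\<Omega>. \<forall>k. \<delta> * (1 / 16 ^ k) ^ 3 < portion \<Omega> x (1 / 16 ^ k)"
proof -
  obtain C where C: "C > 0" "\<forall>x0 k. (portion \<Omega> x0 (1 / 16 ^ Suc k))\<^sup>2 \<le> C * (portion \<Omega> x0 (1 / 16 ^ k) * 16 ^ k) ^ 3"
    using portion_step[OF assms] .
  \<comment> \<open>Chosen so that smallness reproduces itself: from a portion of at most \<delta>
    r^3, the step bounds the square at scale r/16 by C (\<delta> r^2)^3, which is C 16^6 \<delta>
    times the square of \<delta> (r/16)^3. The bound \<delta> \<le> 1 will contradict the volume 8
    r^3 of a full cube.\<close>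
  define \<delta> where "\<delta> = min 1 (1 / (C * 16 ^ 6))"
  have \<delta>: "\<delta> > 0" "\<delta> \<le> 1" "C * 16 ^ 6 * \<delta> \<le> 1" using C(1) by (auto simp: \<delta>_def min_def field_simps)
  show ?thesis
  proof (rule that[OF \<delta>(1)], intro ballI allI, rule ccontr)
    fix x k assume x: "x \<in> \<Omega>" and "\<not> \<delta> * (1 / 16 ^ k) ^ 3 < portion \<Omega> x (1 / 16 ^ k)"
    then have base: "portion \<Omega> x (1 / 16 ^ k) \<le> \<delta> * (1 / 16 ^ k) ^ 3" by simp
    have small: "portion \<Omega> x (1 / 16 ^ (k + n)) \<le> \<delta> * (1 / 16 ^ (k + n)) ^ 3" for n
    proof (induction n)
      case (Suc n)
      define r :: real where "r = 1 / 16 ^ (k + n)"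
      have r: "r > 0" by (simp add: r_def)
      have rs: "1 / 16 ^ (k + Suc n) = r / 16" by (simp add: r_def)
      have "(portion \<Omega> x (r / 16))\<^sup>2 \<le> C * (portion \<Omega> x r * 16 ^ (k + n)) ^ 3"
        using C(2)[rule_format, of x "k + n"] by (simp add: r_def mult.commute[of "16 ^ _" "16::real"])
      also have "\<dots> = C * (portion \<Omega> x r / r) ^ 3" by (simp add: r_def)
      also have "\<dots> \<le> C * (\<delta> * r\<^sup>2) ^ 3"
      proof -
        have "portion \<Omega> x r / r \<le> \<delta> * r\<^sup>2" using Suc.IH r by (simp add: r_def[symmetric] field_simps power2_eq_square power3_eq_cube)
        moreover have "0 \<le> portion \<Omega> x r / r" using r by (simp add: portion_def)
        ultimately show ?thesis using C(1) by (intro mult_left_mono power_mono) auto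
      qed
      also have "\<dots> = (C * 16 ^ 6 * \<delta>) * (\<delta> * (r / 16) ^ 3)\<^sup>2"
        by (simp add: power_mult_distrib power_divide power2_eq_square power3_eq_cube)
      also have "\<dots> \<le> 1 * (\<delta> * (r / 16) ^ 3)\<^sup>2" by (intro mult_right_mono \<delta>) simp
      finally have "(portion \<Omega> x (r / 16))\<^sup>2 \<le> (\<delta> * (r / 16) ^ 3)\<^sup>2" by simp
      then show ?case unfolding rs
        by (rule power2_le_imp_le) (use \<delta> r in simp)
    qed (use base in simp)
    \<comment> \<open>At scales below the distance to the complement the whole cube lies in
      \<Omega>, so its portion cannot be small.\<close>
    obtain e where e: "e > 0" "\<And>y. dist y x < e \<Longrightarrow> y \<in> \<Omega>"
      using assms(1) x by (metis open_dist)
    obtain n where n: "(1 / 16 :: real) ^ n < e / 2" using real_arch_pow_inv[of "e / 2" "1 / 16"] e(1) by auto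
    define r :: real where "r = 1 / 16 ^ (k + n)"
    have r: "r > 0" by (simp add: r_def)
    have "r \<le> (1 / 16) ^ n" by (simp add: r_def power_add power_divide field_simps)
    then have re: "2 * r < e" using n by simp
    have "cube x r \<subseteq> \<Omega>"
    proof
      fix y assume "y \<in> cube x r"
      then have "norm (y - x) \<le> 2 * r" using r by (intro norm_le_sup_R3) (auto simp: cube_def)
      then show "y \<in> \<Omega>" using e(2)[of y] re by (simp add: dist_norm)
    qed
    then have "portion \<Omega> x r = measure lborel (cube x r)" by (simp add: portion_def Int_absorb1)
    then have "8 * r ^ 3 \<le> \<delta> * r ^ 3" using small[of n] measure_cube[of r x] r by (simp add: r_def[symmetric])
    then have "8 \<le> \<delta>" using r by simp
    then show False using \<delta> by simp
  qed
qed

text \<open>The interior bound is uniform in the point, so it reaches the closure through a point of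
  \<Omega> at distance below R. Rounding r to a power of 1/16 costs a factor of at most 64 in
  length, hence 64^3 in volume.\<close>

lemma measure_density:
  assumes "open \<Omega>" and ext: "H1_extension_domain \<Omega>"
  obtains c where "c > 0" "\<forall>x\<in>closure \<Omega>. \<forall>r. 0 < r \<longrightarrow> r < 1 \<longrightarrow> c * r ^ 3 \<le> measure lborel (\<Omega> \<inter> ball x r)"
proof -
  obtain \<delta> where \<delta>: "\<delta> > 0" "\<forall>x\<in>\<Omega>. \<forall>k. \<delta> * (1 / 16 ^ k) ^ 3 < portion \<Omega> x (1 / 16 ^ k)"
    using portion_lower_bound_interior[OF assms] .
  show ?thesis
  proof (rule that[of "\<delta> / 64 ^ 3"], goal_cases)
    case 1
    show ?case using \<delta> by simp
  next
    case 2
    show ?case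
  proof (intro ballI allI impI)
    fix x and r :: real assume x: "x \<in> closure \<Omega>" and r: "0 < r" "r < 1"
    have "\<exists>k. 16 ^ k * r \<ge> 4"
    proof -
      obtain n where "(1 / 16 :: real) ^ n < r / 4" using real_arch_pow_inv[of "r / 4" "1 / 16"] r by auto
      then have "4 \<le> 16 ^ n * r" by (simp add: power_divide field_simps)
      then show ?thesis by blast
    qed
    \<comment> \<open>The least such \<open>k\<close> makes R = 1/16^k satisfy 4 R \<le> r < 64 R,
      where r < 1 rules out k = 0. The factor 4 leaves room for the cube around the nearby centre,
      which lies within 3 R of x.\<close>
    define k where "k = (LEAST k. 16 ^ k * r \<ge> 4)"
    have k: "16 ^ k * r \<ge> 4" unfolding k_def by (rule LeastI_ex) fact
    have k0: "k \<noteq> 0" using k r by (cases "k = 0") auto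
    have "\<not> 16 ^ (k - 1) * r \<ge> 4" unfolding k_def by (rule not_less_Least) (use k0 in \<open>simp add: k_def\<close>)
    then have k2: "16 ^ k * r < 64" using k0 by (cases k) (auto simp: not_le mult.commute)
    define R :: real where "R = 1 / 16 ^ k"
    have R: "R > 0" "4 * R \<le> r" "r < 64 * R" using k k2 by (auto simp: R_def field_simps)
    obtain x' where x': "x' \<in> \<Omega>" "dist x' x < R" using x R(1) unfolding closure_approachable by blast
    have sub: "\<Omega> \<inter> cube x' R \<subseteq> \<Omega> \<inter> ball x r"
    proof (intro Int_mono subset_refl subsetI)
      fix y assume "y \<in> cube x' R"
      then have "norm (y - x') \<le> 2 * R" using R by (intro norm_le_sup_R3) (auto simp: cube_def)
      then have "dist y x < 3 * R" using x'(2) dist_triangle[of y x x'] by (simp add: dist_norm)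
      then show "y \<in> ball x r" using R by (simp add: dist_commute)
    qed
    have "\<delta> / 64 ^ 3 * r ^ 3 \<le> \<delta> / 64 ^ 3 * (64 * R) ^ 3"
      using R r \<delta> by (intro mult_left_mono power_mono) auto
    also have "\<dots> = \<delta> * R ^ 3" by (simp add: power_mult_distrib)
    also have "\<dots> \<le> portion \<Omega> x' R" using \<delta>(2)[rule_format, OF x'(1), of k] by (simp add: R_def)
    also have "\<dots> \<le> measure lborel (\<Omega> \<inter> ball x r)"
      unfolding portion_def
    proof (rule measure_mono_fmeasurable[OF sub])
      show "\<Omega> \<inter> cube x' R \<in> sets lborel" using assms(1) by auto
      show "\<Omega> \<inter> ball x r \<in> fmeasurable lborel"
        using emeasure_mono[of "\<Omega> \<inter> ball x r" "ball x r" lborel] emeasure_lborel_ball_finite[of x r] assms(1)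
        by (intro fmeasurableI) (auto intro: le_less_trans)
    qed
    finally show "\<delta> / 64 ^ 3 * r ^ 3 \<le> measure lborel (\<Omega> \<inter> ball x r)" .
  qed
  qed
qed

section \<open>Traces on lines and integration by parts\<close>

text \<open>The average of v over the part of \<Omega> in a ball deviates from the value L of the
  line representative by at most the integral of |V - L| over the surrounding cube, divided by the
  volume of that part. The density bound makes the divisor comparable to r^3, and every point of the
  line is a Lebesgue point of V; so the limit exists and equals L.\<close>

lemma Tr_eq_line_rep:
  assumes "open \<Omega>" and ext: "H1_extension_domain \<Omega>" and v: "v \<in> L2 \<Omega>"
    and wp: "weak_partial i V g" and eq: "AE x in lborel. x \<in> \<Omega> \<longrightarrow> v x = V x"
  shows "AE y in lborel. \<forall>t. slot i t y \<in> frontier \<Omega> \<longrightarrow> Tr \<Omega> v (slot i t y) = line_rep i V g t y"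
proof -
  obtain c where c: "c > 0" "\<forall>x\<in>closure \<Omega>. \<forall>r. 0 < r \<longrightarrow> r < 1 \<longrightarrow> c * r ^ 3 \<le> measure lborel (\<Omega> \<inter> ball x r)"
    using measure_density[OF assms(1) ext] .
  have sV: "sqint lborel V" using wp by (simp add: weak_partial_def)
  have Vm [measurable]: "V \<in> borel_measurable borel" using sV by (simp add: sqint_def)
  show ?thesis using line_lebesgue_point[OF wp]
  proof eventually_elim
    case (elim y)
    show ?case
    proof (intro allI impI)
      fix t assume "slot i t y \<in> frontier \<Omega>"
      define x where "x = slot i t y"
      define L where "L = line_rep i V g t y"
      have x: "x \<in> closure \<Omega>" using \<open>slot i t y \<in> frontier \<Omega>\<close> by (simp add: x_def frontier_def)
      define avg where "avg r = (1 / measure lebesgue (\<Omega> \<inter> ball x r)) * (LINT y|lebesgue_on (\<Omega> \<inter> ball x r). v y)" for r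
      have bound: "\<bar>avg r - L\<bar> \<le> (LINT z|lborel. indicator (cube x r) z * \<bar>V z - L\<bar>) / (c * r ^ 3)" if r: "0 < r" "r < 1" for r
      proof -
        define B where "B = \<Omega> \<inter> ball x r"
        have Bo: "open B" using assms(1) by (simp add: B_def open_Int)
        then have Bb: "B \<in> sets borel" and Bl: "B \<in> sets lebesgue" by auto
        have Bf: "emeasure lborel B < \<infinity>"
          using emeasure_mono[of B "ball x r" lborel] emeasure_lborel_ball_finite[of x r] by (auto simp: B_def intro: le_less_trans)
        define m where "m = measure lborel B"
        have "c * r ^ 3 \<le> m" using c(2) x r by (simp add: m_def B_def)
        moreover have cr: "0 < c * r ^ 3" using c(1) r by simp
        ultimately have m: "0 < m" "c * r ^ 3 \<le> m" by linarith+
        have mB: "measure lebesgue B = m" unfolding m_def using Bb by (simp add: measure_completion)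
        have iV: "integrable lborel (\<lambda>z. indicator B z * V z)"
          by (intro sqint_mult sqint_indicator sV Bf) (use Bb in simp)
        have iB: "integrable lborel (indicator B :: R3 \<Rightarrow> real)"
          by (intro integrable_real_indicator Bf) (use Bb in simp)
        have vm: "v \<in> borel_measurable (lebesgue_on \<Omega>)" using v by (simp add: L2_def)
        have "(LINT y|lebesgue_on B. v y) = (LINT y|lebesgue_on B. V y)"
        proof (rule integral_cong_AE)
          have "lebesgue_on B = restrict_space (lebesgue_on \<Omega>) B"
            using assms(1) by (subst restrict_restrict_space) (auto simp: B_def Int_absorb1)
          then show "v \<in> borel_measurable (lebesgue_on B)" using measurable_restrict_space1[OF vm, of B] by simp
          show "V \<in> borel_measurable (lebesgue_on B)" by (intro measurable_restrict_space1 measurable_completion) simp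
          show "AE y in lebesgue_on B. v y = V y"
            unfolding AE_lebesgue_on_iff[OF Bl] AE_lebesgue_iff using eq by eventually_elim (simp add: B_def)
        qed
        also have "\<dots> = (LINT y|lebesgue. indicator B y * V y)"
          by (simp add: integral_lebesgue_on_eq[OF Bl] set_lebesgue_integral_def)
        also have "\<dots> = (LINT y|lborel. indicator B y * V y)"
          by (intro integral_completion) (use Bb in simp)
        finally have e1: "(LINT y|lebesgue_on B. v y) = (LINT y|lborel. indicator B y * V y)" .
        have "avg r - L = ((LINT y|lborel. indicator B y * V y) - m * L) / m"
          unfolding avg_def B_def[symmetric] mB e1 using m by (simp add: field_simps)
        also have "m * L = (LINT y|lborel. indicator B y * L)" by (simp add: m_def)
        also have "(LINT y|lborel. indicator B y * V y) - (LINT y|lborel. indicator B y * L) = (LINT y|lborel. indicator B y * V y - indicator B y * L)"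
          by (rule Bochner_Integration.integral_diff[symmetric]) (intro iV integrable_mult_left iB)+
        finally have "\<bar>avg r - L\<bar> = \<bar>LINT y|lborel. indicator B y * V y - indicator B y * L\<bar> / m" using m by simp
        also have "\<dots> \<le> (LINT y|lborel. \<bar>indicator B y * V y - indicator B y * L\<bar>) / m"
          using m by (intro divide_right_mono integral_abs_bound) simp
        also have "\<dots> \<le> (LINT z|lborel. indicator (cube x r) z * \<bar>V z - L\<bar>) / m"
        proof (intro divide_right_mono integral_mono)
          show "integrable lborel (\<lambda>y. \<bar>indicator B y * V y - indicator B y * L\<bar>)"
            by (intro integrable_abs Bochner_Integration.integrable_diff iV integrable_mult_left iB)
          show "integrable lborel (\<lambda>z. indicator (cube x r) z * \<bar>V z - L\<bar>)"
            by (intro integrable_indicator_abs_diff sqint_mult sqint_indicator sV emeasure_cube) simp_all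
          fix z
          have "z \<in> cube x r" if "z \<in> B"
          proof -
            have "norm (z - x) \<le> r" using that by (simp add: B_def dist_norm norm_minus_commute)
            then have "\<bar>(z - x) $ j\<bar> \<le> r" for j using component_le_norm_cart[of "z - x" j] by linarith
            then show ?thesis by (simp add: cube_def)
          qed
          then show "\<bar>indicator B z * V z - indicator B z * L\<bar> \<le> indicator (cube x r) z * \<bar>V z - L\<bar>"
            by (auto simp: indicator_def)
        qed (use m in simp)
        also have "\<dots> \<le> (LINT z|lborel. indicator (cube x r) z * \<bar>V z - L\<bar>) / (c * r ^ 3)"
          using m cr by (intro divide_left_mono) auto
        finally show ?thesis .
      qed
      have "(avg \<longlongrightarrow> L) (at_right 0)"
      proof (rule tendstoI)
        fix e :: real assume e: "e > 0"
        have e': "e * c / 2 > 0" using e c by simp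
        obtain d where d: "d > 0" "\<And>r. 0 < r \<Longrightarrow> r < d \<Longrightarrow> (LINT z|lborel. indicator (cube x r) z * \<bar>V z - L\<bar>) \<le> (e * c / 2) * r ^ 3"
          using mp[OF spec[OF spec[OF elim, of t], of "e * c / 2"] e'] unfolding x_def L_def by blast
        have "\<forall>\<^sub>F r in at_right 0. r \<in> {0<..<min d 1}"
          using d by (intro eventually_at_right_real) simp
        then show "\<forall>\<^sub>F r in at_right 0. dist (avg r) L < e"
        proof eventually_elim
          case (elim r)
          then have r: "0 < r" "r < d" "r < 1" by auto
          have "\<bar>avg r - L\<bar> \<le> ((e * c / 2) * r ^ 3) / (c * r ^ 3)"
            by (rule order_trans[OF bound[OF r(1,3)]], rule divide_right_mono[OF d(2)[OF r(1,2)]]) (use c(1) r in simp)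
          also have "\<dots> = e / 2" using c(1) r by (simp add: field_simps)
          finally show ?case using e by (simp add: dist_real_def)
        qed
      qed
      then have "Lim (at_right 0) avg = L" by (intro tendsto_Lim) simp_all
      then show "Tr \<Omega> v (slot i t y) = line_rep i V g t y" by (simp add: Tr_def avg_def[abs_def] x_def L_def)
    qed
  qed
qed

section \<open>Integration by parts over the components of a section\<close>

lemma open_bounded_connected_real:
  fixes C :: "real set"
  assumes "open C" "bounded C" "connected C" "C \<noteq> {}"
  obtains a b where "a < b" "C = {a<..<b}"
proof -
  define a b where "a = Inf C" and "b = Sup C"
  have bd: "bdd_above C" "bdd_below C" using bounded_imp_bdd_above bounded_imp_bdd_below assms(2) by auto
  have "C \<subseteq> {a<..<b}"
  proof
    fix x assume "x \<in> C"
    then obtain e where e: "e > 0" "\<And>y. dist y x < e \<Longrightarrow> y \<in> C" using assms(1) by (metis open_dist)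
    have "x - e / 2 \<in> C" "x + e / 2 \<in> C" using e by (auto simp: dist_real_def)
    then have "a \<le> x - e / 2" "x + e / 2 \<le> b" using bd by (auto simp: a_def b_def intro: cInf_lower cSup_upper)
    then show "x \<in> {a<..<b}" using e(1) by auto
  qed
  moreover have "{a<..<b} \<subseteq> C"
  proof
    fix x assume x: "x \<in> {a<..<b}"
    obtain p where "p \<in> C" "p < x" using x bd assms(4) cInf_less_iff[of C x] by (auto simp: a_def)
    moreover obtain q where "q \<in> C" "x < q" using x bd assms(4) less_cSup_iff[of C x] by (auto simp: b_def)
    ultimately show "x \<in> C" using connected_contains_Icc[OF assms(3), of p q] by force
  qed
  ultimately show ?thesis using assms(4) that[of a b] by fastforce
qed

text \<open>Each component is a bounded open interval with end points in the frontier, where w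
  vanishes while v is arbitrary. The product rule gives 0 on each component, and there are countably
  many.\<close>

lemma ac_line_product_open:
  assumes w: "ac_line w f" and v: "ac_line v h" and "open S" "bounded S" and z: "\<And>t. t \<in> frontier S \<Longrightarrow> w t = 0"
  shows "(LINT t|lborel. indicator S t * (w t * h t + f t * v t)) = 0"
proof -
  define F where "F t = w t * h t + f t * v t" for t
  have [measurable]: "w \<in> borel_measurable borel" "v \<in> borel_measurable borel" "f \<in> borel_measurable borel" "h \<in> borel_measurable borel"
    using ac_line_measurable[OF w] ac_line_measurable[OF v] w v by (auto simp: ac_line_def sqint_def)
  have [measurable]: "F \<in> borel_measurable borel" unfolding F_def by measurable
  define \<C> where "\<C> = components S"
  have op: "open C" if "C \<in> \<C>" for C
    using that assms(3) open_components by (auto simp: \<C>_def)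
  have disj: "pairwise disjnt \<C>"
    using pairwise_disjoint_components[of S] by (simp add: \<C>_def pairwise_def disjnt_def)
  have cnt: "countable \<C>"
    by (rule countable_disjoint_open_subsets[OF op disj])
  have comp0: "(LINT t:C|lborel. F t) = 0" if C: "C \<in> \<C>" for C
  proof -
    have "C \<subseteq> S" using C in_components_subset by (auto simp: \<C>_def)
    then have "bounded C" using assms(4) bounded_subset by blast
    moreover have "connected C" "C \<noteq> {}" using C in_components_connected in_components_nonempty by (auto simp: \<C>_def)
    ultimately obtain a b where ab: "a < b" "C = {a<..<b}"
      using open_bounded_connected_real[OF op[OF C]] by blast
    have "frontier C \<subseteq> frontier S" using C frontier_of_components_subset by (auto simp: \<C>_def)
    moreover have "a \<in> frontier C" "b \<in> frontier C" using ab by (auto simp: frontier_def)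
    ultimately have "w a = 0" "w b = 0" using z by auto
    moreover have "(LINT t|lborel. indicator C t * F t) = (LINT t|lborel. indicator {a..b} t * F t)"
    proof (rule integral_cong_AE)
      show "AE t in lborel. indicator C t * F t = indicator {a..b} t * F t"
        using AE_lborel_singleton[of a] AE_lborel_singleton[of b]
        by eventually_elim (auto simp: ab(2) indicator_def)
    qed (simp_all add: ab(2))
    ultimately show ?thesis
      using ac_line_product(2)[OF w v, of a b] ab(1) by (simp add: set_lebesgue_integral_def F_def)
  qed
  define A where "A n = \<Union>{C \<in> \<C>. to_nat_on \<C> C = n}" for n
  have A1: "A n = {} \<or> A n \<in> \<C>" for n
  proof (cases "\<exists>C\<in>\<C>. to_nat_on \<C> C = n")
    case True
    then obtain C where C: "C \<in> \<C>" "to_nat_on \<C> C = n" by blast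
    then have "{C \<in> \<C>. to_nat_on \<C> C = n} = {C}"
      using inj_onD[OF inj_on_to_nat_on[OF cnt]] by auto
    then show ?thesis using C by (simp add: A_def)
  next
    case False
    then have e: "{C \<in> \<C>. to_nat_on \<C> C = n} = {}" by blast
    have "A n = {}" unfolding A_def e by simp
    then show ?thesis ..
  qed
  have U: "(\<Union>n. A n) = S"
  proof -
    have "(\<Union>n. A n) = \<Union>\<C>" by (auto simp: A_def)
    then show ?thesis using Union_components[of S] by (simp add: \<C>_def)
  qed
  have "(LINT t:(\<Union>n. A n)|lborel. F t) = (\<Sum>n. LINT t:A n|lborel. F t)"
  proof (rule lebesgue_integral_countable_add)
    show "A n \<in> sets lborel" for n using A1[of n] op by auto
    show "A m \<inter> A n = {}" if "m \<noteq> n" for m n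
    proof (rule ccontr)
      assume "A m \<inter> A n \<noteq> {}"
      then obtain x C D where "C \<in> \<C>" "D \<in> \<C>" "x \<in> C" "x \<in> D" "to_nat_on \<C> C = m" "to_nat_on \<C> D = n"
        by (auto simp: A_def)
      moreover from this that have "C \<noteq> D" by auto
      ultimately show False using pairwiseD[OF disj, of C D] by (auto simp: disjnt_def)
    qed
    obtain a where a: "S \<subseteq> {-a..a}"
      using assms(4) by (metis bounded_subset_cbox_symmetric cbox_interval)
    have "integrable lborel (\<lambda>t. indicator S t *\<^sub>R (indicator {-a..a} t * F t))"
    proof (cases "-a \<le> a")
      case True
      show ?thesis
        by (rule integrable_mult_indicator) (use assms(3) ac_line_product(1)[OF w v True] in \<open>auto simp: F_def\<close>)
    qed simp
    moreover have "(\<lambda>t. indicator S t *\<^sub>R (indicator {-a..a} t * F t)) = (\<lambda>t. indicator S t *\<^sub>R F t)"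
      using a by (auto simp: indicator_def fun_eq_iff)
    ultimately show "set_integrable lborel (\<Union>n. A n) F" unfolding U set_integrable_def by simp
  qed
  also have "\<dots> = (\<Sum>n. 0)"
  proof (intro suminf_cong)
    show "(LINT t:A n|lborel. F t) = 0" for n
      using A1[of n] comp0 by (auto simp: set_lebesgue_integral_def)
  qed
  finally show ?thesis unfolding U by (simp add: set_lebesgue_integral_def F_def)
qed

text \<open>The functions \<open>\<omega>\<close> are absolutely continuous versions of an extension of \<open>w\<close> on lines.\<close>

definition zero_trace :: "R3 set \<Rightarrow> scalar_field \<Rightarrow> bool"
  where "zero_trace \<Omega> w \<longleftrightarrow> (\<exists>W g. (\<forall>i. weak_partial i W (g i)) \<and> (AE x in lborel. x \<in> \<Omega> \<longrightarrow> w x = W x) \<and>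
    (\<forall>i. AE y in lborel. \<exists>\<omega>. ac_line \<omega> (\<lambda>t. g i (slot i t y)) \<and> (AE t in lborel. \<omega> t = W (slot i t y)) \<and>
      (\<forall>t. slot i t y \<in> frontier \<Omega> \<longrightarrow> \<omega> t = 0)))"

text \<open>Weak derivatives restrict to open subsets and are unique there, so the chosen derivative
  on \<Omega> agrees with the Borel derivative of any extension.\<close>

lemma wderiv_weak_partial:
  assumes "open \<Omega>" "u \<in> H1 \<Omega>" and wp: "weak_partial i U g" and eq: "AE x in lborel. x \<in> \<Omega> \<longrightarrow> u x = U x"
  shows "AE x in lborel. x \<in> \<Omega> \<longrightarrow> wderiv \<Omega> i u x = g x"
proof -
  have m: "\<Omega> \<in> sets lebesgue" using assms by auto
  have s: "sqint lborel U" "sqint lborel g" using wp by (auto simp: weak_partial_def)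
  have "is_weak_deriv UNIV i U g"
    unfolding is_weak_deriv_def lebesgue_on_UNIV_eq
  proof
    fix \<phi> assume t: "\<phi> \<in> test_fun UNIV"
    note st = sqint_test_fun[OF t]
    have "(LINT x|lborel. U x * partial i \<phi> x) = (LINT x|lebesgue. U x * partial i \<phi> x)"
      "(LINT x|lborel. g x * \<phi> x) = (LINT x|lebesgue. g x * \<phi> x)"
      by (intro integral_completion[symmetric] borel_measurable_times sqint_measurable s st)+
    then show "(LINT x|lebesgue. U x * partial i \<phi> x) = - (LINT x|lebesgue. g x * \<phi> x)"
      using wp t by (simp add: weak_partial_def)
  qed
  then have 1: "is_weak_deriv \<Omega> i U g" by (rule weak_deriv_restrict[OF _ m])
  have so: "sqint (lebesgue_on \<Omega>) U" "sqint (lebesgue_on \<Omega>) g"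
    by (intro sqint_lebesgue_on sqint_lebesgue s m)+
  have "is_weak_deriv \<Omega> i u g"
  proof (rule weak_deriv_cong_AE[OF 1])
    show "AE x in lebesgue_on \<Omega>. U x = u x"
      unfolding AE_lebesgue_on_iff[OF m] AE_lebesgue_iff using eq by eventually_elim simp
  qed (use so H1_sqint[OF assms(2)] m in \<open>auto intro: sqint_measurable\<close>)
  then have "AE x in lebesgue_on \<Omega>. wderiv \<Omega> i u x = g x"
    by (intro wderiv_unique assms(1,2)) (use so in \<open>auto simp: L2_iff_sqint\<close>)
  then show ?thesis by (simp add: AE_lebesgue_on_iff[OF m] AE_lebesgue_iff)
qed

lemma frontier_line:
  assumes "open \<Omega>" "t \<in> frontier {t. slot i t y \<in> \<Omega>}"
  shows "slot i t y \<in> frontier \<Omega>"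
proof -
  let ?S = "{t. slot i t y \<in> \<Omega>}"
  have "open ((\<lambda>t. slot i t y) -` \<Omega>)" by (rule open_vimage[OF assms(1) continuous_slot_line])
  then have "open ?S" by (simp add: vimage_def)
  then have "t \<notin> ?S" "t \<in> closure ?S" using assms(2) by (auto simp: frontier_def interior_open)
  moreover have "(\<lambda>t. slot i t y) ` closure ?S \<subseteq> closure \<Omega>"
    by (rule image_closure_subset[OF continuous_slot_line]) (use closure_subset in auto)
  ultimately show ?thesis using assms(1) by (auto simp: frontier_def interior_open)
qed

text \<open>One vanishing factor suffices: the product of the absolutely continuous versions is zero
  at the end points whatever the extension of u does there. Functions and weak derivatives are first
  replaced on \<Omega> by Borel representatives coming from extensions, so that Fubini along lines
  applies.\<close>

lemma zero_trace_parts: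
  assumes "open \<Omega>" "bounded \<Omega>" and ext: "H1_extension_domain \<Omega>"
    and u: "u \<in> H1 \<Omega>" and w: "w \<in> H1 \<Omega>" and zt: "zero_trace \<Omega> w"
  shows "(LINT x|lebesgue_on \<Omega>. u x * wderiv \<Omega> i w x + wderiv \<Omega> i u x * w x) = 0"
proof -
  have m: "\<Omega> \<in> sets lebesgue" and Ob: "\<Omega> \<in> sets borel" using assms(1) by auto
  obtain W g' where W': "\<forall>i. weak_partial i W (g' i)" "AE x in lborel. x \<in> \<Omega> \<longrightarrow> w x = W x"
    "\<forall>i. AE y in lborel. \<exists>\<omega>. ac_line \<omega> (\<lambda>t. g' i (slot i t y)) \<and> (AE t in lborel. \<omega> t = W (slot i t y)) \<and>
      (\<forall>t. slot i t y \<in> frontier \<Omega> \<longrightarrow> \<omega> t = 0)"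
    using zt unfolding zero_trace_def by blast
  define g where "g = g' i"
  have W: "weak_partial i W g" "AE y in lborel. \<exists>\<omega>. ac_line \<omega> (\<lambda>t. g (slot i t y)) \<and> (AE t in lborel. \<omega> t = W (slot i t y)) \<and>
      (\<forall>t. slot i t y \<in> frontier \<Omega> \<longrightarrow> \<omega> t = 0)"
    using W'(1,3) by (simp_all add: g_def)
  obtain E where E: "E u \<in> H1 UNIV" "AE x in lebesgue_on \<Omega>. E u x = u x"
    using ext u unfolding H1_extension_domain_def by blast
  obtain U h' where U': "AE x in lborel. E u x = U x" "\<forall>i. AE x in lborel. wderiv UNIV i (E u) x = h' i x"
    "\<forall>i. weak_partial i U (h' i)"
    by (rule H1_UNIV_weak_partial[OF E(1)])
  define h where "h = h' i"
  have U: "weak_partial i U h" using U'(3) by (simp add: h_def)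
  have Eu: "AE x in lborel. x \<in> \<Omega> \<longrightarrow> E u x = u x"
    using E(2) by (simp add: AE_lebesgue_on_iff[OF m] AE_lebesgue_iff)
  have uU: "AE x in lborel. x \<in> \<Omega> \<longrightarrow> u x = U x" using Eu U'(1) by eventually_elim simp
  have s: "sqint lborel W" "sqint lborel g" "sqint lborel U" "sqint lborel h"
    using W(1) U by (auto simp: weak_partial_def)
  have [measurable]: "W \<in> borel_measurable borel" "g \<in> borel_measurable borel" "U \<in> borel_measurable borel" "h \<in> borel_measurable borel"
    using s by (auto simp: sqint_def)
  have dw: "AE x in lborel. x \<in> \<Omega> \<longrightarrow> wderiv \<Omega> i w x = g x"
    by (rule wderiv_weak_partial[OF assms(1) w W(1) W'(2)])
  have du: "AE x in lborel. x \<in> \<Omega> \<longrightarrow> wderiv \<Omega> i u x = h x"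
    by (rule wderiv_weak_partial[OF assms(1) u U uU])
  define K where "K x = indicator \<Omega> x * (U x * g x + h x * W x)" for x
  have K: "integrable lborel K"
  proof -
    have "integrable lborel (\<lambda>x. indicator \<Omega> x *\<^sub>R (U x * g x + h x * W x))"
      by (rule integrable_mult_indicator) (use Ob s in \<open>auto intro!: Bochner_Integration.integrable_add sqint_mult\<close>)
    then show ?thesis by (simp add: K_def[abs_def])
  qed
  have "(LINT x|lebesgue_on \<Omega>. u x * wderiv \<Omega> i w x + wderiv \<Omega> i u x * w x) = (LINT x|lebesgue_on \<Omega>. U x * g x + h x * W x)"
  proof (rule integral_cong_AE)
    show "AE x in lebesgue_on \<Omega>. u x * wderiv \<Omega> i w x + wderiv \<Omega> i u x * w x = U x * g x + h x * W x"
      unfolding AE_lebesgue_on_iff[OF m] AE_lebesgue_iff using dw du uU W'(2) by eventually_elim simp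
    show "(\<lambda>x. u x * wderiv \<Omega> i w x + wderiv \<Omega> i u x * w x) \<in> borel_measurable (lebesgue_on \<Omega>)"
      by (intro borel_measurable_add borel_measurable_times sqint_measurable H1_sqint u w)
    show "(\<lambda>x. U x * g x + h x * W x) \<in> borel_measurable (lebesgue_on \<Omega>)"
      by (intro measurable_restrict_space1 measurable_completion) simp
  qed
  also have "\<dots> = (LINT x|lebesgue. K x)"
    by (simp add: integral_lebesgue_on_eq[OF m] set_lebesgue_integral_def K_def)
  also have "\<dots> = (LINT x|lborel. K x)"
    by (intro integral_completion) (use K in auto)
  also have "\<dots> = (LINT y|lborel. LINT t|lborel. K (slot i t y))" by (rule integral_slot(3)[OF K])
  also have "\<dots> = (LINT (y :: real \<times> real)|lborel. 0)"
  proof (rule integral_cong_AE)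
    show "(\<lambda>y. LINT t|lborel. K (slot i t y)) \<in> borel_measurable lborel" using integral_slot(2)[OF K, of i] by auto
    show "AE y in lborel. (LINT t|lborel. K (slot i t y)) = 0"
      using W(2) line_rep[OF U] integral_slot(1)[OF K, of i]
    proof eventually_elim
      case (elim y)
      then obtain \<omega> where \<omega>: "ac_line \<omega> (\<lambda>t. g (slot i t y))" "AE t in lborel. \<omega> t = W (slot i t y)"
        "\<And>t. slot i t y \<in> frontier \<Omega> \<Longrightarrow> \<omega> t = 0" by blast
      define \<mu> where "\<mu> t = line_rep i U h t y" for t
      have \<mu>: "ac_line \<mu> (\<lambda>t. h (slot i t y))" "AE t in lborel. \<mu> t = U (slot i t y)"
        using elim(2) by (simp_all add: \<mu>_def[abs_def])
      define S where "S = {t. slot i t y \<in> \<Omega>}"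
      have "open ((\<lambda>t. slot i t y) -` \<Omega>)" by (rule open_vimage[OF assms(1) continuous_slot_line])
      then have So: "open S" by (simp add: vimage_def S_def)
      have Sb: "bounded S"
      proof -
        obtain B where B: "\<And>x. x \<in> \<Omega> \<Longrightarrow> norm x \<le> B" using assms(2) unfolding bounded_iff by blast
        have "\<bar>t\<bar> \<le> B" if "t \<in> S" for t
          using B[of "slot i t y"] that component_le_norm_cart[of "slot i t y" i] by (simp add: S_def slot_nth)
        then show ?thesis unfolding bounded_iff by auto
      qed
      have "(LINT t|lborel. K (slot i t y)) = (LINT t|lborel. indicator S t * (\<omega> t * h (slot i t y) + g (slot i t y) * \<mu> t))"
      proof (rule integral_cong_AE)
        show "(\<lambda>t. K (slot i t y)) \<in> borel_measurable lborel" using elim(3) by auto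
        have [measurable]: "\<omega> \<in> borel_measurable borel" "\<mu> \<in> borel_measurable borel" "S \<in> sets borel"
          using ac_line_measurable \<omega>(1) \<mu>(1) So by auto
        show "(\<lambda>t. indicator S t * (\<omega> t * h (slot i t y) + g (slot i t y) * \<mu> t)) \<in> borel_measurable lborel"
          by measurable
        show "AE t in lborel. K (slot i t y) = indicator S t * (\<omega> t * h (slot i t y) + g (slot i t y) * \<mu> t)"
          using \<omega>(2) \<mu>(2) by eventually_elim (simp add: K_def S_def indicator_def algebra_simps)
      qed
      also have "\<dots> = 0"
        by (rule ac_line_product_open[OF \<omega>(1) \<mu>(1) So Sb]) (use \<omega>(3) frontier_line[OF assms(1)] in \<open>auto simp: S_def\<close>)
      finally show ?case .
    qed
  qed simp
  finally show ?thesis by simp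
qed

lemma weak_partial_lincomb:
  assumes "weak_partial i u g" "weak_partial i v h"
  shows "weak_partial i (\<lambda>x. a * u x + c * v x) (\<lambda>x. a * g x + c * h x)"
  unfolding weak_partial_def
proof (intro conjI ballI)
  have s: "sqint lborel u" "sqint lborel g" "sqint lborel v" "sqint lborel h"
    using assms by (auto simp: weak_partial_def)
  then show "sqint lborel (\<lambda>x. a * u x + c * v x)" "sqint lborel (\<lambda>x. a * g x + c * h x)"
    by (auto intro: sqint_lincomb)
  fix \<phi> assume t: "\<phi> \<in> test_fun UNIV"
  note st = sqint_test_fun[OF t]
  have "(LINT x|lborel. (a * p x + c * q x) * \<psi> x) = a * (LINT x|lborel. p x * \<psi> x) + c * (LINT x|lborel. q x * \<psi> x)"
    if "sqint lborel p" "sqint lborel q" "sqint lborel \<psi>" for p q \<psi> :: scalar_field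
    using sqint_mult[OF that(1,3)] sqint_mult[OF that(2,3)] by (simp add: distrib_right mult.assoc)
  then show "(LINT x|lborel. (a * u x + c * v x) * partial i \<phi> x) = - (LINT x|lborel. (a * g x + c * h x) * \<phi> x)"
    using s st assms t by (simp add: weak_partial_def)
qed

text \<open>\<open>Tr\<close> need not be additive where limits fail to exist, so the linear
  combination is formed on lines: on almost every one the three traces equal their continuous
  versions at all frontier points, and the four exceptional sets of capacity zero are
  missed.\<close>

lemma zero_trace_if_qe:
  assumes "open \<Omega>" and ext: "H1_extension_domain \<Omega>"
    and v: "v1 \<in> H1 \<Omega>" "v2 \<in> H1 \<Omega>" "v3 \<in> H1 \<Omega>"
    and qe: "qe_eq \<Omega> (Tr \<Omega> v1) f1" "qe_eq \<Omega> (Tr \<Omega> v2) f2" "qe_eq \<Omega> (Tr \<Omega> v3) f3"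
      "qe_eq \<Omega> f3 (\<lambda>x. a * f1 x + c * f2 x)"
  shows "zero_trace \<Omega> (\<lambda>x. 1 * v3 x + (- 1) * (a * v1 x + c * v2 x))"
proof -
  have m: "\<Omega> \<in> sets lebesgue" using assms(1) by auto
  have rep: "\<exists>V g. (\<forall>i. weak_partial i V (g i)) \<and> (AE x in lborel. x \<in> \<Omega> \<longrightarrow> v x = V x)" if v: "v \<in> H1 \<Omega>" for v
  proof -
    obtain E where E: "E v \<in> H1 UNIV" "AE x in lebesgue_on \<Omega>. E v x = v x"
      using ext v unfolding H1_extension_domain_def by blast
    obtain V g where V: "AE x in lborel. E v x = V x" "\<forall>i. AE x in lborel. wderiv UNIV i (E v) x = g i x"
      "\<forall>i. weak_partial i V (g i)"
      by (rule H1_UNIV_weak_partial[OF E(1)])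
    have "AE x in lborel. x \<in> \<Omega> \<longrightarrow> E v x = v x"
      using E(2) by (simp add: AE_lebesgue_on_iff[OF m] AE_lebesgue_iff)
    then have "AE x in lborel. x \<in> \<Omega> \<longrightarrow> v x = V x" using V(1) by eventually_elim simp
    then show ?thesis using V(3) by blast
  qed
  obtain V1 g1 where V1: "\<forall>i. weak_partial i V1 (g1 i)" "AE x in lborel. x \<in> \<Omega> \<longrightarrow> v1 x = V1 x" using rep[OF v(1)] by blast
  obtain V2 g2 where V2: "\<forall>i. weak_partial i V2 (g2 i)" "AE x in lborel. x \<in> \<Omega> \<longrightarrow> v2 x = V2 x" using rep[OF v(2)] by blast
  obtain V3 g3 where V3: "\<forall>i. weak_partial i V3 (g3 i)" "AE x in lborel. x \<in> \<Omega> \<longrightarrow> v3 x = V3 x" using rep[OF v(3)] by blast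
  define W where "W x = 1 * V3 x + (- 1) * (a * V1 x + c * V2 x)" for x
  define g where "g i x = 1 * g3 i x + (- 1) * (a * g1 i x + c * g2 i x)" for i x
  have "weak_partial i W (g i)" for i
    unfolding W_def[abs_def] g_def[abs_def] using V1(1) V2(1) V3(1) by (intro weak_partial_lincomb) auto
  moreover have "AE x in lborel. x \<in> \<Omega> \<longrightarrow> 1 * v3 x + (- 1) * (a * v1 x + c * v2 x) = W x"
    using V1(2) V2(2) V3(2) by eventually_elim (simp add: W_def)
  moreover have "AE y in lborel. \<exists>\<omega>. ac_line \<omega> (\<lambda>t. g i (slot i t y)) \<and> (AE t in lborel. \<omega> t = W (slot i t y)) \<and>
      (\<forall>t. slot i t y \<in> frontier \<Omega> \<longrightarrow> \<omega> t = 0)" for i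
  proof -
    note cap = capacity_0_AE_line[OF qe(1)[unfolded qe_eq_def], of i] capacity_0_AE_line[OF qe(2)[unfolded qe_eq_def], of i]
      capacity_0_AE_line[OF qe(3)[unfolded qe_eq_def], of i] capacity_0_AE_line[OF qe(4)[unfolded qe_eq_def], of i]
    note tr = Tr_eq_line_rep[OF assms(1) ext H1_L2[OF v(1)] spec[OF V1(1), of i] V1(2)]
      Tr_eq_line_rep[OF assms(1) ext H1_L2[OF v(2)] spec[OF V2(1), of i] V2(2)]
      Tr_eq_line_rep[OF assms(1) ext H1_L2[OF v(3)] spec[OF V3(1), of i] V3(2)]
    show ?thesis
      using cap tr line_rep[OF spec[OF V1(1), of i]] line_rep[OF spec[OF V2(1), of i]] line_rep[OF spec[OF V3(1), of i]]
    proof eventually_elim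
      case (elim y)
      define \<omega> where "\<omega> t = 1 * line_rep i V3 (g3 i) t y + (- 1) * (a * line_rep i V1 (g1 i) t y + c * line_rep i V2 (g2 i) t y)" for t
      have "ac_line \<omega> (\<lambda>t. g i (slot i t y))"
        unfolding \<omega>_def[abs_def] g_def using elim(8-10) by (intro ac_line_lincomb) auto
      moreover have "AE t in lborel. \<omega> t = W (slot i t y)"
      proof -
        have "AE t in lborel. line_rep i V1 (g1 i) t y = V1 (slot i t y)" "AE t in lborel. line_rep i V2 (g2 i) t y = V2 (slot i t y)"
          "AE t in lborel. line_rep i V3 (g3 i) t y = V3 (slot i t y)"
          using elim(8-10) by auto
        then show ?thesis by eventually_elim (simp add: \<omega>_def W_def)
      qed
      moreover have "\<omega> t = 0" if fr: "slot i t y \<in> frontier \<Omega>" for t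
        using elim(1-7) fr by (simp add: \<omega>_def)
      ultimately show ?case by blast
    qed
  qed
  ultimately show ?thesis unfolding zero_trace_def by blast
qed

section \<open>The Stokes form\<close>

definition part_form :: "R3 set \<Rightarrow> 3 \<Rightarrow> scalar_field \<Rightarrow> scalar_field \<Rightarrow> real"
  where "part_form \<Omega> i p q = (LINT x|lebesgue_on \<Omega>. p x * wderiv \<Omega> i q x)"

lemma part_form_lincomb_left:
  assumes "open \<Omega>" "u \<in> H1 \<Omega>" "v \<in> H1 \<Omega>" "w \<in> H1 \<Omega>"
  shows "part_form \<Omega> i (\<lambda>x. a * u x + c * v x) w = a * part_form \<Omega> i u w + c * part_form \<Omega> i v w"
  using sqint_mult[OF H1_sqint(1)[OF assms(2)] H1_sqint(2)[OF assms(4)]]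
    sqint_mult[OF H1_sqint(1)[OF assms(3)] H1_sqint(2)[OF assms(4)]]
  by (simp add: part_form_def distrib_right mult.assoc)

lemma part_form_lincomb_right:
  assumes "open \<Omega>" "u \<in> H1 \<Omega>" "v \<in> H1 \<Omega>" "w \<in> H1 \<Omega>"
  shows "part_form \<Omega> i w (\<lambda>x. a * u x + c * v x) = a * part_form \<Omega> i w u + c * part_form \<Omega> i w v"
proof -
  have "part_form \<Omega> i w (\<lambda>x. a * u x + c * v x) = (LINT x|lebesgue_on \<Omega>. a * (w x * wderiv \<Omega> i u x) + c * (w x * wderiv \<Omega> i v x))"
    unfolding part_form_def
  proof (rule integral_cong_AE)
    show "AE x in lebesgue_on \<Omega>. w x * wderiv \<Omega> i (\<lambda>x. a * u x + c * v x) x = a * (w x * wderiv \<Omega> i u x) + c * (w x * wderiv \<Omega> i v x)"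
      using H1_lincomb(2)[OF assms(1-3), of i a c] by eventually_elim (simp add: algebra_simps)
  qed (intro borel_measurable_add borel_measurable_times borel_measurable_const sqint_measurable H1_sqint H1_lincomb(1) assms)+
  then show ?thesis
    using sqint_mult[OF H1_sqint(1)[OF assms(4)] H1_sqint(2)[OF assms(2)], of i]
      sqint_mult[OF H1_sqint(1)[OF assms(4)] H1_sqint(2)[OF assms(3)], of i]
    by (simp add: part_form_def)
qed

lemma H1v_component: "u \<in> H1v \<Omega> \<Longrightarrow> component u i \<in> H1 \<Omega>"
  by (simp add: H1v_def)

lemma H1v_lincomb:
  assumes "open \<Omega>" "u \<in> H1v \<Omega>" "v \<in> H1v \<Omega>"
  shows "(\<lambda>x. a *\<^sub>R u x + c *\<^sub>R v x) \<in> H1v \<Omega>"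
  using H1_lincomb(1)[OF assms(1)] assms(2,3) by (simp add: H1v_def)

lemma curl_nth:
  "curl \<Omega> u x $ 1 = wderiv \<Omega> 2 (component u 3) x - wderiv \<Omega> 3 (component u 2) x"
  "curl \<Omega> u x $ 2 = wderiv \<Omega> 3 (component u 1) x - wderiv \<Omega> 1 (component u 3) x"
  "curl \<Omega> u x $ 3 = wderiv \<Omega> 1 (component u 2) x - wderiv \<Omega> 2 (component u 1) x"
  by (simp_all add: curl_def)

lemma inner_R3: "(a::R3) \<bullet> b = a $ 1 * b $ 1 + a $ 2 * b $ 2 + a $ 3 * b $ 3"
  by (simp add: inner_vec_def sum_3)

text \<open>Spelled out in scalar terms so that bilinearity is inherited termwise. If w has zero
  trace, exchanging the arguments of each \<open>part_form\<close> changes its sign, and the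
  antisymmetry of the curl restores it; the form then takes the same value with u and w exchanged,
  and the two halves of b cancel.\<close>

definition curl_form :: "R3 set \<Rightarrow> vector_field \<Rightarrow> vector_field \<Rightarrow> real"
  where "curl_form \<Omega> u w =
    part_form \<Omega> 2 (component u 1) (component w 3) - part_form \<Omega> 3 (component u 1) (component w 2) +
    part_form \<Omega> 3 (component u 2) (component w 1) - part_form \<Omega> 1 (component u 2) (component w 3) +
    part_form \<Omega> 1 (component u 3) (component w 2) - part_form \<Omega> 2 (component u 3) (component w 1)"

lemma integral_curl:
  assumes "u \<in> H1v \<Omega>" "w \<in> H1v \<Omega>"
  shows "integrable (lebesgue_on \<Omega>) (\<lambda>x. u x \<bullet> curl \<Omega> w x)"
    and "(LINT x|lebesgue_on \<Omega>. u x \<bullet> curl \<Omega> w x) = curl_form \<Omega> u w"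
proof -
  have i: "integrable (lebesgue_on \<Omega>) (\<lambda>x. u x $ k * wderiv \<Omega> i (component w j) x)" for i j k
    by (intro sqint_mult H1_sqint H1v_component assms)
  show "integrable (lebesgue_on \<Omega>) (\<lambda>x. u x \<bullet> curl \<Omega> w x)"
    unfolding inner_R3 curl_nth right_diff_distrib
    by (intro Bochner_Integration.integrable_add Bochner_Integration.integrable_diff i)
  show "(LINT x|lebesgue_on \<Omega>. u x \<bullet> curl \<Omega> w x) = curl_form \<Omega> u w"
    unfolding inner_R3 curl_nth right_diff_distrib curl_form_def part_form_def
    using i by (simp add: Bochner_Integration.integrable_diff)
qed

lemma stokes_form_eq:
  assumes "u \<in> H1v \<Omega>" "w \<in> H1v \<Omega>"
  shows "stokes_form \<Omega> u w = curl_form \<Omega> u w - curl_form \<Omega> w u"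
  unfolding stokes_form_def
  using integral_curl[OF assms] integral_curl[OF assms(2,1)] by simp

lemma stokes_form_antisym: "stokes_form \<Omega> u w = - stokes_form \<Omega> w u"
  unfolding stokes_form_def by (subst Bochner_Integration.integral_minus[symmetric]) simp

lemma stokes_form_lincomb_left:
  assumes "open \<Omega>" "u \<in> H1v \<Omega>" "v \<in> H1v \<Omega>" "w \<in> H1v \<Omega>"
  shows "stokes_form \<Omega> (\<lambda>x. a *\<^sub>R u x + c *\<^sub>R v x) w = a * stokes_form \<Omega> u w + c * stokes_form \<Omega> v w"
proof -
  note c = H1v_component[OF assms(2)] H1v_component[OF assms(3)] H1v_component[OF assms(4)]
  have "stokes_form \<Omega> (\<lambda>x. a *\<^sub>R u x + c *\<^sub>R v x) w =
      curl_form \<Omega> (\<lambda>x. a *\<^sub>R u x + c *\<^sub>R v x) w - curl_form \<Omega> w (\<lambda>x. a *\<^sub>R u x + c *\<^sub>R v x)"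
    by (intro stokes_form_eq H1v_lincomb assms)
  then show ?thesis
    unfolding stokes_form_eq[OF assms(2,4)] stokes_form_eq[OF assms(3,4)] curl_form_def
    by (simp add: part_form_lincomb_left[OF assms(1) c(1) c(2) c(3)] part_form_lincomb_right[OF assms(1) c(1) c(2) c(3)] algebra_simps)
qed

lemma stokes_form_lincomb_right:
  assumes "open \<Omega>" "u \<in> H1v \<Omega>" "v \<in> H1v \<Omega>" "w \<in> H1v \<Omega>"
  shows "stokes_form \<Omega> w (\<lambda>x. a *\<^sub>R u x + c *\<^sub>R v x) = a * stokes_form \<Omega> w u + c * stokes_form \<Omega> w v"
  unfolding stokes_form_antisym[of \<Omega> w] stokes_form_lincomb_left[OF assms] by simp

lemma stokes_form_zero_trace:
  assumes "open \<Omega>" "bounded \<Omega>" and ext: "H1_extension_domain \<Omega>"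
    and u: "u \<in> H1v \<Omega>" and w: "w \<in> H1v \<Omega>" and z: "\<And>k. zero_trace \<Omega> (component w k)"
  shows "stokes_form \<Omega> u w = 0"
proof -
  have p: "part_form \<Omega> i (component w k) (component u j) = - part_form \<Omega> i (component u j) (component w k)" for i j k
  proof -
    have "(LINT x|lebesgue_on \<Omega>. u x $ j * wderiv \<Omega> i (component w k) x + wderiv \<Omega> i (component u j) x * w x $ k) = 0"
      by (rule zero_trace_parts[OF assms(1-3) H1v_component[OF u] H1v_component[OF w] z])
    moreover have "(LINT x|lebesgue_on \<Omega>. u x $ j * wderiv \<Omega> i (component w k) x + wderiv \<Omega> i (component u j) x * w x $ k) =
      (LINT x|lebesgue_on \<Omega>. u x $ j * wderiv \<Omega> i (component w k) x) + (LINT x|lebesgue_on \<Omega>. wderiv \<Omega> i (component u j) x * w x $ k)"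
      by (intro Bochner_Integration.integral_add sqint_mult H1_sqint H1v_component u w)
    ultimately show ?thesis by (simp add: part_form_def mult.commute)
  qed
  show ?thesis unfolding stokes_form_eq[OF u w] curl_form_def by (simp add: p)
qed

text \<open>The density of the squared norm of H1. Bounding the integrand of b pointwise by energies
  keeps the constant at \<open>sqrt 2\<close>; separate bounds for its two terms would add up to
  twice as much.\<close>

definition energy :: "R3 set \<Rightarrow> vector_field \<Rightarrow> R3 \<Rightarrow> real"
  where "energy \<Omega> u x = (\<Sum>k\<in>UNIV. (u x $ k)\<^sup>2) + (\<Sum>k\<in>UNIV. \<Sum>i\<in>UNIV. (wderiv \<Omega> i (component u k) x)\<^sup>2)"

lemma energy_nonneg: "0 \<le> energy \<Omega> u x"
  by (auto simp: energy_def intro!: add_nonneg_nonneg sum_nonneg)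

lemma integral_energy:
  assumes "u \<in> H1v \<Omega>"
  shows "integrable (lebesgue_on \<Omega>) (energy \<Omega> u)" "(LINT x|lebesgue_on \<Omega>. energy \<Omega> u x) = inner_H1v \<Omega> u u"
proof -
  have i: "integrable (lebesgue_on \<Omega>) (\<lambda>x. (u x $ k)\<^sup>2)" "integrable (lebesgue_on \<Omega>) (\<lambda>x. (wderiv \<Omega> j (component u k) x)\<^sup>2)" for j k
    using sqint_integrable[OF H1_sqint(1)[OF H1v_component[OF assms, of k]]] sqint_integrable[OF H1_sqint(2)[OF H1v_component[OF assms, of k]]] by auto
  show "integrable (lebesgue_on \<Omega>) (energy \<Omega> u)" unfolding energy_def[abs_def] using i by simp
  show "(LINT x|lebesgue_on \<Omega>. energy \<Omega> u x) = inner_H1v \<Omega> u u"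
    unfolding energy_def inner_H1v_def inner_H1_def using i by (simp add: power2_eq_square sum.distrib)
qed

lemma inner_H1v_nonneg: "0 \<le> inner_H1v \<Omega> u u"
  by (auto simp: inner_H1v_def intro!: sum_nonneg inner_H1_nonneg)

lemma norm_H1v_nonneg: "0 \<le> norm_H1v \<Omega> u"
  by (simp add: norm_H1v_def inner_H1v_nonneg)

lemma Cauchy_Schwarz_cross:
  fixes A B :: real
  assumes "0 \<le> a" "0 \<le> b" "0 \<le> A" "0 \<le> B"
  shows "a * B + b * A \<le> sqrt (a\<^sup>2 + A\<^sup>2) * sqrt (b\<^sup>2 + B\<^sup>2)"
proof -
  have "(a * B + b * A)\<^sup>2 \<le> (a\<^sup>2 + A\<^sup>2) * (b\<^sup>2 + B\<^sup>2)"
    using zero_le_power2[of "a * b - A * B"] by (simp add: power2_eq_square algebra_simps)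
  then have "sqrt ((a * B + b * A)\<^sup>2) \<le> sqrt ((a\<^sup>2 + A\<^sup>2) * (b\<^sup>2 + B\<^sup>2))" by (rule real_sqrt_le_mono)
  then show ?thesis using assms by (simp add: real_sqrt_mult)
qed

text \<open>The squared length of the curl is at most twice that of the gradient, since (p - q)^2
  \<le> 2 p^2 + 2 q^2 uses each off-diagonal derivative once. The two terms are then joined by
  Cauchy-Schwarz for the pairs (|u|, |grad u|) and (|grad v|, |v|).\<close>

lemma stokes_integrand_bound:
  "\<bar>u x \<bullet> curl \<Omega> v x - v x \<bullet> curl \<Omega> u x\<bar> \<le> sqrt 2 * (sqrt (energy \<Omega> u x) * sqrt (energy \<Omega> v x))"
proof -
  define D where "D u = sqrt (\<Sum>k\<in>UNIV. \<Sum>i\<in>UNIV. (wderiv \<Omega> i (component u k) x)\<^sup>2)" for u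
  have D0: "0 \<le> D u" for u unfolding D_def by (auto intro!: sum_nonneg)
  have D2: "(D u)\<^sup>2 = (\<Sum>k\<in>UNIV. \<Sum>i\<in>UNIV. (wderiv \<Omega> i (component u k) x)\<^sup>2)" for u
    unfolding D_def by (auto intro!: sum_nonneg)
  have c: "norm (curl \<Omega> u x) \<le> sqrt 2 * D u" for u
  proof -
    have s: "(p - q)\<^sup>2 \<le> 2 * p\<^sup>2 + 2 * q\<^sup>2" for p q :: real
      using zero_le_power2[of "p + q"] by (simp add: power2_eq_square algebra_simps)
    have "(norm (curl \<Omega> u x))\<^sup>2 = (curl \<Omega> u x $ 1)\<^sup>2 + (curl \<Omega> u x $ 2)\<^sup>2 + (curl \<Omega> u x $ 3)\<^sup>2"
      unfolding power2_norm_eq_inner inner_R3 by (simp add: power2_eq_square)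
    also have "\<dots> \<le> (2 * (wderiv \<Omega> 2 (component u 3) x)\<^sup>2 + 2 * (wderiv \<Omega> 3 (component u 2) x)\<^sup>2) +
      (2 * (wderiv \<Omega> 3 (component u 1) x)\<^sup>2 + 2 * (wderiv \<Omega> 1 (component u 3) x)\<^sup>2) +
      (2 * (wderiv \<Omega> 1 (component u 2) x)\<^sup>2 + 2 * (wderiv \<Omega> 2 (component u 1) x)\<^sup>2)"
      unfolding curl_nth by (intro add_mono s)
    also have "\<dots> \<le> 2 * (D u)\<^sup>2" by (simp add: D2 sum_3)
    also have "\<dots> = (sqrt 2 * D u)\<^sup>2" by (simp add: power_mult_distrib)
    finally show ?thesis by (rule power2_le_imp_le) (simp add: D0)
  qed
  have e: "energy \<Omega> u x = (norm (u x))\<^sup>2 + (D u)\<^sup>2" for u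
    unfolding energy_def D2 power2_norm_eq_inner inner_R3 sum_3 by (simp add: power2_eq_square)
  have "\<bar>u x \<bullet> curl \<Omega> v x - v x \<bullet> curl \<Omega> u x\<bar> \<le> \<bar>u x \<bullet> curl \<Omega> v x\<bar> + \<bar>v x \<bullet> curl \<Omega> u x\<bar>" by linarith
  also have "\<dots> \<le> norm (u x) * norm (curl \<Omega> v x) + norm (v x) * norm (curl \<Omega> u x)"
    by (intro add_mono Cauchy_Schwarz_ineq2)
  also have "\<dots> \<le> norm (u x) * (sqrt 2 * D v) + norm (v x) * (sqrt 2 * D u)"
    by (intro add_mono mult_left_mono c) auto
  also have "\<dots> = sqrt 2 * (norm (u x) * D v + norm (v x) * D u)" by (simp add: algebra_simps)
  also have "\<dots> \<le> sqrt 2 * (sqrt (energy \<Omega> u x) * sqrt (energy \<Omega> v x))"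
    unfolding e by (intro mult_left_mono Cauchy_Schwarz_cross D0) auto
  finally show ?thesis .
qed

lemma stokes_form_bound:
  assumes "u \<in> H1v \<Omega>" "v \<in> H1v \<Omega>"
  shows "\<bar>stokes_form \<Omega> u v\<bar> \<le> sqrt 2 * norm_H1v \<Omega> u * norm_H1v \<Omega> v"
proof -
  have s: "sqint (lebesgue_on \<Omega>) (\<lambda>x. sqrt (energy \<Omega> u x))" if "u \<in> H1v \<Omega>" for u
    using integral_energy(1)[OF that] energy_nonneg
    by (auto simp: sqint_def intro!: borel_measurable_sqrt measurable_compose[OF _ borel_measurable_sqrt])
  have "\<bar>stokes_form \<Omega> u v\<bar> \<le> (LINT x|lebesgue_on \<Omega>. \<bar>u x \<bullet> curl \<Omega> v x - v x \<bullet> curl \<Omega> u x\<bar>)"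
    unfolding stokes_form_def by (rule integral_abs_bound)
  also have "\<dots> \<le> (LINT x|lebesgue_on \<Omega>. sqrt 2 * (sqrt (energy \<Omega> u x) * sqrt (energy \<Omega> v x)))"
    by (intro integral_mono stokes_integrand_bound integrable_abs Bochner_Integration.integrable_diff
        integral_curl assms integrable_mult_right sqint_mult s)
  also have "\<dots> = sqrt 2 * (LINT x|lebesgue_on \<Omega>. sqrt (energy \<Omega> u x) * sqrt (energy \<Omega> v x))" by simp
  also have "\<dots> \<le> sqrt 2 * (sqrt (LINT x|lebesgue_on \<Omega>. (sqrt (energy \<Omega> u x))\<^sup>2) * sqrt (LINT x|lebesgue_on \<Omega>. (sqrt (energy \<Omega> v x))\<^sup>2))"
    using integral_Cauchy_Schwarz[OF s[OF assms(1)] s[OF assms(2)]] by (intro mult_left_mono) auto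
  also have "\<dots> = sqrt 2 * (norm_H1v \<Omega> u * norm_H1v \<Omega> v)"
    by (simp add: energy_nonneg integral_energy assms norm_H1v_def)
  finally show ?thesis by (simp add: mult.assoc)
qed

section \<open>The tangential trace\<close>

lemma zero_H1: "(\<lambda>x. 0) \<in> H1 \<Omega>"
  by (auto simp: H1_def L2_def is_weak_deriv_def intro!: exI[of _ "\<lambda>x. 0"] bexI[of _ "\<lambda>x. 0"])

lemma norm_H1_zero:
  assumes "open \<Omega>"
  shows "norm_H1 \<Omega> (\<lambda>x. 0) = 0"
proof -
  have "inner_H1 \<Omega> (\<lambda>x. 0) (\<lambda>x. 0) = 0"
    using inner_H1_lincomb_left[OF assms zero_H1 zero_H1 zero_H1, of 0 0] by simp
  then show ?thesis by (simp add: norm_H1_def)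
qed

lemma zero_H1v: "(\<lambda>x. 0) \<in> H1v \<Omega>"
  by (simp add: H1v_def zero_H1)

lemma capacity_empty: "capacity {} = 0"
proof -
  have "capacity {} \<le> ennreal ((norm_H1 UNIV (\<lambda>x. 0))\<^sup>2)"
    unfolding capacity_def by (rule INF_lower) (auto simp: zero_H1 intro!: exI[of _ "{}"])
  then show ?thesis by (simp add: norm_H1_zero)
qed

lemma qe_eq_refl: "qe_eq \<Omega> f f"
  by (simp add: qe_eq_def capacity_empty)

lemma qe_eq_sym: "qe_eq \<Omega> f g \<Longrightarrow> qe_eq \<Omega> g f"
  unfolding qe_eq_def by (subst eq_commute[of "g _"])

lemma component_Trv: "component (Trv \<Omega> v) k = Tr \<Omega> (component v k)"
  by (simp add: Trv_def fun_eq_iff)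

lemma Trv_in_Bv: "v \<in> H1v \<Omega> \<Longrightarrow> Trv \<Omega> v \<in> Bv \<Omega>"
  unfolding Bv_def
proof (intro CollectI allI)
  fix k assume "v \<in> H1v \<Omega>"
  then show "component (Trv \<Omega> v) k \<in> tr_space \<Omega>"
    unfolding component_Trv tr_space_def using H1v_component qe_eq_refl by blast
qed

text \<open>\<open>norm_B\<close> is an infimum, so a lift can be taken with norm within \<epsilon>
  of it; the components are lifted independently and reassembled.\<close>

lemma Bv_lift:
  assumes "f \<in> Bv \<Omega>" "0 < \<epsilon>"
  obtains v where "v \<in> H1v \<Omega>" "\<forall>k. qe_eq \<Omega> (Tr \<Omega> (component v k)) (component f k)"
    "\<forall>k. norm_H1 \<Omega> (component v k) < norm_B \<Omega> (component f k) + \<epsilon>"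
proof -
  have "\<exists>v. v \<in> H1 \<Omega> \<and> qe_eq \<Omega> (Tr \<Omega> v) (component f k) \<and> norm_H1 \<Omega> v < norm_B \<Omega> (component f k) + \<epsilon>" for k
  proof -
    let ?S = "{norm_H1 \<Omega> v | v. v \<in> H1 \<Omega> \<and> qe_eq \<Omega> (Tr \<Omega> v) (component f k)}"
    have "?S \<noteq> {}" using assms(1) by (auto simp: Bv_def tr_space_def)
    moreover have "Inf ?S < norm_B \<Omega> (component f k) + \<epsilon>" using assms(2) by (simp add: norm_B_def)
    ultimately have "\<exists>s\<in>?S. s < norm_B \<Omega> (component f k) + \<epsilon>" by (rule cInf_lessD)
    then show ?thesis by blast
  qed
  then have "\<forall>k. \<exists>v. v \<in> H1 \<Omega> \<and> qe_eq \<Omega> (Tr \<Omega> v) (component f k) \<and> norm_H1 \<Omega> v < norm_B \<Omega> (component f k) + \<epsilon>" ..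
  from choice[OF this] obtain V where V: "\<forall>k. V k \<in> H1 \<Omega> \<and> qe_eq \<Omega> (Tr \<Omega> (V k)) (component f k) \<and> norm_H1 \<Omega> (V k) < norm_B \<Omega> (component f k) + \<epsilon>"
    by blast
  define v where "v x = (\<chi> k. V k x)" for x
  have "component v k = V k" for k by (simp add: v_def fun_eq_iff)
  then show ?thesis using that[of v] V by (simp add: H1v_def)
qed

text \<open>For a = 1 and c = 0 this is independence of the lift, in general it is linearity of the
  functional on traces. Both amount to b(u, .) vanishing on the single field v3 - (a v1 + c v2),
  whose components have zero trace on lines.\<close>

lemma stokes_form_trace_lincomb:
  assumes "open \<Omega>" "bounded \<Omega>" and ext: "H1_extension_domain \<Omega>"
    and u: "u \<in> H1v \<Omega>" and v: "v1 \<in> H1v \<Omega>" "v2 \<in> H1v \<Omega>" "v3 \<in> H1v \<Omega>"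
    and qe: "\<forall>k. qe_eq \<Omega> (Tr \<Omega> (component v1 k)) (component f k)" "\<forall>k. qe_eq \<Omega> (Tr \<Omega> (component v2 k)) (component g k)"
      "\<forall>k. qe_eq \<Omega> (Tr \<Omega> (component v3 k)) (component h k)" "qe_eqv \<Omega> h (\<lambda>x. a *\<^sub>R f x + c *\<^sub>R g x)"
  shows "stokes_form \<Omega> u v3 = a * stokes_form \<Omega> u v1 + c * stokes_form \<Omega> u v2"
proof -
  let ?v = "\<lambda>x. a *\<^sub>R v1 x + c *\<^sub>R v2 x"
  let ?w = "\<lambda>x. 1 *\<^sub>R v3 x + (- 1) *\<^sub>R (a *\<^sub>R v1 x + c *\<^sub>R v2 x)"
  have V: "?v \<in> H1v \<Omega>" by (intro H1v_lincomb assms)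
  have W: "?w \<in> H1v \<Omega>" by (intro H1v_lincomb assms V)
  have "zero_trace \<Omega> (component ?w k)" for k
  proof -
    have "zero_trace \<Omega> (\<lambda>x. 1 * component v3 k x + (- 1) * (a * component v1 k x + c * component v2 k x))"
      by (rule zero_trace_if_qe[OF assms(1) ext H1v_component[OF v(1)] H1v_component[OF v(2)] H1v_component[OF v(3)]
          spec[OF qe(1)] spec[OF qe(2)] spec[OF qe(3)]])
        (use qe(4) in \<open>simp add: qe_eqv_def\<close>)
    then show ?thesis by simp
  qed
  then have "stokes_form \<Omega> u ?w = 0" by (intro stokes_form_zero_trace[OF assms(1-3) u W])
  then have "1 * stokes_form \<Omega> u v3 + (- 1) * stokes_form \<Omega> u ?v = 0"
    by (simp only: stokes_form_lincomb_right[OF assms(1) v(3) V u])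
  then show ?thesis by (simp add: stokes_form_lincomb_right[OF assms(1) v(1,2) u])
qed

lemma norm_H1v_le_sum: "norm_H1v \<Omega> v \<le> (\<Sum>k\<in>UNIV. norm_H1 \<Omega> (component v k))"
proof -
  have "norm_H1v \<Omega> v = L2_set (\<lambda>k. norm_H1 \<Omega> (component v k)) UNIV"
    by (simp add: norm_H1v_def inner_H1v_def L2_set_def norm_H1_def inner_H1_nonneg)
  also have "\<dots> \<le> (\<Sum>k\<in>UNIV. norm_H1 \<Omega> (component v k))" by (intro L2_set_le_sum norm_H1_nonneg)
  finally show ?thesis .
qed

lemma norm_B_le_norm_Bv: "\<bar>norm_B \<Omega> (component f k)\<bar> \<le> norm_Bv \<Omega> f"
proof -
  have "(norm_B \<Omega> (component f k))\<^sup>2 \<le> (\<Sum>k\<in>UNIV. (norm_B \<Omega> (component f k))\<^sup>2)"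
    by (rule member_le_sum) auto
  from real_sqrt_le_mono[OF this] show ?thesis by (simp add: norm_Bv_def)
qed

lemma TrT_exists:
  assumes "open \<Omega>" "bounded \<Omega>" and ext: "H1_extension_domain \<Omega>" and u: "u \<in> H1v \<Omega>"
  obtains F where "F \<in> Bv_dual \<Omega>" "\<forall>v\<in>H1v \<Omega>. F (Trv \<Omega> v) = stokes_form \<Omega> u v"
proof -
  define lift where "lift f = (SOME v. v \<in> H1v \<Omega> \<and> (\<forall>k. qe_eq \<Omega> (Tr \<Omega> (component v k)) (component f k)))" for f
  have lift: "lift f \<in> H1v \<Omega>" "\<forall>k. qe_eq \<Omega> (Tr \<Omega> (component (lift f) k)) (component f k)" if "f \<in> Bv \<Omega>" for f
  proof -
    have "\<exists>v. v \<in> H1v \<Omega> \<and> (\<forall>k. qe_eq \<Omega> (Tr \<Omega> (component v k)) (component f k))"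
      by (rule Bv_lift[OF that zero_less_one]) blast
    from someI_ex[OF this] show "lift f \<in> H1v \<Omega>" "\<forall>k. qe_eq \<Omega> (Tr \<Omega> (component (lift f) k)) (component f k)"
      by (simp_all add: lift_def)
  qed
  define F where "F f = (if f \<in> Bv \<Omega> then stokes_form \<Omega> u (lift f) else 0)" for f
  have Feq: "F f = stokes_form \<Omega> u v" if f: "f \<in> Bv \<Omega>" and v: "v \<in> H1v \<Omega>" "\<forall>k. qe_eq \<Omega> (Tr \<Omega> (component v k)) (component f k)" for f v
  proof -
    \<comment> \<open>The trivial combination of f with itself: the linearity statement then
      compares an arbitrary lift with the chosen one.\<close>
    have "qe_eqv \<Omega> f (\<lambda>x. 1 *\<^sub>R f x + 0 *\<^sub>R f x)" by (simp add: qe_eqv_def qe_eq_refl)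
    from stokes_form_trace_lincomb[OF assms(1-3) u v(1) v(1) lift(1)[OF f] v(2) v(2) lift(2)[OF f] this]
    show ?thesis using f by (simp add: F_def)
  qed
  have "F \<in> Bv_dual \<Omega>"
    unfolding Bv_dual_def
  proof (intro CollectI conjI ballI allI impI)
    fix f g h a c assume fgh: "f \<in> Bv \<Omega>" "g \<in> Bv \<Omega>" "h \<in> Bv \<Omega>" and qe: "qe_eqv \<Omega> h (\<lambda>x. a *\<^sub>R f x + c *\<^sub>R g x)"
    show "F h = a * F f + c * F g"
      using stokes_form_trace_lincomb[OF assms(1-3) u lift(1)[OF fgh(1)] lift(1)[OF fgh(2)] lift(1)[OF fgh(3)]
          lift(2)[OF fgh(1)] lift(2)[OF fgh(2)] lift(2)[OF fgh(3)] qe] fgh by (simp add: F_def)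
  next
    define M where "M = sqrt 2 * norm_H1v \<Omega> u"
    have M: "0 \<le> M" by (simp add: M_def norm_H1v_nonneg)
    \<comment> \<open>The factor 3 is the crude passage from three components to the vector norm;
      membership in the dual asks for some bound. The error is distributed with M + 1 so that M = 0
      is allowed.\<close>
    have "\<bar>F f\<bar> \<le> 3 * M * norm_Bv \<Omega> f" if f: "f \<in> Bv \<Omega>" for f
    proof (rule field_le_epsilon)
      fix e :: real assume e: "e > 0"
      define \<epsilon> where "\<epsilon> = e / (3 * (M + 1))"
      have \<epsilon>: "\<epsilon> > 0" using e M by (simp add: \<epsilon>_def)
      obtain v where v: "v \<in> H1v \<Omega>" "\<forall>k. qe_eq \<Omega> (Tr \<Omega> (component v k)) (component f k)"
        "\<forall>k. norm_H1 \<Omega> (component v k) < norm_B \<Omega> (component f k) + \<epsilon>"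
        by (rule Bv_lift[OF f \<epsilon>])
      have "norm_H1v \<Omega> v \<le> (\<Sum>k\<in>(UNIV::3 set). norm_Bv \<Omega> f + \<epsilon>)"
      proof (rule order_trans[OF norm_H1v_le_sum sum_mono])
        fix k
        show "norm_H1 \<Omega> (component v k) \<le> norm_Bv \<Omega> f + \<epsilon>"
          using v(3)[rule_format, of k] norm_B_le_norm_Bv[of \<Omega> f k] by linarith
      qed
      then have nv: "norm_H1v \<Omega> v \<le> 3 * (norm_Bv \<Omega> f + \<epsilon>)" by simp
      have "\<bar>F f\<bar> \<le> M * norm_H1v \<Omega> v"
        using stokes_form_bound[OF u v(1)] Feq[OF f v(1,2)] by (simp add: M_def)
      also have "\<dots> \<le> M * (3 * (norm_Bv \<Omega> f + \<epsilon>))" by (rule mult_left_mono[OF nv M])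
      also have "\<dots> = 3 * M * norm_Bv \<Omega> f + M * (3 * \<epsilon>)" by (simp add: algebra_simps)
      also have "M * (3 * \<epsilon>) \<le> e"
      proof -
        have "M * (3 * \<epsilon>) \<le> (M + 1) * (3 * \<epsilon>)" using \<epsilon> by (intro mult_right_mono) auto
        also have "\<dots> = e" using M by (simp add: \<epsilon>_def field_simps)
        finally show ?thesis .
      qed
      finally show "\<bar>F f\<bar> \<le> 3 * M * norm_Bv \<Omega> f + e" by simp
    qed
    then show "\<exists>C. \<forall>f\<in>Bv \<Omega>. \<bar>F f\<bar> \<le> C * norm_Bv \<Omega> f" by blast
  next
    fix f assume "f \<notin> Bv \<Omega>" then show "F f = 0" by (simp add: F_def)
  qed
  moreover have "\<forall>v\<in>H1v \<Omega>. F (Trv \<Omega> v) = stokes_form \<Omega> u v"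
  proof
    fix v assume v: "v \<in> H1v \<Omega>"
    show "F (Trv \<Omega> v) = stokes_form \<Omega> u v"
      by (rule Feq[OF Trv_in_Bv[OF v] v]) (simp only: component_Trv qe_eq_refl simp_thms)
  qed
  ultimately show ?thesis using that by blast
qed

text \<open>Elements of \<open>Bv_dual\<close> respect equality quasi-everywhere, and every element
  of \<open>Bv\<close> is quasi-everywhere the trace of some field; outside \<open>Bv\<close> both
  functionals are 0. This is the uniqueness behind the definite description in
  \<open>TrT\<close>.\<close>

lemma Bv_dual_eqI:
  assumes F: "F \<in> Bv_dual \<Omega>" and G: "G \<in> Bv_dual \<Omega>" and eq: "\<And>v. v \<in> H1v \<Omega> \<Longrightarrow> F (Trv \<Omega> v) = G (Trv \<Omega> v)"
  shows "F = G"
proof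
  fix f
  show "F f = G f"
  proof (cases "f \<in> Bv \<Omega>")
    case True
    obtain v where v: "v \<in> H1v \<Omega>" "\<forall>k. qe_eq \<Omega> (Tr \<Omega> (component v k)) (component f k)"
      "\<forall>k. norm_H1 \<Omega> (component v k) < norm_B \<Omega> (component f k) + 1"
      by (rule Bv_lift[OF True zero_less_one])
    have q: "qe_eqv \<Omega> f (\<lambda>x. 1 *\<^sub>R Trv \<Omega> v x + 0 *\<^sub>R Trv \<Omega> v x)"
      using v(2) by (simp add: qe_eqv_def component_Trv qe_eq_sym)
    have "H f = 1 * H (Trv \<Omega> v) + 0 * H (Trv \<Omega> v)" if "H \<in> Bv_dual \<Omega>" for H
    proof -
      have "\<forall>f\<in>Bv \<Omega>. \<forall>g\<in>Bv \<Omega>. \<forall>h\<in>Bv \<Omega>. \<forall>a c. qe_eqv \<Omega> h (\<lambda>x. a *\<^sub>R f x + c *\<^sub>R g x) \<longrightarrow> H h = a * H f + c * H g"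
        using that unfolding Bv_dual_def by blast
      then show ?thesis using Trv_in_Bv[OF v(1)] True q by blast
    qed
    from this[OF F] this[OF G] show ?thesis using eq[OF v(1)] by simp
  next
    case False
    then show ?thesis using F G by (simp add: Bv_dual_def)
  qed
qed

lemma TrT:
  assumes "open \<Omega>" "bounded \<Omega>" "H1_extension_domain \<Omega>" "u \<in> H1v \<Omega>"
  shows "TrT \<Omega> u \<in> Bv_dual \<Omega>" "v \<in> H1v \<Omega> \<Longrightarrow> TrT \<Omega> u (Trv \<Omega> v) = stokes_form \<Omega> u v"
proof -
  obtain F where F: "F \<in> Bv_dual \<Omega>" "\<forall>v\<in>H1v \<Omega>. F (Trv \<Omega> v) = stokes_form \<Omega> u v"
    by (rule TrT_exists[OF assms])
  have "TrT \<Omega> u = F"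
    unfolding TrT_def
  proof (rule the_equality)
    fix G assume "G \<in> Bv_dual \<Omega> \<and> (\<forall>v\<in>H1v \<Omega>. G (Trv \<Omega> v) = stokes_form \<Omega> u v)"
    then show "G = F" using F by (intro Bv_dual_eqI) auto
  qed (use F in blast)
  then show "TrT \<Omega> u \<in> Bv_dual \<Omega>" "v \<in> H1v \<Omega> \<Longrightarrow> TrT \<Omega> u (Trv \<Omega> v) = stokes_form \<Omega> u v" using F by auto
qed

lemma TrT_eqI:
  assumes "open \<Omega>" "bounded \<Omega>" "H1_extension_domain \<Omega>" "u \<in> H1v \<Omega>"
    and "F \<in> Bv_dual \<Omega>" "\<And>v. v \<in> H1v \<Omega> \<Longrightarrow> F (Trv \<Omega> v) = stokes_form \<Omega> u v"
  shows "TrT \<Omega> u = F"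
  using TrT[OF assms(1-4)] assms(5,6) by (intro Bv_dual_eqI) auto

lemma Bv_dual_lincomb:
  assumes F: "F \<in> Bv_dual \<Omega>" and G: "G \<in> Bv_dual \<Omega>"
  shows "(\<lambda>h. a * F h + c * G h) \<in> Bv_dual \<Omega>"
proof -
  obtain C D where C: "\<forall>f\<in>Bv \<Omega>. \<bar>F f\<bar> \<le> C * norm_Bv \<Omega> f" and D: "\<forall>f\<in>Bv \<Omega>. \<bar>G f\<bar> \<le> D * norm_Bv \<Omega> f"
    using F G unfolding Bv_dual_def by blast
  have lin: "\<forall>f\<in>Bv \<Omega>. \<forall>g\<in>Bv \<Omega>. \<forall>h\<in>Bv \<Omega>. \<forall>a c. qe_eqv \<Omega> h (\<lambda>x. a *\<^sub>R f x + c *\<^sub>R g x) \<longrightarrow> H h = a * H f + c * H g"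
    if "H \<in> Bv_dual \<Omega>" for H using that unfolding Bv_dual_def by blast
  show ?thesis unfolding Bv_dual_def
  proof (intro CollectI conjI ballI allI impI)
    fix f g h b d assume fgh: "f \<in> Bv \<Omega>" "g \<in> Bv \<Omega>" "h \<in> Bv \<Omega>" "qe_eqv \<Omega> h (\<lambda>x. b *\<^sub>R f x + d *\<^sub>R g x)"
    have "F h = b * F f + d * F g" using lin[OF F] fgh by blast
    moreover have "G h = b * G f + d * G g" using lin[OF G] fgh by blast
    ultimately show "a * F h + c * G h = b * (a * F f + c * G f) + d * (a * F g + c * G g)" by (simp add: algebra_simps)
  next
    show "\<exists>C. \<forall>f\<in>Bv \<Omega>. \<bar>a * F f + c * G f\<bar> \<le> C * norm_Bv \<Omega> f"
    proof (intro exI[of _ "\<bar>a\<bar> * C + \<bar>c\<bar> * D"] ballI)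
      fix f assume f: "f \<in> Bv \<Omega>"
      have "\<bar>a * F f + c * G f\<bar> \<le> \<bar>a\<bar> * \<bar>F f\<bar> + \<bar>c\<bar> * \<bar>G f\<bar>" by (metis abs_mult abs_triangle_ineq)
      also have "\<dots> \<le> \<bar>a\<bar> * (C * norm_Bv \<Omega> f) + \<bar>c\<bar> * (D * norm_Bv \<Omega> f)"
        using C D f by (intro add_mono mult_left_mono) auto
      finally show "\<bar>a * F f + c * G f\<bar> \<le> (\<bar>a\<bar> * C + \<bar>c\<bar> * D) * norm_Bv \<Omega> f" by (simp add: algebra_simps)
    qed
  next
    fix f assume "f \<notin> Bv \<Omega>"
    then show "a * F f + c * G f = 0" using F G by (simp add: Bv_dual_def)
  qed
qed

lemma TrT_lincomb:
  assumes "open \<Omega>" "bounded \<Omega>" "H1_extension_domain \<Omega>" and u: "u \<in> H1v \<Omega>" and v: "v \<in> H1v \<Omega>"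
  shows "TrT \<Omega> (\<lambda>x. a *\<^sub>R u x + c *\<^sub>R v x) = (\<lambda>h. a * TrT \<Omega> u h + c * TrT \<Omega> v h)"
proof (rule TrT_eqI[OF assms(1-3)])
  show "(\<lambda>x. a *\<^sub>R u x + c *\<^sub>R v x) \<in> H1v \<Omega>" by (rule H1v_lincomb[OF assms(1) u v])
  show "(\<lambda>h. a * TrT \<Omega> u h + c * TrT \<Omega> v h) \<in> Bv_dual \<Omega>"
    by (intro Bv_dual_lincomb TrT assms)
  fix w assume w: "w \<in> H1v \<Omega>"
  show "a * TrT \<Omega> u (Trv \<Omega> w) + c * TrT \<Omega> v (Trv \<Omega> w) = stokes_form \<Omega> (\<lambda>x. a *\<^sub>R u x + c *\<^sub>R v x) w"
    using TrT(2)[OF assms(1-3) u w] TrT(2)[OF assms(1-3) v w] stokes_form_lincomb_left[OF assms(1) u v w] by simp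
qed

text \<open>In terms of b the kernel is an intersection of null spaces of bounded functionals, from
  which its linearity and closedness can be read off.\<close>

lemma ker_TrT_iff:
  assumes "open \<Omega>" "bounded \<Omega>" "H1_extension_domain \<Omega>"
  shows "u \<in> ker_TrT \<Omega> \<longleftrightarrow> u \<in> H1v \<Omega> \<and> (\<forall>v\<in>H1v \<Omega>. stokes_form \<Omega> u v = 0)"
proof -
  have z: "(\<lambda>f. 0) \<in> Bv_dual \<Omega>" by (auto simp: Bv_dual_def intro!: exI[of _ 0])
  show ?thesis
    unfolding ker_TrT_def using TrT[OF assms, of u] TrT_eqI[OF assms _ z, of u] by fastforce
qed

section \<open>Completeness and the optimal lift\<close>

lemma convergent_if_summable_increments:
  fixes a :: "nat \<Rightarrow> real"
  assumes "\<And>k. \<bar>a (Suc k) - a k\<bar> \<le> b k" "summable b"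
  shows "convergent a"
proof -
  have "summable (\<lambda>k. a (Suc k) - a k)"
    by (rule summable_comparison_test'[OF assms(2)]) (use assms(1) in auto)
  then have "convergent (\<lambda>n. \<Sum>k<n. a (Suc k) - a k)" by (simp add: summable_iff_convergent)
  then have "convergent (\<lambda>n. a n - a 0)" by (simp add: sum_lessThan_telescope)
  then show ?thesis using convergent_add_const_iff[of "- a 0" a] by simp
qed

text \<open>The weights \<open>2\<^sup>k\<close> turn summability of the squared distances of consecutive members into
  almost everywhere absolute convergence, without the triangle inequality in \<open>L\<^sup>2\<close>.\<close>

lemma L2_fast_Cauchy_AE_convergent:
  fixes f :: "nat \<Rightarrow> 'a \<Rightarrow> real"
  assumes f: "\<And>k. sqint M (f k)" and fast: "\<And>k. (LINT x|M. (f (Suc k) x - f k x)\<^sup>2) \<le> 1 / 8 ^ k"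
  shows "AE x in M. convergent (\<lambda>k. f k x)"
proof -
  define d where "d k x = 2 ^ k * (f (Suc k) x - f k x)\<^sup>2" for k x
  have sd: "sqint M (\<lambda>x. f (Suc k) x - f k x)" for k by (intro sqint_diff f)
  have id: "integrable M (d k)" for k unfolding d_def by (intro integrable_mult_right sqint_integrable sd)
  have "(LINT x|M. d k x) \<le> (1 / 4) ^ k" for k
  proof -
    have "(LINT x|M. d k x) = 2 ^ k * (LINT x|M. (f (Suc k) x - f k x)\<^sup>2)" by (simp add: d_def)
    also have "\<dots> \<le> 2 ^ k * (1 / 8 ^ k)" by (intro mult_left_mono fast) simp
    also have "\<dots> = (1 / 4) ^ k" by (simp add: power_divide[symmetric] power_mult_distrib[symmetric])
    finally show ?thesis .
  qed
  then have "summable (\<lambda>k. LINT x|M. norm (d k x))"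
    by (intro summable_comparison_test'[OF summable_geometric[of "1/4"], of 0]) (auto simp: d_def)
  then have "(\<integral>\<^sup>+x. (\<Sum>k. ennreal (d k x)) \<partial>M) \<noteq> \<infinity>"
  proof -
    assume s: "summable (\<lambda>k. LINT x|M. norm (d k x))"
    have "(\<integral>\<^sup>+x. (\<Sum>k. ennreal (d k x)) \<partial>M) = (\<Sum>k. \<integral>\<^sup>+x. ennreal (d k x) \<partial>M)"
      using id by (intro nn_integral_suminf) auto
    also have "\<dots> = (\<Sum>k. ennreal (LINT x|M. norm (d k x)))"
    proof (intro suminf_cong)
      fix k
      have "(\<integral>\<^sup>+x. ennreal (d k x) \<partial>M) = ennreal (LINT x|M. d k x)"
        by (rule nn_integral_eq_integral[OF id]) (simp add: d_def)
      then show "(\<integral>\<^sup>+x. ennreal (d k x) \<partial>M) = ennreal (LINT x|M. norm (d k x))" by (simp add: d_def)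
    qed
    also have "\<dots> = ennreal (\<Sum>k. LINT x|M. norm (d k x))"
      by (intro suminf_ennreal2 s) simp
    finally show ?thesis by simp
  qed
  then have "AE x in M. (\<Sum>k. ennreal (d k x)) \<noteq> \<infinity>"
    by (intro nn_integral_noteq_infinite) (use id in auto)
  then show ?thesis
  proof eventually_elim
    case (elim x)
    have sm: "summable (\<lambda>k. d k x)"
      by (rule summable_suminf_not_top) (use elim in \<open>auto simp: d_def\<close>)
    show ?case
    proof (rule convergent_if_summable_increments)
      show "summable (\<lambda>k. d k x + (1 / 2) ^ k)" using sm by (intro summable_add summable_geometric) auto
      fix k
      define z where "z = \<bar>f (Suc k) x - f k x\<bar>"
      \<comment> \<open>Expanding the square gives 2 z \<le> 2^k z^2 + 2^(-k): the first terms are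
        summable at almost every point, the second form a geometric series.\<close>
      have "0 \<le> 2 ^ k * (z - (1 / 2) ^ k)\<^sup>2" by simp
      also have "\<dots> = 2 ^ k * z\<^sup>2 - 2 * z * (2 ^ k * (1 / 2) ^ k) + (2 ^ k * (1 / 2) ^ k) * (1 / 2) ^ k"
        by (simp add: power2_eq_square algebra_simps)
      also have "(2::real) ^ k * (1 / 2) ^ k = 1" by (simp add: power_mult_distrib[symmetric])
      finally have "2 * z \<le> d k x + (1 / 2) ^ k" by (simp add: d_def z_def)
      moreover have "0 \<le> z" by (simp add: z_def)
      ultimately have "z \<le> d k x + (1 / 2) ^ k" by linarith
      then show "\<bar>f (Suc k) x - f k x\<bar> \<le> d k x + (1 / 2) ^ k" by (simp add: z_def)
    qed
  qed
qed

text \<open>A rapidly Cauchy subsequence converges almost everywhere, and Fatou along this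
  subsequence compares its limit with every late member of the original sequence.\<close>

lemma L2_complete:
  fixes f :: "nat \<Rightarrow> 'a \<Rightarrow> real"
  assumes f: "\<And>n. sqint M (f n)"
    and Cauchy: "\<And>e. e > 0 \<Longrightarrow> \<exists>N. \<forall>m\<ge>N. \<forall>n\<ge>N. (LINT x|M. (f m x - f n x)\<^sup>2) < e"
  shows "\<exists>g. sqint M g \<and> (\<lambda>n. LINT x|M. (f n x - g x)\<^sup>2) \<longlonglongrightarrow> 0"
proof -
  have "\<forall>k. \<exists>N. \<forall>m\<ge>N. \<forall>n\<ge>N. (LINT x|M. (f m x - f n x)\<^sup>2) < 1 / 8 ^ k" using Cauchy by simp
  from choice[OF this] obtain N where N: "\<And>k m n. m \<ge> N k \<Longrightarrow> n \<ge> N k \<Longrightarrow> (LINT x|M. (f m x - f n x)\<^sup>2) < 1 / 8 ^ k" by blast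
  \<comment> \<open>Adding \<open>k\<close> and summing makes the indices nondecreasing, at least
    \<open>k\<close>, and beyond the Cauchy threshold for 1/8^k.\<close>
  define r where "r k = k + (\<Sum>j\<le>k. N j)" for k
  have rN: "r k \<ge> N k" for k
  proof -
    have "N k \<le> (\<Sum>j\<le>k. N j)" by (rule member_le_sum) auto
    then show ?thesis by (simp add: r_def)
  qed
  have r1: "r (Suc k) \<ge> r k" for k by (simp add: r_def)
  have rk: "r k \<ge> k" for k by (simp add: r_def)
  have "AE x in M. convergent (\<lambda>k. f (r k) x)"
    by (rule L2_fast_Cauchy_AE_convergent[OF f]) (use N rN r1 order_trans in \<open>blast intro: less_imp_le\<close>)
  then have conv: "AE x in M. (\<lambda>k. f (r k) x) \<longlonglongrightarrow> lim (\<lambda>k. f (r k) x)"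
    by eventually_elim (simp add: convergent_LIMSEQ_iff)
  define g where "g x = lim (\<lambda>k. f (r k) x)" for x
  have fm [measurable]: "f n \<in> borel_measurable M" for n by (rule sqint_measurable[OF f])
  have gm [measurable]: "g \<in> borel_measurable M" unfolding g_def by measurable
  \<comment> \<open>Fatou for nonnegative extended integrals yields the integrability of the square
    and its bound together; neither is known of the pointwise limit beforehand.\<close>
  have fatou: "integrable M (\<lambda>x. (f n x - g x)\<^sup>2) \<and> (LINT x|M. (f n x - g x)\<^sup>2) \<le> e"
    if e: "e > 0" and n: "\<And>m. m \<ge> K \<Longrightarrow> (LINT x|M. (f n x - f m x)\<^sup>2) \<le> e" for n K e
  proof -
    have "(\<integral>\<^sup>+x. ennreal ((f n x - g x)\<^sup>2) \<partial>M) = (\<integral>\<^sup>+x. liminf (\<lambda>k. ennreal ((f n x - f (r k) x)\<^sup>2)) \<partial>M)"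
    proof (rule nn_integral_cong_AE)
      show "AE x in M. ennreal ((f n x - g x)\<^sup>2) = liminf (\<lambda>k. ennreal ((f n x - f (r k) x)\<^sup>2))"
        using conv
      proof eventually_elim
        case (elim x)
        have "(\<lambda>k. ennreal ((f n x - f (r k) x)\<^sup>2)) \<longlonglongrightarrow> ennreal ((f n x - g x)\<^sup>2)"
          by (intro tendsto_ennrealI tendsto_intros) (use elim in \<open>simp add: g_def\<close>)
        then show ?case using lim_imp_Liminf[OF sequentially_bot] by metis
      qed
    qed
    also have "\<dots> \<le> liminf (\<lambda>k. \<integral>\<^sup>+x. ennreal ((f n x - f (r k) x)\<^sup>2) \<partial>M)"
      by (rule nn_integral_liminf) measurable
    also have "\<dots> \<le> liminf (\<lambda>k::nat. ennreal e)"
    proof (rule Liminf_mono)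
      show "\<forall>\<^sub>F k in sequentially. (\<integral>\<^sup>+x. ennreal ((f n x - f (r k) x)\<^sup>2) \<partial>M) \<le> ennreal e"
        using eventually_ge_at_top[of K]
      proof eventually_elim
        case (elim k)
        have "(\<integral>\<^sup>+x. ennreal ((f n x - f (r k) x)\<^sup>2) \<partial>M) = ennreal (LINT x|M. (f n x - f (r k) x)\<^sup>2)"
          by (intro nn_integral_eq_integral sqint_integrable sqint_diff f) auto
        also have "\<dots> \<le> ennreal e" using n[of "r k"] rk[of k] elim by (intro ennreal_leI) auto
        finally show ?case .
      qed
    qed
    also have "\<dots> = ennreal e" by (simp add: Liminf_const)
    finally have b: "(\<integral>\<^sup>+x. ennreal ((f n x - g x)\<^sup>2) \<partial>M) \<le> ennreal e" .
    have i: "integrable M (\<lambda>x. (f n x - g x)\<^sup>2)"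
      by (rule integrableI_bounded) (use b in \<open>auto intro: le_less_trans\<close>)
    have "ennreal (LINT x|M. (f n x - g x)\<^sup>2) = (\<integral>\<^sup>+x. ennreal ((f n x - g x)\<^sup>2) \<partial>M)"
      by (rule nn_integral_eq_integral[symmetric, OF i]) simp
    then have "ennreal (LINT x|M. (f n x - g x)\<^sup>2) \<le> ennreal e" using b by simp
    then show ?thesis using i e by (subst (asm) ennreal_le_iff) auto
  qed
  have lim: "\<exists>K. \<forall>n\<ge>K. integrable M (\<lambda>x. (f n x - g x)\<^sup>2) \<and> (LINT x|M. (f n x - g x)\<^sup>2) \<le> e" if e: "e > 0" for e
  proof -
    obtain K where K: "\<forall>m\<ge>K. \<forall>n\<ge>K. (LINT x|M. (f m x - f n x)\<^sup>2) < e" using Cauchy[OF e] by blast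
    show ?thesis
    proof (intro exI allI impI)
      fix n assume "n \<ge> K"
      then show "integrable M (\<lambda>x. (f n x - g x)\<^sup>2) \<and> (LINT x|M. (f n x - g x)\<^sup>2) \<le> e"
        using K by (intro fatou[OF e, of K]) (auto intro: less_imp_le)
    qed
  qed
  obtain K where "integrable M (\<lambda>x. (f K x - g x)\<^sup>2)" using lim[of 1] by auto
  then have "sqint M (\<lambda>x. f K x - g x)" by (simp add: sqint_def)
  from sqint_diff[OF f this, of K] have "sqint M g" by simp
  moreover have "(\<lambda>n. LINT x|M. (f n x - g x)\<^sup>2) \<longlonglongrightarrow> 0"
  proof (rule LIMSEQ_I)
    fix e :: real assume e: "e > 0"
    obtain K where K: "\<forall>n\<ge>K. integrable M (\<lambda>x. (f n x - g x)\<^sup>2) \<and> (LINT x|M. (f n x - g x)\<^sup>2) \<le> e / 2"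
      using lim[of "e / 2"] e by auto
    show "\<exists>K. \<forall>n\<ge>K. norm ((LINT x|M. (f n x - g x)\<^sup>2) - 0) < e"
    proof (intro exI[of _ K] allI impI)
      fix n assume "n \<ge> K"
      then have "(LINT x|M. (f n x - g x)\<^sup>2) \<le> e / 2" using K by blast
      then show "norm ((LINT x|M. (f n x - g x)\<^sup>2) - 0) < e" using e by simp
    qed
  qed
  ultimately show ?thesis by blast
qed

lemma integral_product_tendsto:
  assumes f: "\<And>n. sqint M (f n)" and g: "sqint M g" and h: "sqint M h" and lim: "(\<lambda>n. LINT x|M. (f n x - g x)\<^sup>2) \<longlonglongrightarrow> 0"
  shows "(\<lambda>n. LINT x|M. f n x * h x) \<longlonglongrightarrow> (LINT x|M. g x * h x)"
proof -
  have "(\<lambda>n. sqrt (LINT x|M. (f n x - g x)\<^sup>2) * sqrt (LINT x|M. (h x)\<^sup>2)) \<longlonglongrightarrow> sqrt 0 * sqrt (LINT x|M. (h x)\<^sup>2)"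
    by (intro tendsto_mult tendsto_real_sqrt lim tendsto_const)
  then have 0: "(\<lambda>n. sqrt (LINT x|M. (f n x - g x)\<^sup>2) * sqrt (LINT x|M. (h x)\<^sup>2)) \<longlonglongrightarrow> 0" by simp
  have "norm ((LINT x|M. f n x * h x) - (LINT x|M. g x * h x)) \<le> sqrt (LINT x|M. (f n x - g x)\<^sup>2) * sqrt (LINT x|M. (h x)\<^sup>2)" for n
  proof -
    have "(LINT x|M. f n x * h x) - (LINT x|M. g x * h x) = (LINT x|M. (f n x - g x) * h x)"
      using sqint_mult[OF f h] sqint_mult[OF g h] by (simp add: left_diff_distrib)
    then show ?thesis using integral_Cauchy_Schwarz[OF sqint_diff[OF f g] h] by simp
  qed
  then have "(\<lambda>n. (LINT x|M. f n x * h x) - (LINT x|M. g x * h x)) \<longlonglongrightarrow> 0"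
    by (intro Lim_null_comparison[OF _ 0] always_eventually allI)
  then show ?thesis by (simp add: LIM_zero_iff)
qed

lemma norm_H1_diff_sq:
  assumes "open \<Omega>" "u \<in> H1 \<Omega>" "v \<in> H1 \<Omega>"
  shows "(norm_H1 \<Omega> (\<lambda>x. u x - v x))\<^sup>2 = (LINT x|lebesgue_on \<Omega>. (u x - v x)\<^sup>2) +
    (\<Sum>i\<in>UNIV. LINT x|lebesgue_on \<Omega>. (wderiv \<Omega> i u x - wderiv \<Omega> i v x)\<^sup>2)"
proof -
  have H: "(\<lambda>x. u x - v x) \<in> H1 \<Omega>" using H1_lincomb(1)[OF assms, of 1 "-1"] by simp
  have "(LINT x|lebesgue_on \<Omega>. (wderiv \<Omega> i (\<lambda>x. u x - v x) x)\<^sup>2) = (LINT x|lebesgue_on \<Omega>. (wderiv \<Omega> i u x - wderiv \<Omega> i v x)\<^sup>2)" for i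
  proof (rule integral_cong_AE)
    show "AE x in lebesgue_on \<Omega>. (wderiv \<Omega> i (\<lambda>x. u x - v x) x)\<^sup>2 = (wderiv \<Omega> i u x - wderiv \<Omega> i v x)\<^sup>2"
    proof -
      have "AE x in lebesgue_on \<Omega>. wderiv \<Omega> i (\<lambda>x. u x - v x) x = wderiv \<Omega> i u x - wderiv \<Omega> i v x"
        using H1_lincomb(2)[OF assms, of i 1 "-1"] by simp
      then show ?thesis by eventually_elim simp
    qed
  qed (intro borel_measurable_power borel_measurable_diff sqint_measurable H1_sqint H assms)+
  then show ?thesis by (simp add: norm_H1_sq)
qed

lemma H1_complete:
  assumes "open \<Omega>" and u: "\<And>n. u n \<in> H1 \<Omega>"
    and Cauchy: "\<And>e. e > 0 \<Longrightarrow> \<exists>N. \<forall>m\<ge>N. \<forall>n\<ge>N. (norm_H1 \<Omega> (\<lambda>x. u m x - u n x))\<^sup>2 < e"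
  shows "\<exists>v\<in>H1 \<Omega>. (\<lambda>n. (norm_H1 \<Omega> (\<lambda>x. u n x - v x))\<^sup>2) \<longlonglongrightarrow> 0"
proof -
  have m: "\<Omega> \<in> sets lebesgue" using assms(1) by auto
  note s = H1_sqint[OF u]
  have le: "(LINT x|lebesgue_on \<Omega>. (u m x - u n x)\<^sup>2) \<le> (norm_H1 \<Omega> (\<lambda>x. u m x - u n x))\<^sup>2"
    "(LINT x|lebesgue_on \<Omega>. (wderiv \<Omega> i (u m) x - wderiv \<Omega> i (u n) x)\<^sup>2) \<le> (norm_H1 \<Omega> (\<lambda>x. u m x - u n x))\<^sup>2" for m n i
  proof -
    have "(LINT x|lebesgue_on \<Omega>. (wderiv \<Omega> i (u m) x - wderiv \<Omega> i (u n) x)\<^sup>2) \<le>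
      (\<Sum>i\<in>UNIV. LINT x|lebesgue_on \<Omega>. (wderiv \<Omega> i (u m) x - wderiv \<Omega> i (u n) x)\<^sup>2)"
      by (rule member_le_sum) auto
    then show "(LINT x|lebesgue_on \<Omega>. (u m x - u n x)\<^sup>2) \<le> (norm_H1 \<Omega> (\<lambda>x. u m x - u n x))\<^sup>2"
      "(LINT x|lebesgue_on \<Omega>. (wderiv \<Omega> i (u m) x - wderiv \<Omega> i (u n) x)\<^sup>2) \<le> (norm_H1 \<Omega> (\<lambda>x. u m x - u n x))\<^sup>2"
      unfolding norm_H1_diff_sq[OF assms(1) u u] by (auto intro!: sum_nonneg add_increasing)
  qed
  have "\<exists>g. sqint (lebesgue_on \<Omega>) g \<and> (\<lambda>n. LINT x|lebesgue_on \<Omega>. (u n x - g x)\<^sup>2) \<longlonglongrightarrow> 0"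
  proof (rule L2_complete[OF s(1)])
    fix e :: real assume "e > 0"
    then obtain N where "\<forall>m\<ge>N. \<forall>n\<ge>N. (norm_H1 \<Omega> (\<lambda>x. u m x - u n x))\<^sup>2 < e" using Cauchy by blast
    then show "\<exists>N. \<forall>m\<ge>N. \<forall>n\<ge>N. (LINT x|lebesgue_on \<Omega>. (u m x - u n x)\<^sup>2) < e" using le(1) le_less_trans by blast
  qed
  then obtain v where v: "sqint (lebesgue_on \<Omega>) v" "(\<lambda>n. LINT x|lebesgue_on \<Omega>. (u n x - v x)\<^sup>2) \<longlonglongrightarrow> 0" by blast
  have "\<exists>g. sqint (lebesgue_on \<Omega>) g \<and> (\<lambda>n. LINT x|lebesgue_on \<Omega>. (wderiv \<Omega> i (u n) x - g x)\<^sup>2) \<longlonglongrightarrow> 0" for i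
  proof (rule L2_complete[OF s(2)])
    fix e :: real assume "e > 0"
    then obtain N where "\<forall>m\<ge>N. \<forall>n\<ge>N. (norm_H1 \<Omega> (\<lambda>x. u m x - u n x))\<^sup>2 < e" using Cauchy by blast
    then show "\<exists>N. \<forall>m\<ge>N. \<forall>n\<ge>N. (LINT x|lebesgue_on \<Omega>. (wderiv \<Omega> i (u m) x - wderiv \<Omega> i (u n) x)\<^sup>2) < e" using le(2) le_less_trans by blast
  qed
  then have "\<forall>i. \<exists>g. sqint (lebesgue_on \<Omega>) g \<and> (\<lambda>n. LINT x|lebesgue_on \<Omega>. (wderiv \<Omega> i (u n) x - g x)\<^sup>2) \<longlonglongrightarrow> 0" ..
  from choice[OF this] obtain g where g: "\<And>i. sqint (lebesgue_on \<Omega>) (g i)" "\<And>i. (\<lambda>n. LINT x|lebesgue_on \<Omega>. (wderiv \<Omega> i (u n) x - g i x)\<^sup>2) \<longlonglongrightarrow> 0" by blast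
  \<comment> \<open>The defining identity involves one fixed test function at a time, so L2
    convergence of the functions and of their derivatives carries it to the limit.\<close>
  have w: "is_weak_deriv \<Omega> i v (g i)" for i
    unfolding is_weak_deriv_def
  proof
    fix \<phi> assume t: "\<phi> \<in> test_fun \<Omega>"
    note st = sqint_test_fun_on[OF t m]
    have "(\<lambda>n. LINT x|lebesgue_on \<Omega>. u n x * partial i \<phi> x) \<longlonglongrightarrow> (LINT x|lebesgue_on \<Omega>. v x * partial i \<phi> x)"
      by (rule integral_product_tendsto[OF s(1) v(1) st(2) v(2)])
    moreover have "(\<lambda>n. - (LINT x|lebesgue_on \<Omega>. wderiv \<Omega> i (u n) x * \<phi> x)) \<longlonglongrightarrow> - (LINT x|lebesgue_on \<Omega>. g i x * \<phi> x)"
      by (intro tendsto_minus integral_product_tendsto[OF s(2) g(1) st(1) g(2)])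
    moreover have "(LINT x|lebesgue_on \<Omega>. u n x * partial i \<phi> x) = - (LINT x|lebesgue_on \<Omega>. wderiv \<Omega> i (u n) x * \<phi> x)" for n
      using bspec[OF wderiv(2)[OF u, unfolded is_weak_deriv_def] t] .
    ultimately show "(LINT x|lebesgue_on \<Omega>. v x * partial i \<phi> x) = - (LINT x|lebesgue_on \<Omega>. g i x * \<phi> x)"
      using LIMSEQ_unique by simp
  qed
  have "v \<in> L2 \<Omega>" "g i \<in> L2 \<Omega>" for i using v(1) g(1) by (simp_all add: L2_iff_sqint)
  then have vH: "v \<in> H1 \<Omega>" unfolding H1_def using w by blast
  have "(LINT x|lebesgue_on \<Omega>. (wderiv \<Omega> i (u n) x - wderiv \<Omega> i v x)\<^sup>2) = (LINT x|lebesgue_on \<Omega>. (wderiv \<Omega> i (u n) x - g i x)\<^sup>2)" for i n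
  proof (rule integral_cong_AE)
    have "AE x in lebesgue_on \<Omega>. wderiv \<Omega> i v x = g i x"
      by (rule wderiv_unique[OF assms(1) vH _ w]) (use g(1) in \<open>simp add: L2_iff_sqint\<close>)
    then show "AE x in lebesgue_on \<Omega>. (wderiv \<Omega> i (u n) x - wderiv \<Omega> i v x)\<^sup>2 = (wderiv \<Omega> i (u n) x - g i x)\<^sup>2"
      by eventually_elim simp
  qed (intro borel_measurable_power borel_measurable_diff sqint_measurable[OF s(2)] sqint_measurable[OF g(1)] sqint_measurable[OF H1_sqint(2)[OF vH]])+
  then have "(norm_H1 \<Omega> (\<lambda>x. u n x - v x))\<^sup>2 = (LINT x|lebesgue_on \<Omega>. (u n x - v x)\<^sup>2) +
    (\<Sum>i\<in>UNIV. LINT x|lebesgue_on \<Omega>. (wderiv \<Omega> i (u n) x - g i x)\<^sup>2)" for n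
    by (simp add: norm_H1_diff_sq[OF assms(1) u vH])
  moreover have "(\<lambda>n. (LINT x|lebesgue_on \<Omega>. (u n x - v x)\<^sup>2) +
    (\<Sum>i\<in>(UNIV::3 set). LINT x|lebesgue_on \<Omega>. (wderiv \<Omega> i (u n) x - g i x)\<^sup>2)) \<longlonglongrightarrow> 0 + (\<Sum>i\<in>(UNIV::3 set). 0)"
    by (intro tendsto_add tendsto_sum v(2) g(2))
  ultimately have "(\<lambda>n. (norm_H1 \<Omega> (\<lambda>x. u n x - v x))\<^sup>2) \<longlonglongrightarrow> 0" by simp
  then show ?thesis using vH by blast
qed

lemma inner_H1v_diff:
  "inner_H1v \<Omega> (\<lambda>x. u x - v x) (\<lambda>x. u x - v x) = (\<Sum>k\<in>UNIV. (norm_H1 \<Omega> (\<lambda>x. component u k x - component v k x))\<^sup>2)"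
  by (simp add: inner_H1v_def norm_H1_def inner_H1_nonneg)

lemma H1v_complete:
  assumes "open \<Omega>" and u: "\<And>n. u n \<in> H1v \<Omega>"
    and Cauchy: "\<And>e. e > 0 \<Longrightarrow> \<exists>N. \<forall>m\<ge>N. \<forall>n\<ge>N. inner_H1v \<Omega> (\<lambda>x. u m x - u n x) (\<lambda>x. u m x - u n x) < e"
  shows "\<exists>v\<in>H1v \<Omega>. (\<lambda>n. inner_H1v \<Omega> (\<lambda>x. u n x - v x) (\<lambda>x. u n x - v x)) \<longlonglongrightarrow> 0"
proof -
  have "\<exists>v\<in>H1 \<Omega>. (\<lambda>n. (norm_H1 \<Omega> (\<lambda>x. component (u n) k x - v x))\<^sup>2) \<longlonglongrightarrow> 0" for k
  proof (rule H1_complete[OF assms(1)])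
    show "component (u n) k \<in> H1 \<Omega>" for n by (rule H1v_component[OF u])
    fix e :: real assume "e > 0"
    then obtain N where N: "\<forall>m\<ge>N. \<forall>n\<ge>N. inner_H1v \<Omega> (\<lambda>x. u m x - u n x) (\<lambda>x. u m x - u n x) < e" using Cauchy by blast
    have "(norm_H1 \<Omega> (\<lambda>x. component (u m) k x - component (u n) k x))\<^sup>2 \<le> inner_H1v \<Omega> (\<lambda>x. u m x - u n x) (\<lambda>x. u m x - u n x)" for m n
      unfolding inner_H1v_diff by (rule member_le_sum) auto
    then show "\<exists>N. \<forall>m\<ge>N. \<forall>n\<ge>N. (norm_H1 \<Omega> (\<lambda>x. component (u m) k x - component (u n) k x))\<^sup>2 < e"
      using N le_less_trans by blast
  qed
  then have "\<forall>k. \<exists>v. v \<in> H1 \<Omega> \<and> (\<lambda>n. (norm_H1 \<Omega> (\<lambda>x. component (u n) k x - v x))\<^sup>2) \<longlonglongrightarrow> 0" by blast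
  from choice[OF this] obtain V where V: "\<And>k. V k \<in> H1 \<Omega>" "\<And>k. (\<lambda>n. (norm_H1 \<Omega> (\<lambda>x. component (u n) k x - V k x))\<^sup>2) \<longlonglongrightarrow> 0" by blast
  define v where "v x = (\<chi> k. V k x)" for x
  have c: "component v k = V k" for k by (simp add: v_def fun_eq_iff)
  have "(\<lambda>n. \<Sum>k\<in>(UNIV::3 set). (norm_H1 \<Omega> (\<lambda>x. component (u n) k x - V k x))\<^sup>2) \<longlonglongrightarrow> (\<Sum>k\<in>(UNIV::3 set). 0)"
    by (intro tendsto_sum V(2))
  then have "(\<lambda>n. inner_H1v \<Omega> (\<lambda>x. u n x - v x) (\<lambda>x. u n x - v x)) \<longlonglongrightarrow> 0"
    unfolding inner_H1v_diff by (simp add: v_def)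
  moreover have "component v k \<in> H1 \<Omega>" for k unfolding c by (rule V(1))
  then have "v \<in> H1v \<Omega>" unfolding H1v_def by blast
  ultimately show ?thesis by blast
qed

text \<open>The orthogonal projection theorem for a positive semidefinite form on a carrier set; \<open>lc\<close> is
  the operation of forming linear combinations.\<close>

lemma projection_exists:
  fixes lc :: "real \<Rightarrow> 'a \<Rightarrow> real \<Rightarrow> 'a \<Rightarrow> 'a" and ip :: "'a \<Rightarrow> 'a \<Rightarrow> real"
  assumes V: "\<And>a u c v. u \<in> V \<Longrightarrow> v \<in> V \<Longrightarrow> lc a u c v \<in> V"
    and lin: "\<And>a u c v w. u \<in> V \<Longrightarrow> v \<in> V \<Longrightarrow> w \<in> V \<Longrightarrow> ip (lc a u c v) w = a * ip u w + c * ip v w"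
    and sym: "\<And>u v. ip u v = ip v u" and pos: "\<And>u. 0 \<le> ip u u"
    and K: "K \<subseteq> V" "K \<noteq> {}" "\<And>a u c v. u \<in> K \<Longrightarrow> v \<in> K \<Longrightarrow> lc a u c v \<in> K"
    and complete: "\<And>k :: nat \<Rightarrow> 'a. (\<And>n. k n \<in> K) \<Longrightarrow>
      (\<And>e. e > 0 \<Longrightarrow> \<exists>N. \<forall>m\<ge>N. \<forall>n\<ge>N. ip (lc 1 (k m) (- 1) (k n)) (lc 1 (k m) (- 1) (k n)) < e) \<Longrightarrow>
      \<exists>l\<in>K. (\<lambda>n. ip (lc 1 (k n) (- 1) l) (lc 1 (k n) (- 1) l)) \<longlonglongrightarrow> 0"
    and u: "u \<in> V"
  shows "\<exists>k\<in>K. \<forall>h\<in>K. ip (lc 1 u (- 1) k) h = 0"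
proof -
  have linr: "ip w (lc a u c v) = a * ip w u + c * ip w v" if "u \<in> V" "v \<in> V" "w \<in> V" for a u c v w
    using lin[OF that, of a c] sym by metis
  have KV: "k \<in> V" if "k \<in> K" for k using that K(1) by auto
  define q where "q v = ip v v" for v
  have ql: "q (lc a v c w) = a\<^sup>2 * q v + 2 * a * c * ip v w + c\<^sup>2 * q w" if "v \<in> V" "w \<in> V" for a v c w
    using that V[OF that, of a c] by (simp add: q_def lin linr sym[of w v] power2_eq_square algebra_simps)
  define S where "S = {q (lc 1 u (- 1) k) | k. k \<in> K}"
  define d where "d = Inf S"
  have Sne: "S \<noteq> {}" using K(2) by (auto simp: S_def)
  have Sbd: "bdd_below S" by (rule bdd_belowI[of _ 0]) (auto simp: S_def q_def pos)
  have dle: "d \<le> q (lc 1 u (- 1) k)" if "k \<in> K" for k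
    unfolding d_def by (rule cInf_lower[OF _ Sbd]) (use that in \<open>auto simp: S_def\<close>)
  have "\<forall>n. \<exists>k. k \<in> K \<and> q (lc 1 u (- 1) k) < d + 1 / real (Suc n)"
  proof
    fix n
    have "Inf S < d + 1 / real (Suc n)" by (simp add: d_def)
    from cInf_lessD[OF Sne this] show "\<exists>k. k \<in> K \<and> q (lc 1 u (- 1) k) < d + 1 / real (Suc n)" by (auto simp: S_def)
  qed
  from choice[OF this] obtain k where k: "\<And>n. k n \<in> K" "\<And>n. q (lc 1 u (- 1) (k n)) < d + 1 / real (Suc n)" by blast
  have par: "q (lc 1 (k m) (- 1) (k n)) \<le> 2 / real (Suc m) + 2 / real (Suc n)" for m n
  proof -
    \<comment> \<open>The midpoint stays in \<open>K\<close>, so its squared distance to u is at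
      least \<open>d\<close>; by the parallelogram identity near-minimal points are then close to
      each other.\<close>
    define mid where "mid = lc (1/2) (k m) (1/2) (k n)"
    have mid: "mid \<in> K" unfolding mid_def by (intro K k)
    note kv = KV[OF k(1)[of m]] KV[OF k(1)[of n]]
    have "q (lc 1 (k m) (- 1) (k n)) = 2 * q (lc 1 u (- 1) (k m)) + 2 * q (lc 1 u (- 1) (k n)) - 4 * q (lc 1 u (- 1) mid)"
      using kv u KV[OF mid] unfolding ql[OF kv] ql[OF u kv(1)] ql[OF u kv(2)] ql[OF u KV[OF mid]]
      unfolding mid_def ql[OF kv] linr[OF kv u] by (simp add: power2_eq_square algebra_simps)
    also have "\<dots> \<le> 2 / real (Suc m) + 2 / real (Suc n)"
      using k(2)[of m] k(2)[of n] dle[OF mid] by simp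
    finally show ?thesis .
  qed
  have "\<exists>l\<in>K. (\<lambda>n. ip (lc 1 (k n) (- 1) l) (lc 1 (k n) (- 1) l)) \<longlonglongrightarrow> 0"
  proof (rule complete[OF k(1)])
    fix e :: real assume e: "e > 0"
    obtain N where N: "4 / e < real N" using reals_Archimedean2 by blast
    have "ip (lc 1 (k m) (- 1) (k n)) (lc 1 (k m) (- 1) (k n)) < e" if "m \<ge> N" "n \<ge> N" for m n
    proof -
      have b: "2 / real (Suc j) < e / 2" if "j \<ge> N" for j
      proof -
        have "4 / e < real (Suc j)" using N that by linarith
        then show ?thesis using e by (simp add: field_simps)
      qed
      show ?thesis using par[of m n] b[OF that(1)] b[OF that(2)] by (simp add: q_def)
    qed
    then show "\<exists>N. \<forall>m\<ge>N. \<forall>n\<ge>N. ip (lc 1 (k m) (- 1) (k n)) (lc 1 (k m) (- 1) (k n)) < e" by blast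
  qed
  then obtain l where l: "l \<in> K" "(\<lambda>n. q (lc 1 (k n) (- 1) l)) \<longlonglongrightarrow> 0" by (auto simp: q_def)
  have "ip (lc 1 u (- 1) l) h = 0" if h: "h \<in> K" for h
  proof -
    note hV = KV[OF h] and lV = KV[OF l(1)]
    define \<xi> where "\<xi> = ip (lc 1 u (- 1) l) h"
    define x where "x n = ip (lc 1 u (- 1) (k n)) h" for n
    have dx: "x n - \<xi> = - ip (lc 1 (k n) (- 1) l) h" for n
      using KV[OF k(1)[of n]] hV lV u by (simp add: x_def \<xi>_def lin)
    \<comment> \<open>Cauchy-Schwarz with q h + 1 in place of q h, so that division is possible also
      where the semidefinite form vanishes.\<close>
    have cs: "(ip v h)\<^sup>2 \<le> q v * (q h + 1)" if v: "v \<in> V" for v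
    proof -
      have "0 \<le> q (lc (q h + 1) v (- ip v h) h)" by (simp add: q_def pos)
      also have "\<dots> = (q h + 1) * ((q h + 1) * q v) - 2 * (q h + 1) * (ip v h)\<^sup>2 + (ip v h)\<^sup>2 * q h"
        unfolding ql[OF v hV] by (simp add: power2_eq_square algebra_simps)
      also have "\<dots> \<le> (q h + 1) * ((q h + 1) * q v - (ip v h)\<^sup>2)"
        by (simp add: algebra_simps)
      finally show ?thesis using pos[of h] by (simp add: q_def[symmetric] zero_le_mult_iff mult.commute)
    qed
    have "(\<lambda>n. sqrt (q (lc 1 (k n) (- 1) l) * (q h + 1))) \<longlonglongrightarrow> sqrt (0 * (q h + 1))"
      by (intro tendsto_intros l(2))
    then have 0: "(\<lambda>n. sqrt (q (lc 1 (k n) (- 1) l) * (q h + 1))) \<longlonglongrightarrow> 0" by simp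
    have "norm (x n - \<xi>) \<le> sqrt (q (lc 1 (k n) (- 1) l) * (q h + 1))" for n
      using real_sqrt_le_mono[OF cs[OF V[OF KV[OF k(1)[of n]] lV, of 1 "-1"]]] unfolding dx by simp
    then have "(\<lambda>n. x n - \<xi>) \<longlonglongrightarrow> 0" by (intro Lim_null_comparison[OF _ 0] always_eventually allI)
    then have xl: "x \<longlonglongrightarrow> \<xi>" by (simp add: LIM_zero_iff)
    \<comment> \<open>Minimality is tested against k n + s h; the error 1/(n + 1) of near-minimality
      disappears in the limit.\<close>
    have sb: "2 * s * \<xi> \<le> s\<^sup>2 * q h" for s
    proof (rule LIMSEQ_le)
      show "(\<lambda>n. 2 * s * x n) \<longlonglongrightarrow> 2 * s * \<xi>" by (intro tendsto_intros xl)
      have "(\<lambda>n. inverse (real (Suc n)) + s\<^sup>2 * q h) \<longlonglongrightarrow> 0 + s\<^sup>2 * q h"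
        by (intro tendsto_add LIMSEQ_inverse_real_of_nat tendsto_const)
      then show "(\<lambda>n. inverse (real (Suc n)) + s\<^sup>2 * q h) \<longlonglongrightarrow> s\<^sup>2 * q h" by simp
      have "2 * s * x n \<le> inverse (real (Suc n)) + s\<^sup>2 * q h" for n
      proof -
        note kV = KV[OF k(1)[of n]]
        have m: "lc 1 (k n) s h \<in> K" by (intro K k h)
        have "d \<le> q (lc 1 u (- 1) (lc 1 (k n) s h))" by (rule dle[OF m])
        also have "\<dots> = q (lc 1 u (- 1) (k n)) - 2 * s * x n + s\<^sup>2 * q h"
          unfolding ql[OF u KV[OF m]] ql[OF kV hV] linr[OF kV hV u] ql[OF u kV] x_def lin[OF u kV hV]
          by (simp add: algebra_simps)
        finally show ?thesis using k(2)[of n] by (simp add: inverse_eq_divide)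
      qed
      then show "\<exists>N. \<forall>n\<ge>N. 2 * s * x n \<le> inverse (real (Suc n)) + s\<^sup>2 * q h" by blast
    qed
    have "\<xi> = 0"
    proof (rule ccontr)
      assume nz: "\<xi> \<noteq> 0"
      have qh: "0 \<le> q h" by (simp add: q_def pos)
      \<comment> \<open>This s makes the left side exceed the right side by at least \<xi>^2 / (q h
        + 1), which is impossible unless \<xi> = 0.\<close>
      have "2 * (\<xi> / (q h + 1)) * \<xi> \<le> (\<xi> / (q h + 1))\<^sup>2 * q h" by (rule sb)
      also have "\<dots> = (\<xi> / (q h + 1)) * \<xi> * (q h / (q h + 1))" by (simp add: power2_eq_square)
      also have "\<dots> \<le> (\<xi> / (q h + 1)) * \<xi> * 1"
        using qh by (intro mult_left_mono) auto
      finally have "(\<xi> / (q h + 1)) * \<xi> \<le> 0" by simp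
      moreover have "(\<xi> / (q h + 1)) * \<xi> > 0" using nz qh by (simp add: zero_less_mult_iff zero_less_divide_iff divide_less_0_iff) linarith
      ultimately show False by simp
    qed
    then show ?thesis by (simp add: \<xi>_def)
  qed
  then show ?thesis using l(1) by blast
qed

section \<open>Optimal lifts and the tangential component trace\<close>

lemma inner_H1v_lincomb_left:
  assumes "open \<Omega>" "u \<in> H1v \<Omega>" "v \<in> H1v \<Omega>" "w \<in> H1v \<Omega>"
  shows "inner_H1v \<Omega> (\<lambda>x. a *\<^sub>R u x + c *\<^sub>R v x) w = a * inner_H1v \<Omega> u w + c * inner_H1v \<Omega> v w"
  using inner_H1_lincomb_left[OF assms(1) H1v_component[OF assms(2)] H1v_component[OF assms(3)] H1v_component[OF assms(4)]]
  by (simp add: inner_H1v_def sum.distrib sum_distrib_left)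

lemma inner_H1v_commute: "inner_H1v \<Omega> u v = inner_H1v \<Omega> v u"
  unfolding inner_H1v_def by (intro sum.cong inner_H1_commute refl)

text \<open>Subtracting from any lift its projection onto the kernel leaves the tangential trace
  unchanged and lands in \<open>K_perp\<close>. The projection exists because the kernel is a closed
  subspace of a complete space.\<close>

lemma optimal_lift:
  assumes "open \<Omega>" "bounded \<Omega>" "H1_extension_domain \<Omega>" and f: "f \<in> B_perp \<Omega>"
  shows "optimal_lift \<Omega> f \<in> H1v \<Omega>" "TrT \<Omega> (optimal_lift \<Omega> f) = f"
proof -
  obtain u where u: "u \<in> H1v \<Omega>" "f = TrT \<Omega> u" using f by (auto simp: B_perp_def)
  note ker = ker_TrT_iff[OF assms(1-3)]
  have "\<exists>k\<in>ker_TrT \<Omega>. \<forall>h\<in>ker_TrT \<Omega>. inner_H1v \<Omega> (\<lambda>x. 1 *\<^sub>R u x + (- 1) *\<^sub>R k x) h = 0"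
  proof (rule projection_exists[where V = "H1v \<Omega>" and lc = "\<lambda>a u c v x. a *\<^sub>R u x + c *\<^sub>R v x"])
    show "ker_TrT \<Omega> \<noteq> {}"
    proof -
      have "stokes_form \<Omega> (\<lambda>x. 0) v = 0" if "v \<in> H1v \<Omega>" for v
        using stokes_form_lincomb_left[OF assms(1) zero_H1v zero_H1v that, of 0 0] by simp
      then show ?thesis using ker zero_H1v by blast
    qed
    show "(\<lambda>x. a *\<^sub>R k x + c *\<^sub>R l x) \<in> ker_TrT \<Omega>" if "k \<in> ker_TrT \<Omega>" "l \<in> ker_TrT \<Omega>" for a k c l
      using that by (auto simp: ker stokes_form_lincomb_left[OF assms(1)] H1v_lincomb[OF assms(1)])
    show "\<exists>l\<in>ker_TrT \<Omega>. (\<lambda>n. inner_H1v \<Omega> (\<lambda>x. 1 *\<^sub>R k n x + (- 1) *\<^sub>R l x) (\<lambda>x. 1 *\<^sub>R k n x + (- 1) *\<^sub>R l x)) \<longlonglongrightarrow> 0"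
      if k: "\<And>n. k n \<in> ker_TrT \<Omega>"
        and C: "\<And>e. e > 0 \<Longrightarrow> \<exists>N. \<forall>m\<ge>N. \<forall>n\<ge>N. inner_H1v \<Omega> (\<lambda>x. 1 *\<^sub>R k m x + (- 1) *\<^sub>R k n x) (\<lambda>x. 1 *\<^sub>R k m x + (- 1) *\<^sub>R k n x) < e"
      for k :: "nat \<Rightarrow> vector_field"
    proof -
      have kH: "k n \<in> H1v \<Omega>" for n using k ker by blast
      obtain l where l: "l \<in> H1v \<Omega>" "(\<lambda>n. inner_H1v \<Omega> (\<lambda>x. k n x - l x) (\<lambda>x. k n x - l x)) \<longlonglongrightarrow> 0"
        using H1v_complete[where u = k, OF assms(1) kH] C by auto
      \<comment> \<open>Closedness of the kernel: b(k n, v) = 0, so |b(l, v)| = |b(k n - l, v)|,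
        which the bound on b sends to 0.\<close>
      have "stokes_form \<Omega> l v = 0" if v: "v \<in> H1v \<Omega>" for v
      proof -
        have "(\<lambda>n. sqrt 2 * sqrt (inner_H1v \<Omega> (\<lambda>x. k n x - l x) (\<lambda>x. k n x - l x)) * norm_H1v \<Omega> v) \<longlonglongrightarrow> sqrt 2 * sqrt 0 * norm_H1v \<Omega> v"
          by (intro tendsto_intros l(2))
        then have "(\<lambda>n. sqrt 2 * norm_H1v \<Omega> (\<lambda>x. k n x - l x) * norm_H1v \<Omega> v) \<longlonglongrightarrow> 0" by (simp add: norm_H1v_def)
        moreover have "\<bar>stokes_form \<Omega> l v\<bar> \<le> sqrt 2 * norm_H1v \<Omega> (\<lambda>x. k n x - l x) * norm_H1v \<Omega> v" for n
        proof -
          have D: "(\<lambda>x. k n x - l x) \<in> H1v \<Omega>" using H1v_lincomb[OF assms(1) kH l(1), of 1 n "-1"] by simp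
          have "stokes_form \<Omega> (\<lambda>x. k n x - l x) v = stokes_form \<Omega> (k n) v - stokes_form \<Omega> l v"
            using stokes_form_lincomb_left[OF assms(1) kH l(1) v, of 1 n "-1"] by simp
          moreover have "stokes_form \<Omega> (k n) v = 0" using k[of n] v ker by blast
          ultimately show ?thesis using stokes_form_bound[OF D v] by simp
        qed
        ultimately have "\<bar>stokes_form \<Omega> l v\<bar> \<le> 0" by (intro LIMSEQ_le_const) auto
        then show ?thesis by simp
      qed
      then have "l \<in> ker_TrT \<Omega>" using l(1) ker by blast
      then show ?thesis using l(2) by auto
    qed
    show "inner_H1v \<Omega> (\<lambda>x. a *\<^sub>R p x + c *\<^sub>R q x) w = a * inner_H1v \<Omega> p w + c * inner_H1v \<Omega> q w"
      if "p \<in> H1v \<Omega>" "q \<in> H1v \<Omega>" "w \<in> H1v \<Omega>" for a p c q w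
      using that by (rule inner_H1v_lincomb_left[OF assms(1)])
    show "inner_H1v \<Omega> p q = inner_H1v \<Omega> q p" for p q by (rule inner_H1v_commute)
  qed (use u(1) ker in \<open>auto simp: H1v_lincomb[OF assms(1)] inner_H1v_nonneg\<close>)
  then obtain k where k: "k \<in> ker_TrT \<Omega>" "\<forall>h\<in>ker_TrT \<Omega>. inner_H1v \<Omega> (\<lambda>x. 1 *\<^sub>R u x + (- 1) *\<^sub>R k x) h = 0" by blast
  let ?w = "\<lambda>x. 1 *\<^sub>R u x + (- 1) *\<^sub>R k x"
  have kH: "k \<in> H1v \<Omega>" "TrT \<Omega> k = (\<lambda>f. 0)" using k(1) by (auto simp: ker_TrT_def)
  have "?w \<in> K_perp \<Omega>" unfolding K_perp_def using H1v_lincomb[OF assms(1) u(1) kH(1), of 1 "-1"] k(2) by blast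
  moreover have "TrT \<Omega> ?w = f"
    using TrT_lincomb[OF assms(1-3) u(1) kH(1), of 1 "-1"] by (simp add: u(2) kH(2))
  ultimately have "\<exists>w. w \<in> K_perp \<Omega> \<and> TrT \<Omega> w = f" by blast
  from someI_ex[OF this] show "optimal_lift \<Omega> f \<in> H1v \<Omega>" "TrT \<Omega> (optimal_lift \<Omega> f) = f"
    by (auto simp: optimal_lift_def K_perp_def)
qed

text \<open>The lift enters only through its tangential trace, so the optimal lift of the trace of v
  may be replaced by v itself. Linearity in both arguments and the estimates for \<open>piT\<close>
  then become those of b.\<close>

lemma piT_TrT:
  assumes "open \<Omega>" "bounded \<Omega>" "H1_extension_domain \<Omega>" and u: "u \<in> H1v \<Omega>" and v: "v \<in> H1v \<Omega>"
  shows "piT \<Omega> u (TrT \<Omega> v) = stokes_form \<Omega> v u"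
proof -
  have B: "TrT \<Omega> v \<in> B_perp \<Omega>" using v by (simp add: B_perp_def)
  define w where "w = optimal_lift \<Omega> (TrT \<Omega> v)"
  have w: "w \<in> H1v \<Omega>" "TrT \<Omega> w = TrT \<Omega> v" unfolding w_def by (intro optimal_lift[OF assms(1-3) B])+
  have "piT \<Omega> u (TrT \<Omega> v) = - stokes_form \<Omega> u w" using B by (simp add: piT_def w_def)
  also have "\<dots> = stokes_form \<Omega> w u" using stokes_form_antisym[of \<Omega> u w] by simp
  also have "\<dots> = stokes_form \<Omega> v u"
    using TrT(2)[OF assms(1-3) w(1) u] TrT(2)[OF assms(1-3) v u] w(2) by simp
  finally show ?thesis .
qed

lemma piT_outside: "f \<notin> B_perp \<Omega> \<Longrightarrow> piT \<Omega> u f = 0"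
  by (simp add: piT_def)

lemma piT_lincomb:
  assumes "open \<Omega>" "bounded \<Omega>" "H1_extension_domain \<Omega>" and u: "u \<in> H1v \<Omega>" and v: "v \<in> H1v \<Omega>"
  shows "piT \<Omega> (\<lambda>x. a *\<^sub>R u x + c *\<^sub>R v x) = (\<lambda>f. a * piT \<Omega> u f + c * piT \<Omega> v f)"
proof
  fix f
  show "piT \<Omega> (\<lambda>x. a *\<^sub>R u x + c *\<^sub>R v x) f = a * piT \<Omega> u f + c * piT \<Omega> v f"
  proof (cases "f \<in> B_perp \<Omega>")
    case True
    then obtain z where z: "z \<in> H1v \<Omega>" "f = TrT \<Omega> z" by (auto simp: B_perp_def)
    show ?thesis
      unfolding z(2) piT_TrT[OF assms(1-3) H1v_lincomb[OF assms(1) u v] z(1)] piT_TrT[OF assms(1-3) u z(1)] piT_TrT[OF assms(1-3) v z(1)]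
      by (rule stokes_form_lincomb_right[OF assms(1) u v z(1)])
  qed (simp add: piT_outside)
qed

text \<open>The estimate holds with every lift of f and is passed to the infimum of their norms.
  This is done after division by the norm of u, so the case of norm zero is treated apart.\<close>

lemma piT_bound:
  assumes "open \<Omega>" "bounded \<Omega>" "H1_extension_domain \<Omega>" and u: "u \<in> H1v \<Omega>" and f: "f \<in> B_perp \<Omega>"
  shows "\<bar>piT \<Omega> u f\<bar> \<le> sqrt 2 * norm_H1v \<Omega> u * norm_B_perp \<Omega> f"
proof (cases "norm_H1v \<Omega> u = 0")
  case True
  obtain v where v: "v \<in> H1v \<Omega>" "f = TrT \<Omega> v" using f by (auto simp: B_perp_def)
  show ?thesis using stokes_form_bound[OF v(1) u] piT_TrT[OF assms(1-3) u v(1)] True v(2) by simp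
next
  case False
  then have pos: "0 < sqrt 2 * norm_H1v \<Omega> u" using norm_H1v_nonneg[of \<Omega> u] by simp
  let ?S = "{norm_H1v \<Omega> v | v. v \<in> H1v \<Omega> \<and> TrT \<Omega> v = f}"
  have "\<bar>piT \<Omega> u f\<bar> / (sqrt 2 * norm_H1v \<Omega> u) \<le> Inf ?S"
  proof (rule cInf_greatest)
    show "?S \<noteq> {}" using f by (auto simp: B_perp_def)
    fix s assume "s \<in> ?S"
    then obtain v where v: "s = norm_H1v \<Omega> v" "v \<in> H1v \<Omega>" "TrT \<Omega> v = f" by blast
    have "\<bar>piT \<Omega> u f\<bar> \<le> sqrt 2 * norm_H1v \<Omega> v * norm_H1v \<Omega> u"
      using stokes_form_bound[OF v(2) u] piT_TrT[OF assms(1-3) u v(2)] v(3) by simp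
    then show "\<bar>piT \<Omega> u f\<bar> / (sqrt 2 * norm_H1v \<Omega> u) \<le> s"
      using pos by (simp add: v(1) divide_le_eq mult_ac)
  qed
  then show ?thesis using pos by (simp add: norm_B_perp_def divide_le_eq mult_ac)
qed

lemma piT_in_dual:
  assumes "open \<Omega>" "bounded \<Omega>" "H1_extension_domain \<Omega>" and u: "u \<in> H1v \<Omega>"
  shows "piT \<Omega> u \<in> B_perp_dual \<Omega>"
  unfolding B_perp_dual_def
proof (intro CollectI conjI ballI allI impI)
  fix f g a c assume "f \<in> B_perp \<Omega>" "g \<in> B_perp \<Omega>"
  then obtain v w where vw: "v \<in> H1v \<Omega>" "f = TrT \<Omega> v" "w \<in> H1v \<Omega>" "g = TrT \<Omega> w" by (auto simp: B_perp_def)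
  show "piT \<Omega> u (\<lambda>h. a * f h + c * g h) = a * piT \<Omega> u f + c * piT \<Omega> u g"
    unfolding vw(2,4) TrT_lincomb[OF assms(1-3) vw(1,3), symmetric]
      piT_TrT[OF assms(1-3) u H1v_lincomb[OF assms(1) vw(1,3)]] piT_TrT[OF assms(1-3) u vw(1)] piT_TrT[OF assms(1-3) u vw(3)]
    by (rule stokes_form_lincomb_left[OF assms(1) vw(1,3) u])
qed (use piT_bound[OF assms] in \<open>auto simp: piT_outside\<close>)

lemma norm_piT_le:
  assumes "open \<Omega>" "bounded \<Omega>" "H1_extension_domain \<Omega>" and u: "u \<in> H1v \<Omega>"
  shows "norm_B_perp_dual \<Omega> (piT \<Omega> u) \<le> sqrt 2 * norm_H1v \<Omega> u"
  unfolding norm_B_perp_dual_def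
proof (rule cSup_least)
  \<comment> \<open>The supremum is one of reals, so the set must be nonempty; the trace of the zero
    field lies in the unit ball.\<close>
  have z: "TrT \<Omega> (\<lambda>x. 0) \<in> B_perp \<Omega>" by (simp add: B_perp_def zero_H1v)
  have "inner_H1v \<Omega> (\<lambda>x. 0) (\<lambda>x. 0) = 0"
    using inner_H1v_lincomb_left[OF assms(1) zero_H1v zero_H1v zero_H1v, of 0 0] by simp
  then have "norm_H1v \<Omega> (\<lambda>x. 0) = 0" by (simp add: norm_H1v_def)
  then have "norm_B_perp \<Omega> (TrT \<Omega> (\<lambda>x. 0)) \<le> 0"
    unfolding norm_B_perp_def
    by (intro cInf_lower2[of 0]) (auto simp: zero_H1v norm_H1v_nonneg intro!: exI[of _ "\<lambda>x. 0"] bdd_belowI[of _ 0])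
  then have "norm_B_perp \<Omega> (TrT \<Omega> (\<lambda>x. 0)) \<le> 1" by simp
  then show "{\<bar>piT \<Omega> u f\<bar> | f. f \<in> B_perp \<Omega> \<and> norm_B_perp \<Omega> f \<le> 1} \<noteq> {}" using z by blast
  fix s assume "s \<in> {\<bar>piT \<Omega> u f\<bar> | f. f \<in> B_perp \<Omega> \<and> norm_B_perp \<Omega> f \<le> 1}"
  then obtain f where f: "s = \<bar>piT \<Omega> u f\<bar>" "f \<in> B_perp \<Omega>" "norm_B_perp \<Omega> f \<le> 1" by blast
  have "s \<le> sqrt 2 * norm_H1v \<Omega> u * norm_B_perp \<Omega> f" unfolding f(1) by (rule piT_bound[OF assms f(2)])
  also have "\<dots> \<le> sqrt 2 * norm_H1v \<Omega> u * 1" using f(3) norm_H1v_nonneg[of \<Omega> u] by (intro mult_left_mono) auto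
  finally show "s \<le> sqrt 2 * norm_H1v \<Omega> u" by simp
qed

theorem proposition5p2:
  fixes \<Omega> :: "(real ^ 3) set"
  assumes "open \<Omega>" and "connected \<Omega>" and "bounded \<Omega>"
    and "H1_extension_domain \<Omega>"
  shows
    "(\<forall>u\<in>H1v \<Omega>. piT \<Omega> u \<in> B_perp_dual \<Omega>) \<and>
     (\<forall>u\<in>H1v \<Omega>. \<forall>v\<in>H1v \<Omega>. \<forall>a c.
        piT \<Omega> (\<lambda>x. a *\<^sub>R u x + c *\<^sub>R v x) = (\<lambda>f. a * piT \<Omega> u f + c * piT \<Omega> v f)) \<and>
     (\<forall>u\<in>H1v \<Omega>. \<forall>\<epsilon>>0. \<exists>\<delta>>0. \<forall>v\<in>H1v \<Omega>. norm_H1v \<Omega> (\<lambda>x. v x - u x) < \<delta> \<longrightarrow>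
        norm_B_perp_dual \<Omega> (\<lambda>f. piT \<Omega> v f - piT \<Omega> u f) < \<epsilon>) \<and>
     (\<forall>u\<in>H1v \<Omega>. norm_B_perp_dual \<Omega> (piT \<Omega> u) \<le> sqrt 2 * norm_H1v \<Omega> u) \<and>
     (\<forall>u\<in>H1v \<Omega>. \<forall>v\<in>H1v \<Omega>.
        stokes_form \<Omega> u v = - piT \<Omega> u (TrT \<Omega> v) \<and>
        - piT \<Omega> u (TrT \<Omega> v) = piT \<Omega> v (TrT \<Omega> u))"
proof (intro conjI ballI allI impI)
  note dom = assms(1,3,4)
  show "piT \<Omega> u \<in> B_perp_dual \<Omega>" if "u \<in> H1v \<Omega>" for u using that by (rule piT_in_dual[OF dom])
  show "piT \<Omega> (\<lambda>x. a *\<^sub>R u x + c *\<^sub>R v x) = (\<lambda>f. a * piT \<Omega> u f + c * piT \<Omega> v f)"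
    if "u \<in> H1v \<Omega>" "v \<in> H1v \<Omega>" for u v a c using that by (rule piT_lincomb[OF dom])
  show bound: "norm_B_perp_dual \<Omega> (piT \<Omega> u) \<le> sqrt 2 * norm_H1v \<Omega> u" if "u \<in> H1v \<Omega>" for u
    using that by (rule norm_piT_le[OF dom])
  show "\<exists>\<delta>>0. \<forall>v\<in>H1v \<Omega>. norm_H1v \<Omega> (\<lambda>x. v x - u x) < \<delta> \<longrightarrow> norm_B_perp_dual \<Omega> (\<lambda>f. piT \<Omega> v f - piT \<Omega> u f) < \<epsilon>"
    if u: "u \<in> H1v \<Omega>" and \<epsilon>: "\<epsilon> > 0" for u \<epsilon>
  \<comment> \<open>By linearity the norm bound applies to v - u, which makes the operator Lipschitz
    with constant \<open>sqrt 2\<close>.\<close>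
  proof (intro exI[of _ "\<epsilon> / sqrt 2"] conjI ballI impI)
    show "0 < \<epsilon> / sqrt 2" using \<epsilon> by simp
    fix v assume v: "v \<in> H1v \<Omega>" and small: "norm_H1v \<Omega> (\<lambda>x. v x - u x) < \<epsilon> / sqrt 2"
    have D: "(\<lambda>x. v x - u x) \<in> H1v \<Omega>" using H1v_lincomb[OF assms(1) v u, of 1 "-1"] by simp
    have "piT \<Omega> (\<lambda>x. v x - u x) = (\<lambda>f. piT \<Omega> v f - piT \<Omega> u f)"
      using piT_lincomb[OF dom v u, of 1 "-1"] by simp
    then have "norm_B_perp_dual \<Omega> (\<lambda>f. piT \<Omega> v f - piT \<Omega> u f) \<le> sqrt 2 * norm_H1v \<Omega> (\<lambda>x. v x - u x)"
      using bound[OF D] by simp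
    also have "\<dots> < \<epsilon>" using small by (simp add: field_simps)
    finally show "norm_B_perp_dual \<Omega> (\<lambda>f. piT \<Omega> v f - piT \<Omega> u f) < \<epsilon>" .
  qed
  fix u v assume uv: "u \<in> H1v \<Omega>" "v \<in> H1v \<Omega>"
  show "stokes_form \<Omega> u v = - piT \<Omega> u (TrT \<Omega> v)"
    unfolding piT_TrT[OF dom uv] by (rule stokes_form_antisym)
  show "- piT \<Omega> u (TrT \<Omega> v) = piT \<Omega> v (TrT \<Omega> u)"
    unfolding piT_TrT[OF dom uv] piT_TrT[OF dom uv(2,1)] by (simp add: stokes_form_antisym[of \<Omega> u v])
qed

end
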